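(* Let $n\ge 1$ be any integer and define $n':=2\lceil n/2\rceil$. When real $n$-ary quadratic forms are chosen according to the $n$-dimensional Gaussian Orthogonal Ensemble, the probability $\rho_n(\infty)$ that such a form is isotropic over $\mathbb{R}$ is $$\rho_n(\infty)=1-\frac{\mathrm{Pf}(A)}{2^{(n-1)(n+4)/4}\prod_{m=1}^{n}\Gamma\left(\frac m2\right)},$$ where $A$ is the $n'\times n'$ skew-symmetric matrix whose $(i,j)$-entry $a_{ij}$ is given for $i<j$ by $$a_{ij}=\begin{cases}2^{i+j-2}\,\Gamma\left(\frac{i+j}{2}\right)\left(\beta_{\frac12}\left(\frac i2,\frac j2\right)-\beta_{\frac12}\left(\frac j2,\frac i2\right)\right)&\text{if } i<j\le n,\\[4pt] 2^{i-1}\,\Gamma\left(\frac i2\right)&\text{if } i<j=n+1.\end{cases}$$ (The second case arises only when $n$ is odd.)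
   Context: The $n$-dimensional Gaussian Orthogonal Ensemble (GOE) is the distribution of the random real symmetric $n\times n$ matrix $M=\frac1{\sqrt2}(B+B^t)$, where the entries of the $n\times n$ matrix $B$ are independent, identically distributed (standard, mean zero) Gaussians. A symmetric matrix $M$ is identified with the real quadratic form $x\mapsto x^tMx$. A real quadratic form is isotropic over $\mathbb{R}$ if it has a nonzero real zero (up to a set of probability zero, this means it is indefinite). $\Gamma(s)=\int_0^\infty x^{s-1}e^{-x}\,dx$ is the gamma function, and $\beta_t(i,j)=\int_0^t x^{i-1}(1-x)^{j-1}\,dx$ is the incomplete beta function. The Pfaffian of a $2s\times 2s$ skew-symmetric matrix $A=(a_{ij})$ is $\mathrm{Pf}(A)=\sum_\tau \mathrm{sgn}(\tau)\,a_{i_1,j_1}\cdots a_{i_s,j_s}$, where $\tau$ ranges over all partitions $\{(i_1,j_1),\dots,(i_s,j_s)\}$ of $\{1,\dots,2s\}$ into pairs with $i_k<j_k$ and $i_k<i_{k+1}$, and $\mathrm{sgn}(\tau)$ is the sign of the permutation sending $1,2,3,4,\dots,2s$ to $i_1,j_1,i_2,j_2,\dots,j_s$. *)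

theory Defs
  imports "HOL-Probability.Probability" "HOL-Combinatorics.Permutations"
begin

(* B is a matrix of independent standard Gaussians, given as a point of the product space
   over all index pairs. The resulting law lives on all square matrices, but is concentrated
   on the symmetric ones. *)
definition GOE :: "(real ^ 'n ^ 'n) measure" where
  "GOE = distr (\<Pi>\<^sub>M p\<in>(UNIV :: ('n \<times> 'n) set). density lborel std_normal_density) borel
     (\<lambda>b. let B = (\<chi> i j. b (i, j)) in (1 / sqrt 2) *\<^sub>R (B + transpose B))"

definition quad_form :: "real ^ 'n ^ 'n \<Rightarrow> real ^ 'n \<Rightarrow> real" where
  "quad_form M x = x \<bullet> (M *v x)"

definition isotropic :: "('v :: zero \<Rightarrow> real) \<Rightarrow> bool" where
  "isotropic q \<longleftrightarrow> (\<exists>x. x \<noteq> 0 \<and> q x = 0)"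

definition incomplete_beta :: "real \<Rightarrow> real \<Rightarrow> real \<Rightarrow> real" where
  "incomplete_beta t a b = integral {0..t} (\<lambda>x. x powr (a - 1) * (1 - x) powr (b - 1))"

(* A partition {(i_1,j_1),...,(i_s,j_s)} of {1..2s} into pairs, with i_k < j_k and
   i_k < i_(k+1), is encoded by the permutation sending 1,2,3,4,... to i_1,j_1,i_2,j_2,... *)
definition pair_partitions :: "nat \<Rightarrow> (nat \<Rightarrow> nat) set" where
  "pair_partitions s = {\<tau>. \<tau> permutes {1..2 * s} \<and>
     (\<forall>k\<in>{1..s}. \<tau> (2 * k - 1) < \<tau> (2 * k)) \<and>
     (\<forall>k\<in>{1..<s}. \<tau> (2 * k - 1) < \<tau> (2 * k + 1))}"

(* The Pfaffian of the 2s x 2s matrix with entries A i j, where 1 <= i, j <= 2s. *)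
definition pfaffian :: "nat \<Rightarrow> (nat \<Rightarrow> nat \<Rightarrow> real) \<Rightarrow> real" where
  "pfaffian s A = (\<Sum>\<tau>\<in>pair_partitions s.
     of_int (sign \<tau>) * (\<Prod>k=1..s. A (\<tau> (2 * k - 1)) (\<tau> (2 * k))))"

(* Only used for 1 <= i < j; the last column j = n + 1 is used only for odd n. *)
definition upper_entry :: "nat \<Rightarrow> nat \<Rightarrow> nat \<Rightarrow> real" where
  "upper_entry n i j =
     (if j \<le> n then 2 ^ (i + j - 2) * Gamma ((real i + real j) / 2) *
          (incomplete_beta (1 / 2) (real i / 2) (real j / 2)
           - incomplete_beta (1 / 2) (real j / 2) (real i / 2))
      else 2 ^ (i - 1) * Gamma (real i / 2))"

definition skew_matrix :: "nat \<Rightarrow> nat \<Rightarrow> nat \<Rightarrow> real" where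
  "skew_matrix n i j =
     (if i < j then upper_entry n i j else if j < i then - upper_entry n j i else 0)"

end

theory Submission
  imports Defs "HOL-Computational_Algebra.Fundamental_Theorem_Algebra"
begin

text \<open>
  Bordering a principal submatrix of the matrix by one more row and column changes its
  characteristic polynomial \<open>P\<close> to \<open>(X - a) P - \<Sum> w\<^sub>s P / (X - d\<^sub>s)\<close>, where \<open>d\<^sub>s\<close> are the
  roots of \<open>P\<close> and, by orthogonal invariance, \<open>a\<close> is Gaussian and the \<open>w\<^sub>s\<close> are squares of
  Gaussians. Integrating with Lagrange interpolation and the Dixon--Anderson integral gives, by
  induction on the size, the law of the characteristic polynomial: up to a constant it has the density
  \<open>exp (- \<Sum> x\<^sub>i\<^sup>2 / 4)\<close> with respect to Lebesgue measure on the coefficients of the real-rooted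
  polynomials, where \<open>x\<^sub>i\<close> are the roots. Passing from coefficients to roots produces the factor
  \<open>\<bar>\<Prod> (x\<^sub>j - x\<^sub>i)\<bar>\<close>. Almost surely the form is anisotropic iff all roots have the same sign,
  so the complementary probability is twice the integral over positive roots. De Bruijn's formula
  turns this integral into a Pfaffian whose entries are the double integrals of
  \<open>sgn (y - x) x\<^sup>i\<^sup>-\<^sup>1 y\<^sup>j\<^sup>-\<^sup>1 exp (- (x\<^sup>2 + y\<^sup>2) / 4)\<close>, which the substitution \<open>x = r y\<close>
  reduces to incomplete beta functions.
\<close>

subsection \<open>Lebesgue measure on polynomials\<close>

text \<open>The law is carried by coefficients rather than by ordered eigenvalues, so no Jacobian on
  the orthogonal group is needed: rotation invariance enters only for the border vector, expressed
  in the eigenbasis of the fixed block. The induction closes because of a duality. Given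
  \<open>P\<close>, the density of the bordered polynomial \<open>p\<close> involves the residues of
  \<open>- p / P\<close>; integrating out \<open>P\<close> for fixed \<open>p\<close> calls for the
  residues of \<open>P / p\<close>. On interlacing pairs both weights equal the absolute resultant
  of \<open>P\<close> and \<open>p\<close> to the power \<open>-1/2\<close>, so one may replace the
  other, and the residues of \<open>P / p\<close> are positive with sum 1, which gives a Dirichlet
  integral with parameters 1/2. The exponent is \<open>- tr M^2 / 4\<close>: diagonal entries have
  variance 2, off-diagonal ones variance 1. On the Pfaffian side, the absolute Vandermonde product
  is the determinant times its sign; by Schur's identity this sign is the Pfaffian of the signs
  \<open>sgn (x_j - x_i)\<close>. For odd \<open>n\<close> a dummy last point at infinity makes the
  number of points even, which accounts for the extra column of the matrix.\<close>

definition poly_borel :: "real poly measure" where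
  "poly_borel = vimage_algebra UNIV coeff (\<Pi>\<^sub>M i\<in>UNIV. borel)"

lemma space_poly_borel [simp]: "space poly_borel = UNIV"
  by (simp add: poly_borel_def)

lemma measurable_coeff [measurable (raw)]:
  assumes "f \<in> M \<rightarrow>\<^sub>M poly_borel"
  shows "(\<lambda>x. coeff (f x) i) \<in> borel_measurable M"
proof -
  have "coeff \<in> poly_borel \<rightarrow>\<^sub>M (\<Pi>\<^sub>M i\<in>UNIV. borel)"
    unfolding poly_borel_def by (rule measurable_vimage_algebra1) (auto simp: space_PiM)
  from measurable_compose[OF assms this] have "(\<lambda>x. coeff (f x)) \<in> M \<rightarrow>\<^sub>M (\<Pi>\<^sub>M i\<in>UNIV. borel)" .
  from measurable_compose[OF this measurable_component_singleton[of i UNIV]] show ?thesis by simp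
qed

lemma measurable_poly_borelI:
  assumes "\<And>i. (\<lambda>x. coeff (f x) i) \<in> borel_measurable M"
  shows "f \<in> M \<rightarrow>\<^sub>M poly_borel"
  unfolding poly_borel_def
proof (rule measurable_vimage_algebra2)
  show "(\<lambda>x. coeff (f x)) \<in> M \<rightarrow>\<^sub>M (\<Pi>\<^sub>M i\<in>UNIV. borel)"
    by (rule measurable_PiM_single') (use assms in \<open>auto simp: space_PiM\<close>)
qed auto

lemma measurable_pCons [measurable (raw)]:
  assumes [measurable]: "f \<in> borel_measurable M" "g \<in> M \<rightarrow>\<^sub>M poly_borel"
  shows "(\<lambda>x. pCons (f x) (g x)) \<in> M \<rightarrow>\<^sub>M poly_borel"
proof (rule measurable_poly_borelI)
  fix i show "(\<lambda>x. coeff (pCons (f x) (g x)) i) \<in> borel_measurable M"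
    by (cases i) simp_all
qed

lemma measurable_poly_add [measurable (raw)]:
  assumes [measurable]: "f \<in> M \<rightarrow>\<^sub>M poly_borel" "g \<in> M \<rightarrow>\<^sub>M poly_borel"
  shows "(\<lambda>x. f x + g x) \<in> M \<rightarrow>\<^sub>M poly_borel"
  by (rule measurable_poly_borelI) simp

lemma measurable_poly_diff [measurable (raw)]:
  assumes [measurable]: "f \<in> M \<rightarrow>\<^sub>M poly_borel" "g \<in> M \<rightarrow>\<^sub>M poly_borel"
  shows "(\<lambda>x. f x - g x) \<in> M \<rightarrow>\<^sub>M poly_borel"
  by (rule measurable_poly_borelI) simp

lemma measurable_poly_mult [measurable (raw)]:
  assumes [measurable]: "f \<in> M \<rightarrow>\<^sub>M poly_borel" "g \<in> M \<rightarrow>\<^sub>M poly_borel"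
  shows "(\<lambda>x. f x * g x) \<in> M \<rightarrow>\<^sub>M poly_borel"
  by (rule measurable_poly_borelI) (simp add: coeff_mult)

lemma measurable_smult [measurable (raw)]:
  assumes [measurable]: "f \<in> borel_measurable M" "g \<in> M \<rightarrow>\<^sub>M poly_borel"
  shows "(\<lambda>x. smult (f x) (g x)) \<in> M \<rightarrow>\<^sub>M poly_borel"
  by (rule measurable_poly_borelI) simp

lemma measurable_pderiv [measurable (raw)]:
  assumes [measurable]: "f \<in> M \<rightarrow>\<^sub>M poly_borel"
  shows "(\<lambda>x. pderiv (f x)) \<in> M \<rightarrow>\<^sub>M poly_borel"
  by (rule measurable_poly_borelI) (simp add: coeff_pderiv)

lemma measurable_poly_sum [measurable (raw)]:
  assumes [measurable]: "\<And>i. i \<in> I \<Longrightarrow> f i \<in> M \<rightarrow>\<^sub>M poly_borel"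
  shows "(\<lambda>x. \<Sum>i\<in>I. f i x) \<in> M \<rightarrow>\<^sub>M poly_borel"
  by (rule measurable_poly_borelI) (simp add: coeff_sum)

lemma measurable_poly_prod [measurable (raw)]:
  assumes "\<And>i. i \<in> I \<Longrightarrow> f i \<in> M \<rightarrow>\<^sub>M poly_borel"
  shows "(\<lambda>x. \<Prod>i\<in>I. f i x) \<in> M \<rightarrow>\<^sub>M poly_borel"
  using assms by (induction I rule: infinite_finite_induct) auto

text \<open>The degree varies with the point, so evaluation is rewritten as an infinite series over
  all coefficients, whose terms are measurable.\<close>

lemma measurable_poly [measurable (raw)]:
  assumes [measurable]: "f \<in> M \<rightarrow>\<^sub>M poly_borel" "g \<in> borel_measurable M"
  shows "(\<lambda>x. poly (f x) (g x)) \<in> borel_measurable M"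
proof -
  have "poly p t = (\<Sum>i. coeff p i * t ^ i)" for p :: "real poly" and t
    unfolding poly_altdef by (rule suminf_finite[symmetric]) (auto simp: coeff_eq_0)
  then show ?thesis by simp
qed

text \<open>Push-forwards may destroy sigma-finiteness. With a measurable left inverse
  \<open>g\<close>, the preimages under \<open>g\<close> of a cover of the source by sets of finite
  measure cover the target, and each keeps its measure because \<open>f\<close> pulls it back to the
  original set.\<close>

lemma sigma_finite_distr_left_inverse:
  assumes "sigma_finite_measure M" and f [measurable]: "f \<in> M \<rightarrow>\<^sub>M N"
    and g [measurable]: "g \<in> N \<rightarrow>\<^sub>M M" and inv: "\<And>x. x \<in> space M \<Longrightarrow> g (f x) = x"
  shows "sigma_finite_measure (distr M N f)"
proof -
  interpret sigma_finite_measure M by fact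
  obtain A where A: "countable A" "A \<subseteq> sets M" "(\<Union>A) = space M" "\<And>a. a \<in> A \<Longrightarrow> emeasure M a \<noteq> \<infinity>"
    using sigma_finite_countable by blast
  show ?thesis
  proof (standard, intro exI conjI ballI)
    show "countable ((\<lambda>a. g -` a \<inter> space N) ` A)" using A(1) by simp
    show "(\<lambda>a. g -` a \<inter> space N) ` A \<subseteq> sets (distr M N f)"
      using A(2) measurable_sets[OF g] by auto
    show "\<Union> ((\<lambda>a. g -` a \<inter> space N) ` A) = space (distr M N f)"
    proof
      show "space (distr M N f) \<subseteq> \<Union> ((\<lambda>a. g -` a \<inter> space N) ` A)"
      proof
        fix x assume "x \<in> space (distr M N f)"
        then have "g x \<in> \<Union>A" and "x \<in> space N" using A(3) measurable_space[OF g, of x] by auto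
        then show "x \<in> \<Union> ((\<lambda>a. g -` a \<inter> space N) ` A)" by blast
      qed
    qed auto
    fix b assume "b \<in> (\<lambda>a. g -` a \<inter> space N) ` A"
    then obtain a where a: "a \<in> A" "b = g -` a \<inter> space N" by auto
    have "f -` b \<inter> space M = a"
    proof -
      have "a \<subseteq> space M" using a A(2) sets.sets_into_space by blast
      then show ?thesis using inv measurable_space[OF f] unfolding a(2) by auto
    qed
    then show "emeasure (distr M N f) b \<noteq> \<infinity>"
      using a A(2,4) measurable_sets[OF g] by (subst emeasure_distr) auto
  qed
qed

text \<open>Lebesgue measure on the \<open>k\<close> lower coefficients of the polynomials with \<open>k\<close>-th
  coefficient \<open>c\<close>; below \<open>c\<close> is \<open>1\<close> (monic polynomials of degree \<open>k\<close>) or \<open>0\<close>.\<close>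
primrec coeff_lborel :: "real \<Rightarrow> nat \<Rightarrow> real poly measure" where
  "coeff_lborel c 0 = return poly_borel [:c:]"
| "coeff_lborel c (Suc k) = distr (lborel \<Otimes>\<^sub>M coeff_lborel c k) poly_borel (\<lambda>(v, q). pCons v q)"

declare coeff_lborel.simps [simp del]

lemma sets_coeff_lborel [simp, measurable_cong]: "sets (coeff_lborel c k) = sets poly_borel"
  by (cases k) (simp_all add: coeff_lborel.simps)

lemma sigma_finite_coeff_lborel: "sigma_finite_measure (coeff_lborel c k)"
proof (induction k)
  case 0
  interpret prob_space "return poly_borel [:c:]" by (rule prob_space_return) simp
  show ?case unfolding coeff_lborel.simps by (rule sigma_finite_measure_axioms)
next
  case (Suc k)
  interpret K: sigma_finite_measure "coeff_lborel c k" by fact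
  interpret pair_sigma_finite "lborel :: real measure" "coeff_lborel c k" ..
  have [measurable]: "poly_shift 1 \<in> poly_borel \<rightarrow>\<^sub>M poly_borel"
    by (rule measurable_poly_borelI) (simp add: coeff_poly_shift)
  show ?case
    unfolding coeff_lborel.simps
  proof (rule sigma_finite_distr_left_inverse[where g = "\<lambda>p. (coeff p 0, poly_shift 1 p)"])
    show "sigma_finite_measure (lborel \<Otimes>\<^sub>M coeff_lborel c k)"
      by (intro sigma_finite_pair_measure lborel.sigma_finite_measure_axioms Suc)
    show "(\<lambda>p. (coeff p 0, poly_shift 1 p)) \<in> poly_borel \<rightarrow>\<^sub>M lborel \<Otimes>\<^sub>M coeff_lborel c k"
      by measurable
  qed (measurable, auto simp: poly_eq_iff coeff_poly_shift)
qed

lemma nn_integral_coeff_lborel_0 [simp]: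
  "f \<in> borel_measurable poly_borel \<Longrightarrow> (\<integral>\<^sup>+ p. f p \<partial>coeff_lborel c 0) = f [:c:]"
  by (simp add: nn_integral_return coeff_lborel.simps(1))

lemma nn_integral_coeff_lborel_Suc:
  assumes [measurable]: "f \<in> borel_measurable poly_borel"
  shows "(\<integral>\<^sup>+ p. f p \<partial>coeff_lborel c (Suc k)) = (\<integral>\<^sup>+ v. \<integral>\<^sup>+ q. f (pCons v q) \<partial>coeff_lborel c k \<partial>lborel)"
proof -
  interpret K: sigma_finite_measure "coeff_lborel c k" by (rule sigma_finite_coeff_lborel)
  show ?thesis
    by (simp add: coeff_lborel.simps(2) nn_integral_distr K.nn_integral_fst[symmetric] split_beta')
qed

lemma nn_integral_lborel_shift:
  fixes f :: "real \<Rightarrow> ennreal"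
  assumes "f \<in> borel_measurable borel"
  shows "(\<integral>\<^sup>+ x. f (x + a) \<partial>lborel) = (\<integral>\<^sup>+ x. f x \<partial>lborel)"
  using nn_integral_real_affine[OF assms, of 1 a] by (simp add: add.commute)

text \<open>Adding \<open>g\<close> translates only the \<open>k\<close> free coefficients, and
  Lebesgue measure is translation invariant.\<close>

lemma nn_integral_coeff_lborel_add:
  assumes "f \<in> borel_measurable poly_borel" "\<And>i. i \<ge> k \<Longrightarrow> coeff g i = 0"
  shows "(\<integral>\<^sup>+ p. f (p + g) \<partial>coeff_lborel c k) = (\<integral>\<^sup>+ p. f p \<partial>coeff_lborel c k)"
  using assms
proof (induction k arbitrary: f g)
  case 0
  then have "g = 0" by (simp add: poly_eq_iff)
  then show ?case by simp
next
  case (Suc k)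
  note [measurable] = Suc.prems(1)
  interpret K: sigma_finite_measure "coeff_lborel c k" by (rule sigma_finite_coeff_lborel)
  obtain a h where g: "g = pCons a h" by (cases g) 
  have h: "coeff h i = 0" if "i \<ge> k" for i
    using Suc.prems(2)[of "Suc i"] that by (simp add: g)
  have "(\<integral>\<^sup>+ p. f (p + g) \<partial>coeff_lborel c (Suc k))
      = (\<integral>\<^sup>+ v. \<integral>\<^sup>+ q. f (pCons (v + a) (q + h)) \<partial>coeff_lborel c k \<partial>lborel)"
    by (subst nn_integral_coeff_lborel_Suc) (simp_all add: g)
  also have "\<dots> = (\<integral>\<^sup>+ v. \<integral>\<^sup>+ q. f (pCons (v + a) q) \<partial>coeff_lborel c k \<partial>lborel)"
  proof (rule nn_integral_cong)
    fix v :: real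
    show "(\<integral>\<^sup>+ q. f (pCons (v + a) (q + h)) \<partial>coeff_lborel c k) = (\<integral>\<^sup>+ q. f (pCons (v + a) q) \<partial>coeff_lborel c k)"
      using h by (intro Suc.IH[where f = "\<lambda>q. f (pCons (v + a) q)"]) auto
  qed
  also have "\<dots> = (\<integral>\<^sup>+ v. \<integral>\<^sup>+ q. f (pCons v q) \<partial>coeff_lborel c k \<partial>lborel)"
    by (rule nn_integral_lborel_shift) measurable
  finally show ?case by (simp add: nn_integral_coeff_lborel_Suc)
qed

text \<open>Division with remainder by \<open>X - l\<close>: sending quotient and remainder to the
  polynomial is a unipotent triangular map on coefficients, hence has Jacobian 1. The induction
  reads off one coefficient at a time and absorbs the term \<open>- l * u\<close> by a
  shift.\<close>

lemma nn_integral_coeff_lborel_linear: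
  assumes "f \<in> borel_measurable poly_borel"
  shows "(\<integral>\<^sup>+ p. f p \<partial>coeff_lborel c (Suc k))
       = (\<integral>\<^sup>+ v. \<integral>\<^sup>+ q. f ([:- l, 1:] * q + [:v:]) \<partial>coeff_lborel c k \<partial>lborel)"
  using assms
proof (induction k arbitrary: f)
  case 0
  note [measurable] = 0
  have "(\<integral>\<^sup>+ p. f p \<partial>coeff_lborel c (Suc 0)) = (\<integral>\<^sup>+ v. f [:v, c:] \<partial>lborel)"
    by (subst nn_integral_coeff_lborel_Suc) simp_all
  also have "\<dots> = (\<integral>\<^sup>+ v. f [:v + (- l * c), c:] \<partial>lborel)"
    by (rule nn_integral_lborel_shift[symmetric]) measurable
  finally show ?case
    by (simp add: nn_integral_coeff_lborel_0 add.commute)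
next
  case (Suc k)
  note [measurable] = Suc.prems
  interpret K: sigma_finite_measure "coeff_lborel c k" by (rule sigma_finite_coeff_lborel)
  have eq: "[:- l, 1:] * pCons u q + [:v:] = pCons (v + (- l * u)) ([:- l, 1:] * q + [:u:])" for u v q
    by simp
  have "(\<integral>\<^sup>+ p. f p \<partial>coeff_lborel c (Suc (Suc k)))
      = (\<integral>\<^sup>+ v. \<integral>\<^sup>+ q. f (pCons v q) \<partial>coeff_lborel c (Suc k) \<partial>lborel)"
    by (rule nn_integral_coeff_lborel_Suc) measurable
  also have "\<dots> = (\<integral>\<^sup>+ v. \<integral>\<^sup>+ u. \<integral>\<^sup>+ q. f (pCons v ([:- l, 1:] * q + [:u:])) \<partial>coeff_lborel c k \<partial>lborel \<partial>lborel)"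
    by (intro nn_integral_cong Suc.IH) measurable
  also have "\<dots> = (\<integral>\<^sup>+ u. \<integral>\<^sup>+ v. \<integral>\<^sup>+ q. f (pCons v ([:- l, 1:] * q + [:u:])) \<partial>coeff_lborel c k \<partial>lborel \<partial>lborel)"
    by (rule lborel_pair.Fubini') measurable
  also have "\<dots> = (\<integral>\<^sup>+ u. \<integral>\<^sup>+ v. \<integral>\<^sup>+ q. f (pCons (v + (- l * u)) ([:- l, 1:] * q + [:u:])) \<partial>coeff_lborel c k \<partial>lborel \<partial>lborel)"
    by (intro nn_integral_cong nn_integral_lborel_shift[symmetric]) measurable
  also have "\<dots> = (\<integral>\<^sup>+ v. \<integral>\<^sup>+ u. \<integral>\<^sup>+ q. f (pCons (v + (- l * u)) ([:- l, 1:] * q + [:u:])) \<partial>coeff_lborel c k \<partial>lborel \<partial>lborel)"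
    by (rule lborel_pair.Fubini'[symmetric]) measurable
  also have "\<dots> = (\<integral>\<^sup>+ v. \<integral>\<^sup>+ u. \<integral>\<^sup>+ q. f ([:- l, 1:] * pCons u q + [:v:]) \<partial>coeff_lborel c k \<partial>lborel \<partial>lborel)"
    unfolding eq ..
  also have "\<dots> = (\<integral>\<^sup>+ v. \<integral>\<^sup>+ q. f ([:- l, 1:] * q + [:v:]) \<partial>coeff_lborel c (Suc k) \<partial>lborel)"
    by (intro nn_integral_cong nn_integral_coeff_lborel_Suc[symmetric]) measurable
  finally show ?case .
qed

section \<open>Lagrange coordinates on polynomials and their Vandermonde Jacobian\<close>

text \<open>The absolute value of the Vandermonde product. The square root over ordered pairs counts
  every unordered pair once and so needs no order on the index type.\<close>

definition vdm :: "('i \<Rightarrow> real) \<Rightarrow> 'i set \<Rightarrow> real" where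
  "vdm d I = sqrt (\<Prod>s\<in>I. \<Prod>r\<in>I - {s}. \<bar>d s - d r\<bar>)"

lemma vdm_empty [simp]: "vdm d {} = 1"
  by (simp add: vdm_def)

lemma vdm_nonneg: "vdm d I \<ge> 0"
  by (simp add: vdm_def prod_nonneg)

lemma vdm_insert:
  assumes "finite I" "i \<notin> I"
  shows "vdm d (insert i I) = vdm d I * (\<Prod>r\<in>I. \<bar>d i - d r\<bar>)"
proof -
  have "insert i I - {s} = insert i (I - {s})" if "s \<in> I" for s using that assms by auto
  then have "(\<Prod>s\<in>insert i I. \<Prod>r\<in>insert i I - {s}. \<bar>d s - d r\<bar>)
      = (\<Prod>r\<in>I. \<bar>d i - d r\<bar>) * (\<Prod>s\<in>I. \<bar>d s - d i\<bar> * (\<Prod>r\<in>I - {s}. \<bar>d s - d r\<bar>))"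
    using assms by (simp add: insert_Diff_if)
  also have "\<dots> = (\<Prod>s\<in>I. \<Prod>r\<in>I - {s}. \<bar>d s - d r\<bar>) * (\<Prod>r\<in>I. \<bar>d i - d r\<bar>)\<^sup>2"
    by (simp add: prod.distrib power2_eq_square abs_minus_commute)
  finally show ?thesis
    by (simp add: vdm_def real_sqrt_mult prod_nonneg)
qed

lemma vdm_pos:
  assumes "finite I" "inj_on d I"
  shows "vdm d I > 0"
  unfolding vdm_def using assms by (auto intro!: prod_pos simp: inj_on_def)

lemma degree_linear_factors:
  "finite I \<Longrightarrow> degree (\<Prod>r\<in>I. [:- d r, 1:] :: real poly) = card I"
  by (subst degree_prod_sum_eq) auto

text \<open>A polynomial is recorded by its quotient \<open>q\<close> after division by the product
  of the \<open>X - d s\<close> and by the Lagrange coefficients \<open>- w s\<close> of its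
  remainder. The Jacobian of these coordinates is the Vandermonde product: each new node
  \<open>d i\<close> contributes the value \<open>e\<close> at \<open>d i\<close> of the product of
  the earlier linear factors.\<close>

lemma nn_integral_coeff_lborel_lagrange:
  fixes d :: "'i \<Rightarrow> real"
  assumes "finite I" "inj_on d I" "F \<in> borel_measurable poly_borel"
  shows "(\<integral>\<^sup>+ p. F p \<partial>coeff_lborel c (m + card I)) = ennreal (vdm d I) *
    (\<integral>\<^sup>+ w. \<integral>\<^sup>+ q. F (q * (\<Prod>s\<in>I. [:- d s, 1:]) - (\<Sum>s\<in>I. smult (w s) (\<Prod>r\<in>I - {s}. [:- d r, 1:])))
       \<partial>coeff_lborel c m \<partial>(\<Pi>\<^sub>M s\<in>I. lborel))"
  using assms
proof (induction I arbitrary: F rule: finite_induct)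
  case empty
  then show ?case by (simp add: space_PiM emeasure_PiM_empty)
next
  case (insert i I)
  note [measurable] = insert.prems(2)
  interpret K: sigma_finite_measure "coeff_lborel c k" for k by (rule sigma_finite_coeff_lborel)
  interpret P: finite_product_sigma_finite "\<lambda>_::'i. lborel :: real measure" I
    by standard fact
  define L where "L = (\<Prod>r\<in>I. [:- d r, 1:])"
  define e where "e = poly L (d i)"
  define g where "g = synthetic_div L (d i)"
  have e: "\<bar>e\<bar> = (\<Prod>r\<in>I. \<bar>d i - d r\<bar>)" by (simp add: e_def L_def poly_prod abs_prod)
  have e0: "e \<noteq> 0"
    using insert by (auto simp: e_def L_def poly_prod inj_on_def)
  have Lg: "L = [:- d i, 1:] * g + [:e:]"
    using synthetic_div_correct'[of "d i" L] by (simp add: g_def e_def)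
  have degg: "coeff g j = 0" if "j \<ge> m + card I" for j
  proof (cases "I = {}")
    case True
    then show ?thesis by (simp add: g_def L_def synthetic_div_eq_0_iff[THEN iffD2])
  next
    case False
    then have "degree g < card I"
      using insert.hyps by (simp add: g_def L_def degree_synthetic_div degree_linear_factors card_gt_0_iff)
    then show ?thesis using that by (intro coeff_eq_0) auto
  qed
  \<comment> \<open>With remainder \<open>- e * w\<close>, translating the quotient by
    \<open>- w g\<close> turns the constant into \<open>- w L\<close>, because
    \<open>L = (X - d i) g + e\<close>; this \<open>L\<close> is the Lagrange basis element of the
    new node.\<close>
  have eq: "[:- d i, 1:] * (q + smult (- w) g) + [:0 + - e * w:]
        = [:- d i, 1:] * q - smult w L - smult 0 L + [:0:]" for q w
  proof -
    have pl: "poly L x = (x - d i) * poly g x + e" for x by (subst Lg) (simp add: algebra_simps)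
    show ?thesis
      by (intro poly_eq_poly_eq_iff[THEN iffD1] ext) (simp add: pl algebra_simps)
  qed
  have inj: "inj_on d I" using insert.prems by simp
  have prodi: "(\<Prod>s\<in>insert i I. [:- d s, 1:]) = [:- d i, 1:] * L"
    using insert.hyps by (simp add: L_def)
  have sumi: "(\<Sum>s\<in>insert i I. smult ((w(i:=v)) s) (\<Prod>r\<in>insert i I - {s}. [:- d r, 1:]))
      = smult v L + [:- d i, 1:] * (\<Sum>s\<in>I. smult (w s) (\<Prod>r\<in>I - {s}. [:- d r, 1:]))" for v and w :: "'i \<Rightarrow> real"
  proof -
    have "insert i I - {s} = insert i (I - {s})" if "s \<in> I" for s using that insert.hyps by auto
    then have "(\<Sum>s\<in>I. smult ((w(i:=v)) s) (\<Prod>r\<in>insert i I - {s}. [:- d r, 1:]))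
       = (\<Sum>s\<in>I. [:- d i, 1:] * smult (w s) (\<Prod>r\<in>I - {s}. [:- d r, 1:]))"
      using insert.hyps by (intro sum.cong) (auto simp: mult.left_commute mult_smult_right)
    moreover have "insert i I - {i} = I" using insert.hyps by auto
    ultimately show ?thesis
      using insert.hyps by (simp add: L_def sum_distrib_left)
  qed
  have "(\<integral>\<^sup>+ p. F p \<partial>coeff_lborel c (m + card (insert i I)))
      = (\<integral>\<^sup>+ v. \<integral>\<^sup>+ q. F ([:- d i, 1:] * q + [:v:]) \<partial>coeff_lborel c (m + card I) \<partial>lborel)"
    using insert.hyps
    by (simp add: nn_integral_coeff_lborel_linear[where l = "d i"])
  also have "\<dots> = ennreal \<bar>- e\<bar> * (\<integral>\<^sup>+ v. \<integral>\<^sup>+ q. F ([:- d i, 1:] * q + [:0 + - e * v:]) \<partial>coeff_lborel c (m + card I) \<partial>lborel)"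
    by (rule nn_integral_real_affine) (simp_all add: e0)
  also have "(\<integral>\<^sup>+ v. \<integral>\<^sup>+ q. F ([:- d i, 1:] * q + [:0 + - e * v:]) \<partial>coeff_lborel c (m + card I) \<partial>lborel)
     = (\<integral>\<^sup>+ v. \<integral>\<^sup>+ q. F ([:- d i, 1:] * (q + smult (- v) g) + [:0 + - e * v:]) \<partial>coeff_lborel c (m + card I) \<partial>lborel)"
    using degg
    by (intro nn_integral_cong nn_integral_coeff_lborel_add[symmetric, where f = "\<lambda>q. F ([:- d i, 1:] * q + [:0 + - e * v:])" for v]) auto
  also have "\<dots> = (\<integral>\<^sup>+ v. \<integral>\<^sup>+ q. F ([:- d i, 1:] * q - smult v L) \<partial>coeff_lborel c (m + card I) \<partial>lborel)"
    unfolding eq by simp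
  also have "\<dots> = (\<integral>\<^sup>+ v. ennreal (vdm d I) * (\<integral>\<^sup>+ w. \<integral>\<^sup>+ q. F ([:- d i, 1:] * 
          (q * L - (\<Sum>s\<in>I. smult (w s) (\<Prod>r\<in>I - {s}. [:- d r, 1:]))) - smult v L)
       \<partial>coeff_lborel c m \<partial>(\<Pi>\<^sub>M s\<in>I. lborel)) \<partial>lborel)"
    unfolding L_def
    by (intro nn_integral_cong insert.IH[where F = "\<lambda>q. F ([:- d i, 1:] * q - smult v (\<Prod>r\<in>I. [:- d r, 1:]))" for v] inj) measurable
  also have "\<dots> = ennreal (vdm d I) * (\<integral>\<^sup>+ v. (\<integral>\<^sup>+ w. \<integral>\<^sup>+ q. F ([:- d i, 1:] * 
          (q * L - (\<Sum>s\<in>I. smult (w s) (\<Prod>r\<in>I - {s}. [:- d r, 1:]))) - smult v L)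
       \<partial>coeff_lborel c m \<partial>(\<Pi>\<^sub>M s\<in>I. lborel)) \<partial>lborel)"
    by (rule nn_integral_cmult) measurable
  also have "(\<integral>\<^sup>+ v. (\<integral>\<^sup>+ w. \<integral>\<^sup>+ q. F ([:- d i, 1:] * 
          (q * L - (\<Sum>s\<in>I. smult (w s) (\<Prod>r\<in>I - {s}. [:- d r, 1:]))) - smult v L)
       \<partial>coeff_lborel c m \<partial>(\<Pi>\<^sub>M s\<in>I. lborel)) \<partial>lborel)
     = (\<integral>\<^sup>+ v. (\<integral>\<^sup>+ w. \<integral>\<^sup>+ q. F (q * (\<Prod>s\<in>insert i I. [:- d s, 1:]) - (\<Sum>s\<in>insert i I. smult ((w(i:=v)) s) (\<Prod>r\<in>insert i I - {s}. [:- d r, 1:])))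
       \<partial>coeff_lborel c m \<partial>(\<Pi>\<^sub>M s\<in>I. lborel)) \<partial>lborel)"
    unfolding prodi sumi by (simp only: algebra_simps)
  also have "\<dots> = (\<integral>\<^sup>+ w. \<integral>\<^sup>+ q. F (q * (\<Prod>s\<in>insert i I. [:- d s, 1:]) - (\<Sum>s\<in>insert i I. smult (w s) (\<Prod>r\<in>insert i I - {s}. [:- d r, 1:])))
       \<partial>coeff_lborel c m \<partial>(\<Pi>\<^sub>M s\<in>insert i I. lborel))"
    by (rule P.product_nn_integral_insert_rev[symmetric]) (simp_all add: insert.hyps)
  finally show ?case
    using insert.hyps by (simp add: vdm_insert e ennreal_mult vdm_nonneg prod_nonneg mult_ac)
qed

subsection \<open>Real-rooted polynomials and their roots\<close>

definition simple_split :: "nat \<Rightarrow> real poly \<Rightarrow> bool" where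
  "simple_split n p \<longleftrightarrow> (\<exists>S. finite S \<and> card S = n \<and> p = (\<Prod>s\<in>S. [:- s, 1:]))"

lemma roots_linear_factors:
  fixes d :: "'i \<Rightarrow> real"
  shows "finite S \<Longrightarrow> {x. poly (\<Prod>s\<in>S. [:- d s, 1:]) x = 0} = d ` S"
  by (auto simp: poly_prod)

lemma simple_splitD:
  assumes "simple_split n p"
  shows "finite {x. poly p x = 0}" "card {x. poly p x = 0} = n" "p = (\<Prod>s | poly p s = 0. [:- s, 1:])"
  using assms roots_linear_factors[of _ "\<lambda>x. x"] unfolding simple_split_def by auto

lemma simple_splitI:
  assumes "finite I" "inj_on d I" "card I = n"
  shows "simple_split n (\<Prod>s\<in>I. [:- d s, 1:])"
  unfolding simple_split_def using assms
  by (intro exI[of _ "d ` I"]) (simp add: card_image prod.reindex)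

section \<open>Ordered roots as measurable functions\<close>

primrec root_sign :: "nat \<Rightarrow> real poly \<Rightarrow> real \<Rightarrow> real" where
  "root_sign 0 p x = poly p x"
| "root_sign (Suc k) p x = root_sign k p x *
     (x - real_of_ereal (SUP q\<in>\<rat>. if root_sign k p q < 0 then ereal q else - \<infinity>))"

text \<open>For a polynomial with simple real roots this is the \<open>k\<close>-th largest root (from \<open>k = 0\<close>):
  the factors of \<^const>\<open>root_sign\<close> undo the sign changes at the larger roots. Only the values at the
  rationals enter, which makes the root a measurable function of the polynomial.\<close>
definition nth_root_of :: "nat \<Rightarrow> real poly \<Rightarrow> real" where
  "nth_root_of k p = real_of_ereal (SUP q\<in>\<rat>. if root_sign k p q < 0 then ereal q else - \<infinity>)"

lemma measurable_root_sign_nth_root_of: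
  "(\<lambda>p. root_sign k p x) \<in> borel_measurable poly_borel" (is ?A)
  "nth_root_of k \<in> borel_measurable poly_borel" (is ?B)
proof -
  have *: "(\<forall>x. (\<lambda>p. root_sign k p x) \<in> borel_measurable poly_borel) \<Longrightarrow> nth_root_of k \<in> borel_measurable poly_borel" for k
  proof -
    assume [measurable]: "\<forall>x. (\<lambda>p. root_sign k p x) \<in> borel_measurable poly_borel"
    then have [measurable]: "(\<lambda>p. root_sign k p x) \<in> borel_measurable poly_borel" for x ..
    show "nth_root_of k \<in> borel_measurable poly_borel"
      unfolding nth_root_of_def[abs_def]
      by (intro borel_measurable_real_of_ereal borel_measurable_SUP countable_rat) measurable
  qed
  have "\<forall>x. (\<lambda>p. root_sign k p x) \<in> borel_measurable poly_borel"
  proof (induction k)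
    case (Suc k)
    note [measurable] = *[OF Suc, unfolded nth_root_of_def[abs_def]] Suc[rule_format]
    show ?case unfolding root_sign.simps by (intro allI) measurable
  qed simp
  with * show ?A ?B by auto
qed

lemmas [measurable] = measurable_root_sign_nth_root_of(2)

text \<open>\<open>T\<close> holds the roots already removed, which occur squared, and
  \<open>S\<close> the remaining ones. Above \<open>Max S\<close> nothing is negative; just below it
  exactly the factor of \<open>Max S\<close> is negative, so rationals with a negative value
  accumulate at \<open>Max S\<close>. As \<open>Max S\<close> is not in \<open>T\<close>, the
  squares do not vanish close to it.\<close>

lemma SUP_rat_negative:
  fixes S T :: "real set"
  assumes "finite S" "S \<noteq> {}" "finite T" "Max S \<notin> T"
  shows "(SUP q\<in>\<rat>. if (\<Prod>t\<in>T. (q - t)\<^sup>2) * (\<Prod>s\<in>S. q - s) < 0 then ereal q else - \<infinity>) = ereal (Max S)"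
    (is "(SUP q\<in>\<rat>. ?f q) = _")
proof (rule antisym)
  show "(SUP q\<in>\<rat>. ?f q) \<le> ereal (Max S)"
  proof (rule SUP_least)
    fix q :: real
    have "0 \<le> (\<Prod>t\<in>T. (q - t)\<^sup>2) * (\<Prod>s\<in>S. q - s)" if "q > Max S"
      using that assms by (intro mult_nonneg_nonneg prod_nonneg) (auto simp: less_eq_real_def)
    then show "?f q \<le> ereal (Max S)" by force
  qed
  show "ereal (Max S) \<le> (SUP q\<in>\<rat>. ?f q)"
  proof (rule dense_ge)
    fix z assume z: "(SUP q\<in>\<rat>. ?f q) < z"
    show "ereal (Max S) \<le> z"
    proof (rule ccontr)
      assume "\<not> ereal (Max S) \<le> z"
      then have "z < ereal (Max S)" by simp
      then obtain y where y: "z < ereal y" "ereal y < ereal (Max S)"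
        using ereal_dense2 by blast
      \<comment> \<open>No root lies strictly between \<open>a\<close> and \<open>Max S\<close>, so
        any rational there gives a negative value; including \<open>y\<close> keeps this rational
        above the assumed smaller bound.\<close>
      define a where "a = Max (insert y {t \<in> S \<union> T. t < Max S})"
      have fin: "finite (insert y {t \<in> S \<union> T. t < Max S})" using assms by simp
      have "a < Max S" using y fin by (subst a_def, subst Max_less_iff) auto
      then obtain q where q: "q \<in> \<rat>" "a < q" "q < Max S"
        using Rats_dense_in_real by blast
      have aq: "t < q" if "t \<in> S \<union> T" "t < Max S" for t
        using that q Max_ge[OF fin, of t] unfolding a_def by force
      have "y < q" using q Max_ge[OF fin, of y] unfolding a_def by simp
      have "(\<Prod>t\<in>T. (q - t)\<^sup>2) > 0"
      proof (intro prod_pos ballI)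
        fix t assume "t \<in> T"
        then have "q \<noteq> t" using aq[of t] q(3) assms(4) by (cases t "Max S" rule: linorder_cases) auto
        then show "(q - t)\<^sup>2 > 0" by simp
      qed
      moreover have "(\<Prod>s\<in>S - {Max S}. q - s) > 0"
      proof (intro prod_pos ballI)
        fix s assume "s \<in> S - {Max S}"
        then have "s < Max S" using Max_ge[OF assms(1), of s] by auto
        with aq[of s] \<open>s \<in> S - {Max S}\<close> show "q - s > 0" by simp
      qed
      then have "(\<Prod>s\<in>S. q - s) < 0"
        using assms q by (subst prod.remove[of _ "Max S"]) (auto intro: mult_neg_pos)
      ultimately have fq: "?f q = ereal q" by (simp add: mult_pos_neg)
      have "?f q \<le> (SUP q\<in>\<rat>. ?f q)" using q(1) by (rule SUP_upper)
      then have "ereal q \<le> (SUP q\<in>\<rat>. ?f q)" unfolding fq .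
      with z y \<open>y < q\<close> show False
        by (meson ereal_less_eq(3) less_le_not_le order.strict_trans1 order.strict_trans2 order_less_imp_le)
    qed
  qed
qed

text \<open>After \<open>k\<close> steps \<open>T\<close> is the set of roots not yet listed, and
  \<open>root_sign k p\<close> has squared factors for the listed roots and simple ones for
  \<open>T\<close>; the supremum then finds \<open>Max T\<close>.\<close>

lemma bij_betw_nth_root_of:
  assumes "finite S" "p = (\<Prod>s\<in>S. [:- s, 1:])"
  shows "bij_betw (\<lambda>k. nth_root_of k p) {..<card S} S"
proof -
  have "\<exists>T\<subseteq>S. card T = card S - k \<and> bij_betw (\<lambda>k. nth_root_of k p) {..<k} (S - T) \<and>
      (\<forall>x. root_sign k p x = (\<Prod>t\<in>S - T. (x - t)\<^sup>2) * (\<Prod>s\<in>T. x - s))" if "k \<le> card S" for k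
    using that
  proof (induction k)
    case 0
    then show ?case
      using assms by (intro exI[of _ S]) (simp add: bij_betw_def poly_prod)
  next
    case (Suc k)
    then obtain T where T: "T \<subseteq> S" "card T = card S - k" "bij_betw (\<lambda>k. nth_root_of k p) {..<k} (S - T)"
      "\<And>x. root_sign k p x = (\<Prod>t\<in>S - T. (x - t)\<^sup>2) * (\<Prod>s\<in>T. x - s)"
      by auto
    have finT: "finite T" using T(1) assms(1) finite_subset by blast
    have neT: "T \<noteq> {}" using T(2) Suc.prems by auto
    have M: "nth_root_of k p = Max T"
      unfolding nth_root_of_def T(4)
      using finT neT assms(1) by (subst SUP_rat_negative) auto
    have MT: "Max T \<in> T" using finT neT by simp
    have ST: "S - (T - {Max T}) = insert (Max T) (S - T)" using MT T(1) by auto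
    show ?case
    proof (intro exI[of _ "T - {Max T}"] conjI allI)
      show "T - {Max T} \<subseteq> S" "card (T - {Max T}) = card S - Suc k"
        using T(1,2) finT MT by auto
      have "bij_betw (\<lambda>k. nth_root_of k p) ({..<k} \<union> {k}) ((S - T) \<union> {Max T})"
        using MT by (intro bij_betw_combine T(3)) (auto simp: bij_betw_def M)
      then show "bij_betw (\<lambda>k. nth_root_of k p) {..<Suc k} (S - (T - {Max T}))"
        by (simp add: ST lessThan_Suc)
      fix x
      have "root_sign (Suc k) p x = root_sign k p x * (x - Max T)"
        using M by (simp add: nth_root_of_def)
      also have "\<dots> = (\<Prod>t\<in>S - (T - {Max T}). (x - t)\<^sup>2) * (\<Prod>s\<in>T - {Max T}. x - s)"
        using MT finT assms(1) by (simp add: T(4) ST prod.remove[of T "Max T"] power2_eq_square)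
      finally show "root_sign (Suc k) p x = (\<Prod>t\<in>S - (T - {Max T}). (x - t)\<^sup>2) * (\<Prod>s\<in>T - {Max T}. x - s)" .
    qed
  qed
  from this[of "card S"] obtain T where "T \<subseteq> S" "card T = 0" "bij_betw (\<lambda>k. nth_root_of k p) {..<card S} (S - T)"
    by auto
  moreover from this have "T = {}" using assms(1) finite_subset by fastforce
  ultimately show ?thesis by simp
qed

lemma bij_betw_nth_root_of':
  assumes "simple_split n p"
  shows "bij_betw (\<lambda>k. nth_root_of k p) {..<n} {x. poly p x = 0}"
  using bij_betw_nth_root_of[of "{x. poly p x = 0}" p] simple_splitD[OF assms] by simp

text \<open>Replaces the existential over root sets by a condition on the functions
  \<open>nth_root_of k\<close>, which are measurable on all polynomials. For polynomials that do not
  split, one of the two conditions fails whatever values these functions take.\<close>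

lemma simple_split_iff:
  "simple_split n p \<longleftrightarrow> inj_on (\<lambda>k. nth_root_of k p) {..<n} \<and> p = (\<Prod>k<n. [:- nth_root_of k p, 1:])"
proof
  assume *: "simple_split n p"
  note bij = bij_betw_nth_root_of'[OF *]
  show "inj_on (\<lambda>k. nth_root_of k p) {..<n} \<and> p = (\<Prod>k<n. [:- nth_root_of k p, 1:])"
    using bij prod.reindex_bij_betw[OF bij, of "\<lambda>s. [:- s, 1:]"] simple_splitD(3)[OF *]
    by (simp add: bij_betw_def)
next
  assume *: "inj_on (\<lambda>k. nth_root_of k p) {..<n} \<and> p = (\<Prod>k<n. [:- nth_root_of k p, 1:])"
  then show "simple_split n p"
    using simple_splitI[of "{..<n}" "\<lambda>k. nth_root_of k p" n] by simp
qed

lemma measurable_simple_split [measurable]: "Measurable.pred poly_borel (simple_split n)"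
proof -
  have "Measurable.pred poly_borel (\<lambda>p. (\<forall>i<n. \<forall>j<n. nth_root_of i p = nth_root_of j p \<longrightarrow> i = j) \<and>
      (\<forall>i. coeff p i = coeff (\<Prod>k<n. [:- nth_root_of k p, 1:]) i))"
    by measurable
  moreover have "simple_split n = (\<lambda>p. (\<forall>i<n. \<forall>j<n. nth_root_of i p = nth_root_of j p \<longrightarrow> i = j) \<and>
      (\<forall>i. coeff p i = coeff (\<Prod>k<n. [:- nth_root_of k p, 1:]) i))"
  proof
    fix p
    show "simple_split n p = ((\<forall>i<n. \<forall>j<n. nth_root_of i p = nth_root_of j p \<longrightarrow> i = j) \<and>
      (\<forall>i. coeff p i = coeff (\<Prod>k<n. [:- nth_root_of k p, 1:]) i))"
      unfolding simple_split_iff[of n p] poly_eq_iff inj_on_def by blast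
  qed
  ultimately show ?thesis by simp
qed

text \<open>Since \<open>t\<close> is not a root of \<open>q\<close>, it is a new simple root, and
  the factor \<open>X - t\<close> can be cancelled again.\<close>

lemma simple_split_linear_mult:
  assumes "poly q t \<noteq> 0"
  shows "simple_split (Suc n) ([:- t, 1:] * q) \<longleftrightarrow> simple_split n q"
proof
  assume *: "simple_split (Suc n) ([:- t, 1:] * q)"
  define S where "S = {x. poly ([:- t, 1:] * q) x = 0}"
  note S = simple_splitD[OF *, folded S_def]
  have "t \<in> S" by (simp add: S_def)
  have "[:- t, 1:] * q = [:- t, 1:] * (\<Prod>s\<in>S - {t}. [:- s, 1:])"
    using S(1,3) \<open>t \<in> S\<close> by (simp add: prod.remove)
  then have "q = (\<Prod>s\<in>S - {t}. [:- s, 1:])"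
    by (subst (asm) mult_cancel_left) auto
  then show "simple_split n q"
    using S \<open>t \<in> S\<close> unfolding simple_split_def by (intro exI[of _ "S - {t}"]) auto
next
  assume *: "simple_split n q"
  note S = simple_splitD[OF *]
  show "simple_split (Suc n) ([:- t, 1:] * q)"
    unfolding simple_split_def using S assms
    by (intro exI[of _ "insert t {x. poly q x = 0}"]) auto
qed

section \<open>From coefficients to roots\<close>

text \<open>\<open>\<rho>\<close> selects one preimage under \<open>F\<close>, so \<open>F\<close>
  need not be injective globally: it is injective on the set of selected points, which it maps onto
  \<open>V\<close>. The change of variables theorem is applied on bounded sets, where the image has
  finite measure, and the resulting equality of two measures is extended by exhaustion.\<close>

lemma nn_integral_change_of_variables_1:
  fixes F F' \<rho> :: "real \<Rightarrow> real" and G :: "real \<Rightarrow> ennreal"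
  assumes V [measurable]: "V \<in> sets borel" and [measurable]: "\<rho> \<in> borel_measurable borel"
    and F': "\<And>x. (F has_field_derivative F' x) (at x)" and [measurable]: "F' \<in> borel_measurable borel"
    and inv: "\<And>v. v \<in> V \<Longrightarrow> F (\<rho> v) = v"
    and [measurable]: "G \<in> borel_measurable borel"
  shows "(\<integral>\<^sup>+ v. indicator V v * G v \<partial>lborel)
       = (\<integral>\<^sup>+ t. (if F t \<in> V \<and> \<rho> (F t) = t then ennreal \<bar>F' t\<bar> * G (F t) else 0) \<partial>lborel)"
proof -
  have "continuous_on UNIV F"
    using F' by (meson DERIV_continuous_on has_field_derivative_at_within)
  then have [measurable]: "F \<in> borel_measurable borel" by (rule borel_measurable_continuous_onI)
  define U where "U = {t. F t \<in> V \<and> \<rho> (F t) = t}"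
  have U [measurable]: "U \<in> sets borel" unfolding U_def by measurable
  define M1 where "M1 = distr (density lborel (\<lambda>t. indicator U t * ennreal \<bar>F' t\<bar>)) borel F"
  define M2 where "M2 = density lborel (indicator V :: real \<Rightarrow> ennreal)"
  have bounded: "emeasure M1 A = emeasure M2 A" if A [measurable]: "A \<in> sets borel" "bounded A" for A
  proof -
    define S where "S = U \<inter> F -` (A \<inter> V)"
    have S [measurable]: "S \<in> sets borel"
      unfolding S_def using measurable_sets[of F borel borel "A \<inter> V"] by auto
    have inj: "inj_on F S" 
    proof (rule inj_onI)
      fix x y assume xy: "x \<in> S" "y \<in> S" and F: "F x = F y"
      from xy(1) have "\<rho> (F x) = x" by (simp add: S_def U_def)
      moreover from xy(2) have "\<rho> (F y) = y" by (simp add: S_def U_def)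
      ultimately show "x = y" using F by metis
    qed
    have im: "F ` S = A \<inter> V"
    proof
      show "A \<inter> V \<subseteq> F ` S"
      proof
        fix v assume v: "v \<in> A \<inter> V"
        then have Fv: "F (\<rho> v) = v" using inv by simp
        with v have "\<rho> v \<in> S" by (simp add: S_def U_def)
        then show "v \<in> F ` S" using Fv by (metis imageI)
      qed
    qed (auto simp: S_def)
    have AV: "A \<inter> V \<in> lmeasurable"
      using that(2) by (intro bounded_set_imp_lmeasurable) (simp_all add: bounded_Int)
    have *: "(\<lambda>x. \<bar>F' x\<bar> * 1) absolutely_integrable_on S \<and> integral S (\<lambda>x. \<bar>F' x\<bar> * 1) = measure lebesgue (A \<inter> V)"
    proof (subst has_absolute_integral_change_of_variables_1'[OF _ _ inj])
      show "S \<in> sets lebesgue" by simp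
      show "(F has_real_derivative F' x) (at x within S)" if "x \<in> S" for x
        using F' has_field_derivative_at_within by blast
      show "(\<lambda>x. 1 :: real) absolutely_integrable_on F ` S \<and> integral (F ` S) (\<lambda>x. 1) = measure lebesgue (A \<inter> V)"
        unfolding im
      proof
        show "(\<lambda>x. 1::real) absolutely_integrable_on A \<inter> V"
          using AV unfolding lmeasurable_iff_integrable_on
          by (rule nonnegative_absolutely_integrable_1) simp
      qed (rule lmeasure_integral[symmetric, OF AV])
    qed
    then have "((\<lambda>x. \<bar>F' x\<bar>) has_integral measure lebesgue (A \<inter> V)) S"
      by (auto simp: has_integral_integrable_integral absolutely_integrable_on_def)
    from nn_integral_has_integral_lebesgue[OF _ this]
    have "(\<integral>\<^sup>+ x. indicator S x * ennreal \<bar>F' x\<bar> \<partial>lborel) = measure lebesgue (A \<inter> V)"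
      by (simp add: ennreal_mult' ennreal_indicator)
    also have "\<dots> = emeasure lborel (A \<inter> V)"
      using emeasure_eq_measure2[OF AV] by simp
    finally have *: "(\<integral>\<^sup>+ x. indicator S x * ennreal \<bar>F' x\<bar> \<partial>lborel) = emeasure lborel (A \<inter> V)" .
    have "emeasure M1 A = (\<integral>\<^sup>+ x. indicator U x * ennreal \<bar>F' x\<bar> * indicator (F -` A) x \<partial>lborel)"
      unfolding M1_def using measurable_sets[of F borel borel A]
      by (subst emeasure_distr) (auto simp: emeasure_density)
    also have "\<dots> = (\<integral>\<^sup>+ x. indicator S x * ennreal \<bar>F' x\<bar> \<partial>lborel)"
      by (intro nn_integral_cong) (auto simp: S_def U_def indicator_def)
    also have "\<dots> = emeasure M2 A"
      unfolding * M2_def by (subst emeasure_density) (auto simp: nn_integral_indicator indicator_inter_arith[symmetric] Int_commute)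
    finally show ?thesis .
  qed
  have "M1 = M2"
  proof (rule measure_eqI)
    show "sets M1 = sets M2" by (simp add: M1_def M2_def)
    fix A assume "A \<in> sets M1"
    then have A: "A \<in> sets borel" by (simp add: M1_def)
    have UN: "(\<Union>n. A \<inter> {- real n..real n}) = A"
    proof -
      have "\<exists>n. x \<in> {- real n..real n}" for x
        using real_arch_simple[of "\<bar>x\<bar>"] by (auto simp: abs_le_iff) (metis minus_le_iff)
      then show ?thesis by auto
    qed
    have *: "emeasure M A = (SUP n. emeasure M (A \<inter> {- real n..real n}))" if "sets M = sets borel" for M
    proof -
      have "(SUP n. emeasure M (A \<inter> {- real n..real n})) = emeasure M (\<Union>n. A \<inter> {- real n..real n})"
      proof (rule SUP_emeasure_incseq)
        show "range (\<lambda>n. A \<inter> {- real n..real n}) \<subseteq> sets M" using A unfolding that by auto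
        show "incseq (\<lambda>n. A \<inter> {- real n..real n})"
          by (intro monoI Int_mono order_refl atLeastatMost_subset_iff[THEN iffD2]) simp
      qed
      then show ?thesis unfolding UN ..
    qed
    have sets: "sets M1 = sets borel" "sets M2 = sets borel" by (simp_all add: M1_def M2_def)
    have "emeasure M1 (A \<inter> {- real n..real n}) = emeasure M2 (A \<inter> {- real n..real n})" for n
      using A by (intro bounded) (simp_all add: bounded_Int)
    then show "emeasure M1 A = emeasure M2 A" by (subst (1 2) *) (simp_all only: sets)
  qed
  then have "(\<integral>\<^sup>+ v. G v \<partial>M1) = (\<integral>\<^sup>+ v. G v \<partial>M2)" by simp
  also have "(\<integral>\<^sup>+ v. G v \<partial>M2) = (\<integral>\<^sup>+ v. indicator V v * G v \<partial>lborel)"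
    unfolding M2_def by (subst nn_integral_density) auto
  also have "(\<integral>\<^sup>+ v. G v \<partial>M1) = (\<integral>\<^sup>+ t. indicator U t * ennreal \<bar>F' t\<bar> * G (F t) \<partial>lborel)"
    unfolding M1_def by (simp add: nn_integral_distr nn_integral_density)
  also have "\<dots> = (\<integral>\<^sup>+ t. (if F t \<in> V \<and> \<rho> (F t) = t then ennreal \<bar>F' t\<bar> * G (F t) else 0) \<partial>lborel)"
    by (intro nn_integral_cong) (auto simp: U_def)
  finally show ?thesis ..
qed

text \<open>For fixed upper coefficients \<open>q\<close>, the polynomial
  \<open>X q - t q(t)\<close> vanishes at \<open>t\<close>; the map from \<open>q\<close> to its
  cofactor of \<open>X - t\<close> preserves Lebesgue measure. Indeed
  \<open>q = (X - t) q' + v\<close> gives \<open>X q - t v = (X - t) (X q' + v)\<close>.\<close>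

lemma nn_integral_coeff_lborel_quotient:
  assumes [measurable]: "f \<in> borel_measurable poly_borel"
  shows "(\<integral>\<^sup>+ q. f (pCons (- t * poly q t) q) \<partial>coeff_lborel c m) = (\<integral>\<^sup>+ q. f ([:- t, 1:] * q) \<partial>coeff_lborel c m)"
proof (cases m)
  case 0
  then show ?thesis by simp
next
  case (Suc k)
  have "(\<integral>\<^sup>+ q. f (pCons (- t * poly q t) q) \<partial>coeff_lborel c (Suc k))
      = (\<integral>\<^sup>+ v. \<integral>\<^sup>+ q. f (pCons (- t * poly ([:- t, 1:] * q + [:v:]) t) ([:- t, 1:] * q + [:v:])) \<partial>coeff_lborel c k \<partial>lborel)"
    by (rule nn_integral_coeff_lborel_linear) measurable
  also have "\<dots> = (\<integral>\<^sup>+ v. \<integral>\<^sup>+ q. f ([:- t, 1:] * pCons v q) \<partial>coeff_lborel c k \<partial>lborel)"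
    by (simp add: algebra_simps)
  finally show ?thesis
    unfolding Suc by (subst nn_integral_coeff_lborel_Suc) simp_all
qed

text \<open>A polynomial with \<open>Suc m\<close> roots is counted once per choice of a root
  \<open>t\<close>, which explains the factor. For fixed higher coefficients, the constant term
  \<open>- t q(t)\<close> is parametrised by \<open>t\<close> with Jacobian
  \<open>\<bar>p'(t)\<bar>\<close>, and this equals the absolute value at \<open>t\<close> of the
  cofactor of \<open>X - t\<close>.\<close>

lemma nn_integral_simple_split_Suc:
  assumes [measurable]: "g \<in> borel_measurable poly_borel"
  shows "of_nat (Suc m) * (\<integral>\<^sup>+ p. indicator {p. simple_split (Suc m) p} p * g p \<partial>coeff_lborel 1 (Suc m))
    = (\<integral>\<^sup>+ t. \<integral>\<^sup>+ q. indicator {q. simple_split m q} q * ennreal \<bar>poly q t\<bar> * g ([:- t, 1:] * q) \<partial>coeff_lborel 1 m \<partial>lborel)"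
proof -
  interpret K: sigma_finite_measure "coeff_lborel 1 m" by (rule sigma_finite_coeff_lborel)
  interpret L: pair_sigma_finite "lborel :: real measure" "coeff_lborel 1 m" ..
  let ?n = "Suc m"
  let ?F = "\<lambda>q t. - t * poly q t"
  let ?F' = "\<lambda>q t. - poly (pderiv (pCons 0 q)) t"
  let ?SS = "simple_split (Suc m)"
  have fib: "of_nat ?n * (\<integral>\<^sup>+ v. indicator {v. ?SS (pCons v q)} v * g (pCons v q) \<partial>lborel)
     = (\<integral>\<^sup>+ t. (if ?SS (pCons (?F q t) q) then ennreal \<bar>?F' q t\<bar> * g (pCons (?F q t) q) else 0) \<partial>lborel)" for q
  proof -
    have root: "poly (pCons (?F q t) q) t = 0" for t by simp
    have "of_nat ?n * (\<integral>\<^sup>+ v. indicator {v. ?SS (pCons v q)} v * g (pCons v q) \<partial>lborel)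
      = (\<Sum>k<?n. \<integral>\<^sup>+ v. indicator {v. ?SS (pCons v q)} v * g (pCons v q) \<partial>lborel)"
      by simp
    \<comment> \<open>The \<open>k\<close>-th copy of the integral is parametrised by the
      \<open>k\<close>-th root, through the branch \<open>nth_root_of k\<close>.\<close>
    also have "\<dots> = (\<Sum>k<?n. \<integral>\<^sup>+ t. (if ?F q t \<in> {v. ?SS (pCons v q)} \<and> nth_root_of k (pCons (?F q t) q) = t
        then ennreal \<bar>?F' q t\<bar> * g (pCons (?F q t) q) else 0) \<partial>lborel)"
    proof (intro sum.cong refl nn_integral_change_of_variables_1)
      fix k v assume k: "k \<in> {..<?n}" and v: "v \<in> {v. ?SS (pCons v q)}"
      then have "poly (pCons v q) (nth_root_of k (pCons v q)) = 0"
        using bij_betw_nth_root_of'[of ?n "pCons v q"] by (auto simp: bij_betw_def)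
      then show "?F q (nth_root_of k (pCons v q)) = v" by (simp add: algebra_simps)
    next
      fix x
      have "((\<lambda>t. - poly (pCons 0 q) t) has_real_derivative ?F' q x) (at x)"
        by (intro derivative_intros poly_DERIV)
      then show "(?F q has_real_derivative ?F' q x) (at x)" by simp
    qed measurable
    also have "\<dots> = (\<integral>\<^sup>+ t. (\<Sum>k<?n. (if ?F q t \<in> {v. ?SS (pCons v q)} \<and> nth_root_of k (pCons (?F q t) q) = t
        then ennreal \<bar>?F' q t\<bar> * g (pCons (?F q t) q) else 0)) \<partial>lborel)"
      by (rule nn_integral_sum[symmetric]) measurable
    \<comment> \<open>Exactly one branch selects a given root \<open>t\<close>, so the sum over
      \<open>k\<close> collapses.\<close>
    also have "\<dots> = (\<integral>\<^sup>+ t. (if ?SS (pCons (?F q t) q) then ennreal \<bar>?F' q t\<bar> * g (pCons (?F q t) q) else 0) \<partial>lborel)"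
    proof (rule nn_integral_cong)
      fix t
      show "(\<Sum>k<?n. (if ?F q t \<in> {v. ?SS (pCons v q)} \<and> nth_root_of k (pCons (?F q t) q) = t
        then ennreal \<bar>?F' q t\<bar> * g (pCons (?F q t) q) else 0))
        = (if ?SS (pCons (?F q t) q) then ennreal \<bar>?F' q t\<bar> * g (pCons (?F q t) q) else 0)"
      proof (cases "?SS (pCons (?F q t) q)")
        case True
        have "t \<in> (\<lambda>k. nth_root_of k (pCons (?F q t) q)) ` {..<?n}" 
          using bij_betw_nth_root_of'[OF True] root[of t] by (simp only: bij_betw_def) blast
        then obtain k where k: "k < ?n" "nth_root_of k (pCons (?F q t) q) = t" by auto
        have "nth_root_of j (pCons (?F q t) q) = t \<longleftrightarrow> j = k" if "j < ?n" for j
          using bij_betw_imp_inj_on[OF bij_betw_nth_root_of'[OF True], THEN inj_onD, of j k] k that by auto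
        then have "(\<Sum>j<?n. (if ?F q t \<in> {v. ?SS (pCons v q)} \<and> nth_root_of j (pCons (?F q t) q) = t
        then ennreal \<bar>?F' q t\<bar> * g (pCons (?F q t) q) else 0))
         = (\<Sum>j<?n. if j = k then ennreal \<bar>?F' q t\<bar> * g (pCons (?F q t) q) else 0)"
          using True by (intro sum.cong) auto
        then show ?thesis using True k by simp
      qed simp
    qed
    finally show ?thesis .
  qed
  have "of_nat ?n * (\<integral>\<^sup>+ p. indicator {p. ?SS p} p * g p \<partial>coeff_lborel 1 ?n)
     = of_nat ?n * (\<integral>\<^sup>+ v. \<integral>\<^sup>+ q. indicator {v. ?SS (pCons v q)} v * g (pCons v q) \<partial>coeff_lborel 1 m \<partial>lborel)"
    by (subst nn_integral_coeff_lborel_Suc) (simp_all add: indicator_def)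
  also have "\<dots> = of_nat ?n * (\<integral>\<^sup>+ q. \<integral>\<^sup>+ v. indicator {v. ?SS (pCons v q)} v * g (pCons v q) \<partial>lborel \<partial>coeff_lborel 1 m)"
    unfolding indicator_def by (subst L.Fubini') simp_all
  also have "\<dots> = (\<integral>\<^sup>+ q. of_nat ?n * (\<integral>\<^sup>+ v. indicator {v. ?SS (pCons v q)} v * g (pCons v q) \<partial>lborel) \<partial>coeff_lborel 1 m)"
    unfolding indicator_def by (rule nn_integral_cmult[symmetric]) measurable
  also have "\<dots> = (\<integral>\<^sup>+ q. \<integral>\<^sup>+ t. (if ?SS (pCons (?F q t) q) then ennreal \<bar>?F' q t\<bar> * g (pCons (?F q t) q) else 0) \<partial>lborel \<partial>coeff_lborel 1 m)"
    unfolding fib ..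
  also have "\<dots> = (\<integral>\<^sup>+ t. \<integral>\<^sup>+ q. (if ?SS (pCons (?F q t) q) then ennreal \<bar>?F' q t\<bar> * g (pCons (?F q t) q) else 0) \<partial>coeff_lborel 1 m \<partial>lborel)"
    by (rule L.Fubini') measurable
  also have "\<dots> = (\<integral>\<^sup>+ t. \<integral>\<^sup>+ q. indicator {q. simple_split m q} q * ennreal \<bar>poly q t\<bar> * g ([:- t, 1:] * q) \<partial>coeff_lborel 1 m \<partial>lborel)"
  proof (rule nn_integral_cong)
    fix t :: real
    define f where "f = (\<lambda>p. if ?SS p then ennreal \<bar>poly (pderiv p) t\<bar> * g p else 0)"
    have [measurable]: "f \<in> borel_measurable poly_borel" unfolding f_def by measurable
    have "(\<integral>\<^sup>+ q. (if ?SS (pCons (?F q t) q) then ennreal \<bar>?F' q t\<bar> * g (pCons (?F q t) q) else 0) \<partial>coeff_lborel 1 m)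
      = (\<integral>\<^sup>+ q. f (pCons (?F q t) q) \<partial>coeff_lborel 1 m)"
    proof (rule nn_integral_cong)
      fix q
      have "pderiv (pCons (?F q t) q) = pderiv (pCons 0 q)" by (simp add: pderiv_pCons)
      then show "(if ?SS (pCons (?F q t) q) then ennreal \<bar>?F' q t\<bar> * g (pCons (?F q t) q) else 0) = f (pCons (?F q t) q)"
        by (simp only: f_def abs_minus_cancel)
    qed
    also have "\<dots> = (\<integral>\<^sup>+ q. f ([:- t, 1:] * q) \<partial>coeff_lborel 1 m)"
      by (rule nn_integral_coeff_lborel_quotient) measurable
    also have "\<dots> = (\<integral>\<^sup>+ q. indicator {q. simple_split m q} q * ennreal \<bar>poly q t\<bar> * g ([:- t, 1:] * q) \<partial>coeff_lborel 1 m)"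
    proof (intro nn_integral_cong)
      fix q
      have "poly (pderiv ([:- t, 1:] * q)) t = poly q t" by (simp only: pderiv_mult) (simp add: pderiv_pCons)
      then show "f ([:- t, 1:] * q) = indicator {q. simple_split m q} q * ennreal \<bar>poly q t\<bar> * g ([:- t, 1:] * q)"
        using simple_split_linear_mult[of q t m]
        by (cases "poly q t = 0") (auto simp: f_def indicator_def simp del: mult_pCons_left)
    qed
    finally show "(\<integral>\<^sup>+ q. (if ?SS (pCons (?F q t) q) then ennreal \<bar>?F' q t\<bar> * g (pCons (?F q t) q) else 0) \<partial>coeff_lborel 1 m)
      = (\<integral>\<^sup>+ q. indicator {q. simple_split m q} q * ennreal \<bar>poly q t\<bar> * g ([:- t, 1:] * q) \<partial>coeff_lborel 1 m)" .
  qed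
  finally show ?thesis .
qed

lemma measurable_vdm [measurable (raw)]:
  assumes "finite I" and [measurable]: "\<And>i. i \<in> I \<Longrightarrow> (\<lambda>x. d x i) \<in> borel_measurable M"
  shows "(\<lambda>x. vdm (d x) I) \<in> borel_measurable M"
  unfolding vdm_def by measurable

lemma vdm_cong: "(\<And>i. i \<in> I \<Longrightarrow> d i = d' i) \<Longrightarrow> vdm d I = vdm d' I"
  unfolding vdm_def by (intro arg_cong[where f = sqrt] prod.cong) auto

text \<open>The Jacobian of the map from roots to coefficients is the Vandermonde determinant.\<close>
lemma nn_integral_simple_split:
  fixes I :: "'i set"
  assumes "finite I" "g \<in> borel_measurable poly_borel"
  shows "fact (card I) * (\<integral>\<^sup>+ p. indicator {p. simple_split (card I) p} p * g p \<partial>coeff_lborel 1 (card I))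
    = (\<integral>\<^sup>+ x. ennreal (vdm x I) * g (\<Prod>i\<in>I. [:- x i, 1:]) \<partial>(\<Pi>\<^sub>M i\<in>I. lborel))"
  using assms
proof (induction I arbitrary: g rule: finite_induct)
  case empty
  have "simple_split 0 [:1:]"
    unfolding simple_split_def by (intro exI[of _ "{}"]) (auto simp: one_pCons)
  with empty show ?case by (simp add: space_PiM nn_integral_coeff_lborel_0 pCons_one)
next
  case (insert i I)
  note [measurable] = insert.prems
  interpret P: finite_product_sigma_finite "\<lambda>_::'i. lborel :: real measure" I
    by standard fact
  let ?m = "card I"
  interpret K: sigma_finite_measure "coeff_lborel 1 ?m" by (rule sigma_finite_coeff_lborel)
  have "fact (card (insert i I)) * (\<integral>\<^sup>+ p. indicator {p. simple_split (card (insert i I)) p} p * g p \<partial>coeff_lborel 1 (card (insert i I)))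
      = fact ?m * (of_nat (Suc ?m) * (\<integral>\<^sup>+ p. indicator {p. simple_split (Suc ?m) p} p * g p \<partial>coeff_lborel 1 (Suc ?m)))"
    unfolding card_insert_disjoint[OF insert.hyps] fact_Suc by (simp only: mult_ac)
  also have "\<dots> = fact ?m * (\<integral>\<^sup>+ t. \<integral>\<^sup>+ q. indicator {q. simple_split ?m q} q * ennreal \<bar>poly q t\<bar> * g ([:- t, 1:] * q) \<partial>coeff_lborel 1 ?m \<partial>lborel)"
    by (subst nn_integral_simple_split_Suc) auto
  also have "\<dots> = (\<integral>\<^sup>+ t. fact ?m * (\<integral>\<^sup>+ q. indicator {q. simple_split ?m q} q * (ennreal \<bar>poly q t\<bar> * g ([:- t, 1:] * q)) \<partial>coeff_lborel 1 ?m) \<partial>lborel)"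
    unfolding mult.assoc indicator_def by (rule nn_integral_cmult[symmetric]) measurable
  also have "\<dots> = (\<integral>\<^sup>+ t. (\<integral>\<^sup>+ x. ennreal (vdm x I) * (ennreal \<bar>poly (\<Prod>i\<in>I. [:- x i, 1:]) t\<bar> * g ([:- t, 1:] * (\<Prod>i\<in>I. [:- x i, 1:]))) \<partial>(\<Pi>\<^sub>M i\<in>I. lborel)) \<partial>lborel)"
    by (intro nn_integral_cong insert.IH) measurable
  also have "\<dots> = (\<integral>\<^sup>+ t. (\<integral>\<^sup>+ x. ennreal (vdm (x(i:=t)) (insert i I)) * g (\<Prod>j\<in>insert i I. [:- (x(i:=t)) j, 1:]) \<partial>(\<Pi>\<^sub>M i\<in>I. lborel)) \<partial>lborel)"
  proof (intro nn_integral_cong)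
    fix t and x :: "'i \<Rightarrow> real"
    have "vdm (x(i:=t)) I = vdm x I" by (rule vdm_cong) (use insert.hyps in auto)
    moreover have "(\<Prod>r\<in>I. \<bar>t - (x(i := t)) r\<bar>) = \<bar>poly (\<Prod>i\<in>I. [:- x i, 1:]) t\<bar>"
      unfolding poly_prod abs_prod by (rule prod.cong) (use insert.hyps in auto)
    moreover have "(\<Prod>j\<in>insert i I. [:- (x(i:=t)) j, 1:]) = [:- t, 1:] * (\<Prod>j\<in>I. [:- x j, 1:])"
      using insert.hyps by (subst prod.insert) (auto intro!: prod.cong simp del: mult_pCons_left)
    ultimately show "ennreal (vdm x I) * (ennreal \<bar>poly (\<Prod>i\<in>I. [:- x i, 1:]) t\<bar> * g ([:- t, 1:] * (\<Prod>i\<in>I. [:- x i, 1:])))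
       = ennreal (vdm (x(i:=t)) (insert i I)) * g (\<Prod>j\<in>insert i I. [:- (x(i:=t)) j, 1:])"
      using insert.hyps by (simp add: vdm_insert ennreal_mult vdm_nonneg mult_ac del: mult_pCons_left prod.insert)
  qed
  also have "\<dots> = (\<integral>\<^sup>+ x. ennreal (vdm x (insert i I)) * g (\<Prod>j\<in>insert i I. [:- x j, 1:]) \<partial>(\<Pi>\<^sub>M i\<in>insert i I. lborel))"
    by (rule P.product_nn_integral_insert_rev[symmetric]) (simp_all add: insert.hyps)
  finally show ?case .
qed

subsection \<open>Lagrange interpolation and interlacing\<close>

text \<open>The underlying space contains polynomials of every degree; this is how the degree and
  the leading coefficient required by the algebraic lemmas are recovered under the integral.\<close>

lemma AE_coeff_lborel: "AE p in coeff_lborel c k. coeff p k = c \<and> (\<forall>i>k. coeff p i = 0)"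
proof -
  define P where "P k p \<longleftrightarrow> coeff p k = c \<and> (\<forall>i>k. coeff p i = 0)" for k p
  have [measurable]: "Measurable.pred poly_borel (P k)" for k unfolding P_def by measurable
  have "(\<integral>\<^sup>+ p. indicator {p. \<not> P k p} p \<partial>coeff_lborel c k) = 0"
  proof (induction k)
    case 0
    have "coeff [:c:] i = 0" if "i > 0" for i using that by (cases i) auto
    then show ?case by (subst nn_integral_coeff_lborel_0) (auto simp: P_def indicator_def)
  next
    case (Suc k)
    have P_Suc: "P (Suc k) (pCons v q) \<longleftrightarrow> P k q" for v :: real and q
    proof -
      have "(\<forall>i>Suc k. coeff (pCons v q) i = 0) \<longleftrightarrow> (\<forall>i>k. coeff q i = 0)"
      proof safe
        fix i assume "\<forall>i>Suc k. coeff (pCons v q) i = 0" "i > k"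
        then show "coeff q i = 0" using coeff_pCons_Suc[of v q i] by (metis Suc_less_eq)
      next
        fix i assume "\<forall>i>k. coeff q i = 0" "i > Suc k"
        then show "coeff (pCons v q) i = 0" by (cases i) auto
      qed
      then show ?thesis by (simp add: P_def)
    qed
    have "(\<integral>\<^sup>+ p. indicator {p. \<not> P (Suc k) p} p \<partial>coeff_lborel c (Suc k))
      = (\<integral>\<^sup>+ v. \<integral>\<^sup>+ q. indicator {q. \<not> P k q} q \<partial>coeff_lborel c k \<partial>lborel)"
      unfolding indicator_def by (subst nn_integral_coeff_lborel_Suc) (simp_all add: P_Suc)
    then show ?case by (simp only: Suc.IH) simp
  qed
  then have "AE p in coeff_lborel c k. indicator {p. \<not> P k p} p = (0::ennreal)"
    by (subst (asm) nn_integral_0_iff_AE) (auto simp: indicator_def)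
  then show ?thesis by eventually_elim (auto simp: P_def indicator_def split: if_splits)
qed

lemma AE_coeff_lborel_monic: "AE p in coeff_lborel 1 k. degree p = k \<and> lead_coeff p = 1"
  using AE_coeff_lborel
proof eventually_elim
  case (elim p)
  then have "degree p = k" by (intro antisym degree_le le_degree) auto
  with elim show ?case by simp
qed

text \<open>Both sides have no coefficients of index \<open>card I\<close> or more and agree at
  \<open>card I\<close> distinct nodes.\<close>

lemma lagrange_interpolation:
  fixes r :: "real poly"
  assumes "finite I" "inj_on d I" "\<And>i. i \<ge> card I \<Longrightarrow> coeff r i = 0"
  shows "r = (\<Sum>s\<in>I. smult (poly r (d s) / poly (\<Prod>j\<in>I - {s}. [:- d j, 1:]) (d s)) (\<Prod>j\<in>I - {s}. [:- d j, 1:]))"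
    (is "_ = ?R")
proof (rule ccontr)
  assume neq: "r \<noteq> ?R"
  have degR: "coeff ?R i = 0" if "i \<ge> card I" for i
  proof -
    have "degree (\<Prod>j\<in>I - {s}. [:- d j, 1:]) < card I" if "s \<in> I" for s
      using that assms(1) by (subst degree_linear_factors) (auto intro!: psubset_card_mono simp del: card_Diff_insert card_Diff_singleton)
    then have "coeff (\<Prod>j\<in>I - {s}. [:- d j, 1:]) i = 0" if "s \<in> I" for s
      using that \<open>i \<ge> card I\<close> by (intro coeff_eq_0) (meson less_le_trans)
    then show ?thesis by (simp add: coeff_sum)
  qed
  have "poly ?R (d s) = poly r (d s)" if "s \<in> I" for s
  proof -
    have "poly (\<Prod>j\<in>I - {t}. [:- d j, 1:]) (d s) = 0" if "t \<in> I" "t \<noteq> s" for t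
      using that \<open>s \<in> I\<close> assms(1) by (auto simp: poly_prod)
    moreover have "poly (\<Prod>j\<in>I - {s}. [:- d j, 1:]) (d s) \<noteq> 0"
      using that assms(1,2) by (auto simp: poly_prod inj_on_def)
    ultimately show ?thesis
      using that assms(1) by (simp add: poly_sum sum.remove[of I s])
  qed
  then have "d ` I \<subseteq> {x. poly (r - ?R) x = 0}" by auto
  then have "card (d ` I) \<le> card {x. poly (r - ?R) x = 0}"
    using neq by (intro card_mono poly_roots_finite) auto
  also have "\<dots> \<le> degree (r - ?R)" using neq by (intro card_poly_roots_bound) auto
  finally have "card I \<le> degree (r - ?R)" using assms(2) by (simp add: card_image)
  then have "coeff (r - ?R) (degree (r - ?R)) = 0"
    using assms(3) degR by simp
  then have "r - ?R = 0" by (simp only: leading_coeff_0_iff)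
  then show False using neq by (simp only: right_minus_eq)
qed

section \<open>Complex roots and interlacing\<close>

definition cpoly :: "real poly \<Rightarrow> complex poly" where
  "cpoly = map_poly of_real"

lemma coeff_cpoly [simp]: "coeff (cpoly p) i = of_real (coeff p i)"
  by (simp add: cpoly_def coeff_map_poly)

lemma cpoly_simps [simp]:
  "cpoly (p + q) = cpoly p + cpoly q" "cpoly (p - q) = cpoly p - cpoly q"
  "cpoly (- p) = - cpoly p"
  "cpoly (smult a p) = smult (of_real a) (cpoly p)" "cpoly (p * q) = cpoly p * cpoly q"
  "cpoly (pCons a p) = pCons (of_real a) (cpoly p)" "cpoly 0 = 0" "cpoly 1 = 1"
  "cpoly (pderiv p) = pderiv (cpoly p)"
  by (auto simp: poly_eq_iff coeff_mult coeff_pderiv coeff_pCons split: nat.splits)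

lemma cpoly_prod [simp]: "cpoly (\<Prod>i\<in>I. f i) = (\<Prod>i\<in>I. cpoly (f i))"
  by (induction I rule: infinite_finite_induct) simp_all

lemma cpoly_sum [simp]: "cpoly (\<Sum>i\<in>I. f i) = (\<Sum>i\<in>I. cpoly (f i))"
  by (induction I rule: infinite_finite_induct) simp_all

lemma cpoly_eq_iff [simp]: "cpoly p = cpoly q \<longleftrightarrow> p = q"
  by (simp add: poly_eq_iff)

lemma poly_cpoly_of_real [simp]: "poly (cpoly p) (of_real x) = of_real (poly p x)"
  by (induction p) simp_all

lemma lead_coeff_cpoly: "lead_coeff (cpoly p) = of_real (lead_coeff p)"
proof -
  have "degree (cpoly p) = degree p"
    unfolding cpoly_def by (rule degree_map_poly) simp
  then show ?thesis by simp
qed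

text \<open>Over the complex numbers \<open>p\<close> factors completely; since all roots are real,
  their simplicity need only be tested at real points.\<close>

lemma simple_split_from_complex_roots:
  assumes "degree p = n" "lead_coeff p = 1" "\<And>z. poly (cpoly p) z = 0 \<Longrightarrow> z \<in> \<real>"
    and "\<And>x. poly p x = 0 \<Longrightarrow> poly (pderiv p) x \<noteq> 0"
  shows "simple_split n p"
proof -
  have "rsquarefree (cpoly p)"
    unfolding rsquarefree_roots
  proof (intro allI notI)
    fix a assume a: "poly (cpoly p) a = 0 \<and> poly (pderiv (cpoly p)) a = 0"
    then obtain x where x: "a = of_real x" using assms(3) by (auto elim: Reals_cases)
    with a have "poly p x = 0 \<and> poly (pderiv p) x = 0"
      by (simp flip: cpoly_simps(9))
    with assms(4) show False by blast
  qed
  define S where "S = {x. poly p x = 0}"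
  have "p \<noteq> 0" using assms(2) by auto
  then have fin: "finite S" unfolding S_def by (rule poly_roots_finite)
  have "{z. poly (cpoly p) z = 0} = of_real ` S"
  proof safe
    fix z assume z: "poly (cpoly p) z = 0"
    then obtain x where "z = of_real x" using assms(3) by (auto elim: Reals_cases)
    with z show "z \<in> of_real ` S" by (auto simp: S_def)
  qed (simp add: S_def)
  then have "cpoly p = (\<Prod>z\<in>of_real ` S. [:- z, 1:])"
    using complex_poly_decompose_rsquarefree[OF \<open>rsquarefree (cpoly p)\<close>] assms(2)
    by (simp only: lead_coeff_cpoly of_real_1 smult_1_left)
  also have "\<dots> = cpoly (\<Prod>s\<in>S. [:- s, 1:])"
    by (subst prod.reindex) (auto simp: inj_on_def)
  finally have "p = (\<Prod>s\<in>S. [:- s, 1:])" by (rule cpoly_eq_iff[THEN iffD1])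
  with fin assms(1) show ?thesis
    unfolding simple_split_def using degree_linear_factors[OF fin, of "\<lambda>x. x"]
    by (intro exI[of _ S]) auto
qed

text \<open>Dividing by the product of the linear factors, \<open>B\<close> becomes the function
  \<open>\<alpha> t + \<beta> - \<Sum> w\<^sub>s / (t - d\<^sub>s)\<close>, which maps the upper half plane to itself and increases on the real line.\<close>
locale partial_fractions =
  fixes I :: "'i set" and d w :: "'i \<Rightarrow> real" and \<alpha> \<beta> :: real
  assumes fin: "finite I" and w: "\<And>s. s \<in> I \<Longrightarrow> w s > 0" and \<alpha>: "\<alpha> \<ge> 0" "\<alpha> > 0 \<or> I \<noteq> {}"
    and inj: "inj_on d I"
begin

definition A :: "real poly" where "A = (\<Prod>s\<in>I. [:- d s, 1:])"
definition B :: "real poly" where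
  "B = [:\<beta>, \<alpha>:] * A - (\<Sum>s\<in>I. smult (w s) (\<Prod>r\<in>I - {s}. [:- d r, 1:]))"

text \<open>Off the real line, the imaginary part of \<open>B / A\<close> is \<open>Im z\<close>
  times a positive number, so \<open>B\<close> has no zero there.\<close>

lemma complex_root_real:
  assumes "poly (cpoly B) z = 0"
  shows "z \<in> \<real>"
proof (rule ccontr)
  assume z: "z \<notin> \<real>"
  then have Im: "Im z \<noteq> 0" by (simp add: complex_is_Real_iff)
  have nz: "z - of_real x \<noteq> 0" for x using z by auto
  have A: "poly (cpoly A) z = (\<Prod>s\<in>I. z - of_real (d s))" by (simp add: A_def poly_prod)
  then have A0: "poly (cpoly A) z \<noteq> 0" using nz fin by simp
  have eq: "(\<Prod>r\<in>I - {s}. z - of_real (d r)) = poly (cpoly A) z / (z - of_real (d s))" if "s \<in> I" for s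
    using that fin nz by (simp add: A prod.remove[of I s])
  have "0 = (of_real \<beta> + z * of_real \<alpha>) * poly (cpoly A) z - (\<Sum>s\<in>I. of_real (w s) * (\<Prod>r\<in>I - {s}. z - of_real (d r)))"
    using assms by (simp add: B_def poly_sum poly_prod algebra_simps)
  also have "(\<Sum>s\<in>I. of_real (w s) * (\<Prod>r\<in>I - {s}. z - of_real (d r))) = (\<Sum>s\<in>I. of_real (w s) / (z - of_real (d s))) * poly (cpoly A) z"
    by (simp add: eq sum_distrib_right)
  finally have "poly (cpoly A) z * (of_real \<beta> + z * of_real \<alpha> - (\<Sum>s\<in>I. of_real (w s) / (z - of_real (d s)))) = 0"
    by (simp add: algebra_simps)
  with A0 have "of_real \<beta> + z * of_real \<alpha> - (\<Sum>s\<in>I. of_real (w s) / (z - of_real (d s))) = 0" by simp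
  then have "Im (of_real \<beta> + z * of_real \<alpha> - (\<Sum>s\<in>I. of_real (w s) / (z - of_real (d s)))) = 0" by simp
  moreover have "Im (of_real \<beta> + z * of_real \<alpha> - (\<Sum>s\<in>I. of_real (w s) / (z - of_real (d s))))
     = Im z * (\<alpha> + (\<Sum>s\<in>I. w s / (cmod (z - of_real (d s)))\<^sup>2))"
    by (simp add: Im_divide cmod_power2 sum_distrib_left sum_negf algebra_simps)
  moreover have "\<alpha> + (\<Sum>s\<in>I. w s / (cmod (z - of_real (d s)))\<^sup>2) > 0"
  proof (cases "I = {}")
    case False
    then have "(\<Sum>s\<in>I. w s / (cmod (z - of_real (d s)))\<^sup>2) > 0"
      using w nz fin by (intro sum_pos) auto
    with \<alpha> show ?thesis by simp
  qed (use \<alpha> in simp)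
  ultimately show False using Im by simp
qed

text \<open>At a node \<open>d s\<close> the value of \<open>B\<close> is \<open>- w s\<close> times
  a nonzero product, so roots of \<open>B\<close> avoid the nodes. Near a root,
  \<open>B = A R\<close> with \<open>R\<close> the partial fraction; since \<open>R\<close> vanishes
  at the root, \<open>B' = A R'\<close> there, and \<open>R' > 0\<close>.\<close>

lemma root_B:
  assumes "poly B x = 0"
  shows "poly A x \<noteq> 0" "poly (pderiv B) x / poly A x > 0"
proof -
  have LA: "poly (\<Prod>r\<in>I - {s}. [:- d r, 1:]) (d t) = 0" if "s \<in> I" "t \<in> I" "t \<noteq> s" for s t
    using that fin by (auto simp: poly_prod)
  have x: "x \<noteq> d s" if "s \<in> I" for s
  proof
    assume x: "x = d s"
    have "poly A x = 0" using that fin by (auto simp: A_def poly_prod x)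
    then have "poly B x = - w s * poly (\<Prod>r\<in>I - {s}. [:- d r, 1:]) (d s)"
    proof -
      have "(\<Sum>t\<in>I. w t * poly (\<Prod>r\<in>I - {t}. [:- d r, 1:]) (d s)) = (\<Sum>t\<in>I. if t = s then w s * poly (\<Prod>r\<in>I - {s}. [:- d r, 1:]) (d s) else 0)"
        using LA that by (intro sum.cong) auto
      then show ?thesis
        using that fin \<open>poly A x = 0\<close> by (simp add: B_def poly_sum x)
    qed
    moreover have "poly (\<Prod>r\<in>I - {s}. [:- d r, 1:]) (d s) \<noteq> 0"
      using that fin inj by (auto simp: poly_prod inj_on_def)
    ultimately show False using assms w[OF that] by simp
  qed
  then show A0: "poly A x \<noteq> 0" using fin by (auto simp: A_def poly_prod)
  define R where "R t = \<beta> + t * \<alpha> - (\<Sum>s\<in>I. w s / (t - d s))" for t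
  have eq: "poly B t = poly A t * R t" if t: "t \<in> - d ` I" for t
  proof -
    have "(\<Prod>r\<in>I - {s}. t - d r) = poly A t / (t - d s)" if "s \<in> I" for s
    proof -
      have "t - d s \<noteq> 0" using that t by auto
      moreover have "poly A t = (t - d s) * (\<Prod>r\<in>I - {s}. t - d r)"
        using that fin by (simp add: A_def poly_prod prod.remove algebra_simps)
      ultimately show ?thesis by simp
    qed
    then show ?thesis
      by (simp add: B_def R_def poly_sum poly_prod sum_distrib_left sum_distrib_right algebra_simps)
  qed
  have R': "(R has_real_derivative \<alpha> + (\<Sum>s\<in>I. w s / (x - d s)\<^sup>2)) (at x)"
    unfolding R_def using x
    by (auto intro!: derivative_eq_intros simp: power2_eq_square sum_negf)
  have "((\<lambda>t. poly A t * R t) has_real_derivative poly A x * (\<alpha> + (\<Sum>s\<in>I. w s / (x - d s)\<^sup>2)) + poly (pderiv A) x * R x) (at x)"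
    using R' by (auto intro!: derivative_eq_intros)
  moreover have "R x = 0" using eq[of x] x assms A0 by auto
  ultimately have "((\<lambda>t. poly A t * R t) has_real_derivative poly A x * (\<alpha> + (\<Sum>s\<in>I. w s / (x - d s)\<^sup>2))) (at x)"
    by simp
  then have "(poly B has_real_derivative poly A x * (\<alpha> + (\<Sum>s\<in>I. w s / (x - d s)\<^sup>2))) (at x)"
    by (rule has_field_derivative_transform_within_open[where S = "- d ` I"])
       (use fin x eq in \<open>auto intro!: open_Compl finite_imp_closed\<close>)
  then have "poly (pderiv B) x = poly A x * (\<alpha> + (\<Sum>s\<in>I. w s / (x - d s)\<^sup>2))"
    using poly_DERIV DERIV_unique by blast
  moreover have "\<alpha> + (\<Sum>s\<in>I. w s / (x - d s)\<^sup>2) > 0"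
  proof (cases "I = {}")
    case False
    then have "(\<Sum>s\<in>I. w s / (x - d s)\<^sup>2) > 0"
      using w x fin by (intro sum_pos) auto
    with \<alpha> show ?thesis by simp
  qed (use \<alpha> in simp)
  ultimately show "poly (pderiv B) x / poly A x > 0" using A0 by simp
qed

end

lemma poly_pderiv_linear_factors:
  assumes "finite I" "s \<in> I"
  shows "poly (pderiv (\<Prod>r\<in>I. [:- d r, 1:])) (d s :: real) = poly (\<Prod>r\<in>I - {s}. [:- d r, 1:]) (d s)"
proof -
  have "(\<Prod>r\<in>I. [:- d r, 1:]) = [:- d s, 1:] * (\<Prod>r\<in>I - {s}. [:- d r, 1:])"
    using assms by (rule prod.remove)
  then show ?thesis by (simp only: pderiv_mult poly_add poly_mult) (simp add: pderiv_pCons)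
qed

text \<open>The residues of \<open>- p / P\<close> at the roots of \<open>P\<close> and those of \<open>P / p\<close> at the roots of \<open>p\<close>
  are positive at the same time: this happens iff the roots interlace.\<close>
lemma interlace_residues:
  assumes p: "degree p = Suc m" "lead_coeff p = 1" and P: "simple_split m P"
    and pos: "\<And>s. poly P s = 0 \<Longrightarrow> - poly p s / poly (pderiv P) s > 0"
  shows "simple_split (Suc m) p" "\<And>x. poly p x = 0 \<Longrightarrow> poly P x / poly (pderiv p) x > 0"
proof -
  define S where "S = {x. poly P x = 0}"
  note S = simple_splitD[OF P, folded S_def]
  define w where "w s = - poly p s / poly (pderiv P) s" for s
  \<comment> \<open>The aim is \<open>p = (X + a) P + r\<close> with no coefficient of
    \<open>r\<close> from index \<open>m\<close> on; interpolating \<open>r\<close> at the roots of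
    \<open>P\<close> exhibits \<open>p / P\<close> as a partial fraction with
    \<open>\<alpha> = 1\<close>, \<open>\<beta> = a\<close> and weights \<open>w\<close>.\<close>
  define q where "q = p - monom 1 1 * P"
  have degP: "degree P = m" "lead_coeff P = 1"
  proof -
    have "degree (\<Prod>s\<in>S. [:- s, 1:]) = m" "lead_coeff (\<Prod>s\<in>S. [:- s, 1:]) = 1"
      using S(2) degree_linear_factors[OF S(1), of "\<lambda>x. x"] by (simp, subst lead_coeff_prod, simp)
    then show "degree P = m" "lead_coeff P = 1" using S(3) by simp_all
  qed
  define a where "a = coeff q m"
  define r where "r = q - smult a P"
  have r0: "coeff r i = 0" if i: "i \<ge> card S" for i
  proof -
    consider "i = m" | "i = Suc m" | "i > Suc m" using i S(2) by linarith
    then show ?thesis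
    proof cases
      case 1 then show ?thesis using degP by (simp add: r_def a_def)
    next
      case 2 then show ?thesis using degP p by (simp add: r_def q_def coeff_monom_mult coeff_eq_0)
    next
      case 3 then show ?thesis using degP p by (simp add: r_def q_def coeff_monom_mult coeff_eq_0)
    qed
  qed
  have pr: "p = [:a, 1:] * P + r" by (simp add: r_def q_def monom_altdef algebra_simps)
  have rs: "poly r s / poly (\<Prod>j\<in>S - {s}. [:- j, 1:]) s = - w s" if "s \<in> S" for s
  proof -
    have "poly (pderiv P) s = poly (\<Prod>j\<in>S - {s}. [:- j, 1:]) s"
      using poly_pderiv_linear_factors[OF S(1) that, of "\<lambda>x. x"] S(3) by simp
    moreover have "poly r s = poly p s" using that by (simp add: pr S_def)
    ultimately show ?thesis by (simp add: w_def)
  qed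
  have "r = (\<Sum>s\<in>S. smult (- w s) (\<Prod>j\<in>S - {s}. [:- j, 1:]))"
    by (subst lagrange_interpolation[OF S(1) inj_on_id2 r0]) (auto intro!: sum.cong simp: rs)
  then have pr': "p = [:a, 1:] * (\<Prod>s\<in>S. [:- s, 1:]) - (\<Sum>s\<in>S. smult (w s) (\<Prod>j\<in>S - {s}. [:- j, 1:]))"
    using pr S(3) by (simp add: sum_negf)
  interpret pf: partial_fractions S "\<lambda>x. x" w 1 a
    by unfold_locales (use S(1) pos in \<open>auto simp: w_def S_def\<close>)
  have AB: "pf.A = P" "pf.B = p"
    using S(3) pr' unfolding pf.A_def pf.B_def by simp_all
  show pos': "poly P x / poly (pderiv p) x > 0" if "poly p x = 0" for x
    using pf.root_B[of x] that unfolding AB by (auto simp: zero_less_divide_iff)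
  show "simple_split (Suc m) p"
    using p pf.complex_root_real[unfolded AB] pos' by (intro simple_split_from_complex_roots) force+
qed

text \<open>Here \<open>P / p\<close> is a pure sum of poles, so the partial fraction has
  \<open>\<alpha> = \<beta> = 0\<close> and numerator \<open>B = - P\<close>; this sign matches the
  minus sign in front of the weights.\<close>

lemma interlace_residues_converse:
  assumes P: "degree P = m" "lead_coeff P = 1" and p: "simple_split (Suc m) p"
    and pos: "\<And>x. poly p x = 0 \<Longrightarrow> poly P x / poly (pderiv p) x > 0"
  shows "simple_split m P" "\<And>s. poly P s = 0 \<Longrightarrow> - poly p s / poly (pderiv P) s > 0"
proof -
  define S where "S = {x. poly p x = 0}"
  note S = simple_splitD[OF p, folded S_def]
  define w where "w s = poly P s / poly (pderiv p) s" for s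
  have r0: "coeff P i = 0" if "i \<ge> card S" for i
    using that S(2) P by (intro coeff_eq_0) auto
  have rs: "poly P s / poly (\<Prod>j\<in>S - {s}. [:- j, 1:]) s = w s" if "s \<in> S" for s
    using poly_pderiv_linear_factors[OF S(1) that, of "\<lambda>x. x"] S(3) by (simp add: w_def)
  have P': "P = (\<Sum>s\<in>S. smult (w s) (\<Prod>j\<in>S - {s}. [:- j, 1:]))"
    by (subst lagrange_interpolation[OF S(1) inj_on_id2 r0]) (auto intro!: sum.cong simp: rs)
  have "S \<noteq> {}" using S(2) by auto
  interpret pf: partial_fractions S "\<lambda>x. x" w 0 0
    by unfold_locales (use S(1) pos \<open>S \<noteq> {}\<close> in \<open>auto simp: w_def S_def\<close>)
  have AB: "pf.A = p" "pf.B = - P"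
    using S(3) P' unfolding pf.A_def pf.B_def by simp_all
  show pos': "- poly p s / poly (pderiv P) s > 0" if "poly P s = 0" for s
    using pf.root_B[of s] that unfolding AB by (auto simp: pderiv_minus divide_less_0_iff zero_less_divide_iff)
  show "simple_split m P"
    using P pf.complex_root_real[unfolded AB] pos' by (intro simple_split_from_complex_roots) force+
qed

subsection \<open>Dirichlet and Dixon--Anderson integrals\<close>

text \<open>Tonelli, one coordinate at a time: if \<open>\<phi> i\<close> carries \<open>M i\<close>
  to the density \<open>h i\<close>, the product map carries the product measure to the product
  density. It serves squares of Gaussians, rescalings and reflections alike.\<close>

lemma nn_integral_PiM_transform:
  fixes M :: "'i \<Rightarrow> real measure" and \<phi> :: "'i \<Rightarrow> real \<Rightarrow> real" and h :: "'i \<Rightarrow> real \<Rightarrow> ennreal"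
  assumes "finite I" and M: "product_sigma_finite M" and sets [measurable_cong]: "\<And>i. sets (M i) = sets borel"
    and [measurable]: "\<And>i. \<phi> i \<in> borel_measurable borel" "\<And>i. h i \<in> borel_measurable borel"
    and step: "\<And>i g. i \<in> I \<Longrightarrow> g \<in> borel_measurable borel \<Longrightarrow>
      (\<integral>\<^sup>+ x. g (\<phi> i x) \<partial>M i) = (\<integral>\<^sup>+ y. h i y * g y \<partial>lborel)"
    and "F \<in> borel_measurable (\<Pi>\<^sub>M i\<in>I. lborel)"
  shows "(\<integral>\<^sup>+ x. F (\<lambda>i\<in>I. \<phi> i (x i)) \<partial>Pi\<^sub>M I M) = (\<integral>\<^sup>+ y. (\<Prod>i\<in>I. h i (y i)) * F y \<partial>(\<Pi>\<^sub>M i\<in>I. lborel))"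
  using assms(1) step assms(7)
proof (induction I arbitrary: F rule: finite_induct)
  case empty
  then show ?case by (simp add: space_PiM PiM_empty nn_integral_count_space_finite restrict_def)
next
  case (insert i I)
  note [measurable] = insert.prems(2)
  interpret M: product_sigma_finite M by fact
  interpret MI: finite_product_sigma_finite M I by standard fact
  interpret P: finite_product_sigma_finite "\<lambda>_::'i. lborel :: real measure" I by standard fact
  have upd: "(\<lambda>j\<in>insert i I. \<phi> j ((x(i := y)) j)) = (\<lambda>j\<in>I. \<phi> j (x j))(i := \<phi> i y)" for x y
    using insert.hyps by (auto simp: restrict_def)
  have [measurable]: "(\<lambda>x. \<lambda>j\<in>insert i I. \<phi> j (x j)) \<in> Pi\<^sub>M (insert i I) M \<rightarrow>\<^sub>M (\<Pi>\<^sub>M i\<in>insert i I. lborel)"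
    by measurable
  define G where "G z = (\<integral>\<^sup>+ x. (\<Prod>i\<in>I. h i (x i)) * F (x(i := z)) \<partial>(\<Pi>\<^sub>M i\<in>I. lborel))" for z
  have [measurable]: "G \<in> borel_measurable borel"
    unfolding G_def[abs_def] by measurable
  have "(\<integral>\<^sup>+ x. F (\<lambda>j\<in>insert i I. \<phi> j (x j)) \<partial>Pi\<^sub>M (insert i I) M)
      = (\<integral>\<^sup>+ y. \<integral>\<^sup>+ x. F ((\<lambda>j\<in>I. \<phi> j (x j))(i := \<phi> i y)) \<partial>Pi\<^sub>M I M \<partial>M i)"
    by (subst M.product_nn_integral_insert_rev) (use insert.hyps in \<open>simp_all add: upd del: fun_upd_apply\<close>)
  also have "\<dots> = (\<integral>\<^sup>+ y. G (\<phi> i y) \<partial>M i)"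
    unfolding G_def
    by (intro nn_integral_cong insert.IH[where F = "\<lambda>x. F (x(i := \<phi> i y))" for y] insert.prems(1)) auto
  also have "\<dots> = (\<integral>\<^sup>+ z. h i z * G z \<partial>lborel)"
    by (rule insert.prems(1)) auto
  also have "\<dots> = (\<integral>\<^sup>+ z. \<integral>\<^sup>+ x. h i z * ((\<Prod>i\<in>I. h i (x i)) * F (x(i := z))) \<partial>(\<Pi>\<^sub>M i\<in>I. lborel) \<partial>lborel)"
    unfolding G_def by (intro nn_integral_cong nn_integral_cmult[symmetric]) measurable
  also have "\<dots> = (\<integral>\<^sup>+ z. \<integral>\<^sup>+ x. (\<Prod>j\<in>insert i I. h j ((x(i := z)) j)) * F (x(i := z)) \<partial>(\<Pi>\<^sub>M i\<in>I. lborel) \<partial>lborel)"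
  proof (intro nn_integral_cong)
    fix x :: "'i \<Rightarrow> real" and z
    have "(\<Prod>j\<in>I. h j ((x(i := z)) j)) = (\<Prod>j\<in>I. h j (x j))"
      using insert.hyps by (intro prod.cong) auto
    then show "h i z * ((\<Prod>i\<in>I. h i (x i)) * F (x(i := z))) = (\<Prod>j\<in>insert i I. h j ((x(i := z)) j)) * F (x(i := z))"
      using insert.hyps by (simp add: mult_ac)
  qed
  also have "\<dots> = (\<integral>\<^sup>+ y. (\<Prod>j\<in>insert i I. h j (y j)) * F y \<partial>(\<Pi>\<^sub>M i\<in>insert i I. lborel))"
    by (rule P.product_nn_integral_insert_rev[symmetric]) (use insert.hyps in simp_all)
  finally show ?case .
qed

text \<open>The unnormalised Gamma-type density with parameter \<open>c\<close>. Its support in the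
  positive half-line is built in, so positivity constraints need no separate indicators, and
  parameters add under convolution.\<close>

definition pos_powr :: "real \<Rightarrow> real \<Rightarrow> real" where
  "pos_powr c x = (if x > 0 then x powr (c - 1) else 0)"

lemma pos_powr_nonneg [simp]: "pos_powr c x \<ge> 0"
  by (simp add: pos_powr_def)

lemma measurable_pos_powr [measurable]: "pos_powr c \<in> borel_measurable borel"
  unfolding pos_powr_def[abs_def] by measurable

text \<open>Scaling \<open>y\<close> by \<open>u\<close> reduces the convolution to Euler's Beta
  integral.\<close>

lemma nn_integral_pos_powr_convolution:
  assumes "a > 0" "b > 0"
  shows "(\<integral>\<^sup>+ y. ennreal (pos_powr a y) * ennreal (pos_powr b (u - y)) \<partial>lborel) = ennreal (Beta a b * pos_powr (a + b) u)"
proof (cases "u > 0")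
  case False
  have "(\<integral>\<^sup>+ y. ennreal (pos_powr a y) * ennreal (pos_powr b (u - y)) \<partial>lborel) = (\<integral>\<^sup>+ (y::real). 0 \<partial>lborel)"
    by (intro nn_integral_cong) (use False in \<open>auto simp: pos_powr_def\<close>)
  with False show ?thesis by (simp add: pos_powr_def)
next
  case True
  have "(\<integral>\<^sup>+ y. ennreal (pos_powr a y) * ennreal (pos_powr b (u - y)) \<partial>lborel)
     = ennreal \<bar>u\<bar> * (\<integral>\<^sup>+ y. ennreal (pos_powr a (0 + u * y)) * ennreal (pos_powr b (u - (0 + u * y))) \<partial>lborel)"
    by (rule nn_integral_real_affine) (use True in auto)
  also have "(\<integral>\<^sup>+ y. ennreal (pos_powr a (0 + u * y)) * ennreal (pos_powr b (u - (0 + u * y))) \<partial>lborel)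
    = (\<integral>\<^sup>+ y. ennreal (u powr (a + b - 2)) * (indicator {0..1} y * ennreal (y powr (a - 1) * (1 - y) powr (b - 1))) \<partial>lborel)"
  proof (rule nn_integral_cong)
    fix y :: real
    have eq: "u - u * y = u * (1 - y)" by (simp add: algebra_simps)
    have "u powr (a - 1) * u powr (b - 1) = u powr (a + b - 2)" by (simp flip: powr_add)
    then show "ennreal (pos_powr a (0 + u * y)) * ennreal (pos_powr b (u - (0 + u * y)))
       = ennreal (u powr (a + b - 2)) * (indicator {0..1} y * ennreal (y powr (a - 1) * (1 - y) powr (b - 1)))"
      using True unfolding add_0 eq
      by (cases "y = 0"; cases "y = 1")
         (auto simp: pos_powr_def zero_less_mult_iff powr_mult indicator_def simp flip: ennreal_mult)
  qed
  also have "\<dots> = ennreal (u powr (a + b - 2)) * (\<integral>\<^sup>+ y. indicator {0..1} y * ennreal (y powr (a - 1) * (1 - y) powr (b - 1)) \<partial>lborel)"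
    by (rule nn_integral_cmult) measurable
  also have "(\<integral>\<^sup>+ y. indicator {0..1} y * ennreal (y powr (a - 1) * (1 - y) powr (b - 1)) \<partial>lborel) = ennreal (Beta a b)"
    using nn_integral_has_integral_lebesgue[OF _ has_integral_Beta_real[OF assms]]
    by (simp add: ennreal_mult' ennreal_indicator)
  also have "ennreal \<bar>u\<bar> * (ennreal (u powr (a + b - 2)) * ennreal (Beta a b)) = ennreal (Beta a b * pos_powr (a + b) u)"
  proof -
    have "u * u powr (a + b - 2) = u powr (a + b - 1)" using True by (simp add: powr_mult_base)
    moreover have "Beta a b \<ge> 0" using assms by (simp add: Beta_def Gamma_real_pos less_imp_le)
    ultimately show ?thesis using True
      by (simp add: pos_powr_def mult_ac flip: ennreal_mult)
  qed
  finally show ?thesis .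
qed

text \<open>Integrating out one variable convolves the parameters \<open>1/2\<close> and
  \<open>c\<close> and so raises \<open>c\<close> by \<open>1/2\<close>; hence the induction runs
  over all \<open>c\<close>. The Beta factors telescope to a quotient of Gamma values.\<close>

lemma nn_integral_dirichlet:
  fixes S :: "'i set"
  assumes "finite S" "c > 0"
  shows "(\<integral>\<^sup>+ x. (\<Prod>s\<in>S. ennreal (pos_powr (1/2) (x s))) * ennreal (pos_powr c (u - (\<Sum>s\<in>S. x s))) \<partial>(\<Pi>\<^sub>M s\<in>S. lborel))
    = ennreal (sqrt pi ^ card S * Gamma c / Gamma (c + card S / 2) * pos_powr (c + card S / 2) u)"
  using assms
proof (induction S arbitrary: c rule: finite_induct)
  case empty
  then show ?case using Gamma_real_pos[of c, THEN less_imp_neq] by (simp add: PiM_empty nn_integral_count_space_finite)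
next
  case (insert i S)
  interpret P: finite_product_sigma_finite "\<lambda>_::'i. lborel :: real measure" S by standard fact
  have "(\<integral>\<^sup>+ x. (\<Prod>s\<in>insert i S. ennreal (pos_powr (1/2) (x s))) * ennreal (pos_powr c (u - (\<Sum>s\<in>insert i S. x s))) \<partial>(\<Pi>\<^sub>M s\<in>insert i S. lborel))
     = (\<integral>\<^sup>+ x. \<integral>\<^sup>+ y. (\<Prod>s\<in>insert i S. ennreal (pos_powr (1/2) ((x(i:=y)) s))) * ennreal (pos_powr c (u - (\<Sum>s\<in>insert i S. (x(i:=y)) s))) \<partial>lborel \<partial>(\<Pi>\<^sub>M s\<in>S. lborel))"
    by (rule P.product_nn_integral_insert) (use insert.hyps in simp_all)
  also have "\<dots> = (\<integral>\<^sup>+ x. \<integral>\<^sup>+ y. (\<Prod>s\<in>S. ennreal (pos_powr (1/2) (x s))) * (ennreal (pos_powr (1/2) y) * ennreal (pos_powr c (u - (\<Sum>s\<in>S. x s) - y))) \<partial>lborel \<partial>(\<Pi>\<^sub>M s\<in>S. lborel))"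
  proof (intro nn_integral_cong)
    fix x :: "'i \<Rightarrow> real" and y
    have "(\<Prod>s\<in>S. ennreal (pos_powr (1/2) ((x(i:=y)) s))) = (\<Prod>s\<in>S. ennreal (pos_powr (1/2) (x s)))"
      "(\<Sum>s\<in>S. (x(i:=y)) s) = (\<Sum>s\<in>S. x s)"
      using insert.hyps by (auto intro!: prod.cong sum.cong)
    then show "(\<Prod>s\<in>insert i S. ennreal (pos_powr (1/2) ((x(i:=y)) s))) * ennreal (pos_powr c (u - (\<Sum>s\<in>insert i S. (x(i:=y)) s)))
      = (\<Prod>s\<in>S. ennreal (pos_powr (1/2) (x s))) * (ennreal (pos_powr (1/2) y) * ennreal (pos_powr c (u - (\<Sum>s\<in>S. x s) - y)))"
      using insert.hyps by (simp add: mult_ac algebra_simps)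
  qed
  also have "\<dots> = (\<integral>\<^sup>+ x. (\<Prod>s\<in>S. ennreal (pos_powr (1/2) (x s))) * ennreal (Beta (1/2) c * pos_powr (1/2 + c) (u - (\<Sum>s\<in>S. x s))) \<partial>(\<Pi>\<^sub>M s\<in>S. lborel))"
    using insert.prems
    by (subst nn_integral_cmult) (simp_all add: nn_integral_pos_powr_convolution)
  also have "\<dots> = (\<integral>\<^sup>+ x. ennreal (Beta (1/2) c) * ((\<Prod>s\<in>S. ennreal (pos_powr (1/2) (x s))) * ennreal (pos_powr (c + 1/2) (u - (\<Sum>s\<in>S. x s)))) \<partial>(\<Pi>\<^sub>M s\<in>S. lborel))"
    by (simp add: ennreal_mult'' mult_ac add.commute)
  also have "\<dots> = ennreal (Beta (1/2) c) * ennreal (sqrt pi ^ card S * Gamma (c + 1/2) / Gamma (c + 1/2 + card S / 2) * pos_powr (c + 1/2 + card S / 2) u)"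
    using insert.prems by (subst nn_integral_cmult) (simp, subst insert.IH, simp_all)
  also have "\<dots> = ennreal (sqrt pi ^ card (insert i S) * Gamma c / Gamma (c + card (insert i S) / 2) * pos_powr (c + card (insert i S) / 2) u)"
  proof -
    have *: "c + 1/2 + card S / 2 = c + card (insert i S) / 2" using insert.hyps by (simp add: field_simps)
    have G: "Gamma (c + 1/2) > 0" "Gamma c > 0" "Gamma (c + 1/2 + card S / 2) > 0"
      using insert.prems by (auto intro!: Gamma_real_pos add_pos_nonneg)
    have "Beta (1/2) c \<ge> 0" unfolding Beta_def using G by (auto simp: Gamma_one_half_real add.commute)
    then have "ennreal (Beta (1/2) c) * ennreal (sqrt pi ^ card S * Gamma (c + 1/2) / Gamma (c + 1/2 + card S / 2) * pos_powr (c + 1/2 + card S / 2) u)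
       = ennreal (Beta (1/2) c * (sqrt pi ^ card S * Gamma (c + 1/2) / Gamma (c + 1/2 + card S / 2) * pos_powr (c + 1/2 + card S / 2) u))"
      by (rule ennreal_mult'[symmetric])
    also have "Beta (1/2) c * (sqrt pi ^ card S * Gamma (c + 1/2) / Gamma (c + 1/2 + card S / 2) * pos_powr (c + 1/2 + card S / 2) u)
      = sqrt pi ^ card (insert i S) * Gamma c / Gamma (c + 1/2 + card S / 2) * pos_powr (c + 1/2 + card S / 2) u"
      using insert.hyps G by (simp add: Beta_def Gamma_one_half_real add.commute[of "1/2" c])
    finally show ?thesis unfolding * .
  qed
  finally show ?case .
qed

section \<open>The bordering kernel and its reciprocity\<close>

text \<open>Up to the Gaussian factor and constants, the conditional density of the bordered
  polynomial \<open>p\<close> given \<open>P\<close>. Each residue of \<open>- p / P\<close> is a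
  squared Gaussian, with density proportional to \<open>w^(-1/2)\<close> apart from the exponential;
  the denominator is the Vandermonde product of the roots of \<open>P\<close>, the Jacobian from
  residues to coefficients. The weight vanishes unless all these residues are positive.\<close>

definition residue_weight :: "real poly \<Rightarrow> real poly \<Rightarrow> real" where
  "residue_weight P p = (\<Prod>s | poly P s = 0. pos_powr (1/2) (- poly p s / poly (pderiv P) s)) /
     sqrt (\<Prod>s | poly P s = 0. \<bar>poly (pderiv P) s\<bar>)"

text \<open>A positive quotient forces equal signs, and its power \<open>-1/2\<close> contributes a
  factor \<open>sqrt \<bar>v s\<bar>\<close> that cancels the denominator; what remains depends on
  the numerators only.\<close>

lemma prod_pos_powr_half:
  assumes "finite S" "\<And>s. s \<in> S \<Longrightarrow> u s / v s > 0"
  shows "(\<Prod>s\<in>S. pos_powr (1/2) (u s / v s)) / sqrt (\<Prod>s\<in>S. \<bar>v s\<bar>) = 1 / sqrt (\<Prod>s\<in>S. \<bar>u s\<bar>)"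
  using assms
proof (induction S rule: finite_induct)
  case (insert i S)
  have "u i / v i = \<bar>u i\<bar> / \<bar>v i\<bar>" using insert.prems[of i] by (auto simp: zero_less_divide_iff)
  moreover have "u i \<noteq> 0" "v i \<noteq> 0" using insert.prems[of i] by auto
  ultimately have "pos_powr (1/2) (u i / v i) = sqrt \<bar>v i\<bar> / sqrt \<bar>u i\<bar>"
    by (simp add: pos_powr_def powr_minus powr_half_sqrt real_sqrt_divide inverse_eq_divide)
  then have "(\<Prod>s\<in>insert i S. pos_powr (1/2) (u s / v s)) / sqrt (\<Prod>s\<in>insert i S. \<bar>v s\<bar>)
     = 1 / sqrt \<bar>u i\<bar> * ((\<Prod>s\<in>S. pos_powr (1/2) (u s / v s)) / sqrt (\<Prod>s\<in>S. \<bar>v s\<bar>))"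
    using insert.hyps \<open>v i \<noteq> 0\<close> by (simp add: real_sqrt_mult)
  then show ?case using insert by (simp add: real_sqrt_mult)
qed simp

text \<open>Both sides are the absolute value of the resultant, a product over all pairs of
  roots.\<close>

lemma resultant_swap:
  assumes "simple_split m P" "simple_split n p"
  shows "(\<Prod>s | poly P s = 0. \<bar>poly p s\<bar>) = (\<Prod>s | poly p s = 0. \<bar>poly P s\<bar>)"
proof -
  define S R where "S = {x. poly P x = 0}" and "R = {x. poly p x = 0}"
  note S = simple_splitD[OF assms(1), folded S_def] and R = simple_splitD[OF assms(2), folded R_def]
  have "\<bar>poly p s\<bar> = (\<Prod>r\<in>R. \<bar>s - r\<bar>)" for s by (subst R(3)) (simp add: poly_prod abs_prod)
  moreover have "\<bar>poly P r\<bar> = (\<Prod>s\<in>S. \<bar>s - r\<bar>)" for r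
    by (subst S(3)) (simp add: poly_prod abs_prod abs_minus_commute)
  ultimately show ?thesis by (simp add: S_def[symmetric] R_def[symmetric] prod.swap[of _ S])
qed

text \<open>If the roots interlace, both sides equal the absolute resultant to the power
  \<open>-1/2\<close>. Otherwise both sides vanish, since positivity of one family of residues
  forces that of the other.\<close>

lemma residue_weight_swap:
  assumes P: "degree P = m" "lead_coeff P = 1" and p: "simple_split (Suc m) p"
  shows "(if simple_split m P then residue_weight P p else 0)
    = (\<Prod>x | poly p x = 0. pos_powr (1/2) (poly P x / poly (pderiv p) x)) / sqrt (\<Prod>x | poly p x = 0. \<bar>poly (pderiv p) x\<bar>)"
proof -
  define R where "R = {x. poly p x = 0}"
  note R = simple_splitD[OF p, folded R_def]
  have p': "degree p = Suc m" "lead_coeff p = 1"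
  proof -
    have "degree (\<Prod>s\<in>R. [:- s, 1:]) = Suc m" "lead_coeff (\<Prod>s\<in>R. [:- s, 1:]) = 1"
      using R(2) degree_linear_factors[OF R(1), of "\<lambda>x. x"] by (simp, subst lead_coeff_prod, simp)
    then show "degree p = Suc m" "lead_coeff p = 1" using R(3) by simp_all
  qed
  show ?thesis
  proof (cases "\<forall>x. poly p x = 0 \<longrightarrow> poly P x / poly (pderiv p) x > 0")
    case True
    then have *: "poly P x / poly (pderiv p) x > 0" if "poly p x = 0" for x using that by blast
    note i = interlace_residues_converse[OF P p *]
    have fin: "finite {x. poly P x = 0}" using simple_splitD(1)[OF i(1)] by simp
    have "residue_weight P p = 1 / sqrt (\<Prod>s | poly P s = 0. \<bar>- poly p s\<bar>)"
      unfolding residue_weight_def using i(2) by (intro prod_pos_powr_half fin) auto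
    also have "\<dots> = 1 / sqrt (\<Prod>s | poly p s = 0. \<bar>poly P s\<bar>)"
      using resultant_swap[OF i(1) p] by simp
    also have "\<dots> = (\<Prod>x | poly p x = 0. pos_powr (1/2) (poly P x / poly (pderiv p) x)) / sqrt (\<Prod>x | poly p x = 0. \<bar>poly (pderiv p) x\<bar>)"
      using * by (intro prod_pos_powr_half[symmetric] R(1)[unfolded R_def]) auto
    finally show ?thesis using i(1) by simp
  next
    case False
    then obtain x where x: "poly p x = 0" "\<not> poly P x / poly (pderiv p) x > 0" by blast
    then have "pos_powr (1/2) (poly P x / poly (pderiv p) x) = 0" by (simp only: pos_powr_def if_False)
    then have 0: "(\<Prod>x | poly p x = 0. pos_powr (1/2) (poly P x / poly (pderiv p) x)) = 0"
      using x(1) R(1) by (intro prod_zero) (auto simp: R_def)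
    have "residue_weight P p = 0" if "simple_split m P"
    proof -
      have "\<exists>s. poly P s = 0 \<and> \<not> - poly p s / poly (pderiv P) s > 0"
      proof (rule ccontr)
        assume "\<not> ?thesis"
        then have "- poly p s / poly (pderiv P) s > 0" if "poly P s = 0" for s using that by blast
        from interlace_residues(2)[OF p' \<open>simple_split m P\<close> this x(1)] x(2) show False by simp
      qed
      then obtain s where s: "poly P s = 0" "\<not> - poly p s / poly (pderiv P) s > 0" by blast
      then have "pos_powr (1/2) (- poly p s / poly (pderiv P) s) = 0" by (simp only: pos_powr_def if_False)
      then show ?thesis
        unfolding residue_weight_def using s(1) simple_splitD(1)[OF that]
        by (subst prod_zero) auto
    qed
    then show ?thesis using 0 by simp
  qed
qed

lemma residue_weight_nth_root_of:
  assumes "simple_split m P"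
  shows "residue_weight P p = (\<Prod>k<m. pos_powr (1/2) (- poly p (nth_root_of k P) / poly (pderiv P) (nth_root_of k P))) /
     sqrt (\<Prod>k<m. \<bar>poly (pderiv P) (nth_root_of k P)\<bar>)"
  unfolding residue_weight_def by (simp add: prod.reindex_bij_betw[OF bij_betw_nth_root_of'[OF assms], symmetric])

text \<open>The products over the root set are handled by listing the roots through
  \<open>nth_root_of\<close>; the guard restricts to the polynomials for which this listing is
  valid.\<close>

lemma measurable_residue_weight [measurable (raw)]:
  assumes [measurable]: "f \<in> M \<rightarrow>\<^sub>M poly_borel" "g \<in> M \<rightarrow>\<^sub>M poly_borel"
  shows "(\<lambda>x. if simple_split m (f x) then residue_weight (f x) (g x) else 0) \<in> borel_measurable M"
proof -
  have "(\<lambda>x. if simple_split m (f x) then residue_weight (f x) (g x) else 0) =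
    (\<lambda>x. if simple_split m (f x) then (\<Prod>k<m. pos_powr (1/2) (- poly (g x) (nth_root_of k (f x)) / poly (pderiv (f x)) (nth_root_of k (f x)))) /
     sqrt (\<Prod>k<m. \<bar>poly (pderiv (f x)) (nth_root_of k (f x))\<bar>) else 0)"
    by (intro ext) (simp add: residue_weight_nth_root_of)
  also have "\<dots> \<in> borel_measurable M" by measurable
  finally show ?thesis .
qed

text \<open>In the coordinates \<open>w\<close> (the residues) and \<open>a\<close> of
  \<open>p\<close>, the Jacobian \<open>vdm d I\<close> cancels the denominator of the weight, which
  leaves one factor \<open>w^(-1/2)\<close> for each residue.\<close>

lemma nn_integral_residue_weight_lagrange:
  fixes d :: "'i \<Rightarrow> real"
  assumes "finite I" "inj_on d I" and P: "P = (\<Prod>s\<in>I. [:- d s, 1:])" and [measurable]: "f \<in> borel_measurable poly_borel"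
  shows "(\<integral>\<^sup>+ p. ennreal (residue_weight P p) * f p \<partial>coeff_lborel 1 (Suc (card I)))
    = (\<integral>\<^sup>+ w. \<integral>\<^sup>+ a. (\<Prod>s\<in>I. ennreal (pos_powr (1/2) (w s))) *
         f ([:a, 1:] * P - (\<Sum>s\<in>I. smult (w s) (\<Prod>r\<in>I - {s}. [:- d r, 1:]))) \<partial>lborel \<partial>(\<Pi>\<^sub>M s\<in>I. lborel))"
proof -
  have split: "simple_split (card I) P" unfolding P using assms(1,2) by (intro simple_splitI) auto
  have [measurable]: "(\<lambda>p. residue_weight P p) \<in> borel_measurable poly_borel"
  proof -
    have "(\<lambda>p. if simple_split (card I) P then residue_weight P p else 0) \<in> borel_measurable poly_borel"
      by (rule measurable_residue_weight) simp_all
    then show ?thesis by (simp only: split if_True)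
  qed
  interpret I: finite_product_sigma_finite "\<lambda>_::'i. lborel :: real measure" I by standard fact
  let ?p = "\<lambda>w a. [:a, 1:] * P - (\<Sum>s\<in>I. smult (w s) (\<Prod>r\<in>I - {s}. [:- d r, 1:]))"
  have roots: "{x. poly P x = 0} = d ` I" unfolding P by (rule roots_linear_factors) fact
  have P': "poly (pderiv P) (d s) = poly (\<Prod>r\<in>I - {s}. [:- d r, 1:]) (d s)" "poly (pderiv P) (d s) \<noteq> 0" if "s \<in> I" for s
  proof -
    show *: "poly (pderiv P) (d s) = poly (\<Prod>r\<in>I - {s}. [:- d r, 1:]) (d s)"
      unfolding P using assms(1) that by (rule poly_pderiv_linear_factors)
    show "poly (pderiv P) (d s) \<noteq> 0"
      unfolding * using that assms(1,2) by (auto simp: poly_prod inj_on_def)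
  qed
  have vdm: "vdm d I = sqrt (\<Prod>s | poly P s = 0. \<bar>poly (pderiv P) s\<bar>)"
    unfolding vdm_def roots prod.reindex[OF assms(2)]
    by (intro arg_cong[where f = sqrt] prod.cong) (simp_all add: P'(1) poly_prod abs_prod)
  have w: "- poly (?p w a) (d s) / poly (pderiv P) (d s) = w s" if "s \<in> I" for w a s
  proof -
    have "poly (\<Prod>j\<in>I - {t}. [:- d j, 1:]) (d s) = 0" if "t \<in> I" "t \<noteq> s" for t
      using that \<open>s \<in> I\<close> assms(1) by (auto simp: poly_prod)
    then have "(\<Sum>t\<in>I. w t * poly (\<Prod>j\<in>I - {t}. [:- d j, 1:]) (d s)) = (\<Sum>t\<in>I. if t = s then w s * poly (pderiv P) (d s) else 0)"
      using P'(1)[OF that] by (intro sum.cong) auto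
    moreover have "poly P (d s) = 0" using roots that by auto
    ultimately show ?thesis using that assms(1) P'(2)[OF that] by (simp add: poly_sum)
  qed
  have rw: "ennreal (vdm d I) * ennreal (residue_weight P (?p w a)) = (\<Prod>s\<in>I. ennreal (pos_powr (1/2) (w s)))" for w a
  proof -
    have "residue_weight P (?p w a) = (\<Prod>s\<in>I. pos_powr (1/2) (w s)) / vdm d I"
      unfolding residue_weight_def vdm[symmetric] unfolding roots
      using assms(2) w by (simp add: prod.reindex)
    then show ?thesis
      using vdm_pos[OF assms(1,2)] by (simp add: prod_ennreal prod_nonneg flip: ennreal_mult)
  qed
  have "(\<integral>\<^sup>+ p. ennreal (residue_weight P p) * f p \<partial>coeff_lborel 1 (Suc (card I)))
    = ennreal (vdm d I) * (\<integral>\<^sup>+ w. \<integral>\<^sup>+ a. ennreal (residue_weight P (?p w a)) * f (?p w a) \<partial>lborel \<partial>(\<Pi>\<^sub>M s\<in>I. lborel))"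
    using nn_integral_coeff_lborel_lagrange[OF assms(1,2), of "\<lambda>p. ennreal (residue_weight P p) * f p" 1 1]
    by (simp add: nn_integral_coeff_lborel_Suc P[symmetric] del: mult_pCons_left)
  also have "\<dots> = (\<integral>\<^sup>+ w. \<integral>\<^sup>+ a. ennreal (vdm d I) * (ennreal (residue_weight P (?p w a)) * f (?p w a)) \<partial>lborel \<partial>(\<Pi>\<^sub>M s\<in>I. lborel))"
    by (simp add: nn_integral_cmult del: mult_pCons_left)
  finally show ?thesis by (simp only: mult.assoc[symmetric] rw)
qed

text \<open>The Dixon--Anderson integral: in terms of the residues of \<open>P / p\<close> it is a Dirichlet integral.\<close>
lemma nn_integral_residue_weight:
  assumes p: "simple_split (Suc m) p"
  shows "(\<integral>\<^sup>+ P. ennreal (if simple_split m P then residue_weight P p else 0) \<partial>coeff_lborel 1 m)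
    = ennreal (sqrt pi ^ Suc m / Gamma (Suc m / 2))"
proof -
  define R where "R = {x. poly p x = 0}"
  note R = simple_splitD[OF p, folded R_def]
  \<comment> \<open>As \<open>P\<close> and \<open>p\<close> are monic of neighbouring degrees, the
    residues of \<open>P / p\<close> sum to 1. The residues at the other roots serve as coordinates,
    and that at \<open>x0\<close> is one minus their sum.\<close>
  obtain x0 where x0: "x0 \<in> R" using R(2) by fastforce
  define R0 where "R0 = R - {x0}"
  have R0: "finite R0" "card R0 = m" "x0 \<notin> R0" "R = insert x0 R0" using R x0 by (auto simp: R0_def)
  define A where "A = (\<Prod>s\<in>R0. [:- s, 1:])"
  define A' where "A' s = (\<Prod>r\<in>R0 - {s}. [:- r, 1:])" for s
  have A': "poly (A' s) s \<noteq> 0" "poly (A' s) x0 = poly A x0 / (x0 - s)" if "s \<in> R0" for s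
  proof -
    show "poly (A' s) s \<noteq> 0" using R0 by (auto simp: A'_def poly_prod)
    have "poly A x0 = (x0 - s) * poly (A' s) x0"
      using that R0 by (simp add: A'_def A_def poly_prod prod.remove[of R0 s] algebra_simps)
    moreover have "x0 - s \<noteq> 0" using that R0 by auto
    ultimately show "poly (A' s) x0 = poly A x0 / (x0 - s)" by simp
  qed
  have Ax0: "poly A x0 \<noteq> 0" using R0 by (auto simp: A_def poly_prod)
  have p': "poly (pderiv p) x0 = poly A x0" "\<And>s. s \<in> R0 \<Longrightarrow> poly (pderiv p) s = (s - x0) * poly (A' s) s"
  proof -
    have *: "poly (pderiv p) s = poly (\<Prod>r\<in>R - {s}. [:- r, 1:]) s" if "s \<in> R" for s
      using poly_pderiv_linear_factors[OF R(1) that, of "\<lambda>x. x"] R(3) by simp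
    show "poly (pderiv p) x0 = poly A x0" using *[OF x0] by (simp add: A_def R0_def)
    fix s assume s: "s \<in> R0"
    then have "R - {s} = insert x0 (R0 - {s})" using R0 by auto
    then show "poly (pderiv p) s = (s - x0) * poly (A' s) s"
      using *[of s] s R0 by (simp add: A'_def poly_prod algebra_simps)
  qed
  define D where "D = vdm (\<lambda>x. x) R"
  have D: "D = sqrt (\<Prod>x\<in>R. \<bar>poly (pderiv p) x\<bar>)"
    unfolding D_def vdm_def using poly_pderiv_linear_factors[OF R(1), of _ "\<lambda>x. x"] R(3)
    by (intro arg_cong[where f = sqrt] prod.cong) (simp_all add: poly_prod abs_prod)
  have Dpos: "D > 0" unfolding D_def using R(1) by (rule vdm_pos) simp
  have DR0: "D = vdm (\<lambda>x. x) R0 * (\<Prod>s\<in>R0. \<bar>x0 - s\<bar>)"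
    unfolding D_def R0(4) using R0 by (simp add: vdm_insert)
  interpret I: finite_product_sigma_finite "\<lambda>_::real. lborel :: real measure" R0 by standard fact
  define W where "W P = (\<Prod>x\<in>R. pos_powr (1/2) (poly P x / poly (pderiv p) x)) / D" for P
  have [measurable]: "W \<in> borel_measurable poly_borel" unfolding W_def[abs_def] by measurable
  have "(\<integral>\<^sup>+ P. ennreal (if simple_split m P then residue_weight P p else 0) \<partial>coeff_lborel 1 m)
     = (\<integral>\<^sup>+ P. ennreal (W P) \<partial>coeff_lborel 1 m)"
  proof (rule nn_integral_cong_AE)
    show "AE P in coeff_lborel 1 m. ennreal (if simple_split m P then residue_weight P p else 0) = ennreal (W P)"
      using AE_coeff_lborel_monic
    proof eventually_elim
      case (elim P)
      then have "(if simple_split m P then residue_weight P p else 0) = W P"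
        using residue_weight_swap[of P m p] p unfolding W_def D R_def by blast
      then show ?case by (rule arg_cong)
    qed
  qed
  also have "\<dots> = ennreal (vdm (\<lambda>x. x) R0) * (\<integral>\<^sup>+ w. ennreal (W (A - (\<Sum>s\<in>R0. smult (w s) (A' s)))) \<partial>(\<Pi>\<^sub>M s\<in>R0. lborel))"
    using nn_integral_coeff_lborel_lagrange[OF R0(1), of "\<lambda>x. x" "\<lambda>P. ennreal (W P)" 1 0]
    by (simp add: R0(2) A_def A'_def)
  \<comment> \<open>The substitution \<open>w s = (x0 - s) * q s\<close> turns the Lagrange
    coefficients at the nodes \<open>R0\<close> into the residues \<open>q s\<close> of
    \<open>P / p\<close>; the factor it produces completes the Vandermonde product of
    \<open>R\<close>.\<close>
  also have "(\<integral>\<^sup>+ w. ennreal (W (A - (\<Sum>s\<in>R0. smult (w s) (A' s)))) \<partial>(\<Pi>\<^sub>M s\<in>R0. lborel))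
     = ennreal (\<Prod>s\<in>R0. \<bar>x0 - s\<bar>) * (\<integral>\<^sup>+ q. ennreal (W (A - (\<Sum>s\<in>R0. smult ((\<lambda>s\<in>R0. (x0 - s) * q s) s) (A' s)))) \<partial>(\<Pi>\<^sub>M s\<in>R0. lborel))"
  proof -
    have "(\<integral>\<^sup>+ q. ennreal (W (A - (\<Sum>s\<in>R0. smult ((\<lambda>s\<in>R0. (x0 - s) * q s) s) (A' s)))) \<partial>(\<Pi>\<^sub>M s\<in>R0. lborel))
      = (\<integral>\<^sup>+ w. (\<Prod>s\<in>R0. ennreal (1 / \<bar>x0 - s\<bar>)) * ennreal (W (A - (\<Sum>s\<in>R0. smult (w s) (A' s)))) \<partial>(\<Pi>\<^sub>M s\<in>R0. lborel))"
    proof (rule nn_integral_PiM_transform[where F = "\<lambda>w. ennreal (W (A - (\<Sum>s\<in>R0. smult (w s) (A' s))))"])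
      fix s and g :: "real \<Rightarrow> ennreal" assume s: "s \<in> R0" and [measurable]: "g \<in> borel_measurable borel"
      have ne: "x0 - s \<noteq> 0" using s R0(3) by auto
      have "(\<integral>\<^sup>+ x. g x \<partial>lborel) = ennreal \<bar>x0 - s\<bar> * (\<integral>\<^sup>+ x. g (0 + (x0 - s) * x) \<partial>lborel)"
        by (rule nn_integral_real_affine) (use ne in auto)
      then have "ennreal (1 / \<bar>x0 - s\<bar>) * (\<integral>\<^sup>+ x. g x \<partial>lborel) = (\<integral>\<^sup>+ x. g ((x0 - s) * x) \<partial>lborel)"
        using ne by (simp add: mult.assoc[symmetric] flip: ennreal_mult)
      then show "(\<integral>\<^sup>+ x. g ((x0 - s) * x) \<partial>lborel) = (\<integral>\<^sup>+ y. ennreal (1 / \<bar>x0 - s\<bar>) * g y \<partial>lborel)"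
        by (simp add: nn_integral_cmult)
    qed (use R0(1) in \<open>auto intro: I.product_sigma_finite_axioms\<close>)
    also have "\<dots> = (\<Prod>s\<in>R0. ennreal (1 / \<bar>x0 - s\<bar>)) * (\<integral>\<^sup>+ w. ennreal (W (A - (\<Sum>s\<in>R0. smult (w s) (A' s)))) \<partial>(\<Pi>\<^sub>M s\<in>R0. lborel))"
      by (rule nn_integral_cmult) measurable
    finally show ?thesis
    proof -
      assume eq: "(\<integral>\<^sup>+ q. ennreal (W (A - (\<Sum>s\<in>R0. smult ((\<lambda>s\<in>R0. (x0 - s) * q s) s) (A' s)))) \<partial>(\<Pi>\<^sub>M s\<in>R0. lborel))
        = (\<Prod>s\<in>R0. ennreal (1 / \<bar>x0 - s\<bar>)) * (\<integral>\<^sup>+ w. ennreal (W (A - (\<Sum>s\<in>R0. smult (w s) (A' s)))) \<partial>(\<Pi>\<^sub>M s\<in>R0. lborel))"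
      have "ennreal (\<Prod>s\<in>R0. \<bar>x0 - s\<bar>) * (\<Prod>s\<in>R0. ennreal (1 / \<bar>x0 - s\<bar>)) = (\<Prod>s\<in>R0. ennreal \<bar>x0 - s\<bar> * ennreal (1 / \<bar>x0 - s\<bar>))"
        by (simp add: prod.distrib prod_ennreal)
      also have "\<dots> = 1" using R0(3) by (intro prod.neutral) (auto simp flip: ennreal_mult)
      finally show ?thesis unfolding eq by (simp add: mult.assoc[symmetric])
    qed
  qed
  also have "(\<integral>\<^sup>+ q. ennreal (W (A - (\<Sum>s\<in>R0. smult ((\<lambda>s\<in>R0. (x0 - s) * q s) s) (A' s)))) \<partial>(\<Pi>\<^sub>M s\<in>R0. lborel))
     = (\<integral>\<^sup>+ q. ennreal (1 / D) * ((\<Prod>s\<in>R0. ennreal (pos_powr (1/2) (q s))) * ennreal (pos_powr (1/2) (1 - (\<Sum>s\<in>R0. q s)))) \<partial>(\<Pi>\<^sub>M s\<in>R0. lborel))"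
  proof (intro nn_integral_cong)
    fix q :: "real \<Rightarrow> real"
    define P where "P = A - (\<Sum>s\<in>R0. smult ((\<lambda>s\<in>R0. (x0 - s) * q s) s) (A' s))"
    have P: "poly P x = poly A x - (\<Sum>s\<in>R0. (x0 - s) * q s * poly (A' s) x)" for x
      by (simp add: P_def poly_sum)
    have "(\<Sum>s\<in>R0. (x0 - s) * q s * poly (A' s) x0) = (\<Sum>s\<in>R0. q s * poly A x0)"
      using R0(3) by (intro sum.cong) (auto simp: A')
    then have 1: "poly P x0 / poly (pderiv p) x0 = 1 - (\<Sum>s\<in>R0. q s)"
      using Ax0 by (simp add: P p' sum_distrib_right[symmetric] diff_divide_distrib)
    have 2: "poly P s / poly (pderiv p) s = q s" if s: "s \<in> R0" for s
    proof -
      have "poly (A' t) s = 0" if "t \<in> R0" "t \<noteq> s" for t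
        using that s R0(1) by (auto simp: A'_def poly_prod)
      then have "(\<Sum>t\<in>R0. (x0 - t) * q t * poly (A' t) s) = (\<Sum>t\<in>R0. if t = s then (x0 - s) * q s * poly (A' s) s else 0)"
        by (intro sum.cong) auto
      moreover have "poly A s = 0" using s R0(1) by (auto simp: A_def poly_prod)
      ultimately have "poly P s = - ((x0 - s) * q s * poly (A' s) s)" using s R0(1) by (simp add: P)
      also have "\<dots> = q s * poly (pderiv p) s" unfolding p'(2)[OF s] by (simp add: algebra_simps)
      moreover have "poly (pderiv p) s \<noteq> 0" using s R0(3) A'(1)[OF s] p'(2)[OF s] by auto
      ultimately show ?thesis by simp
    qed
    have "W P = (1 / D) * ((\<Prod>s\<in>R0. pos_powr (1/2) (q s)) * pos_powr (1/2) (1 - (\<Sum>s\<in>R0. q s)))"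
      unfolding W_def R0(4) using R0 1 2 by simp
    then show "ennreal (W (A - (\<Sum>s\<in>R0. smult ((\<lambda>s\<in>R0. (x0 - s) * q s) s) (A' s))))
       = ennreal (1 / D) * ((\<Prod>s\<in>R0. ennreal (pos_powr (1/2) (q s))) * ennreal (pos_powr (1/2) (1 - (\<Sum>s\<in>R0. q s))))"
      unfolding P_def[symmetric] using Dpos by (simp add: prod_ennreal prod_nonneg flip: ennreal_mult)
  qed
  also have "\<dots> = ennreal (1 / D) * ennreal (sqrt pi ^ m * Gamma (1/2) / Gamma (1/2 + m / 2) * pos_powr (1/2 + m / 2) 1)"
    using nn_integral_dirichlet[OF R0(1), of "1/2" 1] by (subst nn_integral_cmult) (simp_all add: R0(2))
  also have "sqrt pi ^ m * Gamma (1/2) / Gamma (1/2 + m / 2) * pos_powr (1/2 + m / 2) 1 = sqrt pi ^ Suc m / Gamma (Suc m / 2)"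
    by (simp add: pos_powr_def Gamma_one_half_real add_divide_distrib)
  also have "ennreal (vdm (\<lambda>x. x) R0) * (ennreal (\<Prod>s\<in>R0. \<bar>x0 - s\<bar>) * (ennreal (1 / D) * ennreal (sqrt pi ^ Suc m / Gamma (Suc m / 2))))
     = ennreal D * ennreal (1 / D) * ennreal (sqrt pi ^ Suc m / Gamma (Suc m / 2))"
    unfolding DR0 by (simp add: ennreal_mult vdm_nonneg prod_nonneg mult.assoc)
  also have "\<dots> = ennreal (sqrt pi ^ Suc m / Gamma (Suc m / 2))"
    using Dpos by (simp flip: ennreal_mult)
  finally show ?thesis .
qed

text \<open>After exchanging the integrals, the integral over \<open>P\<close> for fixed
  \<open>p\<close> is the Dixon--Anderson constant if \<open>p\<close> splits. If \<open>p\<close>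
  does not split, no \<open>P\<close> interlaces with it and the weight vanishes.\<close>

lemma nn_integral_bordering:
  assumes [measurable]: "f \<in> borel_measurable poly_borel"
  shows "(\<integral>\<^sup>+ P. indicator {P. simple_split m P} P *
       (\<integral>\<^sup>+ p. ennreal (residue_weight P p) * f p \<partial>coeff_lborel 1 (Suc m)) \<partial>coeff_lborel 1 m)
    = ennreal (sqrt pi ^ Suc m / Gamma (Suc m / 2)) *
       (\<integral>\<^sup>+ p. indicator {p. simple_split (Suc m) p} p * f p \<partial>coeff_lborel 1 (Suc m))"
proof -
  interpret A: sigma_finite_measure "coeff_lborel 1 m" by (rule sigma_finite_coeff_lborel)
  interpret B: sigma_finite_measure "coeff_lborel 1 (Suc m)" by (rule sigma_finite_coeff_lborel)
  interpret AB: pair_sigma_finite "coeff_lborel 1 (Suc m)" "coeff_lborel 1 m" ..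
  let ?w = "\<lambda>P p. ennreal (if simple_split m P then residue_weight P p else 0)"
  have "(\<integral>\<^sup>+ P. indicator {P. simple_split m P} P *
       (\<integral>\<^sup>+ p. ennreal (residue_weight P p) * f p \<partial>coeff_lborel 1 (Suc m)) \<partial>coeff_lborel 1 m)
    = (\<integral>\<^sup>+ P. \<integral>\<^sup>+ p. ?w P p * f p \<partial>coeff_lborel 1 (Suc m) \<partial>coeff_lborel 1 m)"
    by (intro nn_integral_cong) (auto simp: indicator_def)
  also have "\<dots> = (\<integral>\<^sup>+ p. \<integral>\<^sup>+ P. ?w P p * f p \<partial>coeff_lborel 1 m \<partial>coeff_lborel 1 (Suc m))"
    by (rule AB.Fubini') measurable
  also have "\<dots> = (\<integral>\<^sup>+ p. (\<integral>\<^sup>+ P. ?w P p \<partial>coeff_lborel 1 m) * f p \<partial>coeff_lborel 1 (Suc m))"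
    by (intro nn_integral_cong nn_integral_multc) measurable
  also have "\<dots> = (\<integral>\<^sup>+ p. ennreal (sqrt pi ^ Suc m / Gamma (Suc m / 2)) * (indicator {p. simple_split (Suc m) p} p * f p) \<partial>coeff_lborel 1 (Suc m))"
  proof (rule nn_integral_cong_AE)
    show "AE p in coeff_lborel 1 (Suc m). (\<integral>\<^sup>+ P. ?w P p \<partial>coeff_lborel 1 m) * f p
       = ennreal (sqrt pi ^ Suc m / Gamma (Suc m / 2)) * (indicator {p. simple_split (Suc m) p} p * f p)"
      using AE_coeff_lborel_monic
    proof eventually_elim
      case (elim p)
      show ?case
      proof (cases "simple_split (Suc m) p")
        case True
        then show ?thesis by (simp only: nn_integral_residue_weight[OF True]) simp
      next
        case False
        have "(if simple_split m P then residue_weight P p else 0) = 0" for P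
        proof (rule ccontr)
          assume ne: "(if simple_split m P then residue_weight P p else 0) \<noteq> 0"
          then have P: "simple_split m P" "residue_weight P p \<noteq> 0" by (auto split: if_splits)
          have "- poly p s / poly (pderiv P) s > 0" if "poly P s = 0" for s
          proof (rule ccontr)
            assume "\<not> - poly p s / poly (pderiv P) s > 0"
            then have "pos_powr (1/2) (- poly p s / poly (pderiv P) s) = 0" by (simp only: pos_powr_def if_False)
            then have "(\<Prod>s | poly P s = 0. pos_powr (1/2) (- poly p s / poly (pderiv P) s)) = 0"
              using that simple_splitD(1)[OF P(1)] by (intro prod_zero) auto
            with P(2) show False by (simp add: residue_weight_def)
          qed
          from interlace_residues(1)[OF _ _ P(1) this] elim False show False by auto
        qed
        then show ?thesis using False by simp
      qed
    qed
  qed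
  also have "\<dots> = ennreal (sqrt pi ^ Suc m / Gamma (Suc m / 2)) *
       (\<integral>\<^sup>+ p. indicator {p. simple_split (Suc m) p} p * f p \<partial>coeff_lborel 1 (Suc m))"
    unfolding indicator_def by (rule nn_integral_cmult) measurable
  finally show ?thesis .
qed

subsection \<open>Bordering symmetric matrices\<close>

text \<open>Spectral theorem by induction on the dimension: the maximum of the Rayleigh quotient on
  the unit sphere of an invariant subspace is attained at an eigenvector, whose orthogonal
  complement in the subspace is again invariant.\<close>

lemma self_adjoint_eigenbasis:
  fixes f :: "'a::euclidean_space \<Rightarrow> 'a"
  assumes "linear f" "\<And>x y. f x \<bullet> y = x \<bullet> f y" "subspace S" "f ` S \<subseteq> S"
  shows "\<exists>B\<subseteq>S. finite B \<and> card B = dim S \<and> pairwise orthogonal B \<and> (\<forall>b\<in>B. norm b = 1 \<and> (\<exists>c. f b = c *\<^sub>R b))"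
  using assms(3,4)
proof (induction "dim S" arbitrary: S)
  case 0
  then show ?case by (intro exI[of _ "{}"]) auto
next
  case (Suc n)
  interpret f: linear f by fact
  have "\<exists>x\<in>S. x \<noteq> 0"
  proof (rule ccontr)
    assume "\<not> ?thesis"
    then have "S \<subseteq> {0}" by auto
    then have "dim S = 0" by (simp add: dim_eq_0)
    with Suc(2) show False by simp
  qed
  then obtain x0 where x0: "x0 \<in> S" "x0 \<noteq> 0" by blast
  define K where "K = S \<inter> sphere 0 1"
  have "x0 /\<^sub>R norm x0 \<in> K"
    using x0 Suc.prems(1) by (auto simp: K_def subspace_scale)
  then have "K \<noteq> {}" by auto
  moreover have "compact K"
    unfolding K_def using closed_subspace[OF Suc.prems(1)] by (intro closed_Int_compact) auto
  moreover have "continuous_on K (\<lambda>x. f x \<bullet> x)"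
    by (intro continuous_intros linear_continuous_on linear_conv_bounded_linear[THEN iffD1] assms(1))
  ultimately obtain u where u: "u \<in> K" "\<And>y. y \<in> K \<Longrightarrow> f y \<bullet> y \<le> f u \<bullet> u"
    using continuous_attains_sup[of K "\<lambda>x. f x \<bullet> x"] by blast
  then have uS: "u \<in> S" and nu: "u \<bullet> u = 1" by (auto simp: K_def norm_eq_1)
  define \<mu> where "\<mu> = f u \<bullet> u"
  have max: "f y \<bullet> y \<le> \<mu> * (y \<bullet> y)" if "y \<in> S" for y
  proof (cases "y = 0")
    case True then show ?thesis by (simp add: f.zero)
  next
    case False
    then have "y /\<^sub>R norm y \<in> K" using that Suc.prems(1) by (auto simp: K_def subspace_scale)
    from u(2)[OF this] have "f y \<bullet> y / (norm y)\<^sup>2 \<le> \<mu>"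
      by (simp add: f.scale \<mu>_def power2_eq_square divide_inverse mult_ac)
    then show ?thesis using False by (simp add: divide_le_eq power2_norm_eq_inner)
  qed
  have orth: "f u \<bullet> v = 0" if v: "v \<in> S" "u \<bullet> v = 0" for v
  proof (rule ccontr)
    assume ne: "f u \<bullet> v \<noteq> 0"
    define c where "c = \<mu> * (v \<bullet> v) - f v \<bullet> v"
    have *: "2 * t * (f u \<bullet> v) \<le> t\<^sup>2 * c" for t
    proof -
      have "u + t *\<^sub>R v \<in> S" using uS v Suc.prems(1) by (simp add: subspace_add subspace_scale)
      from max[OF this] have "f u \<bullet> u + t * (f u \<bullet> v) + t * (f v \<bullet> u) + t\<^sup>2 * (f v \<bullet> v) \<le> \<mu> * (1 + t\<^sup>2 * (v \<bullet> v))"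
        using v nu by (simp add: f.add f.scale inner_add_left inner_add_right inner_commute[of v u] power2_eq_square algebra_simps)
      moreover have "f v \<bullet> u = f u \<bullet> v" using assms(2)[of v u] by (simp add: inner_commute)
      ultimately show ?thesis by (simp add: \<mu>_def c_def algebra_simps)
    qed
    define b where "b = f u \<bullet> v"
    \<comment> \<open>\<open>t\<close> has the sign of \<open>b\<close> and is so small that the
      quadratic term \<open>t^2 * c\<close> cannot offset the linear gain
      \<open>2 * t * b\<close>.\<close>
    define t where "t = b / (\<bar>c\<bar> + 1)"
    have "2 * t * b \<le> t\<^sup>2 * c" using * by (simp add: b_def)
    also have "\<dots> \<le> t\<^sup>2 * (\<bar>c\<bar> + 1)" by (intro mult_left_mono) auto
    also have "\<dots> = t * b" by (simp add: t_def power2_eq_square)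
    finally have "t * b \<le> 0" by (simp add: mult.commute)
    moreover have "t * b > 0" using ne by (simp add: t_def b_def power2_eq_square[symmetric])
    ultimately show False by simp
  qed
  have fu: "f u = \<mu> *\<^sub>R u"
  proof -
    define w where "w = f u - \<mu> *\<^sub>R u"
    have "w \<in> S" using uS Suc.prems by (auto simp: w_def subspace_diff subspace_scale)
    moreover have uw: "u \<bullet> w = 0" by (simp add: w_def inner_diff_right nu \<mu>_def inner_commute)
    ultimately have "f u \<bullet> w = 0" by (rule orth)
    moreover have "w \<bullet> w = f u \<bullet> w - \<mu> * (u \<bullet> w)" by (subst (1) w_def) (simp add: inner_diff_left)
    ultimately have "w \<bullet> w = 0" using uw by simp
    then show ?thesis by (simp add: w_def)
  qed
  define S' where "S' = {y \<in> S. \<forall>x\<in>span {u}. orthogonal x y}"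
  have S'_iff: "y \<in> S' \<longleftrightarrow> y \<in> S \<and> u \<bullet> y = 0" for y
    by (auto simp: S'_def span_singleton orthogonal_def)
  have "dim S' + dim (span {u}) = dim S"
    unfolding S'_def using uS Suc.prems(1)
    by (intro dim_subspace_orthogonal_to_vectors span_minimal) auto
  moreover have "dim (span {u}) = 1" using nu by (auto simp: dim_singleton)
  ultimately have "n = dim S'" using Suc(2) by simp
  moreover have "subspace S'"
    using Suc.prems(1) by (auto simp: S'_iff subspace_def inner_add_right)
  moreover have "f ` S' \<subseteq> S'"
  proof
    fix z assume "z \<in> f ` S'"
    then obtain y where y: "y \<in> S'" "z = f y" by blast
    have "u \<bullet> f y = f u \<bullet> y" using assms(2) by simp
    then show "z \<in> S'" using y Suc.prems(2) by (auto simp: S'_iff fu)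
  qed
  ultimately have "\<exists>B\<subseteq>S'. finite B \<and> card B = dim S' \<and> pairwise orthogonal B \<and>
      (\<forall>b\<in>B. norm b = 1 \<and> (\<exists>c. f b = c *\<^sub>R b))"
    by (rule Suc(1))
  then obtain B where B: "B \<subseteq> S'" "finite B" "card B = dim S'" "pairwise orthogonal B"
     "\<And>b. b \<in> B \<Longrightarrow> norm b = 1 \<and> (\<exists>c. f b = c *\<^sub>R b)"
    by blast
  have uB: "u \<notin> B" using B(1) nu by (auto simp: S'_iff)
  show ?case
  proof (intro exI[of _ "insert u B"] conjI ballI)
    show "insert u B \<subseteq> S" using uS B(1) by (auto simp: S'_iff)
    show "card (insert u B) = dim S" using uB B(2,3) Suc(2) \<open>n = dim S'\<close> by simp
    show "pairwise orthogonal (insert u B)"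
      using B(1,4) by (auto simp: pairwise_insert S'_iff orthogonal_def inner_commute)
    fix b assume "b \<in> insert u B"
    then show "norm b = 1" "\<exists>c. f b = c *\<^sub>R b" using B(5) nu fu by (auto simp: norm_eq_1)
  qed (use B(2) in auto)
qed

section \<open>Characteristic polynomials of principal submatrices\<close>

text \<open>The characteristic polynomial of the principal submatrix on \<open>I\<close>. Padding
  with the identity outside \<open>I\<close> keeps all determinants over the full index type, so no
  types of varying dimension occur.\<close>

definition sub_charpoly :: "'n::finite set \<Rightarrow> real ^ 'n ^ 'n \<Rightarrow> real poly" where
  "sub_charpoly I M = det (\<chi> i j. if i \<in> I \<and> j \<in> I then (if i = j then [:0, 1:] else 0) - [:M $ i $ j:]
     else if i = j then 1 else 0)"

definition sub_char_matrix :: "'n::finite set \<Rightarrow> real ^ 'n ^ 'n \<Rightarrow> real \<Rightarrow> real ^ 'n ^ 'n" where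
  "sub_char_matrix I M t = (\<chi> i j. if i \<in> I \<and> j \<in> I then (if i = j then t else 0) - M $ i $ j
     else if i = j then 1 else 0)"

lemma poly_sub_charpoly: "poly (sub_charpoly I M) t = det (sub_char_matrix I M t)"
proof -
  have "poly (of_int k) t = of_int k" for k :: int by simp
  then show ?thesis
    unfolding sub_charpoly_def sub_char_matrix_def det_def
    by (auto simp: poly_sum poly_prod intro!: sum.cong prod.cong)
qed

lemma measurable_sub_charpoly:
  assumes "\<And>i j. i \<in> I \<Longrightarrow> j \<in> I \<Longrightarrow> (\<lambda>x. f x $ i $ j) \<in> borel_measurable M"
  shows "(\<lambda>x. sub_charpoly I (f x)) \<in> M \<rightarrow>\<^sub>M poly_borel"
proof -
  have "(\<lambda>x. if i \<in> I \<and> j \<in> I then (if i = j then [:0, 1:] else 0) - [:f x $ i $ j:]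
     else if i = j then 1 else 0) \<in> M \<rightarrow>\<^sub>M poly_borel" for i j
    using assms by (cases "i \<in> I \<and> j \<in> I") (auto intro!: measurable_poly_diff measurable_pCons)
  note [measurable] = this
  show ?thesis
    unfolding sub_charpoly_def det_def by simp
qed

lemma sub_charpoly_empty [simp]: "sub_charpoly {} (M :: real ^ 'n ^ 'n) = 1"
proof -
  have "(\<chi> i j. if i = j then 1 else 0) = (mat 1 :: real poly ^ 'n ^ 'n)" by (simp add: mat_def)
  then show ?thesis by (simp add: sub_charpoly_def det_I)
qed

lemma det_arrowhead:
  fixes T :: "real ^ 'n ^ 'n"
  assumes i: "i \<notin> I" and T: "\<And>k j. T $ k $ j = (if k = i \<and> j = i then a else if k = i \<and> j \<in> I then - z j
    else if j = i \<and> k \<in> I then - z k else if k = j then (if k \<in> I then e k else 1) else 0)"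
  shows "det T = a * (\<Prod>s\<in>I. e s) - (\<Sum>s\<in>I. (z s)\<^sup>2 * (\<Prod>r\<in>I - {s}. e r))"
proof -
  let ?term = "\<lambda>p. of_int (sign p) * (\<Prod>k\<in>UNIV. T $ k $ p k)"
  have "finite I" by simp
  have perm: "p = id \<or> p \<in> Transposition.transpose i ` I" if p: "p permutes UNIV" "?term p \<noteq> 0" for p
  proof -
    have ne: "T $ k $ p k \<noteq> 0" for k using p(2) by simp
    have 1: "p k = k" if "k \<notin> insert i I" for k using ne[of k] that by (auto simp: T split: if_splits)
    have 2: "p k = k \<or> p k = i" if "k \<in> I" for k using ne[of k] that i by (auto simp: T split: if_splits)
    have 3: "p i = i \<or> p i \<in> I" using ne[of i] i by (auto simp: T split: if_splits)
    have inj: "p x = p y \<longleftrightarrow> x = y" for x y using p(1) by (simp add: permutes_inj inj_eq)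
    show ?thesis
    proof (cases "p i = i")
      case True
      then have "p k = k" for k using 1 2 inj[of k i] by (cases "k \<in> insert i I") auto
      then show ?thesis by auto
    next
      case False
      with 3 have s: "p i \<in> I" by simp
      have pp: "p (p i) = i" using 2[OF s] inj[of "p i" i] False by auto
      have "p k = Transposition.transpose i (p i) k" for k
      proof (cases "k = i \<or> k = p i")
        case False
        then have "p k = k" using 1 2 inj[of k "p i"] pp by (cases "k \<in> I") auto
        then show ?thesis using False by simp
      qed (use pp in auto)
      then show ?thesis using s by blast
    qed
  qed
  have "det T = (\<Sum>p\<in>insert id (Transposition.transpose i ` I). ?term p)"
    unfolding det_def using perm
    by (intro sum.mono_neutral_right) (auto simp: permutes_swap_id permutes_id)
  also have "\<dots> = ?term id + (\<Sum>s\<in>I. ?term (Transposition.transpose i s))"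
  proof (subst sum.insert)
    have "Transposition.transpose i s \<noteq> id" if "s \<in> I" for s
      using that i by (metis id_apply transpose_apply_first)
    then show "id \<notin> Transposition.transpose i ` I" by (metis imageE)
    have "inj_on (Transposition.transpose i) I" by (rule inj_onI) (metis transpose_apply_first)
    then show "?term id + sum ?term (Transposition.transpose i ` I) = ?term id + (\<Sum>s\<in>I. ?term (Transposition.transpose i s))"
      by (simp add: sum.reindex)
  qed auto
  also have "?term id = a * (\<Prod>s\<in>I. e s)"
  proof -
    have "(\<Prod>k\<in>UNIV. T $ k $ k) = T $ i $ i * (\<Prod>k\<in>UNIV - {i}. T $ k $ k)" by (simp add: prod.remove)
    also have "(\<Prod>k\<in>UNIV - {i}. T $ k $ k) = (\<Prod>k\<in>I. T $ k $ k)"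
      using i by (intro prod.mono_neutral_right) (auto simp: T)
    also have "\<dots> = (\<Prod>s\<in>I. e s)" using i by (intro prod.cong) (auto simp: T)
    finally show ?thesis by (simp add: T sign_id)
  qed
  also have "(\<Sum>s\<in>I. ?term (Transposition.transpose i s)) = (\<Sum>s\<in>I. - ((z s)\<^sup>2 * (\<Prod>r\<in>I - {s}. e r)))"
  proof (rule sum.cong[OF refl])
    fix s assume s: "s \<in> I"
    then have si: "s \<noteq> i" using i by auto
    let ?p = "Transposition.transpose i s"
    have "(\<Prod>k\<in>UNIV. T $ k $ ?p k) = T $ i $ s * (T $ s $ i * (\<Prod>k\<in>UNIV - {i} - {s}. T $ k $ ?p k))"
      using si by (simp add: prod.remove[of UNIV i] prod.remove[of "UNIV - {i}" s])
    also have "(\<Prod>k\<in>UNIV - {i} - {s}. T $ k $ ?p k) = (\<Prod>k\<in>I - {s}. T $ k $ ?p k)"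
      using i by (intro prod.mono_neutral_right) (auto simp: T)
    also have "\<dots> = (\<Prod>r\<in>I - {s}. e r)"
    proof (rule prod.cong[OF refl])
      fix k assume k: "k \<in> I - {s}"
      then have "?p k = k" using i by (intro transpose_apply_other) auto
      with k show "T $ k $ ?p k = e k" using i by (auto simp: T)
    qed
    finally show "?term (Transposition.transpose i s) = - ((z s)\<^sup>2 * (\<Prod>r\<in>I - {s}. e r))"
      using s si i by (simp add: T sign_swap_id power2_eq_square)
  qed
  finally show ?thesis by (simp add: sum_negf)
qed

text \<open>The block on \<open>I\<close>, padded by zeros, maps the coordinate subspace of
  \<open>I\<close> to itself; its eigenbasis there has \<open>card I\<close> members and can
  therefore be indexed by \<open>I\<close>.\<close>

lemma sub_spectral_decomposition:
  fixes M :: "real ^ 'n ^ 'n"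
  assumes sym: "\<And>i j. i \<in> I \<Longrightarrow> j \<in> I \<Longrightarrow> M $ i $ j = M $ j $ i"
  obtains d :: "'n \<Rightarrow> real" and u :: "'n \<Rightarrow> real ^ 'n" where
    "\<And>s r. s \<in> I \<Longrightarrow> r \<in> I \<Longrightarrow> u s \<bullet> u r = (if s = r then 1 else 0)"
    "\<And>s k. s \<in> I \<Longrightarrow> k \<notin> I \<Longrightarrow> u s $ k = 0"
    "\<And>s k. s \<in> I \<Longrightarrow> k \<in> I \<Longrightarrow> (\<Sum>j\<in>I. M $ k $ j * u s $ j) = d s * u s $ k"
proof -
  define A where "A = (\<chi> i j. if i \<in> I \<and> j \<in> I then M $ i $ j else 0)"
  define S where "S = {x :: real ^ 'n. \<forall>i. i \<notin> I \<longrightarrow> x $ i = 0}"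
  have At: "transpose A = A" using sym by (auto simp: A_def transpose_def vec_eq_iff)
  have "\<exists>B\<subseteq>S. finite B \<and> card B = dim S \<and> pairwise orthogonal B \<and> (\<forall>b\<in>B. norm b = 1 \<and> (\<exists>c. (*v) A b = c *\<^sub>R b))"
  proof (rule self_adjoint_eigenbasis)
    show "(*v) A x \<bullet> y = x \<bullet> (*v) A y" for x y
      using dot_lmul_matrix[of x A y] At by (metis inner_commute transpose_matrix_vector)
    show "subspace S" by (auto simp: S_def subspace_def)
    show "(*v) A ` S \<subseteq> S" by (auto simp: S_def A_def matrix_vector_mult_def intro!: sum.neutral)
  qed simp
  then obtain B where B: "B \<subseteq> S" "finite B" "card B = dim S" "pairwise orthogonal B"
    "\<And>b. b \<in> B \<Longrightarrow> norm b = 1" "\<And>b. b \<in> B \<Longrightarrow> \<exists>c. A *v b = c *\<^sub>R b" by blast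
  have "dim S = card I" unfolding S_def dim_vec_eq[symmetric] by (rule dim_substandard_cart)
  then obtain u where u: "bij_betw u I B"
    using B(2,3) by (metis finite finite_same_card_bij)
  define d where "d s = (SOME c. A *v u s = c *\<^sub>R u s)" for s
  have uB: "u s \<in> B" if "s \<in> I" for s using u that by (auto simp: bij_betw_def)
  have d: "A *v u s = d s *\<^sub>R u s" if "s \<in> I" for s
    unfolding d_def using B(6)[OF uB[OF that]] by (rule someI_ex)
  show ?thesis
  proof
    fix s r assume sr: "s \<in> I" "r \<in> I"
    show "u s \<bullet> u r = (if s = r then 1 else 0)"
    proof (cases "s = r")
      case True
      then show ?thesis using B(5)[OF uB[OF sr(1)]] by (simp add: norm_eq_1)
    next
      case False
      then have "u s \<noteq> u r" using u sr by (auto simp: bij_betw_def inj_on_def)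
      then show ?thesis using False B(4) uB sr by (auto simp: pairwise_def orthogonal_def)
    qed
  next
    fix s k assume "s \<in> I" "k \<notin> I"
    then show "u s $ k = 0" using uB[of s] B(1) by (auto simp: S_def)
  next
    fix s k assume sk: "s \<in> I" "k \<in> I"
    have "(\<Sum>j\<in>I. M $ k $ j * u s $ j) = (\<Sum>j\<in>UNIV. A $ k $ j * u s $ j)"
      using sk by (intro sum.mono_neutral_cong_left) (auto simp: A_def)
    also have "\<dots> = (A *v u s) $ k" by (simp add: matrix_vector_mult_def)
    also have "\<dots> = d s * u s $ k" using d[OF sk(1)] by simp
    finally show "(\<Sum>j\<in>I. M $ k $ j * u s $ j) = d s * u s $ k" .
  qed
qed

lemma det_orthogonal_conjugate:
  fixes Q A :: "real ^ 'n ^ 'n"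
  assumes "orthogonal_matrix Q"
  shows "det (transpose Q ** A ** Q) = det A"
  using det_orthogonal_matrix[OF assms] by (auto simp: det_mul det_transpose)

locale sub_eigenbasis =
  fixes I :: "'n::finite set" and M :: "real ^ 'n ^ 'n" and d :: "'n \<Rightarrow> real" and u :: "'n \<Rightarrow> real ^ 'n"
  assumes orthonormal: "\<And>s r. s \<in> I \<Longrightarrow> r \<in> I \<Longrightarrow> u s \<bullet> u r = (if s = r then 1 else 0)"
    and support: "\<And>s k. s \<in> I \<Longrightarrow> k \<notin> I \<Longrightarrow> u s $ k = 0"
    and eigen: "\<And>s k. s \<in> I \<Longrightarrow> k \<in> I \<Longrightarrow> (\<Sum>j\<in>I. M $ k $ j * u s $ j) = d s * u s $ k"
begin

text \<open>The eigenvectors are the columns with index in \<open>I\<close>; the identity outside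
  leaves the border index alone during conjugation.\<close>

definition Q :: "real ^ 'n ^ 'n" where
  "Q = (\<chi> i s. if s \<in> I then u s $ i else if i = s then 1 else 0)"

lemma inner_eq_sum: "s \<in> I \<Longrightarrow> u s \<bullet> x = (\<Sum>k\<in>I. u s $ k * x $ k)"
  unfolding inner_vec_def using support by (intro sum.mono_neutral_cong_right) auto

lemma orthogonal_Q: "orthogonal_matrix Q"
proof -
  have col: "column s Q = (if s \<in> I then u s else axis s 1)" for s
    by (auto simp: column_def Q_def vec_eq_iff axis_def)
  show ?thesis
    unfolding orthogonal_matrix_orthonormal_columns col orthogonal_def
    using orthonormal support
    by (auto simp: norm_eq_1 inner_axis inner_axis' inner_axis_axis; simp add: axis_def)
qed

lemma conjugate_nth:
  "(transpose Q ** A ** Q) $ s $ r = (\<Sum>k\<in>UNIV. Q $ k $ s * (\<Sum>j\<in>UNIV. A $ k $ j * Q $ j $ r))"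
  unfolding matrix_mul_assoc[symmetric] by (simp add: matrix_matrix_mult_def transpose_def)

text \<open>Conjugation by the orthogonal matrix \<open>Q\<close> diagonalises the padded
  characteristic matrix and leaves its determinant unchanged.\<close>

lemma sub_charpoly_eq: "sub_charpoly I M = (\<Prod>s\<in>I. [:- d s, 1:])"
proof (rule poly_eq_poly_eq_iff[THEN iffD1], rule ext)
  fix t
  define T where "T = transpose Q ** sub_char_matrix I M t ** Q"
  have T: "T $ s $ r = (if s = r then (if s \<in> I then t - d s else 1) else 0)" for s r
  proof -
    have inner: "(\<Sum>j\<in>UNIV. sub_char_matrix I M t $ k $ j * Q $ j $ r)
      = (if r \<in> I then (t - d r) * u r $ k else if k = r then 1 else 0)" for k
    proof (cases "r \<in> I")
      case True
      show ?thesis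
      proof (cases "k \<in> I")
        case k: True
        have "(\<Sum>j\<in>UNIV. sub_char_matrix I M t $ k $ j * Q $ j $ r) = (\<Sum>j\<in>I. ((if k = j then t else 0) - M $ k $ j) * u r $ j)"
          using k True support by (intro sum.mono_neutral_cong_right) (auto simp: sub_char_matrix_def Q_def)
        also have "\<dots> = (\<Sum>j\<in>I. if k = j then t * u r $ j else 0) - (\<Sum>j\<in>I. M $ k $ j * u r $ j)"
          by (subst sum_subtractf[symmetric]) (auto intro!: sum.cong simp: algebra_simps)
        also have "\<dots> = (t - d r) * u r $ k" using k True eigen by (simp add: algebra_simps)
        finally show ?thesis using True by simp
      next
        case False
        then show ?thesis using True support
          by (auto simp: sub_char_matrix_def Q_def if_distrib[of "\<lambda>x. x * _"] cong: if_cong intro!: sum.neutral)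
      qed
    next
      case False
      have "(\<Sum>j\<in>UNIV. sub_char_matrix I M t $ k $ j * Q $ j $ r) = (\<Sum>j\<in>UNIV. if j = r then sub_char_matrix I M t $ k $ r else 0)"
        using False by (intro sum.cong) (auto simp: Q_def)
      also have "\<dots> = (if k = r then 1 else 0)" using False by (simp add: sub_char_matrix_def)
      finally show ?thesis using False by simp
    qed
    show ?thesis
    proof (cases "r \<in> I")
      case True
      have "T $ s $ r = (\<Sum>k\<in>UNIV. Q $ k $ s * ((t - d r) * u r $ k))" 
        unfolding T_def conjugate_nth inner using True by simp
      also have "\<dots> = (t - d r) * (\<Sum>k\<in>UNIV. Q $ k $ s * u r $ k)" by (simp add: sum_distrib_left mult_ac)
      also have "(\<Sum>k\<in>UNIV. Q $ k $ s * u r $ k) = (if s = r then 1 else 0)"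
      proof (cases "s \<in> I")
        case s: True
        then have "(\<Sum>k\<in>UNIV. Q $ k $ s * u r $ k) = u s \<bullet> u r" by (simp add: Q_def inner_vec_def)
        then show ?thesis using orthonormal[OF s True] by simp
      next
        case s: False
        then have "(\<Sum>k\<in>UNIV. Q $ k $ s * u r $ k) = (\<Sum>k\<in>UNIV. if k = s then u r $ s else 0)"
          by (intro sum.cong) (auto simp: Q_def)
        then show ?thesis using s True support by auto
      qed
      finally show ?thesis using True by auto
    next
      case False
      have "T $ s $ r = (\<Sum>k\<in>UNIV. if k = r then Q $ r $ s else 0)"
        unfolding T_def conjugate_nth inner using False by (intro sum.cong) auto
      also have "\<dots> = Q $ r $ s" by simp
      also have "\<dots> = (if s = r then 1 else 0)" using False support by (auto simp: Q_def)
      finally show ?thesis using False by auto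
    qed
  qed
  have "poly (sub_charpoly I M) t = det T"
    unfolding T_def det_orthogonal_conjugate[OF orthogonal_Q] by (rule poly_sub_charpoly)
  also have "\<dots> = (\<Prod>s\<in>UNIV. T $ s $ s)" by (rule det_diagonal) (simp add: T)
  also have "\<dots> = (\<Prod>s\<in>I. t - d s)" by (intro prod.mono_neutral_cong_right) (auto simp: T)
  finally show "poly (sub_charpoly I M) t = poly (\<Prod>s\<in>I. [:- d s, 1:]) t" by (simp add: poly_prod)
qed

text \<open>Conjugation by \<open>Q\<close> diagonalises the block on \<open>I\<close> and replaces
  the border by its coordinates \<open>z s\<close> in the eigenbasis, so the bordered matrix becomes
  an arrowhead.\<close>

lemma sub_charpoly_insert:
  assumes i: "i \<notin> I" and N: "\<And>j k. j \<in> I \<Longrightarrow> k \<in> I \<Longrightarrow> N $ j $ k = M $ j $ k" "\<And>j. N $ j $ i = N $ i $ j"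
  shows "sub_charpoly (insert i I) N = [:- N $ i $ i, 1:] * (\<Prod>s\<in>I. [:- d s, 1:])
    - (\<Sum>s\<in>I. smult ((\<Sum>j\<in>I. u s $ j * N $ i $ j)\<^sup>2) (\<Prod>r\<in>I - {s}. [:- d r, 1:]))"
proof (rule poly_eq_poly_eq_iff[THEN iffD1], rule ext)
  fix t
  define z where "z s = (\<Sum>j\<in>I. u s $ j * N $ i $ j)" for s
  define E where "E = sub_char_matrix (insert i I) N t"
  define T where "T = transpose Q ** E ** Q"
  have inner: "(\<Sum>j\<in>UNIV. E $ k $ j * Q $ j $ r)
      = (if r \<in> I then (if k = i then - z r else (t - d r) * u r $ k) else E $ k $ r)" for k r
  proof (cases "r \<in> I")
    case True
    have Esum: "(\<Sum>j\<in>UNIV. E $ k $ j * Q $ j $ r) = (\<Sum>j\<in>I. E $ k $ j * u r $ j)"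
      using True support by (intro sum.mono_neutral_cong_right) (auto simp: Q_def)
    consider "k = i" | "k \<in> I" "k \<noteq> i" | "k \<notin> insert i I" by blast
    then show ?thesis
    proof cases
      case 1
      have "(\<Sum>j\<in>I. E $ k $ j * u r $ j) = (\<Sum>j\<in>I. - (u r $ j * N $ i $ j))"
        using i 1 by (intro sum.cong) (auto simp: E_def sub_char_matrix_def)
      then show ?thesis using True 1 Esum by (simp add: z_def sum_negf)
    next
      case 2
      have "(\<Sum>j\<in>I. E $ k $ j * u r $ j) = (\<Sum>j\<in>I. (if k = j then t * u r $ j else 0) - M $ k $ j * u r $ j)"
        using 2 N(1) by (intro sum.cong) (auto simp: E_def sub_char_matrix_def algebra_simps)
      also have "\<dots> = (t - d r) * u r $ k" using 2 True eigen by (simp add: sum_subtractf algebra_simps)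
      finally show ?thesis using True 2 Esum by simp
    next
      case 3
      then have "(\<Sum>j\<in>I. E $ k $ j * u r $ j) = 0"
        by (intro sum.neutral) (auto simp: E_def sub_char_matrix_def)
      then show ?thesis using 3 True Esum support by simp
    qed
  next
    case False
    have "(\<Sum>j\<in>UNIV. E $ k $ j * Q $ j $ r) = (\<Sum>j\<in>UNIV. if j = r then E $ k $ r else 0)"
      using False by (intro sum.cong) (auto simp: Q_def)
    then show ?thesis using False by simp
  qed
  have outer: "(\<Sum>k\<in>UNIV. Q $ k $ s * x k) = (if s \<in> I then (\<Sum>k\<in>I. u s $ k * x k) else x s)" for s and x :: "'n \<Rightarrow> real"
  proof (cases "s \<in> I")
    case True
    then show ?thesis using support by (auto simp: Q_def intro!: sum.mono_neutral_cong_right)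
  next
    case False
    then have "(\<Sum>k\<in>UNIV. Q $ k $ s * x k) = (\<Sum>k\<in>UNIV. if k = s then x s else 0)"
      by (intro sum.cong) (auto simp: Q_def)
    then show ?thesis using False by simp
  qed
  have T: "T $ s $ r = (if s = i \<and> r = i then t - N $ i $ i else if s = i \<and> r \<in> I then - z r
    else if r = i \<and> s \<in> I then - z s else if s = r then (if s \<in> I then t - d s else 1) else 0)" for s r
  proof (cases "r \<in> I")
    case r: True
    have T1: "T $ s $ r = (if s \<in> I then (\<Sum>k\<in>I. u s $ k * (if k = i then - z r else (t - d r) * u r $ k))
       else (if s = i then - z r else (t - d r) * u r $ s))"
      unfolding T_def conjugate_nth inner outer using r by simp
    have "(\<Sum>k\<in>I. u s $ k * (if k = i then - z r else (t - d r) * u r $ k)) = (t - d r) * (u s \<bullet> u r)" if "s \<in> I"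
      using i inner_eq_sum[OF that, of "u r"] by (auto simp: sum_distrib_left intro!: sum.cong)
    then show ?thesis using r i orthonormal support by (auto simp: T1)
  next
    case r: False
    have T1: "T $ s $ r = (if s \<in> I then (\<Sum>k\<in>I. u s $ k * E $ k $ r) else E $ s $ r)"
      unfolding T_def conjugate_nth inner outer using r by simp
    show ?thesis
    proof (cases "s \<in> I")
      case s: True
      have "(\<Sum>k\<in>I. u s $ k * E $ k $ r) = (if r = i then - z s else 0)"
      proof (cases "r = i")
        case True
        have "(\<Sum>k\<in>I. u s $ k * E $ k $ r) = (\<Sum>k\<in>I. - (u s $ k * N $ i $ k))"
        proof (rule sum.cong[OF refl])
          fix k assume k: "k \<in> I"
          then have "E $ k $ r = - N $ k $ i" using True i by (auto simp: E_def sub_char_matrix_def)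
          also have "\<dots> = - N $ i $ k" by (simp only: N(2)[of k])
          finally show "u s $ k * E $ k $ r = - (u s $ k * N $ i $ k)" by simp
        qed
        then show ?thesis using True by (simp add: z_def sum_negf)
      qed (use r in \<open>auto intro!: sum.neutral simp: E_def sub_char_matrix_def\<close>)
      then show ?thesis using T1 s r i by auto
    next
      case False
      then show ?thesis using T1 r i by (auto simp: E_def sub_char_matrix_def)
    qed
  qed
  have "poly (sub_charpoly (insert i I) N) t = det T"
    unfolding T_def E_def det_orthogonal_conjugate[OF orthogonal_Q] by (rule poly_sub_charpoly)
  also have "\<dots> = (t - N $ i $ i) * (\<Prod>s\<in>I. t - d s) - (\<Sum>s\<in>I. (z s)\<^sup>2 * (\<Prod>r\<in>I - {s}. t - d r))"
    by (rule det_arrowhead[OF i T])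
  finally show "poly (sub_charpoly (insert i I) N) t = poly ([:- N $ i $ i, 1:] * (\<Prod>s\<in>I. [:- d s, 1:])
    - (\<Sum>s\<in>I. smult ((\<Sum>j\<in>I. u s $ j * N $ i $ j)\<^sup>2) (\<Prod>r\<in>I - {s}. [:- d r, 1:]))) t"
    by (simp add: poly_prod poly_sum z_def algebra_simps)
qed

end

subsection \<open>Gaussian vectors\<close>

text \<open>A well-ordered copy of a finite type: the change of variables theorem of the library
  is stated for well-ordered index types only.\<close>
typedef 'a indexed = "UNIV :: 'a set"
  by simp

instance indexed :: (finite) finite
proof
  have "(UNIV :: 'a indexed set) = Abs_indexed ` UNIV"
    by (metis Abs_indexed_cases UNIV_eq_I rangeI)
  then show "finite (UNIV :: 'a indexed set)" by (metis finite finite_imageI)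
qed

instantiation indexed :: (finite) wellorder
begin

definition less_eq_indexed :: "'a indexed \<Rightarrow> 'a indexed \<Rightarrow> bool" where
  "x \<le> y \<longleftrightarrow> to_nat (Rep_indexed x) \<le> to_nat (Rep_indexed y)"

definition less_indexed :: "'a indexed \<Rightarrow> 'a indexed \<Rightarrow> bool" where
  "x < y \<longleftrightarrow> to_nat (Rep_indexed x) < to_nat (Rep_indexed y)"

instance
proof
  fix x y z :: "'a indexed" and P and a :: "'a indexed"
  show "(x < y) = (x \<le> y \<and> \<not> y \<le> x)" "x \<le> x" "x \<le> y \<Longrightarrow> y \<le> z \<Longrightarrow> x \<le> z" "x \<le> y \<or> y \<le> x"
    by (auto simp: less_eq_indexed_def less_indexed_def)
  show "x \<le> y \<Longrightarrow> y \<le> x \<Longrightarrow> x = y"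
    unfolding less_eq_indexed_def by (metis Rep_indexed_inject antisym from_nat_to_nat)
  assume step: "\<And>x :: 'a indexed. (\<And>y. y < x \<Longrightarrow> P y) \<Longrightarrow> P x"
  show "P a"
    by (induction "to_nat (Rep_indexed a)" arbitrary: a rule: less_induct)
       (rule step, simp add: less_indexed_def)
qed

end

text \<open>By uniqueness of Lebesgue measure it suffices to look at boxes. The preimage of a box is
  its image under the transpose, an orthogonal transformation, and these preserve measure.\<close>

lemma lborel_orthogonal_matrix:
  fixes A :: "real ^ 'n::{finite,wellorder} ^ 'n::_"
  assumes "orthogonal_matrix A"
  shows "distr lborel borel ((*v) A) = lborel"
proof (rule lborel_eqI[symmetric])
  have [measurable]: "(*v) A \<in> borel_measurable borel"
    by (intro borel_measurable_continuous_onI matrix_vector_mult_linear_continuous_on)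
  have orth: "orthogonal_matrix (transpose A)" using assms by (simp add: orthogonal_matrix_transpose)
  have inv: "transpose A *v (A *v x) = x" "A *v (transpose A *v x) = x" for x
    using assms by (simp_all add: matrix_vector_mul_assoc orthogonal_matrix_def del: transpose_matrix_vector)
  fix l u :: "(real, 'n) vec"
  assume le: "\<And>b. b \<in> Basis \<Longrightarrow> l \<bullet> b \<le> u \<bullet> b"
  have eq: "(*v) A -` box l u = (*v) (transpose A) ` box l u"
    using inv by (auto simp: image_iff) metis
  have tr: "orthogonal_transformation ((*v) (transpose A))"
    using orth by (simp add: orthogonal_transformation_matrix)
  have lm: "(*v) (transpose A) ` box l u \<in> lmeasurable"
    by (rule measurable_orthogonal_image[OF tr]) simp
  have "emeasure (distr lborel borel ((*v) A)) (box l u) = emeasure lborel ((*v) (transpose A) ` box l u)"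
    by (subst emeasure_distr) (simp_all add: eq)
  also have "\<dots> = emeasure lebesgue ((*v) (transpose A) ` box l u)"
    using measurable_sets[of "(*v) A" borel borel "box l u"] by (simp add: eq)
  also have "\<dots> = ennreal (measure lebesgue ((*v) (transpose A) ` box l u))"
    by (rule emeasure_eq_measure2[OF lm])
  also have "measure lebesgue ((*v) (transpose A) ` box l u) = measure lebesgue (box l u)"
    by (rule measure_orthogonal_image[OF tr]) simp
  also have "ennreal \<dots> = ennreal (\<Prod>b\<in>Basis. (u - l) \<bullet> b)"
    using le by (simp add: measure_lborel_box_eq inner_diff_left)
  finally show "emeasure (distr lborel borel ((*v) A)) (box l u) = ennreal (\<Prod>b\<in>Basis. (u - l) \<bullet> b)" .
qed simp

lemma borel_measurable_vec_lambdaI: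
  fixes f :: "'a \<Rightarrow> 'n::finite \<Rightarrow> real"
  assumes "\<And>i. (\<lambda>x. f x i) \<in> borel_measurable M"
  shows "(\<lambda>x. \<chi> i. f x i) \<in> borel_measurable M"
  using assms by (subst borel_measurable_euclidean_space) (auto simp: Basis_vec_def inner_axis)

lemma distr_PiM_vec:
  "distr (\<Pi>\<^sub>M k\<in>(UNIV :: 'k::finite set). lborel) borel (\<lambda>y. \<chi> i. y (Rep_indexed i)) = (lborel :: (real ^ 'k indexed) measure)"
proof (rule lborel_eqI[symmetric])
  interpret P: finite_product_sigma_finite "\<lambda>_::'k. lborel :: real measure" UNIV by standard simp
  have [measurable]: "(\<lambda>y. \<chi> i. y (Rep_indexed i)) \<in> (\<Pi>\<^sub>M k\<in>(UNIV :: 'k::finite set). lborel) \<rightarrow>\<^sub>M (borel :: (real ^ 'k indexed) measure)"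
    by (rule borel_measurable_vec_lambdaI) simp
  fix l u :: "real ^ 'k indexed"
  assume le: "\<And>b. b \<in> Basis \<Longrightarrow> l \<bullet> b \<le> u \<bullet> b"
  then have le': "l $ i \<le> u $ i" for i by (metis axis_in_Basis_iff cart_eq_inner_axis Basis_real_def singletonI)
  have bij: "bij_betw Rep_indexed (UNIV :: 'k indexed set) UNIV"
    by (simp add: bij_betw_def inj_on_def Rep_indexed_inject) (metis Rep_indexed_cases UNIV_I rangeI subsetI top.extremum_uniqueI)
  have inv: "Abs_indexed (Rep_indexed i) = i" for i :: "'k indexed" by (rule Rep_indexed_inverse)
  have inv': "Rep_indexed (Abs_indexed k) = k" for k :: 'k by (simp add: Abs_indexed_inverse)
  have eq: "(\<lambda>y. \<chi> i. y (Rep_indexed i)) -` box l u \<inter> space (\<Pi>\<^sub>M k\<in>(UNIV :: 'k set). lborel)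
     = (\<Pi>\<^sub>E k\<in>UNIV. {l $ Abs_indexed k<..<u $ Abs_indexed k})"
    by (auto simp: mem_box_cart space_PiM PiE_def Pi_def) (metis inv inv')+
  have "emeasure (distr (\<Pi>\<^sub>M k\<in>(UNIV :: 'k::finite set). lborel) borel (\<lambda>y. \<chi> i. y (Rep_indexed i))) (box l u)
     = (\<Prod>k\<in>(UNIV::'k set). emeasure lborel {l $ Abs_indexed k<..<u $ Abs_indexed k})"
    by (subst emeasure_distr) (simp_all add: eq P.measure_times)
  also have "\<dots> = (\<Prod>k\<in>(UNIV::'k set). ennreal (u $ Abs_indexed k - l $ Abs_indexed k))"
    using le' by simp
  also have "\<dots> = (\<Prod>i\<in>UNIV. ennreal (u $ i - l $ i))"
    by (subst prod.reindex_bij_betw[OF bij, symmetric]) (simp add: inv)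
  also have "\<dots> = ennreal (\<Prod>i\<in>UNIV. u $ i - l $ i)" using le' by (intro prod_ennreal) simp
  also have "(\<Prod>i\<in>UNIV. u $ i - l $ i) = (\<Prod>b\<in>Basis. (u - l) \<bullet> b)"
    by (simp add: Basis_vec_def UNION_singleton_eq_range prod.reindex inj_on_def axis_eq_axis inner_axis)
  finally show "emeasure (distr (\<Pi>\<^sub>M k\<in>(UNIV :: 'k::finite set). lborel) borel (\<lambda>y. \<chi> i. y (Rep_indexed i))) (box l u)
     = ennreal (\<Prod>b\<in>Basis. (u - l) \<bullet> b)" .
qed simp

abbreviation gauss :: "real measure" where
  "gauss \<equiv> density lborel (\<lambda>x. ennreal (std_normal_density x))"

lemma prob_space_gauss: "prob_space gauss"
  by (rule prob_space_normal_density) simp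

lemma product_prob_space_gauss: "product_prob_space (\<lambda>_. gauss)"
  by (intro product_prob_spaceI prob_space_gauss)

lemma nn_integral_PiM_gauss:
  assumes "finite I" "F \<in> borel_measurable (\<Pi>\<^sub>M i\<in>I. lborel)"
  shows "(\<integral>\<^sup>+ x. F x \<partial>(\<Pi>\<^sub>M i\<in>I. gauss)) = (\<integral>\<^sup>+ y. (\<Prod>i\<in>I. ennreal (std_normal_density (y i))) * F y \<partial>(\<Pi>\<^sub>M i\<in>I. lborel))"
proof -
  interpret G: product_prob_space "\<lambda>_. gauss" by (rule product_prob_space_gauss)
  have "(\<integral>\<^sup>+ x. F x \<partial>(\<Pi>\<^sub>M i\<in>I. gauss)) = (\<integral>\<^sup>+ x. F (\<lambda>i\<in>I. x i) \<partial>(\<Pi>\<^sub>M i\<in>I. gauss))"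
    by (intro nn_integral_cong) (simp add: space_PiM PiE_restrict)
  also have "\<dots> = (\<integral>\<^sup>+ y. (\<Prod>i\<in>I. ennreal (std_normal_density (y i))) * F y \<partial>(\<Pi>\<^sub>M i\<in>I. lborel))"
    by (rule nn_integral_PiM_transform[where \<phi> = "\<lambda>_ x. x"])
       (use assms in \<open>auto simp: nn_integral_density intro: G.product_sigma_finite_axioms\<close>)
  finally show ?thesis .
qed

text \<open>The product density is a function of the Euclidean norm, and Lebesgue measure is
  invariant; everything is transported to vectors over the well-ordered copy of the index type and
  back.\<close>

lemma gauss_orthogonal_matrix:
  fixes A :: "real ^ 'k::finite ^ 'k::_"
  assumes A: "orthogonal_matrix A" and [measurable]: "F \<in> borel_measurable (\<Pi>\<^sub>M k\<in>UNIV. lborel)"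
  shows "(\<integral>\<^sup>+ y. F (\<lambda>k. \<Sum>j\<in>UNIV. A $ k $ j * y j) \<partial>(\<Pi>\<^sub>M k\<in>UNIV. gauss)) = (\<integral>\<^sup>+ y. F y \<partial>(\<Pi>\<^sub>M k\<in>UNIV. gauss))"
proof -
  define L :: "('k \<Rightarrow> real) \<Rightarrow> real ^ 'k indexed" where "L y = (\<chi> i. y (Rep_indexed i))" for y
  define L' :: "real ^ 'k indexed \<Rightarrow> 'k \<Rightarrow> real" where "L' x k = x $ Abs_indexed k" for x k
  have inv: "Abs_indexed (Rep_indexed i) = i" for i :: "'k indexed" by (rule Rep_indexed_inverse)
  have inv': "Rep_indexed (Abs_indexed k) = k" for k :: 'k by (simp add: Abs_indexed_inverse)
  have L'L: "L' (L y) = y" for y by (rule ext) (simp add: L_def L'_def inv')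
  have bij: "bij_betw Rep_indexed (UNIV :: 'k indexed set) UNIV"
    by (rule bij_betwI[where g = Abs_indexed]) (auto simp: inv inv')
  have [measurable]: "L \<in> (\<Pi>\<^sub>M k\<in>(UNIV :: 'k set). lborel) \<rightarrow>\<^sub>M borel"
    unfolding L_def by (rule borel_measurable_vec_lambdaI) simp
  have [measurable]: "L' \<in> borel \<rightarrow>\<^sub>M (\<Pi>\<^sub>M k\<in>(UNIV :: 'k set). lborel)"
    unfolding L'_def[abs_def] by (rule measurable_PiM_single') (auto simp: space_PiM)
  define B :: "real ^ 'k indexed ^ 'k indexed" where "B = (\<chi> i j. A $ Rep_indexed i $ Rep_indexed j)"
  have "orthogonal_matrix B"
  proof -
    have sum: "(\<Sum>i\<in>UNIV. h (Rep_indexed i)) = (\<Sum>k\<in>UNIV. h k)" for h :: "'k \<Rightarrow> real"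
      by (rule sum.reindex_bij_betw[OF bij])
    have "transpose A ** A = mat 1" using A by (simp add: orthogonal_matrix)
    then have "(\<Sum>k\<in>UNIV. A $ k $ a * A $ k $ b) = (if a = b then 1 else 0)" for a b
      by (simp add: vec_eq_iff matrix_matrix_mult_def transpose_def mat_def)
    then show ?thesis
      unfolding orthogonal_matrix
      by (simp add: vec_eq_iff matrix_matrix_mult_def transpose_def mat_def B_def sum[of "\<lambda>k. A $ k $ _ * A $ k $ _"] Rep_indexed_inject)
  qed
  have BL: "B *v L y = L (\<lambda>k. \<Sum>j\<in>UNIV. A $ k $ j * y j)" for y
    by (simp add: vec_eq_iff matrix_vector_mult_def B_def L_def sum.reindex_bij_betw[OF bij, of "\<lambda>j. A $ _ $ j * y j"])
  define c where "c = (\<lambda>x :: real ^ 'k indexed. ennreal ((1 / sqrt (2 * pi)) ^ CARD('k) * exp (- (norm x)\<^sup>2 / 2)))"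
  have [measurable]: "c \<in> borel_measurable borel" unfolding c_def by measurable
  have dens: "(\<Prod>k\<in>UNIV. ennreal (std_normal_density (y k))) = c (L y)" for y :: "'k \<Rightarrow> real"
  proof -
    have "(\<Prod>k\<in>UNIV. std_normal_density (y k)) = (1 / sqrt (2 * pi)) ^ CARD('k) * exp (\<Sum>k\<in>UNIV. - (y k)\<^sup>2 / 2)"
      by (simp add: std_normal_density_def prod.distrib exp_sum power_divide prod_dividef)
    also have "(\<Sum>k\<in>UNIV. - (y k)\<^sup>2 / 2) = - (norm (L y))\<^sup>2 / 2"
      by (simp add: norm_vec_def L2_set_def L_def sum_nonneg sum.reindex_bij_betw[OF bij, of "\<lambda>k. (y k)\<^sup>2"] sum_negf sum_divide_distrib)
    finally show ?thesis by (simp add: c_def prod_ennreal)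
  qed
  have meas: "(\<lambda>y. \<lambda>k. \<Sum>j\<in>UNIV. A $ k $ j * y j) \<in> (\<Pi>\<^sub>M k\<in>(UNIV :: 'k set). lborel) \<rightarrow>\<^sub>M (\<Pi>\<^sub>M k\<in>(UNIV :: 'k set). lborel)"
    by (rule measurable_PiM_single') (auto simp: space_PiM)
  note [measurable] = meas
  have [measurable]: "(*v) B \<in> borel_measurable borel"
    by (intro borel_measurable_continuous_onI matrix_vector_mult_linear_continuous_on)
  have cB: "c (B *v x) = c x" for x
  proof -
    have "norm (B *v x) = norm x"
      using \<open>orthogonal_matrix B\<close> orthogonal_transformation_matrix[of "(*v) B"] by (auto simp: orthogonal_transformation)
    then show ?thesis by (simp add: c_def)
  qed
  have via: "(\<integral>\<^sup>+ y. G (L y) \<partial>(\<Pi>\<^sub>M k\<in>UNIV. lborel)) = (\<integral>\<^sup>+ x. G x \<partial>lborel)"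
    if [measurable]: "G \<in> borel_measurable borel" for G :: "real ^ 'k indexed \<Rightarrow> ennreal"
    unfolding distr_PiM_vec[symmetric, where 'k = 'k] L_def[symmetric, abs_def]
    by (subst nn_integral_distr) auto
  have "(\<integral>\<^sup>+ y. F (\<lambda>k. \<Sum>j\<in>UNIV. A $ k $ j * y j) \<partial>(\<Pi>\<^sub>M k\<in>UNIV. gauss))
      = (\<integral>\<^sup>+ y. c (L y) * F (\<lambda>k. \<Sum>j\<in>UNIV. A $ k $ j * y j) \<partial>(\<Pi>\<^sub>M k\<in>UNIV. lborel))"
    by (subst nn_integral_PiM_gauss) (simp_all add: dens)
  also have "\<dots> = (\<integral>\<^sup>+ y. c (B *v L y) * F (L' (B *v L y)) \<partial>(\<Pi>\<^sub>M k\<in>UNIV. lborel))"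
    unfolding cB unfolding BL L'L ..
  also have "\<dots> = (\<integral>\<^sup>+ x. c (B *v x) * F (L' (B *v x)) \<partial>lborel)"
    by (rule via) measurable
  also have "\<dots> = (\<integral>\<^sup>+ x. c x * F (L' x) \<partial>distr lborel borel ((*v) B))"
    by (subst nn_integral_distr) auto
  also have "\<dots> = (\<integral>\<^sup>+ x. c x * F (L' x) \<partial>lborel)"
    by (simp add: lborel_orthogonal_matrix[OF \<open>orthogonal_matrix B\<close>])
  also have "\<dots> = (\<integral>\<^sup>+ y. c (L y) * F (L' (L y)) \<partial>(\<Pi>\<^sub>M k\<in>UNIV. lborel))"
    by (rule via[symmetric]) measurable
  also have "\<dots> = (\<integral>\<^sup>+ y. F y \<partial>(\<Pi>\<^sub>M k\<in>UNIV. gauss))"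
    unfolding L'L by (subst nn_integral_PiM_gauss) (simp_all add: dens)
  finally show ?thesis .
qed

text \<open>An orthogonal completion of the family, normalised; a count of dimensions lets the
  remaining basis vectors fill the rows outside \<open>S\<close>.\<close>

lemma orthonormal_family_extension:
  fixes v :: "'k::finite \<Rightarrow> real ^ 'k"
  assumes v: "\<And>s r. s \<in> S \<Longrightarrow> r \<in> S \<Longrightarrow> v s \<bullet> v r = (if s = r then 1 else 0)"
  obtains A :: "real ^ 'k ^ 'k" where "orthogonal_matrix A" "\<And>s. s \<in> S \<Longrightarrow> A $ s = v s"
proof -
  have "pairwise orthogonal (v ` S)"
    using v by (auto simp: pairwise_def orthogonal_def)
  then obtain U where U: "pairwise orthogonal (v ` S \<union> U)" "span (v ` S \<union> U) = span (v ` S \<union> UNIV)"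
    using orthogonal_extension by blast
  define B where "B = (\<lambda>x. x /\<^sub>R norm x) ` (v ` S \<union> U - {0})"
  have nv: "norm (v s) = 1" if "s \<in> S" for s using v[OF that that] by (simp add: norm_eq_1)
  have vB: "v ` S \<subseteq> B"
  proof
    fix x assume x: "x \<in> v ` S"
    then have nx: "norm x = 1" using nv by auto
    then have "x \<noteq> 0" by (metis norm_zero zero_neq_one)
    with x have "x \<in> v ` S \<union> U - {0}" by blast
    then show "x \<in> B" unfolding B_def by (intro image_eqI[of _ _ x]) (simp_all add: nx)
  qed
  have normB: "norm b = 1" if bB: "b \<in> B" for b
  proof -
    obtain x where "b = x /\<^sub>R norm x" "x \<noteq> 0" using bB unfolding B_def by blast
    then show ?thesis by simp
  qed
  have orthB: "pairwise orthogonal B"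
  proof (rule pairwiseI)
    fix a b assume ab: "a \<in> B" "b \<in> B" "a \<noteq> b"
    then obtain x y where xy: "x \<in> v ` S \<union> U" "y \<in> v ` S \<union> U" "a = x /\<^sub>R norm x" "b = y /\<^sub>R norm y"
      by (auto simp: B_def)
    then have "x \<noteq> y" using ab(3) by blast
    then have "orthogonal x y" using U(1) xy(1,2) unfolding pairwise_def by blast
    then show "orthogonal a b" by (simp add: xy orthogonal_def)
  qed
  have "0 \<notin> B" using normB by force
  then have indep: "independent B" using orthB by (intro pairwise_orthogonal_independent)
  have "v ` S \<union> U \<subseteq> span B"
  proof
    fix x assume x: "x \<in> v ` S \<union> U"
    show "x \<in> span B"
    proof (cases "x = 0")
      case False
      then have "x /\<^sub>R norm x \<in> B" using x by (auto simp: B_def)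
      then have "norm x *\<^sub>R (x /\<^sub>R norm x) \<in> span B" by (intro span_scale span_base)
      then show ?thesis using False by simp
    qed (simp add: span_zero)
  qed
  then have "span (v ` S \<union> U) \<subseteq> span B" by (rule span_minimal) simp
  then have spanB: "span B = UNIV" using U(2) by auto
  have finB: "finite B" using indep by (rule independent_imp_finite)
  have cardB: "card B = CARD('k)"
    using indep spanB by (metis DIM_cart DIM_real dim_UNIV dim_eq_card_independent dim_span mult.right_neutral)
  have injv: "inj_on v S"
    by (rule inj_onI) (metis v zero_neq_one)
  have "card (UNIV - S) = card (B - v ` S)"
    using cardB finB vB injv by (simp add: card_Diff_subset card_image)
  then obtain h where h: "bij_betw h (UNIV - S) (B - v ` S)"
    using finB by (metis finite finite_Diff finite_same_card_bij)
  define w where "w k = (if k \<in> S then v k else h k)" for k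
  have "bij_betw w (S \<union> (UNIV - S)) (v ` S \<union> (B - v ` S))"
  proof (rule bij_betw_combine)
    show "bij_betw w S (v ` S)" using injv by (auto simp: bij_betw_def w_def inj_on_def)
    show "bij_betw w (UNIV - S) (B - v ` S)"
      using h by (subst bij_betw_cong[of _ _ h]) (auto simp: w_def)
  qed auto
  then have bijw: "bij_betw w UNIV B" using vB by (simp add: Un_absorb1)
  show ?thesis
  proof
    show "orthogonal_matrix (\<chi> k. w k)"
      unfolding orthogonal_matrix_orthonormal_rows
    proof (intro conjI allI impI)
      fix i j :: 'k
      show "norm (row i (\<chi> k. w k)) = 1"
        using bijw normB by (auto simp: row_def vec_lambda_eta bij_betw_def)
      assume "i \<noteq> j"
      then have "w i \<noteq> w j" using bijw by (auto simp: bij_betw_def inj_on_def)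
      then show "orthogonal (row i (\<chi> k. w k)) (row j (\<chi> k. w k))"
        using bijw orthB by (auto simp: row_def vec_lambda_eta bij_betw_def pairwise_def)
    qed
    show "(\<chi> k. w k) $ s = v s" if "s \<in> S" for s using that by (simp add: w_def)
  qed
qed

text \<open>Read as rows of an orthogonal matrix, orthonormal functionals of independent standard
  Gaussians are some of the coordinates of a rotated vector; marginalising the other coordinates
  leaves independent standard Gaussians.\<close>

lemma gauss_orthonormal_family:
  fixes v :: "'k::finite \<Rightarrow> real ^ 'k"
  assumes v: "\<And>s r. s \<in> S \<Longrightarrow> r \<in> S \<Longrightarrow> v s \<bullet> v r = (if s = r then 1 else 0)"
    and F [measurable]: "F \<in> borel_measurable (\<Pi>\<^sub>M k\<in>S. lborel)"
  shows "(\<integral>\<^sup>+ y. F (\<lambda>s\<in>S. \<Sum>j\<in>UNIV. v s $ j * y j) \<partial>(\<Pi>\<^sub>M k\<in>UNIV. gauss)) = (\<integral>\<^sup>+ y. F y \<partial>(\<Pi>\<^sub>M k\<in>S. gauss))"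
proof -
  interpret G: product_prob_space "\<lambda>_. gauss" by (rule product_prob_space_gauss)
  obtain A :: "real ^ 'k ^ 'k" where A: "orthogonal_matrix A" "\<And>s. s \<in> S \<Longrightarrow> A $ s = v s"
    using orthonormal_family_extension[of S v] v by blast
  have sets [measurable_cong]: "sets (\<Pi>\<^sub>M k\<in>I. gauss) = sets (\<Pi>\<^sub>M k\<in>I. lborel)" for I :: "'k set"
    by (intro sets_PiM_cong) simp_all
  have [measurable]: "(\<lambda>y. restrict y S) \<in> (\<Pi>\<^sub>M k\<in>UNIV. lborel) \<rightarrow>\<^sub>M (\<Pi>\<^sub>M k\<in>S. lborel)"
    by (rule measurable_restrict_subset) simp
  have "(\<integral>\<^sup>+ y. F (\<lambda>s\<in>S. \<Sum>j\<in>UNIV. v s $ j * y j) \<partial>(\<Pi>\<^sub>M k\<in>UNIV. gauss))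
     = (\<integral>\<^sup>+ y. F (restrict (\<lambda>k. \<Sum>j\<in>UNIV. A $ k $ j * y j) S) \<partial>(\<Pi>\<^sub>M k\<in>UNIV. gauss))"
    using A(2) by (intro nn_integral_cong arg_cong[where f = F] restrict_ext) simp
  also have "\<dots> = (\<integral>\<^sup>+ y. F (restrict y S) \<partial>(\<Pi>\<^sub>M k\<in>UNIV. gauss))"
    by (rule gauss_orthogonal_matrix[OF A(1), of "\<lambda>y. F (restrict y S)"]) measurable
  also have "\<dots> = (\<integral>\<^sup>+ y. F y \<partial>distr (\<Pi>\<^sub>M k\<in>UNIV. gauss) (\<Pi>\<^sub>M k\<in>S. gauss) (\<lambda>y. restrict y S))"
    by (subst nn_integral_distr) (auto intro!: measurable_restrict_subset)
  also have "\<dots> = (\<integral>\<^sup>+ y. F y \<partial>(\<Pi>\<^sub>M k\<in>S. gauss))"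
    by (subst G.distr_restrict[of S UNIV]) simp_all
  finally show ?thesis .
qed

section \<open>One-dimensional images of the Gaussian law\<close>

text \<open>This is the law of the constant coefficient of \<open>X - M_ii\<close>, where the
  diagonal entry \<open>M_ii\<close> is \<open>sqrt 2\<close> times a standard Gaussian: a centred
  Gaussian of variance 2.\<close>

lemma nn_integral_gauss_scale:
  fixes g :: "real \<Rightarrow> ennreal"
  assumes [measurable]: "g \<in> borel_measurable borel"
  shows "(\<integral>\<^sup>+ x. g (- (sqrt 2 * x)) \<partial>gauss) = (\<integral>\<^sup>+ a. ennreal (exp (- a\<^sup>2 / 4) / (2 * sqrt pi)) * g a \<partial>lborel)"
proof -
  have "(\<integral>\<^sup>+ a. ennreal (exp (- a\<^sup>2 / 4) / (2 * sqrt pi)) * g a \<partial>lborel)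
    = ennreal \<bar>- sqrt 2\<bar> * (\<integral>\<^sup>+ x. ennreal (exp (- (0 + - sqrt 2 * x)\<^sup>2 / 4) / (2 * sqrt pi)) * g (0 + - sqrt 2 * x) \<partial>lborel)"
    by (rule nn_integral_real_affine) auto
  also have "\<dots> = (\<integral>\<^sup>+ x. ennreal (sqrt 2) * (ennreal (exp (- (0 + - sqrt 2 * x)\<^sup>2 / 4) / (2 * sqrt pi)) * g (0 + - sqrt 2 * x)) \<partial>lborel)"
    by (subst nn_integral_cmult) auto
  also have "\<dots> = (\<integral>\<^sup>+ x. ennreal (std_normal_density x) * g (- (sqrt 2 * x)) \<partial>lborel)"
  proof (rule nn_integral_cong)
    fix x :: real
    have "sqrt 2 * (exp (- (0 + - sqrt 2 * x)\<^sup>2 / 4) / (2 * sqrt pi)) = std_normal_density x"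
      by (simp add: std_normal_density_def power_mult_distrib real_sqrt_mult field_simps)
    then show "ennreal (sqrt 2) * (ennreal (exp (- (0 + - sqrt 2 * x)\<^sup>2 / 4) / (2 * sqrt pi)) * g (0 + - sqrt 2 * x))
      = ennreal (std_normal_density x) * g (- (sqrt 2 * x))"
      by (simp add: mult.assoc[symmetric] flip: ennreal_mult)
  qed
  also have "\<dots> = (\<integral>\<^sup>+ x. g (- (sqrt 2 * x)) \<partial>gauss)"
    by (simp add: nn_integral_density)
  finally show ?thesis ..
qed

text \<open>The chi-square density with one degree of freedom. The branch \<open>sqrt\<close> of the
  inverse sees only positive \<open>t\<close>; by symmetry the half-line integral, doubled, is the
  integral over the whole line.\<close>

lemma nn_integral_gauss_square:
  fixes g :: "real \<Rightarrow> ennreal"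
  assumes [measurable]: "g \<in> borel_measurable borel"
  shows "(\<integral>\<^sup>+ x. g (x\<^sup>2) \<partial>gauss)
    = (\<integral>\<^sup>+ w. ennreal (pos_powr (1/2) w * (exp (- w / 2) / sqrt (2 * pi))) * g w \<partial>lborel)"
proof -
  define G where "G w = ennreal (pos_powr (1/2) w * (exp (- w / 2) / sqrt (2 * pi))) * g w" for w
  have [measurable]: "G \<in> borel_measurable borel" unfolding G_def by measurable
  define \<Phi> where "\<Phi> x = ennreal (std_normal_density x) * g (x\<^sup>2)" for x
  have [measurable]: "\<Phi> \<in> borel_measurable borel" unfolding \<Phi>_def by measurable
  have "(\<integral>\<^sup>+ w. G w \<partial>lborel) = (\<integral>\<^sup>+ w. indicator {0<..} w * G w \<partial>lborel)"
    by (intro nn_integral_cong) (auto simp: G_def pos_powr_def indicator_def)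
  also have "\<dots> = (\<integral>\<^sup>+ t. (if t\<^sup>2 \<in> {0<..} \<and> sqrt (t\<^sup>2) = t then ennreal \<bar>2 * t\<bar> * G (t\<^sup>2) else 0) \<partial>lborel)"
    by (rule nn_integral_change_of_variables_1) (auto intro!: derivative_eq_intros)
  also have "\<dots> = (\<integral>\<^sup>+ t. indicator {0<..} t * \<Phi> t + indicator {0<..} t * \<Phi> t \<partial>lborel)"
  proof (rule nn_integral_cong)
    fix t :: real
    show "(if t\<^sup>2 \<in> {0<..} \<and> sqrt (t\<^sup>2) = t then ennreal \<bar>2 * t\<bar> * G (t\<^sup>2) else 0) = indicator {0<..} t * \<Phi> t + indicator {0<..} t * \<Phi> t"
    proof (cases "t > 0")
      case True
      have "pos_powr (1/2) (t\<^sup>2) = 1 / t"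
        using True by (simp add: pos_powr_def powr_minus powr_half_sqrt inverse_eq_divide)
      then have "\<bar>2 * t\<bar> * (pos_powr (1/2) (t\<^sup>2) * (exp (- t\<^sup>2 / 2) / sqrt (2 * pi))) = std_normal_density t + std_normal_density t"
        using True by (simp add: std_normal_density_def)
      then have "ennreal \<bar>2 * t\<bar> * G (t\<^sup>2) = \<Phi> t + \<Phi> t"
        unfolding G_def \<Phi>_def
        by (simp add: mult.assoc[symmetric] distrib_right[symmetric] flip: ennreal_mult ennreal_plus)
      then show ?thesis using True by simp
    next
      case False
      then have "\<not> (t\<^sup>2 \<in> {0<..} \<and> sqrt (t\<^sup>2) = t)" by auto
      then show ?thesis using False by simp
    qed
  qed
  also have "\<dots> = (\<integral>\<^sup>+ t. indicator {0<..} t * \<Phi> t \<partial>lborel) + (\<integral>\<^sup>+ t. indicator {0<..} t * \<Phi> t \<partial>lborel)"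
    by (rule nn_integral_add) measurable
  also have "(\<integral>\<^sup>+ t. indicator {0<..} t * \<Phi> t \<partial>lborel) + (\<integral>\<^sup>+ t. indicator {0<..} t * \<Phi> t \<partial>lborel)
     = (\<integral>\<^sup>+ t. indicator {..<0} t * \<Phi> t \<partial>lborel) + (\<integral>\<^sup>+ t. indicator {0<..} t * \<Phi> t \<partial>lborel)"
  proof -
    have "(\<integral>\<^sup>+ t. indicator {0<..} t * \<Phi> t \<partial>lborel) = (\<integral>\<^sup>+ t. indicator {..<0} t * \<Phi> t \<partial>lborel)"
      by (subst nn_integral_real_affine[of _ "-1" 0])
         (auto intro!: nn_integral_cong simp: \<Phi>_def std_normal_density_def indicator_def)
    then show ?thesis by (rule arg_cong2[where f = "(+)"]) (rule refl)
  qed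
  also have "(\<integral>\<^sup>+ t. indicator {..<0} t * \<Phi> t \<partial>lborel) + (\<integral>\<^sup>+ t. indicator {0<..} t * \<Phi> t \<partial>lborel)
     = (\<integral>\<^sup>+ t. indicator {..<0} t * \<Phi> t + indicator {0<..} t * \<Phi> t \<partial>lborel)"
    by (rule nn_integral_add[symmetric]) measurable
  also have "\<dots> = (\<integral>\<^sup>+ t. \<Phi> t \<partial>lborel)"
  proof (rule nn_integral_cong_AE)
    show "AE t in lborel. indicator {..<0} t * \<Phi> t + indicator {0<..} t * \<Phi> t = \<Phi> t"
      using AE_lborel_singleton[of 0] by eventually_elim (auto simp: indicator_def)
  qed
  also have "\<dots> = (\<integral>\<^sup>+ x. g (x\<^sup>2) \<partial>gauss)"
    unfolding \<Phi>_def by (simp add: nn_integral_density)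
  finally show ?thesis unfolding G_def ..
qed

subsection \<open>The law of the characteristic polynomial\<close>

text \<open>The sum of the squared roots of a monic polynomial of degree \<open>n\<close>, expressed by its coefficients;
  the factors \<open>X\<close> and \<open>X\<^sup>2\<close> make the formula right for \<open>n \<le> 1\<close> as well.\<close>
definition sum_sq_roots :: "nat \<Rightarrow> real poly \<Rightarrow> real" where
  "sum_sq_roots n p = (coeff (pCons 0 p) n)\<^sup>2 - 2 * coeff (pCons 0 (pCons 0 p)) n"

lemma measurable_sum_sq_roots [measurable]: "sum_sq_roots n \<in> borel_measurable poly_borel"
  unfolding sum_sq_roots_def[abs_def] by measurable

text \<open>Among the coefficients that matter, the weights enter only that of index
  \<open>m - 1\<close>, because each \<open>L s\<close> is monic of degree \<open>m - 1\<close>. For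
  matrices the formula says how \<open>tr M^2\<close> grows under bordering: by \<open>a^2\<close>
  plus twice the squared norm of the border.\<close>

lemma sum_sq_roots_border:
  assumes "finite I" "card I = m"
  shows "sum_sq_roots (Suc m) ([:a, 1:] * (\<Prod>s\<in>I. [:- d s, 1:]) - (\<Sum>s\<in>I. smult (w s) (\<Prod>r\<in>I - {s}. [:- d r, 1:])))
    = sum_sq_roots m (\<Prod>s\<in>I. [:- d s, 1:]) + a\<^sup>2 + 2 * (\<Sum>s\<in>I. w s)"
proof -
  define P where "P = (\<Prod>s\<in>I. [:- d s, 1:])"
  define L where "L s = (\<Prod>r\<in>I - {s}. [:- d r, 1:])" for s
  define p where "p = [:a, 1:] * P - (\<Sum>s\<in>I. smult (w s) (L s))"
  have degP: "degree P = m" "coeff P m = 1"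
  proof -
    show "degree P = m" using degree_linear_factors[OF assms(1)] assms(2) by (simp add: P_def)
    moreover have "lead_coeff P = 1" by (simp add: P_def lead_coeff_prod)
    ultimately show "coeff P m = 1" by simp
  qed
  have Lm: "coeff (L s) m = 0" "coeff (pCons 0 (L s)) m = 1" if s: "s \<in> I" for s
  proof -
    have "m > 0" using s assms by (auto simp: card_gt_0_iff)
    then obtain m' where m': "m = Suc m'" by (cases m) auto
    have deg: "degree (L s) = m'"
      using degree_linear_factors[of "I - {s}" d] assms s m' by (simp add: L_def)
    then show "coeff (L s) m = 0" by (intro coeff_eq_0) (simp add: m')
    have "lead_coeff (L s) = 1" by (simp add: L_def lead_coeff_prod)
    then show "coeff (pCons 0 (L s)) m = 1" using deg m' by simp
  qed
  have 1: "coeff p m = a + coeff (pCons 0 P) m"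
    using Lm degP by (simp add: p_def coeff_sum)
  have "pCons 0 p = smult a (pCons 0 P) + pCons 0 (pCons 0 P) - (\<Sum>s\<in>I. smult (w s) (pCons 0 (L s)))"
    by (simp add: p_def poly_eq_iff coeff_pCons coeff_sum split: nat.splits)
  then have 2: "coeff (pCons 0 p) m = a * coeff (pCons 0 P) m + coeff (pCons 0 (pCons 0 P)) m - (\<Sum>s\<in>I. w s)"
  proof -
    have "coeff (pCons 0 (smult c q)) m = c * coeff (pCons 0 q) m"
      "coeff (pCons 0 (q + q')) m = coeff (pCons 0 q) m + coeff (pCons 0 q') m" for c :: real and q q'
      by (cases m; simp)+
    then show ?thesis
      unfolding \<open>pCons 0 p = _\<close> using Lm by (simp add: coeff_sum)
  qed
  have "sum_sq_roots (Suc m) p = sum_sq_roots m P + a\<^sup>2 + 2 * (\<Sum>s\<in>I. w s)"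
    using 1 2 by (simp add: sum_sq_roots_def power2_eq_square algebra_simps)
  then show ?thesis by (simp add: p_def P_def L_def)
qed

text \<open>Bordering with zero weights multiplies by \<open>X - d i\<close>, so the border formula
  adds one root at a time.\<close>

lemma sum_sq_roots_linear_factors:
  assumes "finite I"
  shows "sum_sq_roots (card I) (\<Prod>s\<in>I. [:- d s, 1:]) = (\<Sum>s\<in>I. (d s)\<^sup>2)"
  using assms
proof (induction I rule: finite_induct)
  case empty
  then show ?case by (simp add: sum_sq_roots_def)
next
  case (insert i I)
  have "sum_sq_roots (Suc (card I)) ([:- d i, 1:] * (\<Prod>s\<in>I. [:- d s, 1:])) = (\<Sum>s\<in>I. (d s)\<^sup>2) + (d i)\<^sup>2"
    using sum_sq_roots_border[OF insert.hyps(1) refl, of "- d i" d "\<lambda>_. 0"] insert.IH by simp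
  then show ?case using insert.hyps by (simp del: mult_pCons_left)
qed

definition sym_matrix :: "('n::finite \<times> 'n \<Rightarrow> real) \<Rightarrow> real ^ 'n ^ 'n" where
  "sym_matrix b = (\<chi> i j. (b (i, j) + b (j, i)) / sqrt 2)"

lemma sub_charpoly_cong:
  assumes "\<And>i j. i \<in> I \<Longrightarrow> j \<in> I \<Longrightarrow> M $ i $ j = N $ i $ j"
  shows "sub_charpoly I M = sub_charpoly I N"
proof -
  have "(\<chi> i j. if i \<in> I \<and> j \<in> I then (if i = j then [:0, 1:] else 0) - [:M $ i $ j:] else if i = j then 1 else 0)
     = (\<chi> i j. if i \<in> I \<and> j \<in> I then (if i = j then [:0, 1:] else 0) - [:N $ i $ j:] else if i = j then 1 else 0)"
    using assms by (auto simp: vec_eq_iff)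
  then show ?thesis by (simp add: sub_charpoly_def)
qed

section \<open>Normalising constants and the conditional law of the border\<close>

text \<open>The total mass of the density \<open>exp (- sum_sq_roots n p / 4)\<close> over the
  polynomials with \<open>n\<close> distinct real roots. The \<open>k\<close>-th factor is the
  reciprocal of the constant produced by bordering a block of size \<open>k\<close>.\<close>

definition goe_norm :: "nat \<Rightarrow> real" where
  "goe_norm n = (\<Prod>k<n. 2 * sqrt 2 ^ k * Gamma (Suc k / 2))"

lemma goe_norm_pos: "goe_norm n > 0"
  unfolding goe_norm_def by (intro prod_pos) (auto intro!: mult_pos_pos Gamma_real_pos)

text \<open>One factor \<open>1 / sqrt (2 * pi)\<close> for each of the \<open>m\<close> chi-square
  densities, and \<open>1 / (2 * sqrt pi)\<close> for the diagonal Gaussian of variance 2.\<close>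

definition border_const :: "nat \<Rightarrow> real" where
  "border_const m = (1 / sqrt (2 * pi)) ^ m / (2 * sqrt pi)"

lemma goe_norm_Suc: "border_const m * (sqrt pi ^ Suc m / Gamma (Suc m / 2)) / goe_norm m = 1 / goe_norm (Suc m)"
proof -
  have G: "Gamma (Suc m / 2) > 0" by (intro Gamma_real_pos) simp
  have "(1 / sqrt (2 * pi)) ^ m * sqrt pi ^ m = (1 / sqrt 2) ^ m"
    by (simp add: power_mult_distrib[symmetric] real_sqrt_mult)
  then have "border_const m * (sqrt pi ^ Suc m / Gamma (Suc m / 2)) = 1 / (2 * sqrt 2 ^ m * Gamma (Suc m / 2))"
    using G by (simp add: border_const_def power_divide field_simps)
  then show ?thesis using goe_norm_pos[of m] by (simp add: goe_norm_def)
qed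

text \<open>Conditionally on the principal submatrix on \<open>I\<close>, whose characteristic polynomial is \<open>P\<close>.\<close>
lemma border_conditional_law:
  fixes d :: "'i \<Rightarrow> real"
  assumes I: "finite I" "inj_on d I" "card I = m" "i \<notin> I" and [measurable]: "f \<in> borel_measurable poly_borel"
    and P: "P = (\<Prod>s\<in>I. [:- d s, 1:])"
  shows "ennreal (exp (- sum_sq_roots m P / 4)) *
     (\<integral>\<^sup>+ y. f ([:- (sqrt 2 * y i), 1:] * P - (\<Sum>s\<in>I. smult ((y s)\<^sup>2) (\<Prod>r\<in>I - {s}. [:- d r, 1:]))) \<partial>(\<Pi>\<^sub>M s\<in>insert i I. gauss))
    = ennreal (border_const m) * (\<integral>\<^sup>+ p. ennreal (residue_weight P p) * (ennreal (exp (- sum_sq_roots (Suc m) p / 4)) * f p) \<partial>coeff_lborel 1 (Suc m))"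
proof -
  interpret G: product_prob_space "\<lambda>_ :: 'i. gauss" UNIV by (rule product_prob_space_gauss)
  interpret L: finite_product_sigma_finite "\<lambda>_::'i. lborel :: real measure" I by standard fact
  interpret gauss: prob_space gauss by (rule prob_space_gauss)
  have [measurable_cong]: "sets (\<Pi>\<^sub>M k\<in>I. gauss) = sets (\<Pi>\<^sub>M k\<in>I. lborel)" for I :: "'i set"
    by (intro sets_PiM_cong) simp_all
  let ?p = "\<lambda>a w. [:a, 1:] * P - (\<Sum>s\<in>I. smult (w s) (\<Prod>r\<in>I - {s}. [:- d r, 1:]))"
  let ?k = "\<lambda>a::real. exp (- a\<^sup>2 / 4) / (2 * sqrt pi)"
  let ?h = "\<lambda>w::real. pos_powr (1/2) w * (exp (- w / 2) / sqrt (2 * pi))"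
  define F where "F w = (\<integral>\<^sup>+ a. ennreal (?k a) * f (?p a w) \<partial>lborel)" for w
  have [measurable]: "F \<in> borel_measurable (\<Pi>\<^sub>M s\<in>I. lborel)" unfolding F_def[abs_def] by measurable
  have "(\<integral>\<^sup>+ y. f ([:- (sqrt 2 * y i), 1:] * P - (\<Sum>s\<in>I. smult ((y s)\<^sup>2) (\<Prod>r\<in>I - {s}. [:- d r, 1:]))) \<partial>(\<Pi>\<^sub>M s\<in>insert i I. gauss))
     = (\<integral>\<^sup>+ y. \<integral>\<^sup>+ x. f (?p (- (sqrt 2 * x)) (\<lambda>s\<in>I. (y s)\<^sup>2)) \<partial>gauss \<partial>(\<Pi>\<^sub>M s\<in>I. gauss))"
  proof (subst G.product_nn_integral_insert)
    show "(\<integral>\<^sup>+ y. \<integral>\<^sup>+ x. f ([:- (sqrt 2 * (y(i := x)) i), 1:] * P - (\<Sum>s\<in>I. smult (((y(i := x)) s)\<^sup>2) (\<Prod>r\<in>I - {s}. [:- d r, 1:]))) \<partial>gauss \<partial>(\<Pi>\<^sub>M s\<in>I. gauss))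
      = (\<integral>\<^sup>+ y. \<integral>\<^sup>+ x. f (?p (- (sqrt 2 * x)) (\<lambda>s\<in>I. (y s)\<^sup>2)) \<partial>gauss \<partial>(\<Pi>\<^sub>M s\<in>I. gauss))"
    proof (intro nn_integral_cong arg_cong[where f = f] arg_cong2[where f = "(-)"] sum.cong refl)
      fix y :: "'i \<Rightarrow> real" and x :: real
      show "[:- (sqrt 2 * (y(i := x)) i), 1:] * P = [:- (sqrt 2 * x), 1:] * P" by simp
      fix s assume "s \<in> I"
      then show "smult (((y(i := x)) s)\<^sup>2) (\<Prod>r\<in>I - {s}. [:- d r, 1:]) = smult ((\<lambda>s\<in>I. (y s)\<^sup>2) s) (\<Prod>r\<in>I - {s}. [:- d r, 1:])"
        using I(4) by auto
    qed
  qed (use I in simp_all)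
  also have "\<dots> = (\<integral>\<^sup>+ y. F (\<lambda>s\<in>I. (y s)\<^sup>2) \<partial>(\<Pi>\<^sub>M s\<in>I. gauss))"
    unfolding F_def by (intro nn_integral_cong nn_integral_gauss_scale) measurable
  also have "\<dots> = (\<integral>\<^sup>+ w. (\<Prod>s\<in>I. ennreal (?h (w s))) * F w \<partial>(\<Pi>\<^sub>M s\<in>I. lborel))"
  proof (rule nn_integral_PiM_transform[where \<phi> = "\<lambda>_ x. x\<^sup>2" and h = "\<lambda>_ w. ennreal (?h w)"])
    show "product_sigma_finite (\<lambda>_ :: 'i. gauss)" by (rule G.product_sigma_finite_axioms)
    show "(\<integral>\<^sup>+ x. g (x\<^sup>2) \<partial>gauss) = (\<integral>\<^sup>+ y. ennreal (?h y) * g y \<partial>lborel)"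
      if "g \<in> borel_measurable borel" for g
      using that by (rule nn_integral_gauss_square)
  qed (use I in simp_all)
  finally have "ennreal (exp (- sum_sq_roots m P / 4)) *
     (\<integral>\<^sup>+ y. f ([:- (sqrt 2 * y i), 1:] * P - (\<Sum>s\<in>I. smult ((y s)\<^sup>2) (\<Prod>r\<in>I - {s}. [:- d r, 1:]))) \<partial>(\<Pi>\<^sub>M s\<in>insert i I. gauss))
    = (\<integral>\<^sup>+ w. ennreal (exp (- sum_sq_roots m P / 4)) * ((\<Prod>s\<in>I. ennreal (?h (w s))) * F w) \<partial>(\<Pi>\<^sub>M s\<in>I. lborel))"
    by (simp add: nn_integral_cmult)
  also have "\<dots> = (\<integral>\<^sup>+ w. \<integral>\<^sup>+ a. ennreal (exp (- sum_sq_roots m P / 4)) * (\<Prod>s\<in>I. ennreal (?h (w s))) * ennreal (?k a) * f (?p a w) \<partial>lborel \<partial>(\<Pi>\<^sub>M s\<in>I. lborel))"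
    unfolding F_def by (intro nn_integral_cong) (simp add: nn_integral_cmult mult.assoc del: mult_pCons_left)
  \<comment> \<open>The exponentials of the block, of the weights and of \<open>a\<close> merge into
    that of the bordered polynomial, by the formula for \<open>sum_sq_roots\<close> under
    bordering.\<close>
  also have "\<dots> = (\<integral>\<^sup>+ w. \<integral>\<^sup>+ a. ennreal (border_const m) * ((\<Prod>s\<in>I. ennreal (pos_powr (1/2) (w s))) *
      (ennreal (exp (- sum_sq_roots (Suc m) (?p a w) / 4)) * f (?p a w))) \<partial>lborel \<partial>(\<Pi>\<^sub>M s\<in>I. lborel))"
  proof (intro nn_integral_cong)
    fix w :: "'i \<Rightarrow> real" and a :: real
    have "(\<Prod>s\<in>I. ?h (w s)) = (\<Prod>s\<in>I. pos_powr (1/2) (w s)) * exp (- (\<Sum>s\<in>I. w s) / 2) * (1 / sqrt (2 * pi)) ^ m"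
      using I by (simp add: prod.distrib prod_dividef exp_sum[symmetric] power_divide sum_divide_distrib sum_negf)
    then have "exp (- sum_sq_roots m P / 4) * (\<Prod>s\<in>I. ?h (w s)) * ?k a
      = border_const m * (\<Prod>s\<in>I. pos_powr (1/2) (w s)) * (exp (- sum_sq_roots m P / 4) * exp (- (\<Sum>s\<in>I. w s) / 2) * exp (- a\<^sup>2 / 4))"
      by (simp add: border_const_def)
    also have "exp (- sum_sq_roots m P / 4) * exp (- (\<Sum>s\<in>I. w s) / 2) * exp (- a\<^sup>2 / 4) = exp (- sum_sq_roots (Suc m) (?p a w) / 4)"
      unfolding P sum_sq_roots_border[OF I(1,3)] by (simp add: exp_add[symmetric] field_simps)
    finally have "ennreal (exp (- sum_sq_roots m P / 4) * (\<Prod>s\<in>I. ?h (w s)) * ?k a)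
       = ennreal (border_const m * (\<Prod>s\<in>I. pos_powr (1/2) (w s)) * exp (- sum_sq_roots (Suc m) (?p a w) / 4))"
      by (rule arg_cong)
    moreover have "border_const m \<ge> 0" by (simp add: border_const_def)
    ultimately have "ennreal (exp (- sum_sq_roots m P / 4)) * (\<Prod>s\<in>I. ennreal (?h (w s))) * ennreal (?k a)
       = ennreal (border_const m) * (\<Prod>s\<in>I. ennreal (pos_powr (1/2) (w s))) * ennreal (exp (- sum_sq_roots (Suc m) (?p a w) / 4))"
    proof -
      assume eq: "ennreal (exp (- sum_sq_roots m P / 4) * (\<Prod>s\<in>I. ?h (w s)) * ?k a)
       = ennreal (border_const m * (\<Prod>s\<in>I. pos_powr (1/2) (w s)) * exp (- sum_sq_roots (Suc m) (?p a w) / 4))"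
        and b: "border_const m \<ge> 0"
      have p1: "(\<Prod>s\<in>I. ennreal (?h (w s))) = ennreal (\<Prod>s\<in>I. ?h (w s))" by (rule prod_ennreal) simp
      have p2: "(\<Prod>s\<in>I. ennreal (pos_powr (1/2) (w s))) = ennreal (\<Prod>s\<in>I. pos_powr (1/2) (w s))" by (rule prod_ennreal) simp
      have n: "0 \<le> exp (- sum_sq_roots m P / 4)" "0 \<le> exp (- sum_sq_roots m P / 4) * (\<Prod>s\<in>I. ?h (w s))"
        "0 \<le> border_const m * (\<Prod>s\<in>I. pos_powr (1/2) (w s))"
        using b by (auto intro!: mult_nonneg_nonneg prod_nonneg)
      show ?thesis
        unfolding p1 p2 ennreal_mult'[OF n(1), symmetric] ennreal_mult'[OF b, symmetric]
          ennreal_mult'[OF n(2), symmetric] ennreal_mult'[OF n(3), symmetric] by (rule eq)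
    qed
    then show "ennreal (exp (- sum_sq_roots m P / 4)) * (\<Prod>s\<in>I. ennreal (?h (w s))) * ennreal (?k a) * f (?p a w)
      = ennreal (border_const m) * ((\<Prod>s\<in>I. ennreal (pos_powr (1/2) (w s))) * (ennreal (exp (- sum_sq_roots (Suc m) (?p a w) / 4)) * f (?p a w)))"
      by (simp only: mult.assoc)
  qed
  also have "\<dots> = ennreal (border_const m) * (\<integral>\<^sup>+ w. \<integral>\<^sup>+ a. (\<Prod>s\<in>I. ennreal (pos_powr (1/2) (w s))) *
      (ennreal (exp (- sum_sq_roots (Suc m) (?p a w) / 4)) * f (?p a w)) \<partial>lborel \<partial>(\<Pi>\<^sub>M s\<in>I. lborel))"
    by (simp add: nn_integral_cmult del: mult_pCons_left)
  also have "\<dots> = ennreal (border_const m) * (\<integral>\<^sup>+ p. ennreal (residue_weight P p) * (ennreal (exp (- sum_sq_roots (Suc m) p / 4)) * f p) \<partial>coeff_lborel 1 (Suc m))"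
    using nn_integral_residue_weight_lagrange[OF I(1,2) P, of "\<lambda>p. ennreal (exp (- sum_sq_roots (Suc m) p / 4)) * f p"] I(3)
    by (simp del: mult_pCons_left)
  finally show ?thesis .
qed

text \<open>With the entries of \<open>x\<close> on \<open>I \<times> I\<close> frozen, the bordered
  polynomial depends on the fresh entries only through \<open>y (i, i)\<close> and the coordinates
  of the border in the eigenbasis. These are orthonormal functionals of the raw Gaussians, so they
  are independent standard Gaussians.\<close>

lemma sub_charpoly_border_law:
  fixes I :: "'n::finite set"
  assumes i: "i \<notin> I" and split: "simple_split (card I) (sub_charpoly I (sym_matrix x))"
    and [measurable]: "f \<in> borel_measurable poly_borel"
    and J: "J = I \<times> I" and K: "K = - J"
  shows "ennreal (exp (- sum_sq_roots (card I) (sub_charpoly I (sym_matrix x)) / 4)) *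
      (\<integral>\<^sup>+ y. f (sub_charpoly (insert i I) (sym_matrix (merge J K (x, y)))) \<partial>(\<Pi>\<^sub>M k\<in>K. gauss))
    = ennreal (border_const (card I)) * (\<integral>\<^sup>+ p. ennreal (residue_weight (sub_charpoly I (sym_matrix x)) p) *
        (ennreal (exp (- sum_sq_roots (Suc (card I)) p / 4)) * f p) \<partial>coeff_lborel 1 (Suc (card I)))"
proof -
  interpret G: product_prob_space "\<lambda>_ :: 'n \<times> 'n. gauss" UNIV by (rule product_prob_space_gauss)
  have [measurable_cong]: "sets (\<Pi>\<^sub>M k\<in>I. gauss) = sets (\<Pi>\<^sub>M k\<in>I. lborel)" for I :: "('n \<times> 'n) set"
    by (intro sets_PiM_cong) simp_all
  define M where "M = sym_matrix x"
  define P where "P = sub_charpoly I M"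
  have sym: "sym_matrix b $ j $ k = sym_matrix b $ k $ j" for b :: "'n \<times> 'n \<Rightarrow> real" and j k
    by (simp add: sym_matrix_def add.commute)
  have symM: "M $ j $ k = M $ k $ j" for j k unfolding M_def by (rule sym)
  obtain u d where du: "\<And>s r. s \<in> I \<Longrightarrow> r \<in> I \<Longrightarrow> u s \<bullet> u r = (if s = r then 1 else 0)"
    "\<And>s k. s \<in> I \<Longrightarrow> k \<notin> I \<Longrightarrow> u s $ k = 0"
    "\<And>s k. s \<in> I \<Longrightarrow> k \<in> I \<Longrightarrow> (\<Sum>j\<in>I. M $ k $ j * u s $ j) = d s * u s $ k"
    by (rule sub_spectral_decomposition[of I M, OF symM]) (rule that; assumption)
  interpret E: sub_eigenbasis I M d u by unfold_locales (use du in blast)+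
  have P: "P = (\<Prod>s\<in>I. [:- d s, 1:])" unfolding P_def by (rule E.sub_charpoly_eq)
  have injd: "inj_on d I"
  proof -
    have "{x. poly P x = 0} = d ` I" unfolding P by (rule roots_linear_factors) simp
    moreover have "card {x. poly P x = 0} = card I"
      using simple_splitD(2)[OF split] by (simp add: P_def M_def)
    ultimately show ?thesis by (intro eq_card_imp_inj_on) auto
  qed
  \<comment> \<open>The functional of index \<open>(i, s)\<close> puts the coordinates of
    \<open>u s / sqrt 2\<close> on both copies \<open>(i, j)\<close> and \<open>(j, i)\<close> of
    the off-diagonal entries, so it has norm 1 and yields the coordinate along \<open>u s\<close> of
    the border of the symmetrised matrix. Index \<open>(i, i)\<close> is the raw diagonal
    entry.\<close>
  define v :: "'n \<times> 'n \<Rightarrow> real ^ ('n \<times> 'n)" where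
    "v = (\<lambda>(_, s). if s = i then axis (i, i) 1 else
       (\<chi> k. if fst k = i \<and> snd k \<in> I then u s $ snd k / sqrt 2
         else if snd k = i \<and> fst k \<in> I then u s $ fst k / sqrt 2 else 0))"
  define S where "S = {i} \<times> insert i I"
  define S0 where "S0 = {i} \<times> I"
  have vK: "v k $ j = 0" if kj: "k \<in> S" "j \<in> J" for k j
  proof -
    obtain s a b where "k = (i, s)" "j = (a, b)" "a \<in> I" "b \<in> I" using kj by (auto simp: S_def J)
    moreover from this have "a \<noteq> i" "b \<noteq> i" using i by auto
    ultimately show ?thesis by (simp add: v_def axis_def)
  qed
  have sum_v: "(\<Sum>k\<in>UNIV. v (i, s) $ k * y k) = (\<Sum>j\<in>I. u s $ j * ((y (i, j) + y (j, i)) / sqrt 2))"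
    if s: "s \<in> I" for s and y :: "'n \<times> 'n \<Rightarrow> real"
  proof -
    have si: "s \<noteq> i" using s i by auto
    have "(\<Sum>k\<in>UNIV. v (i, s) $ k * y k) = (\<Sum>k\<in>Pair i ` I \<union> (\<lambda>j. (j, i)) ` I. v (i, s) $ k * y k)"
      using si by (intro sum.mono_neutral_right) (auto simp: v_def image_iff)
    also have "\<dots> = (\<Sum>k\<in>Pair i ` I. v (i, s) $ k * y k) + (\<Sum>k\<in>(\<lambda>j. (j, i)) ` I. v (i, s) $ k * y k)"
      using i by (intro sum.union_disjoint) auto
    also have "\<dots> = (\<Sum>j\<in>I. u s $ j / sqrt 2 * y (i, j)) + (\<Sum>j\<in>I. u s $ j / sqrt 2 * y (j, i))"
      using si i by (subst (1 2) sum.reindex) (auto simp: inj_on_def v_def intro!: arg_cong2[where f = "(+)"] sum.cong)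
    also have "\<dots> = (\<Sum>j\<in>I. u s $ j * ((y (i, j) + y (j, i)) / sqrt 2))"
      by (simp add: sum.distrib[symmetric] add_divide_distrib algebra_simps)
    finally show ?thesis .
  qed
  have orth: "v k \<bullet> v l = (if k = l then 1 else 0)" if "k \<in> S" "l \<in> S" for k l
  proof -
    obtain s r where kl: "k = (i, s)" "l = (i, r)" "s \<in> insert i I" "r \<in> insert i I" using \<open>k \<in> S\<close> \<open>l \<in> S\<close> by (auto simp: S_def)
    have inner: "v (i, s) \<bullet> v (i, r) = (if s = r then 1 else 0)" if s: "s \<in> I" and r: "r \<in> insert i I" for s r
    proof -
      have "v (i, s) \<bullet> v (i, r) = (\<Sum>k\<in>UNIV. v (i, s) $ k * v (i, r) $ k)" by (simp add: inner_vec_def)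
      also have "\<dots> = (\<Sum>j\<in>I. u s $ j * ((v (i, r) $ (i, j) + v (i, r) $ (j, i)) / sqrt 2))" by (rule sum_v[OF s])
      also have "\<dots> = (if r = i then 0 else u s \<bullet> u r)"
      proof (cases "r = i")
        case True
        then show ?thesis using i by (auto simp: v_def axis_def intro!: sum.neutral)
      next
        case False
        then show ?thesis using i E.inner_eq_sum[OF s, of "u r"]
          by (auto simp: v_def intro!: sum.cong)
      qed
      finally show ?thesis using du(1)[OF s, of r] r s i by auto
    qed
    show ?thesis
    proof (cases "s = i")
      case s: True
      show ?thesis
      proof (cases "r = i")
        case True
        then show ?thesis using s by (simp add: kl v_def inner_axis_axis)
      next
        case False
        then show ?thesis using s inner[of r i] kl by (simp add: inner_commute)
      qed
    next
      case False
      then show ?thesis using inner[of s r] kl by simp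
    qed
  qed
  define F where "F y = f ([:- (sqrt 2 * y (i, i)), 1:] * P - (\<Sum>s\<in>S0. smult ((y s)\<^sup>2) (\<Prod>r\<in>S0 - {s}. [:- d (snd r), 1:])))"
    for y :: "'n \<times> 'n \<Rightarrow> real"
  have S: "S = insert (i, i) S0" "(i, i) \<notin> S0" "finite S0" using i by (auto simp: S_def S0_def)
  have "F \<in> borel_measurable (\<Pi>\<^sub>M k\<in>S. lborel)"
    unfolding F_def[abs_def] S(1) by measurable
  note [measurable] = this
  have bij: "bij_betw (Pair i) I S0" by (auto simp: bij_betw_def inj_on_def S0_def)
  have P': "P = (\<Prod>s\<in>S0. [:- d (snd s), 1:])"
    unfolding P by (subst prod.reindex_bij_betw[OF bij, symmetric]) simp
  have key: "f (sub_charpoly (insert i I) (sym_matrix (merge J K (x, restrict y K)))) = F (\<lambda>s\<in>S. \<Sum>k\<in>UNIV. v s $ k * y k)"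
    for y
  proof -
    define b where "b = merge J K (x, restrict y K)"
    have bK: "b k = y k" if "k \<in> K" for k using that K by (auto simp: b_def merge_def)
    have bJ: "b k = x k" if "k \<in> J" for k using that by (auto simp: b_def merge_def)
    have "sub_charpoly (insert i I) (sym_matrix b) = [:- sym_matrix b $ i $ i, 1:] * (\<Prod>s\<in>I. [:- d s, 1:])
       - (\<Sum>s\<in>I. smult ((\<Sum>j\<in>I. u s $ j * sym_matrix b $ i $ j)\<^sup>2) (\<Prod>r\<in>I - {s}. [:- d r, 1:]))"
    proof (rule E.sub_charpoly_insert[OF i])
      show "sym_matrix b $ j $ k = M $ j $ k" if "j \<in> I" "k \<in> I" for j k
        using that bJ by (simp add: M_def sym_matrix_def J)
    qed (rule sym)
    also have "sym_matrix b $ i $ i = sqrt 2 * y (i, i)"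
    proof -
      have "b (i, i) = y (i, i)" using i bK[of "(i, i)"] by (simp add: K J)
      then have "sym_matrix b $ i $ i = 2 * y (i, i) / sqrt 2" by (simp add: sym_matrix_def)
      also have "\<dots> = sqrt 2 * y (i, i)"
        by (metis mult.commute real_div_sqrt times_divide_eq_right zero_le_numeral)
      finally show ?thesis .
    qed
    also have "(\<Sum>s\<in>I. smult ((\<Sum>j\<in>I. u s $ j * sym_matrix b $ i $ j)\<^sup>2) (\<Prod>r\<in>I - {s}. [:- d r, 1:]))
      = (\<Sum>s\<in>I. smult ((\<Sum>k\<in>UNIV. v (i, s) $ k * y k)\<^sup>2) (\<Prod>r\<in>S0 - {(i, s)}. [:- d (snd r), 1:]))"
    proof (rule sum.cong[OF refl])
      fix s assume s: "s \<in> I"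
      have "(\<Sum>j\<in>I. u s $ j * sym_matrix b $ i $ j) = (\<Sum>k\<in>UNIV. v (i, s) $ k * y k)"
        unfolding sum_v[OF s] using i bK by (intro sum.cong) (auto simp: sym_matrix_def K J)
      moreover have "(\<Prod>r\<in>I - {s}. [:- d r, 1:]) = (\<Prod>r\<in>S0 - {(i, s)}. [:- d (snd r), 1:])"
      proof -
        have "bij_betw (Pair i) (I - {s}) (S0 - {(i, s)})" by (auto simp: bij_betw_def inj_on_def S0_def)
        from prod.reindex_bij_betw[OF this, of "\<lambda>r. [:- d (snd r), 1:]"] show ?thesis by simp
      qed
      ultimately show "smult ((\<Sum>j\<in>I. u s $ j * sym_matrix b $ i $ j)\<^sup>2) (\<Prod>r\<in>I - {s}. [:- d r, 1:])
         = smult ((\<Sum>k\<in>UNIV. v (i, s) $ k * y k)\<^sup>2) (\<Prod>r\<in>S0 - {(i, s)}. [:- d (snd r), 1:])" by simp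
    qed
    also have "\<dots> = (\<Sum>s\<in>S0. smult (((\<lambda>s\<in>S. \<Sum>k\<in>UNIV. v s $ k * y k) s)\<^sup>2) (\<Prod>r\<in>S0 - {s}. [:- d (snd r), 1:]))"
      by (subst sum.reindex_bij_betw[OF bij, symmetric]) (auto simp: S_def intro!: sum.cong)
    also have "y (i, i) = (\<lambda>s\<in>S. \<Sum>k\<in>UNIV. v s $ k * y k) (i, i)"
    proof -
      have "(\<Sum>k\<in>UNIV. v (i, i) $ k * y k) = (\<Sum>k\<in>UNIV. if k = (i, i) then y (i, i) else 0)"
        by (intro sum.cong) (auto simp: v_def axis_def)
      then show ?thesis by (simp add: S_def)
    qed
    finally show ?thesis unfolding F_def b_def P by simp
  qed
  have [measurable]: "(\<lambda>y. restrict y K) \<in> (\<Pi>\<^sub>M k\<in>UNIV. lborel) \<rightarrow>\<^sub>M (\<Pi>\<^sub>M k\<in>K. lborel)"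
    by (rule measurable_restrict_subset) simp
  have mK: "(\<lambda>y. f (sub_charpoly (insert i I) (sym_matrix (merge J K (x, y))))) \<in> borel_measurable (\<Pi>\<^sub>M k\<in>K. lborel)"
  proof (rule measurable_compose[OF measurable_sub_charpoly])
    have *: "(\<lambda>y. merge J K (x, y) k) \<in> borel_measurable (\<Pi>\<^sub>M k\<in>K. lborel)" for k
      by (cases "k \<in> K"; cases "k \<in> J") (auto simp: merge_def K)
    show "(\<lambda>y. sym_matrix (merge J K (x, y)) $ j $ k) \<in> borel_measurable (\<Pi>\<^sub>M k\<in>K. lborel)" for j k
      unfolding sym_matrix_def by (simp, intro borel_measurable_divide borel_measurable_add * borel_measurable_const)
  qed simp
  \<comment> \<open>The integral over \<open>K\<close> is a marginal of the one over all entries,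
    where the orthonormal functionals live.\<close>
  have "(\<integral>\<^sup>+ y. f (sub_charpoly (insert i I) (sym_matrix (merge J K (x, y)))) \<partial>(\<Pi>\<^sub>M k\<in>K. gauss))
     = (\<integral>\<^sup>+ y. f (sub_charpoly (insert i I) (sym_matrix (merge J K (x, restrict y K)))) \<partial>(\<Pi>\<^sub>M k\<in>UNIV. gauss))"
  proof -
    have "(\<integral>\<^sup>+ y. f (sub_charpoly (insert i I) (sym_matrix (merge J K (x, y)))) \<partial>(\<Pi>\<^sub>M k\<in>K. gauss))
      = (\<integral>\<^sup>+ y. f (sub_charpoly (insert i I) (sym_matrix (merge J K (x, y)))) \<partial>distr (\<Pi>\<^sub>M k\<in>UNIV. gauss) (\<Pi>\<^sub>M k\<in>K. gauss) (\<lambda>y. restrict y K))"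
      by (subst G.distr_restrict[of K UNIV]) simp_all
    also have "\<dots> = (\<integral>\<^sup>+ y. f (sub_charpoly (insert i I) (sym_matrix (merge J K (x, restrict y K)))) \<partial>(\<Pi>\<^sub>M k\<in>UNIV. gauss))"
      using mK by (subst nn_integral_distr) (auto intro!: measurable_restrict_subset)
    finally show ?thesis .
  qed
  also have "\<dots> = (\<integral>\<^sup>+ y. F y \<partial>(\<Pi>\<^sub>M k\<in>S. gauss))"
    unfolding key by (rule gauss_orthonormal_family) (use orth in auto)
  finally have 1: "(\<integral>\<^sup>+ y. f (sub_charpoly (insert i I) (sym_matrix (merge J K (x, y)))) \<partial>(\<Pi>\<^sub>M k\<in>K. gauss))
     = (\<integral>\<^sup>+ y. F y \<partial>(\<Pi>\<^sub>M k\<in>insert (i, i) S0. gauss))" unfolding S(1) .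
  have cS: "card S0 = card I" by (simp add: S0_def)
  have injS: "inj_on (\<lambda>s. d (snd s)) S0" using injd by (auto simp: inj_on_def S0_def)
  show ?thesis
    unfolding 1 F_def M_def[symmetric] P_def[symmetric]
    by (rule border_conditional_law[OF S(3) injS cS S(2) _ P']) simp
qed

text \<open>The raw entries are split into the block \<open>I \<times> I\<close> and the rest; the
  rest is integrated by the conditional law, and the block follows the induction hypothesis. Stating
  the law for principal submatrices of one fixed random matrix lets the size vary while the type
  stays fixed.\<close>

theorem sub_charpoly_law:
  fixes I :: "'n::finite set"
  assumes "f \<in> borel_measurable poly_borel"
  shows "(\<integral>\<^sup>+ b. f (sub_charpoly I (sym_matrix b)) \<partial>(\<Pi>\<^sub>M k\<in>UNIV. gauss))
    = ennreal (1 / goe_norm (card I)) *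
      (\<integral>\<^sup>+ p. indicator {p. simple_split (card I) p} p * (ennreal (exp (- sum_sq_roots (card I) p / 4)) * f p) \<partial>coeff_lborel 1 (card I))"
  using finite[of I] assms
proof (induction I arbitrary: f rule: finite_induct)
  case empty
  interpret prob_space "\<Pi>\<^sub>M k\<in>(UNIV::('n\<times>'n) set). gauss" by (rule prob_space_PiM) (rule prob_space_gauss)
  have "simple_split 0 [:1:]"
    unfolding simple_split_def by (intro exI[of _ "{}"]) (auto simp: one_pCons)
  with empty show ?case
    by (simp add: goe_norm_def sum_sq_roots_def emeasure_space_1 one_pCons)
next
  case (insert i I)
  interpret G: product_prob_space "\<lambda>_ :: 'n \<times> 'n. gauss" UNIV by (rule product_prob_space_gauss)
  note [measurable] = insert.prems
  let ?m = "card I"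
  define J K where "J = I \<times> I" and "K = - J"
  interpret GJ: prob_space "\<Pi>\<^sub>M k\<in>J. gauss" by (rule prob_space_PiM) (rule prob_space_gauss)
  interpret cm: sigma_finite_measure "coeff_lborel 1 (Suc ?m)" by (rule sigma_finite_coeff_lborel)
  have sets [measurable_cong]: "sets (\<Pi>\<^sub>M k\<in>I. gauss) = sets (\<Pi>\<^sub>M k\<in>I. lborel)" for I :: "('n \<times> 'n) set"
    by (intro sets_PiM_cong) simp_all
  have meas: "(\<lambda>b. sub_charpoly I' (sym_matrix b)) \<in> (\<Pi>\<^sub>M k\<in>J'. lborel) \<rightarrow>\<^sub>M poly_borel" if "I' \<times> I' \<subseteq> J'" for I' :: "'n set" and J'
  proof (rule measurable_sub_charpoly)
    fix a b assume "a \<in> I'" "b \<in> I'"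
    then have "(a, b) \<in> J'" "(b, a) \<in> J'" using that by auto
    then show "(\<lambda>x. sym_matrix x $ a $ b) \<in> borel_measurable (\<Pi>\<^sub>M k\<in>J'. lborel)"
      unfolding sym_matrix_def by simp
  qed
  have mJ [measurable]: "(\<lambda>b. sub_charpoly I (sym_matrix b)) \<in> (\<Pi>\<^sub>M k\<in>J. lborel) \<rightarrow>\<^sub>M poly_borel"
    by (rule meas) (simp add: J_def)
  have mU [measurable]: "(\<lambda>b. sub_charpoly I' (sym_matrix b)) \<in> (\<Pi>\<^sub>M k\<in>UNIV. lborel) \<rightarrow>\<^sub>M poly_borel" for I' :: "'n set"
    by (rule meas) simp
  have marg: "(\<integral>\<^sup>+ b. h (sub_charpoly I (sym_matrix b)) \<partial>(\<Pi>\<^sub>M k\<in>J. gauss)) = ennreal (1 / goe_norm ?m) *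
      (\<integral>\<^sup>+ p. indicator {p. simple_split ?m p} p * (ennreal (exp (- sum_sq_roots ?m p / 4)) * h p) \<partial>coeff_lborel 1 ?m)"
    if [measurable]: "h \<in> borel_measurable poly_borel" for h
  proof -
    have "(\<integral>\<^sup>+ b. h (sub_charpoly I (sym_matrix b)) \<partial>(\<Pi>\<^sub>M k\<in>J. gauss))
       = (\<integral>\<^sup>+ b. h (sub_charpoly I (sym_matrix b)) \<partial>distr (\<Pi>\<^sub>M k\<in>UNIV. gauss) (\<Pi>\<^sub>M k\<in>J. gauss) (\<lambda>y. restrict y J))"
      by (subst G.distr_restrict[of J UNIV]) simp_all
    also have "\<dots> = (\<integral>\<^sup>+ b. h (sub_charpoly I (sym_matrix (restrict b J))) \<partial>(\<Pi>\<^sub>M k\<in>UNIV. gauss))"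
      by (subst nn_integral_distr) (auto intro!: measurable_restrict_subset)
    also have "\<dots> = (\<integral>\<^sup>+ b. h (sub_charpoly I (sym_matrix b)) \<partial>(\<Pi>\<^sub>M k\<in>UNIV. gauss))"
      by (intro nn_integral_cong arg_cong[where f = h] sub_charpoly_cong) (simp add: sym_matrix_def J_def)
    finally show ?thesis using insert.IH[OF that] by simp
  qed
  \<comment> \<open>Testing the induction hypothesis on the indicator of the non-split polynomials
    shows that these have probability zero.\<close>
  have AE_split: "AE b in (\<Pi>\<^sub>M k\<in>J. gauss). simple_split ?m (sub_charpoly I (sym_matrix b))"
  proof -
    have "(\<integral>\<^sup>+ b. indicator {p. \<not> simple_split ?m p} (sub_charpoly I (sym_matrix b)) \<partial>(\<Pi>\<^sub>M k\<in>J. gauss)) = 0"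
    proof -
      have z: "indicator {p. simple_split ?m p} p * (c * indicator {p. \<not> simple_split ?m p} p) = (0::ennreal)" for p c
        by (simp add: indicator_def)
      show ?thesis by (subst marg, measurable) (simp only: z, simp)
    qed
    then have "AE b in (\<Pi>\<^sub>M k\<in>J. gauss). indicator {p. \<not> simple_split ?m p} (sub_charpoly I (sym_matrix b)) = (0::ennreal)"
      by (subst (asm) nn_integral_0_iff_AE) (auto simp: indicator_def)
    then show ?thesis by eventually_elim (auto simp: indicator_def split: if_splits)
  qed
  let ?e = "\<lambda>n p. ennreal (exp (- sum_sq_roots n p / 4))"
  define R where "R P = (\<integral>\<^sup>+ p. ennreal (if simple_split ?m P then residue_weight P p else 0) * (?e (Suc ?m) p * f p) \<partial>coeff_lborel 1 (Suc ?m))" for P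
  have [measurable]: "R \<in> borel_measurable poly_borel" unfolding R_def[abs_def] by measurable
  \<comment> \<open>The positive exponential undoes the density
    \<open>exp (- sum_sq_roots ?m P / 4)\<close> that the induction hypothesis supplies for the
    block; the conditional law already puts the whole exponent on \<open>p\<close>.\<close>
  define h where "h P = ennreal (exp (sum_sq_roots ?m P / 4)) * (ennreal (border_const ?m) * R P)" for P
  have [measurable]: "h \<in> borel_measurable poly_borel" unfolding h_def[abs_def] by measurable
  have einv: "?e ?m P * (ennreal (exp (sum_sq_roots ?m P / 4)) * z) = z" "ennreal (exp (sum_sq_roots ?m P / 4)) * (?e ?m P * z) = z" for P z
    by (simp_all add: mult.assoc[symmetric] exp_add[symmetric] flip: ennreal_mult)
  have "(\<integral>\<^sup>+ b. f (sub_charpoly (insert i I) (sym_matrix b)) \<partial>(\<Pi>\<^sub>M k\<in>UNIV. gauss))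
      = (\<integral>\<^sup>+ x. \<integral>\<^sup>+ y. f (sub_charpoly (insert i I) (sym_matrix (merge J K (x, y)))) \<partial>(\<Pi>\<^sub>M k\<in>K. gauss) \<partial>(\<Pi>\<^sub>M k\<in>J. gauss))"
  proof -
    have JK: "J \<inter> K = {}" "J \<union> K = UNIV" by (auto simp: K_def)
    have m: "(\<lambda>b. f (sub_charpoly (insert i I) (sym_matrix b))) \<in> borel_measurable (\<Pi>\<^sub>M k\<in>J \<union> K. gauss)"
      unfolding JK by measurable
    show ?thesis using G.product_nn_integral_fold[OF JK(1) _ _ m] by (simp add: JK(2))
  qed
  also have "\<dots> = (\<integral>\<^sup>+ x. h (sub_charpoly I (sym_matrix x)) \<partial>(\<Pi>\<^sub>M k\<in>J. gauss))"
  proof (rule nn_integral_cong_AE)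
    show "AE x in (\<Pi>\<^sub>M k\<in>J. gauss). (\<integral>\<^sup>+ y. f (sub_charpoly (insert i I) (sym_matrix (merge J K (x, y)))) \<partial>(\<Pi>\<^sub>M k\<in>K. gauss))
       = h (sub_charpoly I (sym_matrix x))"
      using AE_split
    proof eventually_elim
      case (elim x)
      let ?P = "sub_charpoly I (sym_matrix x)"
      have "(\<integral>\<^sup>+ y. f (sub_charpoly (insert i I) (sym_matrix (merge J K (x, y)))) \<partial>(\<Pi>\<^sub>M k\<in>K. gauss))
        = ennreal (exp (sum_sq_roots ?m ?P / 4)) * (?e ?m ?P * (\<integral>\<^sup>+ y. f (sub_charpoly (insert i I) (sym_matrix (merge J K (x, y)))) \<partial>(\<Pi>\<^sub>M k\<in>K. gauss)))"
        unfolding einv ..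
      also have "\<dots> = h ?P"
        unfolding sub_charpoly_border_law[OF insert.hyps(2) elim insert.prems J_def K_def] h_def R_def using elim by simp
      finally show ?case .
    qed
  qed
  also have "\<dots> = ennreal (1 / goe_norm ?m) *
      (\<integral>\<^sup>+ p. indicator {p. simple_split ?m p} p * (?e ?m p * h p) \<partial>coeff_lborel 1 ?m)"
    by (rule marg) measurable
  also have "(\<integral>\<^sup>+ p. indicator {p. simple_split ?m p} p * (?e ?m p * h p) \<partial>coeff_lborel 1 ?m)
     = (\<integral>\<^sup>+ P. ennreal (border_const ?m) * (indicator {P. simple_split ?m P} P * R P) \<partial>coeff_lborel 1 ?m)"
    unfolding h_def einv by (simp add: mult.left_commute)
  also have "\<dots> = ennreal (border_const ?m) * (\<integral>\<^sup>+ P. indicator {P. simple_split ?m P} P * R P \<partial>coeff_lborel 1 ?m)"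
    unfolding indicator_def by (rule nn_integral_cmult) measurable
  also have "(\<integral>\<^sup>+ P. indicator {P. simple_split ?m P} P * R P \<partial>coeff_lborel 1 ?m)
     = (\<integral>\<^sup>+ P. indicator {P. simple_split ?m P} P * (\<integral>\<^sup>+ p. ennreal (residue_weight P p) * (?e (Suc ?m) p * f p) \<partial>coeff_lborel 1 (Suc ?m)) \<partial>coeff_lborel 1 ?m)"
    by (intro nn_integral_cong) (auto simp: R_def indicator_def)
  also have "\<dots> = ennreal (sqrt pi ^ Suc ?m / Gamma (Suc ?m / 2)) *
     (\<integral>\<^sup>+ p. indicator {p. simple_split (Suc ?m) p} p * (?e (Suc ?m) p * f p) \<partial>coeff_lborel 1 (Suc ?m))"
    by (rule nn_integral_bordering) measurable
  also have "ennreal (1 / goe_norm ?m) * (ennreal (border_const ?m) * (ennreal (sqrt pi ^ Suc ?m / Gamma (Suc ?m / 2)) *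
     (\<integral>\<^sup>+ p. indicator {p. simple_split (Suc ?m) p} p * (?e (Suc ?m) p * f p) \<partial>coeff_lborel 1 (Suc ?m))))
    = ennreal (1 / goe_norm (Suc ?m)) * (\<integral>\<^sup>+ p. indicator {p. simple_split (Suc ?m) p} p * (?e (Suc ?m) p * f p) \<partial>coeff_lborel 1 (Suc ?m))"
  proof -
    have "0 \<le> border_const ?m" by (simp add: border_const_def)
    moreover have "0 \<le> sqrt pi ^ Suc ?m / Gamma (Suc ?m / 2)"
      using Gamma_real_pos[of "Suc ?m / 2"] by (intro divide_nonneg_nonneg) auto
    ultimately have "ennreal (1 / goe_norm ?m) * ennreal (border_const ?m) * ennreal (sqrt pi ^ Suc ?m / Gamma (Suc ?m / 2)) = ennreal (1 / goe_norm (Suc ?m))"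
      unfolding goe_norm_Suc[symmetric] using goe_norm_pos[of ?m]
      by (simp add: mult_ac flip: ennreal_mult del: power_Suc)
    then show ?thesis by (simp only: mult.assoc[symmetric])
  qed
  finally show ?case using insert.hyps by simp
qed

subsection \<open>Anisotropic forms\<close>

text \<open>By homogeneity a nontrivial zero may be taken on the unit sphere; compactness then
  passes zeros to limits of matrices. Closedness is what makes the event measurable.\<close>

lemma closed_isotropic: "closed {M :: real ^ 'n ^ 'n. isotropic (quad_form M)}"
proof -
  have cont: "continuous_on UNIV (\<lambda>p :: (real ^ 'n ^ 'n) \<times> (real ^ 'n). quad_form (fst p) (snd p))"
    unfolding quad_form_def inner_vec_def matrix_vector_mult_def by (simp, intro continuous_intros)
  have eq: "isotropic (quad_form M) \<longleftrightarrow> (\<exists>x\<in>sphere 0 1. quad_form M x = 0)" for M :: "real ^ 'n ^ 'n"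
  proof
    assume "isotropic (quad_form M)"
    then obtain x where x: "x \<noteq> 0" "quad_form M x = 0" by (auto simp: isotropic_def)
    have "quad_form M (x /\<^sub>R norm x) = 0"
      using x(2) by (simp add: quad_form_def matrix_vector_mult_scaleR)
    moreover have "x /\<^sub>R norm x \<in> sphere 0 1" using x(1) by simp
    ultimately show "\<exists>x\<in>sphere 0 1. quad_form M x = 0" by blast
  next
    assume "\<exists>x\<in>sphere 0 1. quad_form M x = 0"
    then obtain x where "norm x = 1" "quad_form M x = 0" by auto
    then show "isotropic (quad_form M)" unfolding isotropic_def by (metis norm_zero zero_neq_one)
  qed
  show ?thesis
    unfolding closed_sequential_limits
  proof (intro allI impI, elim conjE)
    fix X and M :: "real ^ 'n ^ 'n"
    assume "\<forall>k. X k \<in> {M. isotropic (quad_form M)}" and lim: "X \<longlonglongrightarrow> M"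
    then have "\<forall>k. \<exists>x\<in>sphere 0 1. quad_form (X k) x = 0" by (simp add: eq)
    then obtain x where x: "\<And>k. x k \<in> sphere 0 1" "\<And>k. quad_form (X k) (x k) = 0" by metis
    have "compact (sphere (0 :: real ^ 'n) 1)" by simp
    then obtain y r where y: "y \<in> sphere 0 1" "strict_mono r" "(x \<circ> r) \<longlonglongrightarrow> y"
      unfolding compact_def using x(1) by metis
    have "(\<lambda>k. ((X \<circ> r) k, (x \<circ> r) k)) \<longlonglongrightarrow> (M, y)"
      by (intro tendsto_Pair LIMSEQ_subseq_LIMSEQ[OF lim] y)
    then have "(\<lambda>k. quad_form (fst ((X \<circ> r) k, (x \<circ> r) k)) (snd ((X \<circ> r) k, (x \<circ> r) k))) \<longlonglongrightarrow> quad_form (fst (M, y)) (snd (M, y))"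
      by (rule continuous_on_tendsto_compose[OF cont]) auto
    then have "(\<lambda>k. 0) \<longlonglongrightarrow> quad_form M y" by (simp add: x(2))
    then have "quad_form M y = 0" using LIMSEQ_unique[OF tendsto_const] by metis
    then show "M \<in> {M. isotropic (quad_form M)}" using y(1) by (auto simp: eq)
  qed
qed

lemma measurable_sym_matrix:
  "sym_matrix \<in> borel_measurable (\<Pi>\<^sub>M p\<in>(UNIV :: ('n::finite \<times> 'n) set). gauss)"
proof -
  have [measurable]: "(\<lambda>x. x p) \<in> borel_measurable (\<Pi>\<^sub>M p\<in>(UNIV :: ('n \<times> 'n) set). gauss)" for p
    by (rule measurable_compose[OF measurable_component_singleton[of p]]) simp_all
  have "(\<lambda>b. sym_matrix b \<bullet> axis i (axis j 1)) \<in> borel_measurable (\<Pi>\<^sub>M p\<in>(UNIV :: ('n \<times> 'n) set). gauss)" for i j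
    by (simp add: inner_axis sym_matrix_def)
  then show ?thesis
    by (subst borel_measurable_euclidean_space) (auto simp: Basis_vec_def)
qed

lemma GOE_eq: "GOE = distr (\<Pi>\<^sub>M p\<in>(UNIV :: ('n::finite \<times> 'n) set). gauss) borel sym_matrix"
proof -
  have "(\<lambda>b :: 'n \<times> 'n \<Rightarrow> real. let B = (\<chi> i j. b (i, j)) in (1 / sqrt 2) *\<^sub>R (B + transpose B)) = sym_matrix"
    by (auto simp: fun_eq_iff vec_eq_iff sym_matrix_def transpose_def Let_def)
  then show ?thesis by (simp add: GOE_def)
qed

lemma sub_eigenbasis_exists:
  fixes M :: "real ^ 'n ^ 'n"
  assumes "\<And>i j. i \<in> I \<Longrightarrow> j \<in> I \<Longrightarrow> M $ i $ j = M $ j $ i"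
  shows "\<exists>d u. sub_eigenbasis I M d u"
proof (rule sub_spectral_decomposition[OF assms])
  fix d u
  assume "\<And>s r. s \<in> I \<Longrightarrow> r \<in> I \<Longrightarrow> u s \<bullet> u r = (if s = r then 1 else 0)"
    "\<And>s k. s \<in> I \<Longrightarrow> k \<notin> I \<Longrightarrow> u s $ k = 0"
    "\<And>s k. s \<in> I \<Longrightarrow> k \<in> I \<Longrightarrow> (\<Sum>j\<in>I. M $ k $ j * u s $ j) = d s * u s $ k"
  then have "sub_eigenbasis I M d u" by (rule sub_eigenbasis.intro)
  then show ?thesis by blast
qed

text \<open>In an eigenbasis the form is a sum of \<open>d s\<close> times squared coordinates, and
  it is anisotropic exactly when all \<open>d s\<close> are nonzero and of one sign.\<close>

lemma isotropic_iff_roots: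
  fixes M :: "real ^ 'n ^ 'n"
  assumes sym: "\<And>i j. M $ i $ j = M $ j $ i"
  shows "isotropic (quad_form M) \<longleftrightarrow>
    \<not> (\<forall>x. poly (sub_charpoly UNIV M) x = 0 \<longrightarrow> x > 0) \<and> \<not> (\<forall>x. poly (sub_charpoly UNIV M) x = 0 \<longrightarrow> x < 0)"
proof -
  obtain d u where E: "sub_eigenbasis UNIV M d u"
    using sub_eigenbasis_exists[of UNIV M] sym by blast
  interpret E: sub_eigenbasis UNIV M d u by (rule E)
  have roots: "{x. poly (sub_charpoly UNIV M) x = 0} = range d"
    unfolding E.sub_charpoly_eq by (rule roots_linear_factors) simp
  have orth: "u s \<bullet> u r = (if s = r then 1 else 0)" for s r using E.orthonormal by simp
  have Mu: "M *v u s = d s *\<^sub>R u s" for s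
    using E.eigen[of s] by (simp add: vec_eq_iff matrix_vector_mult_def)
  have expand: "x = (\<Sum>s\<in>UNIV. (u s \<bullet> x) *\<^sub>R u s)" for x
  proof -
    have Qv: "(E.Q *v y) = (\<Sum>s\<in>UNIV. y $ s *\<^sub>R u s)" for y
      by (simp add: vec_eq_iff matrix_vector_mult_def E.Q_def mult.commute)
    have "transpose E.Q *v x = (\<chi> s. u s \<bullet> x)"
      by (simp add: vec_eq_iff matrix_vector_mult_def E.Q_def transpose_def inner_vec_def del: transpose_matrix_vector)
    moreover have "E.Q *v (transpose E.Q *v x) = x"
      using E.orthogonal_Q by (simp add: matrix_vector_mul_assoc orthogonal_matrix_def del: transpose_matrix_vector)
    ultimately show ?thesis by (simp add: Qv)
  qed
  have q: "quad_form M x = (\<Sum>s\<in>UNIV. d s * (u s \<bullet> x)\<^sup>2)" for x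
  proof -
    have "M *v x = (\<Sum>s\<in>UNIV. (u s \<bullet> x) *\<^sub>R (d s *\<^sub>R u s))"
      by (subst expand) (simp add: linear_sum[OF matrix_vector_mul_linear] matrix_vector_mult_scaleR Mu)
    then have "quad_form M x = (\<Sum>s\<in>UNIV. (u s \<bullet> x) * (d s * (x \<bullet> u s)))"
      by (simp add: quad_form_def inner_sum_right mult.assoc)
    then show ?thesis by (simp add: inner_commute power2_eq_square mult_ac)
  qed
  have nz: "\<exists>s. u s \<bullet> x \<noteq> 0" if "x \<noteq> 0" for x
  proof (rule ccontr)
    assume "\<not> ?thesis"
    then have "x = 0" using expand[of x] by simp
    with that show False ..
  qed
  have un: "u s \<noteq> 0" for s using orth[of s s] by auto
  show ?thesis
  proof (intro iffI conjI notI)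
    assume iso: "isotropic (quad_form M)" and pos: "\<forall>x. poly (sub_charpoly UNIV M) x = 0 \<longrightarrow> x > 0"
    then obtain x where x: "x \<noteq> 0" "quad_form M x = 0" by (auto simp: isotropic_def)
    have d: "d s > 0" for s using pos roots by blast
    obtain s where "u s \<bullet> x \<noteq> 0" using nz[OF x(1)] by blast
    then have "quad_form M x > 0"
      unfolding q using d by (intro sum_pos2[of _ s]) (auto simp: less_imp_le)
    with x(2) show False by simp
  next
    assume iso: "isotropic (quad_form M)" and neg: "\<forall>x. poly (sub_charpoly UNIV M) x = 0 \<longrightarrow> x < 0"
    then obtain x where x: "x \<noteq> 0" "quad_form M x = 0" by (auto simp: isotropic_def)
    have d: "d s < 0" for s using neg roots by blast
    obtain s where "u s \<bullet> x \<noteq> 0" using nz[OF x(1)] by blast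
    then have "(\<Sum>s\<in>UNIV. - d s * (u s \<bullet> x)\<^sup>2) > 0"
      using d by (intro sum_pos2[of _ s]) (auto simp: mult_nonpos_nonneg mult_neg_pos less_imp_le)
    with x(2) show False by (simp add: q sum_negf)
  next
    assume *: "\<not> (\<forall>x. poly (sub_charpoly UNIV M) x = 0 \<longrightarrow> x > 0) \<and> \<not> (\<forall>x. poly (sub_charpoly UNIV M) x = 0 \<longrightarrow> x < 0)"
    have all: "(\<forall>x. poly (sub_charpoly UNIV M) x = 0 \<longrightarrow> Q x) \<longleftrightarrow> (\<forall>s. Q (d s))" for Q
    proof -
      have "(\<forall>x. poly (sub_charpoly UNIV M) x = 0 \<longrightarrow> Q x) \<longleftrightarrow> (\<forall>x\<in>{x. poly (sub_charpoly UNIV M) x = 0}. Q x)" by simp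
      then show ?thesis unfolding roots by simp
    qed
    obtain s where s: "d s \<le> 0" using * unfolding all by (auto simp: not_less)
    obtain r where r: "d r \<ge> 0" using * unfolding all by (auto simp: not_less)
    have "\<exists>x. x \<noteq> 0 \<and> quad_form M x = 0"
    proof (cases "d s = 0")
      case True
      then have "quad_form M (u s) = 0" by (simp add: quad_form_def Mu)
      then show ?thesis using un by blast
    next
      case False
      then have sr: "s \<noteq> r" using s r by auto
      \<comment> \<open>The coefficients make the two eigenvectors contribute
        \<open>d s * d r\<close> and \<open>- d r * d s\<close>, which cancel.\<close>
      define x where "x = sqrt (d r) *\<^sub>R u s + sqrt (- d s) *\<^sub>R u r"
      have "x \<bullet> u r = sqrt (- d s)" using sr by (simp add: x_def inner_add_left orth)
      then have "x \<noteq> 0" using False s by auto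
      moreover have "quad_form M x = 0"
        using s r sr by (simp add: quad_form_def x_def matrix_vector_right_distrib matrix_vector_mult_scaleR Mu inner_add_left inner_add_right orth algebra_simps)
      ultimately show ?thesis by blast
    qed
    then show "isotropic (quad_form M)" by (auto simp: isotropic_def)
  qed
qed

section \<open>Definite forms as integrals over eigenvalues\<close>

lemma vdm_not_inj: "finite I \<Longrightarrow> \<not> inj_on x I \<Longrightarrow> vdm x I = 0"
  unfolding vdm_def inj_on_def by (auto intro!: prod_zero)

lemma vdm_uminus: "vdm (\<lambda>i. - x i) I = vdm x I"
proof -
  have "\<bar>- x s - - x r\<bar> = \<bar>x s - x r\<bar>" for r s by linarith
  then show ?thesis by (simp add: vdm_def)
qed

definition half_weight :: "real \<Rightarrow> real" where
  "half_weight x = (if x > 0 then exp (- x\<^sup>2 / 4) else 0)"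

lemma half_weight_nonneg [simp]: "half_weight x \<ge> 0"
  by (simp add: half_weight_def)

lemma measurable_half_weight [measurable]: "half_weight \<in> borel_measurable borel"
  unfolding half_weight_def[abs_def] by measurable

text \<open>Passing to labelled roots brings in \<open>n!\<close> and the Vandermonde factor. Points
  with coinciding coordinates, which do not give a split polynomial, are killed by this
  factor.\<close>

lemma nn_integral_simple_split_all_roots:
  fixes I :: "'i set" and Q :: "real \<Rightarrow> bool"
  assumes I: "finite I" "card I = n" and [measurable]: "Measurable.pred borel Q"
  shows "fact n * (\<integral>\<^sup>+ p. indicator {p. simple_split n p} p * (ennreal (exp (- sum_sq_roots n p / 4)) *
      indicator {p. \<forall>k<n. Q (nth_root_of k p)} p) \<partial>coeff_lborel 1 n)
    = (\<integral>\<^sup>+ x. ennreal (vdm x I) * (\<Prod>i\<in>I. ennreal (if Q (x i) then exp (- (x i)\<^sup>2 / 4) else 0)) \<partial>(\<Pi>\<^sub>M i\<in>I. lborel))"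
proof -
  let ?f = "\<lambda>p. ennreal (exp (- sum_sq_roots n p / 4)) * indicator {p. \<forall>k<n. Q (nth_root_of k p)} p"
  have "?f \<in> borel_measurable poly_borel" by measurable
  from nn_integral_simple_split[OF I(1) this]
  have "fact n * (\<integral>\<^sup>+ p. indicator {p. simple_split n p} p * ?f p \<partial>coeff_lborel 1 n)
    = (\<integral>\<^sup>+ x. ennreal (vdm x I) * ?f (\<Prod>i\<in>I. [:- x i, 1:]) \<partial>(\<Pi>\<^sub>M i\<in>I. lborel))"
    by (simp add: I(2))
  also have "\<dots> = (\<integral>\<^sup>+ x. ennreal (vdm x I) * (\<Prod>i\<in>I. ennreal (if Q (x i) then exp (- (x i)\<^sup>2 / 4) else 0)) \<partial>(\<Pi>\<^sub>M i\<in>I. lborel))"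
  proof (rule nn_integral_cong)
    fix x :: "'i \<Rightarrow> real"
    show "ennreal (vdm x I) * ?f (\<Prod>i\<in>I. [:- x i, 1:]) = ennreal (vdm x I) * (\<Prod>i\<in>I. ennreal (if Q (x i) then exp (- (x i)\<^sup>2 / 4) else 0))"
    proof (cases "inj_on x I")
      case False
      then show ?thesis using vdm_not_inj[OF I(1)] by simp
    next
      case True
      define p where "p = (\<Prod>i\<in>I. [:- x i, 1:])"
      have split: "simple_split n p" unfolding p_def by (rule simple_splitI[OF I(1) True I(2)])
      have "(\<lambda>k. nth_root_of k p) ` {..<n} = x ` I"
        using bij_betw_nth_root_of'[OF split] roots_linear_factors[OF I(1), of x]
        by (simp add: bij_betw_def p_def)
      then have all: "(\<forall>k<n. Q (nth_root_of k p)) \<longleftrightarrow> (\<forall>i\<in>I. Q (x i))"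
      proof -
        assume eq: "(\<lambda>k. nth_root_of k p) ` {..<n} = x ` I"
        have "(\<forall>k<n. Q (nth_root_of k p)) \<longleftrightarrow> (\<forall>y\<in>(\<lambda>k. nth_root_of k p) ` {..<n}. Q y)" by auto
        then show ?thesis unfolding eq by simp
      qed
      have "sum_sq_roots n p = (\<Sum>i\<in>I. (x i)\<^sup>2)"
        using sum_sq_roots_linear_factors[OF I(1), of x] by (simp add: p_def I(2))
      then have "exp (- sum_sq_roots n p / 4) = (\<Prod>i\<in>I. exp (- (x i)\<^sup>2 / 4))"
        using I(1) by (simp add: exp_sum[symmetric] sum_negf sum_divide_distrib)
      then have "ennreal (exp (- sum_sq_roots n p / 4)) = (\<Prod>i\<in>I. ennreal (exp (- (x i)\<^sup>2 / 4)))"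
        by (simp add: prod_ennreal)
      then have "?f p = (\<Prod>i\<in>I. ennreal (if Q (x i) then exp (- (x i)\<^sup>2 / 4) else 0))"
      proof (cases "\<forall>i\<in>I. Q (x i)")
        case False
        then have "(\<Prod>i\<in>I. ennreal (if Q (x i) then exp (- (x i)\<^sup>2 / 4) else 0)) = 0"
          using I(1) by (auto intro!: prod_zero)
        then show ?thesis using False all by simp
      qed (simp add: all)
      then show ?thesis by (simp add: p_def)
    qed
  qed
  finally show ?thesis .
qed

text \<open>Positive and negative definiteness are disjoint events since \<open>n > 0\<close>, and
  the reflection of all coordinates identifies their integrals; this gives the factor 2.\<close>

lemma emeasure_GOE_anisotropic:
  fixes I :: "'i set"
  assumes n: "n = CARD('n::finite)" and I: "finite I" "card I = n"
  shows "ennreal (fact n * goe_norm n) * emeasure GOE (- {M :: real ^ 'n ^ 'n. isotropic (quad_form M)})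
    = 2 * (\<integral>\<^sup>+ x. ennreal (vdm x I * (\<Prod>i\<in>I. half_weight (x i))) \<partial>(\<Pi>\<^sub>M i\<in>I. lborel))"
proof -
  have npos: "n > 0" unfolding n by simp
  let ?G = "\<Pi>\<^sub>M p\<in>(UNIV :: ('n \<times> 'n) set). gauss"
  let ?A = "- {M :: real ^ 'n ^ 'n. isotropic (quad_form M)}"
  define C where "C b = sub_charpoly UNIV (sym_matrix b :: real ^ 'n ^ 'n)" for b
  have sets [measurable_cong]: "sets ?G = sets (\<Pi>\<^sub>M k\<in>UNIV. lborel)" by (intro sets_PiM_cong) simp_all
  have [measurable]: "C \<in> ?G \<rightarrow>\<^sub>M poly_borel"
    unfolding C_def[abs_def] by (rule measurable_sub_charpoly) (simp add: sym_matrix_def)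
  note law = sub_charpoly_law[where I = "UNIV :: 'n set", folded n C_def]
  define Pr where "Pr Q p \<longleftrightarrow> (\<forall>k<n. Q (nth_root_of k p))" for Q p
  have meas_Pr [measurable]: "Measurable.pred poly_borel (Pr Q)" if [measurable]: "Measurable.pred borel Q" for Q
    unfolding Pr_def by measurable
  have AE_split: "AE b in ?G. simple_split n (C b)"
  proof -
    have "(\<integral>\<^sup>+ b. indicator {p. \<not> simple_split n p} (C b) \<partial>?G) = 0"
    proof -
      have z: "indicator {p. simple_split n p} p * (c * indicator {p. \<not> simple_split n p} p) = (0::ennreal)" for p c
        by (simp add: indicator_def)
      show ?thesis by (subst law, measurable) (simp only: z, simp)
    qed
    then have "AE b in ?G. indicator {p. \<not> simple_split n p} (C b) = (0::ennreal)"
      by (subst (asm) nn_integral_0_iff_AE) (auto simp: indicator_def)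
    then show ?thesis by eventually_elim (auto simp: indicator_def split: if_splits)
  qed
  have A: "?A \<in> sets borel" by (intro borel_open open_Compl closed_isotropic)
  have "emeasure GOE ?A = (\<integral>\<^sup>+ b. indicator ?A (sym_matrix b) \<partial>?G)"
    unfolding GOE_eq using A measurable_sym_matrix
    by (subst nn_integral_indicator[symmetric], simp, subst nn_integral_distr) auto
  also have "\<dots> = (\<integral>\<^sup>+ b. indicator {p. Pr (\<lambda>x. x > 0) p} (C b) + indicator {p. Pr (\<lambda>x. x < 0) p} (C b) \<partial>?G)"
  proof (rule nn_integral_cong_AE)
    show "AE b in ?G. indicator ?A (sym_matrix b) = indicator {p. Pr (\<lambda>x. x > 0) p} (C b) + (indicator {p. Pr (\<lambda>x. x < 0) p} (C b) :: ennreal)"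
      using AE_split
    proof eventually_elim
      case (elim b)
      have "(\<lambda>k. nth_root_of k (C b)) ` {..<n} = {x. poly (C b) x = 0}"
        using bij_betw_nth_root_of'[OF elim] by (simp add: bij_betw_def)
      then have all: "Pr Q (C b) \<longleftrightarrow> (\<forall>x. poly (C b) x = 0 \<longrightarrow> Q x)" for Q
      proof -
        have "Pr Q (C b) \<longleftrightarrow> (\<forall>x\<in>(\<lambda>k. nth_root_of k (C b)) ` {..<n}. Q x)" by (auto simp: Pr_def)
        then show ?thesis unfolding \<open>(\<lambda>k. nth_root_of k (C b)) ` {..<n} = _\<close> by simp
      qed
      have sym: "sym_matrix b $ i $ j = (sym_matrix b $ j $ i :: real)" for i j :: 'n
        by (simp add: sym_matrix_def add.commute)
      have "isotropic (quad_form (sym_matrix b)) \<longleftrightarrow> \<not> Pr (\<lambda>x. x > 0) (C b) \<and> \<not> Pr (\<lambda>x. x < 0) (C b)"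
        unfolding all unfolding C_def by (rule isotropic_iff_roots) (rule sym)
      moreover have "\<not> (Pr (\<lambda>x. x > 0) (C b) \<and> Pr (\<lambda>x. x < 0) (C b))"
        using npos unfolding Pr_def by (metis less_asym)
      ultimately show ?case by (auto simp: indicator_def)
    qed
  qed
  also have "\<dots> = (\<integral>\<^sup>+ b. indicator {p. Pr (\<lambda>x. x > 0) p} (C b) \<partial>?G) + (\<integral>\<^sup>+ b. indicator {p. Pr (\<lambda>x. x < 0) p} (C b) \<partial>?G)"
    by (rule nn_integral_add) measurable
  finally have 1: "emeasure GOE ?A = (\<integral>\<^sup>+ b. indicator {p. Pr (\<lambda>x. x > 0) p} (C b) \<partial>?G) + (\<integral>\<^sup>+ b. indicator {p. Pr (\<lambda>x. x < 0) p} (C b) \<partial>?G)" .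
  have 2: "ennreal (fact n * goe_norm n) * (\<integral>\<^sup>+ b. indicator {p. Pr Q p} (C b) \<partial>?G)
    = (\<integral>\<^sup>+ x. ennreal (vdm x I) * (\<Prod>i\<in>I. ennreal (if Q (x i) then exp (- (x i)\<^sup>2 / 4) else 0)) \<partial>(\<Pi>\<^sub>M i\<in>I. lborel))"
    if [measurable]: "Measurable.pred borel Q" for Q
  proof -
    define X where "X = (\<integral>\<^sup>+ p. indicator {p. simple_split n p} p * (ennreal (exp (- sum_sq_roots n p / 4)) *
      indicator {p. Pr Q p} p) \<partial>coeff_lborel 1 n)"
    have "ennreal (fact n * goe_norm n) * (\<integral>\<^sup>+ b. indicator {p. Pr Q p} (C b) \<partial>?G) = ennreal (fact n * goe_norm n) * (ennreal (1 / goe_norm n) * X)"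
      unfolding X_def by (subst law) measurable
    also have "\<dots> = ennreal (fact n) * X"
      using goe_norm_pos[of n] by (simp add: mult.assoc[symmetric] flip: ennreal_mult)
    also have "ennreal (fact n) = fact n"
      by (metis ennreal_of_nat_eq_real_of_nat of_nat_fact)
    finally show ?thesis
      unfolding X_def Pr_def nn_integral_simple_split_all_roots[OF I that] .
  qed
  interpret P: finite_product_sigma_finite "\<lambda>_::'i. lborel :: real measure" I by standard fact
  have hw: "(\<integral>\<^sup>+ x. ennreal (vdm x I * (\<Prod>i\<in>I. half_weight (x i))) \<partial>(\<Pi>\<^sub>M i\<in>I. lborel))
    = (\<integral>\<^sup>+ x. ennreal (vdm x I) * (\<Prod>i\<in>I. ennreal (half_weight (x i))) \<partial>(\<Pi>\<^sub>M i\<in>I. lborel))"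
    by (simp add: ennreal_mult vdm_nonneg prod_nonneg prod_ennreal)
  have "ennreal (fact n * goe_norm n) * (\<integral>\<^sup>+ b. indicator {p. Pr (\<lambda>x. x > 0) p} (C b) \<partial>?G)
     = (\<integral>\<^sup>+ x. ennreal (vdm x I) * (\<Prod>i\<in>I. ennreal (half_weight (x i))) \<partial>(\<Pi>\<^sub>M i\<in>I. lborel))"
    unfolding half_weight_def by (rule 2) measurable
  moreover have "ennreal (fact n * goe_norm n) * (\<integral>\<^sup>+ b. indicator {p. Pr (\<lambda>x. x < 0) p} (C b) \<partial>?G)
     = (\<integral>\<^sup>+ x. ennreal (vdm x I) * (\<Prod>i\<in>I. ennreal (half_weight (x i))) \<partial>(\<Pi>\<^sub>M i\<in>I. lborel))"
  proof -
    let ?F = "\<lambda>x. ennreal (vdm x I) * (\<Prod>i\<in>I. ennreal (half_weight (x i)))"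
    have "ennreal (fact n * goe_norm n) * (\<integral>\<^sup>+ b. indicator {p. Pr (\<lambda>x. x < 0) p} (C b) \<partial>?G)
       = (\<integral>\<^sup>+ x. ennreal (vdm x I) * (\<Prod>i\<in>I. ennreal (if x i < 0 then exp (- (x i)\<^sup>2 / 4) else 0)) \<partial>(\<Pi>\<^sub>M i\<in>I. lborel))"
      by (rule 2) measurable
    also have "\<dots> = (\<integral>\<^sup>+ x. ?F (\<lambda>i\<in>I. - x i) \<partial>(\<Pi>\<^sub>M i\<in>I. lborel))"
    proof (rule nn_integral_cong)
      fix x :: "'i \<Rightarrow> real"
      have "vdm (\<lambda>i\<in>I. - x i) I = vdm x I"
        by (subst vdm_cong[where d' = "\<lambda>i. - x i"]) (auto simp: vdm_uminus)
      moreover have "(\<Prod>i\<in>I. ennreal (half_weight ((\<lambda>i\<in>I. - x i) i))) = (\<Prod>i\<in>I. ennreal (if x i < 0 then exp (- (x i)\<^sup>2 / 4) else 0))"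
        by (intro prod.cong) (auto simp: half_weight_def)
      ultimately show "ennreal (vdm x I) * (\<Prod>i\<in>I. ennreal (if x i < 0 then exp (- (x i)\<^sup>2 / 4) else 0)) = ?F (\<lambda>i\<in>I. - x i)"
        by simp
    qed
    also have "\<dots> = (\<integral>\<^sup>+ y. (\<Prod>i\<in>I. 1) * ?F y \<partial>(\<Pi>\<^sub>M i\<in>I. lborel))"
    proof (rule nn_integral_PiM_transform[where F = ?F])
      show "product_sigma_finite (\<lambda>i::'i. lborel :: real measure)" by (rule P.product_sigma_finite_axioms)
      show "(\<integral>\<^sup>+ x. g (- x) \<partial>lborel) = (\<integral>\<^sup>+ y. 1 * g y \<partial>lborel)" if "g \<in> borel_measurable borel" for g :: "real \<Rightarrow> ennreal"
        using nn_integral_real_affine[OF that, of "-1" 0] by simp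
    qed (use I(1) in simp_all)
    finally show ?thesis by simp
  qed
  ultimately show ?thesis
    unfolding 1 hw by (simp add: distrib_left mult_2)
qed

subsection \<open>Pfaffians\<close>

text \<open>The involution exchanging \<open>2k - 1\<close> and \<open>2k\<close> for every positive
  \<open>k\<close>; its value at 0 is 0.\<close>

definition block_partner :: "nat \<Rightarrow> nat" where
  "block_partner j = (if odd j then Suc j else j - 1)"

text \<open>The hyperoctahedral group, that is, the stabiliser of the standard pairing
  \<open>{1,2}, {3,4}, ...\<close>. Its order enters the identities below as a common factor and
  cancels, so it is never evaluated.\<close>

definition block_perms :: "nat \<Rightarrow> (nat \<Rightarrow> nat) set" where
  "block_perms s = {h. h permutes {1..2 * s} \<and> (\<forall>j\<in>{1..2 * s}. h (block_partner j) = block_partner (h j))}"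

text \<open>The summand of the Pfaffian, taken for an arbitrary permutation: sums over the whole
  symmetric group can be reindexed by composition, sums over normalised pairings cannot.\<close>

definition pf_term :: "nat \<Rightarrow> (nat \<Rightarrow> nat \<Rightarrow> real) \<Rightarrow> (nat \<Rightarrow> nat) \<Rightarrow> real" where
  "pf_term s A \<sigma> = of_int (sign \<sigma>) * (\<Prod>k=1..s. A (\<sigma> (2 * k - 1)) (\<sigma> (2 * k)))"

lemma block_partner_simps [simp]:
  "Suc 0 \<le> k \<Longrightarrow> block_partner (2 * k - Suc 0) = 2 * k" "block_partner (2 * k) = 2 * k - Suc 0"
  by (auto simp: block_partner_def)

lemma block_cases:
  fixes j :: nat
  assumes "j \<in> {1..2 * s}"
  obtains k where "k \<in> {1..s}" "j = 2 * k - 1" | k where "k \<in> {1..s}" "j = 2 * k"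
proof (cases "even j")
  case True
  then obtain k where "j = 2 * k" by blast
  with assms show ?thesis by (intro that(2)[of k]) auto
next
  case False
  then obtain k where "j = 2 * k + 1" by (metis oddE)
  with assms show ?thesis by (intro that(1)[of "Suc k"]) auto
qed

lemma block_partner_twice: "j \<in> {1..2 * s} \<Longrightarrow> block_partner (block_partner j) = j"
  by (erule block_cases) auto

lemma sign_comp:
  assumes "p permutes S" "q permutes S" "finite S"
  shows "sign (p \<circ> q) = sign p * sign q"
  using assms by (intro sign_compose) (auto simp: permutation_permutes)

lemma block_perms_permutes: "h \<in> block_perms s \<Longrightarrow> h permutes {1..2 * s}"
  by (simp add: block_perms_def)

lemma block_perms_id: "id \<in> block_perms s"
  by (simp add: block_perms_def permutes_id)

lemma block_perms_compose: "g \<in> block_perms s \<Longrightarrow> h \<in> block_perms s \<Longrightarrow> g \<circ> h \<in> block_perms s"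
proof -
  assume g: "g \<in> block_perms s" and h: "h \<in> block_perms s"
  have "h j \<in> {1..2 * s}" if "j \<in> {1..2 * s}" for j
    using permutes_in_image[OF block_perms_permutes[OF h]] that by blast
  note im = this
  have "(g \<circ> h) (block_partner j) = block_partner ((g \<circ> h) j)" if "j \<in> {1..2 * s}" for j
  proof -
    have "h (block_partner j) = block_partner (h j)" using h that by (simp add: block_perms_def)
    moreover have "g (block_partner (h j)) = block_partner (g (h j))"
      using g im[OF that] by (simp add: block_perms_def)
    ultimately show ?thesis by simp
  qed
  with permutes_compose[OF block_perms_permutes[OF h] block_perms_permutes[OF g]] show ?thesis
    by (simp add: block_perms_def)
qed

lemma block_perms_inv:
  assumes "h \<in> block_perms s"
  shows "inv h \<in> block_perms s"
proof -
  have p: "h permutes {1..2 * s}" using assms by (rule block_perms_permutes)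
  have "inv h (block_partner j) = block_partner (inv h j)" if "j \<in> {1..2 * s}" for j
  proof -
    have ih: "inv h j \<in> {1..2 * s}" using p that by (metis permutes_in_image permutes_inv)
    have "h (block_partner (inv h j)) = block_partner (h (inv h j))"
      using assms ih by (auto simp: block_perms_def)
    also have "\<dots> = block_partner j" using p by (simp add: permutes_inverses)
    finally show ?thesis using p by (metis permutes_inverses(2))
  qed
  then show ?thesis using p by (simp add: block_perms_def permutes_inv)
qed

lemma flip_in_block_perms:
  assumes "k \<in> {1..s}"
  shows "Transposition.transpose (2 * k - 1) (2 * k) \<in> block_perms s"
proof -
  let ?t = "Transposition.transpose (2 * k - 1) (2 * k)"
  have "?t (block_partner j) = block_partner (?t j)" if "j \<in> {1..2 * s}" for j
    using that
  proof (cases rule: block_cases)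
    case (1 l)
    then show ?thesis by (cases "l = k") (auto simp: Transposition.transpose_def)
  next
    case (2 l)
    then show ?thesis by (cases "l = k") (auto simp: Transposition.transpose_def)
  qed
  moreover have "?t permutes {1..2 * s}" using assms by (intro permutes_swap_id) auto
  ultimately show ?thesis by (simp add: block_perms_def)
qed

definition block_swap :: "nat \<Rightarrow> nat \<Rightarrow> nat \<Rightarrow> nat" where
  "block_swap k l = Transposition.transpose (2 * k - 1) (2 * l - 1) \<circ> Transposition.transpose (2 * k) (2 * l)"

lemma block_swap_apply:
  assumes "Suc 0 \<le> k" "Suc 0 \<le> l" "Suc 0 \<le> m"
  shows "block_swap k l (2 * m - Suc 0) = 2 * Transposition.transpose k l m - Suc 0"
    "block_swap k l (2 * m) = 2 * Transposition.transpose k l m"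
proof -
  have ne: "2 * a \<noteq> 2 * b - Suc 0" if "Suc 0 \<le> b" for a b :: nat using that by presburger
  have eq: "2 * a - Suc 0 = 2 * b - Suc 0 \<longleftrightarrow> a = b" if "Suc 0 \<le> a" "Suc 0 \<le> b" for a b :: nat
    using that by presburger
  note [simp] = ne ne[symmetric] eq
  show "block_swap k l (2 * m - Suc 0) = 2 * Transposition.transpose k l m - Suc 0"
    using assms by (simp add: block_swap_def Transposition.transpose_def)
  show "block_swap k l (2 * m) = 2 * Transposition.transpose k l m"
    using assms by (simp add: block_swap_def Transposition.transpose_def)
qed

lemma transpose_in_interval:
  fixes k l m :: nat
  shows "k \<in> {1..s} \<Longrightarrow> l \<in> {1..s} \<Longrightarrow> m \<in> {1..s} \<Longrightarrow> Transposition.transpose k l m \<in> {1..s}"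
  by (auto simp: Transposition.transpose_def)

lemma block_swap_in_block_perms:
  assumes "k \<in> {1..s}" "l \<in> {1..s}"
  shows "block_swap k l \<in> block_perms s"
proof -
  have "block_swap k l (block_partner j) = block_partner (block_swap k l j)" if "j \<in> {1..2 * s}" for j
    using that
  proof (cases rule: block_cases)
    case (1 m)
    then show ?thesis using assms transpose_in_interval[OF assms 1(1)] by (simp add: block_swap_apply)
  next
    case (2 m)
    then show ?thesis using assms transpose_in_interval[OF assms 2(1)] by (simp add: block_swap_apply)
  qed
  moreover have "block_swap k l permutes {1..2 * s}"
    unfolding block_swap_def using assms by (intro permutes_compose permutes_swap_id) auto
  ultimately show ?thesis by (simp add: block_perms_def)
qed

lemma sign_block_swap: "k \<ge> 1 \<Longrightarrow> l \<ge> 1 \<Longrightarrow> sign (block_swap k l) = 1"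
proof -
  assume kl: "k \<ge> 1" "l \<ge> 1"
  have "sign (block_swap k l) = sign (Transposition.transpose (2 * k - 1) (2 * l - 1)) * sign (Transposition.transpose (2 * k) (2 * l))"
    unfolding block_swap_def by (rule sign_compose) (rule permutation_swap_id)+
  then show ?thesis using kl by (cases "k = l") (auto simp: sign_swap_id)
qed

context
  fixes A :: "nat \<Rightarrow> nat \<Rightarrow> real" and s :: nat
  assumes skew: "\<And>i j. A i j = - A j i"
begin

text \<open>A flip changes the sign of the permutation and, by skew symmetry, the sign of one
  entry.\<close>

lemma pf_term_flip:
  assumes \<sigma>: "\<sigma> permutes {1..2 * s}" and k: "k \<in> {1..s}"
  shows "pf_term s A (\<sigma> \<circ> Transposition.transpose (2 * k - 1) (2 * k)) = pf_term s A \<sigma>"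
proof -
  let ?t = "Transposition.transpose (2 * k - 1) (2 * k)"
  let ?f = "\<lambda>l. A (\<sigma> (2 * l - 1)) (\<sigma> (2 * l))"
  have "?t permutes {1..2 * s}" using block_perms_permutes[OF flip_in_block_perms[OF k]] .
  then have "sign (\<sigma> \<circ> ?t) = - sign \<sigma>"
    using \<sigma> k by (subst sign_comp[of _ "{1..2 * s}"]) (auto simp: sign_swap_id)
  moreover have "(\<Prod>l=1..s. A ((\<sigma> \<circ> ?t) (2 * l - 1)) ((\<sigma> \<circ> ?t) (2 * l))) = - (\<Prod>l=1..s. ?f l)"
  proof -
    have "(\<Prod>l=1..s. A ((\<sigma> \<circ> ?t) (2 * l - 1)) ((\<sigma> \<circ> ?t) (2 * l))) = - ?f k * (\<Prod>l\<in>{1..s} - {k}. ?f l)"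
    proof (subst prod.remove[OF _ k])
      have "(\<Prod>l\<in>{1..s} - {k}. A ((\<sigma> \<circ> ?t) (2 * l - 1)) ((\<sigma> \<circ> ?t) (2 * l))) = (\<Prod>l\<in>{1..s} - {k}. ?f l)"
      proof (rule prod.cong[OF refl])
        fix l assume l: "l \<in> {1..s} - {k}"
        then have "2 * l - 1 \<noteq> 2 * k - 1" "2 * l - 1 \<noteq> 2 * k" "2 * l \<noteq> 2 * k - 1" "2 * l \<noteq> 2 * k"
          using k by (auto; presburger)+
        then show "A ((\<sigma> \<circ> ?t) (2 * l - 1)) ((\<sigma> \<circ> ?t) (2 * l)) = ?f l" by (simp add: Transposition.transpose_def)
      qed
      then show "A ((\<sigma> \<circ> ?t) (2 * k - 1)) ((\<sigma> \<circ> ?t) (2 * k)) * (\<Prod>l\<in>{1..s} - {k}. A ((\<sigma> \<circ> ?t) (2 * l - 1)) ((\<sigma> \<circ> ?t) (2 * l)))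
         = - ?f k * (\<Prod>l\<in>{1..s} - {k}. ?f l)"
        using skew[of "\<sigma> (2 * k)" "\<sigma> (2 * k - 1)"] by simp
    qed simp
    also have "\<dots> = - (\<Prod>l=1..s. ?f l)" using prod.remove[OF _ k, of ?f] by simp
    finally show ?thesis .
  qed
  ultimately show ?thesis by (simp add: pf_term_def)
qed

text \<open>Exchanging two pairs is an even permutation and merely permutes the factors.\<close>

lemma pf_term_block_swap:
  assumes \<sigma>: "\<sigma> permutes {1..2 * s}" and kl: "k \<in> {1..s}" "l \<in> {1..s}"
  shows "pf_term s A (\<sigma> \<circ> block_swap k l) = pf_term s A \<sigma>"
proof -
  let ?f = "\<lambda>m. A (\<sigma> (2 * m - 1)) (\<sigma> (2 * m))"
  have "sign (\<sigma> \<circ> block_swap k l) = sign \<sigma>"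
    using \<sigma> kl block_perms_permutes[OF block_swap_in_block_perms[OF kl]]
    by (subst sign_comp[of _ "{1..2 * s}"]) (auto simp: sign_block_swap)
  moreover have "(\<Prod>m=1..s. A ((\<sigma> \<circ> block_swap k l) (2 * m - 1)) ((\<sigma> \<circ> block_swap k l) (2 * m)))
     = (\<Prod>m=1..s. ?f (Transposition.transpose k l m))"
    using kl by (intro prod.cong) (auto simp: block_swap_apply)
  moreover have "\<dots> = (\<Prod>m=1..s. ?f m)"
    using kl permutes_imp_bij[OF permutes_swap_id[OF kl]] by (rule_tac prod.reindex_bij_betw)
  ultimately show ?thesis by (simp add: pf_term_def)
qed

text \<open>Flips and exchanges of pairs generate the block permutations. The induction is on
  \<open>m\<close>, with \<open>h\<close> fixing everything above \<open>2 * m\<close>: composing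
  with an exchange, and with a flip if needed, fixes the top pair as well.\<close>

lemma pf_term_block_perm:
  assumes "h \<in> block_perms s" "\<sigma> permutes {1..2 * s}"
  shows "pf_term s A (\<sigma> \<circ> h) = pf_term s A \<sigma>"
proof -
  define good where "good h \<longleftrightarrow> (\<forall>\<sigma>. \<sigma> permutes {1..2 * s} \<longrightarrow> pf_term s A (\<sigma> \<circ> h) = pf_term s A \<sigma>)" for h
  have comp: "good (g \<circ> h)" if "good g" "good h" "g permutes {1..2 * s}" for g h
    using that by (auto simp: good_def o_assoc permutes_compose)
  have "good h" if "h \<in> block_perms s" "m \<le> s" "\<And>j. j > 2 * m \<Longrightarrow> h j = j" for m h
    using that
  proof (induction m arbitrary: h)
    case 0
    then have "h j = j" for j
      using permutes_not_in[OF block_perms_permutes[OF 0(1)], of 0] by (cases j) auto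
    then have "h = id" by auto
    then show ?case unfolding good_def by (simp only: comp_id simp_thms)
  next
    case (Suc m)
    note p = block_perms_permutes[OF Suc.prems(1)]
    have Sm: "Suc m \<in> {1..s}" using Suc.prems(2) by simp
    \<comment> \<open>If \<open>h\<close> sends \<open>2 * Suc m - 1\<close> to the first element of
      pair \<open>l\<close>, exchanging the pairs \<open>l\<close> and \<open>Suc m\<close> makes
      the whole top pair fixed, the image of the partner being forced.\<close>
    have step: "\<exists>g \<in> block_perms s. good g \<and> g \<circ> g = id \<and> good (g \<circ> h)"
      if h1: "h (2 * Suc m - 1) = 2 * l - 1" and l: "l \<in> {1..Suc m}" and h: "h \<in> block_perms s" "\<And>j. j > 2 * Suc m \<Longrightarrow> h j = j" for h l
    proof (intro bexI conjI)
      let ?g = "block_swap l (Suc m)"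
      have lS: "l \<in> {1..s}" using l Sm by auto
      show g: "?g \<in> block_perms s" by (rule block_swap_in_block_perms[OF lS Sm])
      show "good ?g" using pf_term_block_swap[OF _ lS Sm] by (simp add: good_def)
      have "h (2 * Suc m) = 2 * l"
      proof -
        have "2 * Suc m - 1 \<in> {1..2 * s}" using Sm by auto
        then have "h (block_partner (2 * Suc m - 1)) = block_partner (h (2 * Suc m - 1))"
          using h(1) unfolding block_perms_def by blast
        then show ?thesis unfolding h1 using l by (simp del: mult_Suc_right)
      qed
      have gg: "?g (?g j) = j" for j
      proof (cases "j \<in> {1..2 * s}")
        case True
        then show ?thesis
          using l lS Sm transpose_in_interval[OF lS Sm]
          by (cases rule: block_cases) (simp_all add: block_swap_apply)
      next
        case False
        then show ?thesis using permutes_not_in[OF block_perms_permutes[OF g]] by simp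
      qed
      then show "?g \<circ> ?g = id" by auto
      show "good (?g \<circ> h)"
      proof (rule Suc.IH)
        show "?g \<circ> h \<in> block_perms s" by (rule block_perms_compose[OF g h(1)])
        show "m \<le> s" using Suc.prems(2) by simp
        fix j assume j: "j > 2 * m"
        have "j = 2 * Suc m - 1 \<or> j = 2 * Suc m \<or> j > 2 * Suc m" using j by auto
        then consider "j = 2 * Suc m - 1" | "j = 2 * Suc m" | "j > 2 * Suc m" by blast
        then show "(?g \<circ> h) j = j"
        proof cases
          case 1 then show ?thesis using h1 l by (simp add: block_swap_apply del: mult_Suc_right)
        next
          case 2 then show ?thesis using \<open>h (2 * Suc m) = 2 * l\<close> l by (simp add: block_swap_apply del: mult_Suc_right)
        next
          case 3
          then have "j \<noteq> 2 * l - 1" "j \<noteq> 2 * l" "j \<noteq> 2 * Suc m - 1" "j \<noteq> 2 * Suc m" using l by auto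
          then show ?thesis using h(2)[OF 3] by (simp add: block_swap_def Transposition.transpose_def)
        qed
      qed
    qed
    have fin: "good h" if "g \<in> block_perms s" "good g" "g \<circ> g = id" "good (g \<circ> h)" for g h
    proof -
      have "good (g \<circ> (g \<circ> h))" by (rule comp[OF that(2) that(4) block_perms_permutes[OF that(1)]])
      then show ?thesis using that(3) by (simp add: o_assoc)
    qed
    have im: "h (2 * Suc m - 1) \<in> {1..2 * Suc m}"
    proof (rule ccontr)
      assume *: "h (2 * Suc m - 1) \<notin> {1..2 * Suc m}"
      have "h (2 * Suc m - 1) \<in> {1..2 * s}" using p Sm by (subst permutes_in_image) auto
      with * have gt: "h (2 * Suc m - 1) > 2 * Suc m" by auto
      then have "h (h (2 * Suc m - 1)) = h (2 * Suc m - 1)" by (rule Suc.prems(3))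
      then have "h (2 * Suc m - 1) = 2 * Suc m - 1" using permutes_inj[OF p] by (auto dest: injD)
      with gt show False by simp
    qed
    show ?case
      using im
    proof (cases rule: block_cases)
      case (1 l)
      then show ?thesis using step[of h l] Suc.prems fin by blast
    next
      \<comment> \<open>The image is the second element of its pair; flipping that pair leads back
        to the previous situation.\<close>
      case (2 l)
      let ?f = "Transposition.transpose (2 * l - 1) (2 * l)"
      have lS: "l \<in> {1..s}" using 2 Sm by auto
      have f: "?f \<in> block_perms s" by (rule flip_in_block_perms[OF lS])
      have fh: "?f \<circ> h \<in> block_perms s" by (rule block_perms_compose[OF f Suc.prems(1)])
      have "(?f \<circ> h) j = j" if "j > 2 * Suc m" for j
      proof -
        have "j \<noteq> 2 * l - 1" "j \<noteq> 2 * l" using that 2(1) by auto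
        then show ?thesis using Suc.prems(3)[OF that] by (simp add: Transposition.transpose_def)
      qed
      note fixed = this
      have "(?f \<circ> h) (2 * Suc m - 1) = 2 * l - 1" using 2(2) by simp
      from step[OF this 2(1) fh fixed] have "good (?f \<circ> h)" using fin by blast
      moreover have "good ?f" using pf_term_flip[OF _ lS] by (simp add: good_def)
      ultimately show ?thesis using fin[OF f, of h] by simp
    qed
  qed
  from this[of h s] have "good h"
    using assms(1) permutes_not_in[OF block_perms_permutes[OF assms(1)]] by simp
  then show ?thesis using assms(2) by (simp add: good_def)
qed

end

lemma strict_mono_on_same_image:
  fixes f g :: "nat \<Rightarrow> nat"
  assumes f: "\<And>i j. i \<in> {1..s} \<Longrightarrow> j \<in> {1..s} \<Longrightarrow> i < j \<Longrightarrow> f i < f j"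
    and g: "\<And>i j. i \<in> {1..s} \<Longrightarrow> j \<in> {1..s} \<Longrightarrow> i < j \<Longrightarrow> g i < g j"
    and im: "f ` {1..s} = g ` {1..s}" and k: "k \<in> {1..s}"
  shows "f k = g k"
  using k
proof (induction k rule: less_induct)
  case (less k)
  obtain a where a: "a \<in> {1..s}" "f k = g a" using im less.prems by (metis imageE imageI)
  obtain b where b: "b \<in> {1..s}" "g k = f b" using im less.prems by (metis imageE imageI)
  have "\<not> a < k" using a less f[of a k] by fastforce
  moreover have "\<not> b < k" using b less g[of b k] by fastforce
  moreover have "a > k \<Longrightarrow> g k < f k" using g[of k a] a less.prems by simp
  moreover have "b > k \<Longrightarrow> f k < g k" using f[of k b] b less.prems by simp
  ultimately show ?case using a b by (metis linorder_neqE_nat less_asym)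
qed

lemma pair_partitions_firsts:
  assumes "\<tau> \<in> pair_partitions s" "i \<in> {1..s}" "j \<in> {1..s}" "i < j"
  shows "\<tau> (2 * i - 1) < \<tau> (2 * j - 1)"
proof -
  have "j \<le> s \<Longrightarrow> i < j \<Longrightarrow> \<tau> (2 * i - 1) < \<tau> (2 * j - 1)" for j
  proof (induction j)
    case (Suc j)
    have step: "\<tau> (2 * j - 1) < \<tau> (2 * Suc j - 1)" if "j \<ge> 1"
      using assms(1) Suc.prems that by (auto simp: pair_partitions_def)
    show ?case
    proof (cases "i = j")
      case True
      then show ?thesis using step assms(2) by simp
    next
      case False
      then have "\<tau> (2 * i - 1) < \<tau> (2 * j - 1)" using Suc by simp
      also have "\<dots> < \<tau> (2 * Suc j - 1)" using step False Suc.prems assms(2) by simp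
      finally show ?thesis .
    qed
  qed simp
  then show ?thesis using assms by simp
qed

lemma finite_block_perms [simp]: "finite (block_perms s)"
  unfolding block_perms_def by (rule finite_subset[OF _ finite_permutations[of "{1..2 * s}"]]) auto

text \<open>The set of pair minima is the same for \<open>\<tau>\<close> and
  \<open>\<tau> \<circ> g\<close>, because \<open>g\<close> permutes the pairs. In a normalised
  pairing the first entries are these minima in increasing order, so they are determined, and the
  second entries follow as partners.\<close>

lemma inj_on_block_decomposition:
  assumes \<tau>: "\<tau> \<in> pair_partitions s" "\<tau>' \<in> pair_partitions s" and g: "g \<in> block_perms s" and eq: "\<tau>' = \<tau> \<circ> g"
  shows "g = id"
proof -
  have p: "\<tau> permutes {1..2 * s}" "\<tau>' permutes {1..2 * s}" using \<tau> by (auto simp: pair_partitions_def)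
  have pg: "g permutes {1..2 * s}" by (rule block_perms_permutes[OF g])
  define m where "m \<sigma> j = min (\<sigma> j) (\<sigma> (block_partner j))" for \<sigma> :: "nat \<Rightarrow> nat" and j
  have firsts: "m \<sigma> ` {1..2 * s} = (\<lambda>k. \<sigma> (2 * k - 1)) ` {1..s}" if "\<sigma> \<in> pair_partitions s" for \<sigma>
  proof -
    have lt: "\<sigma> (2 * k - Suc 0) < \<sigma> (2 * k)" if "k \<in> {1..s}" for k using \<open>\<sigma> \<in> _\<close> that by (auto simp: pair_partitions_def)
    have m: "m \<sigma> (2 * k - 1) = \<sigma> (2 * k - 1)" "m \<sigma> (2 * k) = \<sigma> (2 * k - 1)" if "k \<in> {1..s}" for k
      using lt[OF that] that by (auto simp: m_def)
    show ?thesis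
    proof
      show "m \<sigma> ` {1..2 * s} \<subseteq> (\<lambda>k. \<sigma> (2 * k - 1)) ` {1..s}"
        by (rule image_subsetI, erule block_cases) (simp_all only: m, blast+)
      show "(\<lambda>k. \<sigma> (2 * k - 1)) ` {1..s} \<subseteq> m \<sigma> ` {1..2 * s}"
      proof (rule image_subsetI)
        fix k assume k: "k \<in> {1..s}"
        then have "m \<sigma> (2 * k) \<in> m \<sigma> ` {1..2 * s}" by (intro imageI) auto
        then show "\<sigma> (2 * k - 1) \<in> m \<sigma> ` {1..2 * s}" using m(2)[OF k] by simp
      qed
    qed
  qed
  have "m \<tau>' j = m \<tau> (g j)" if "j \<in> {1..2 * s}" for j
    using g that by (simp add: m_def eq block_perms_def)
  then have "m \<tau>' ` {1..2 * s} = m \<tau> ` g ` {1..2 * s}" unfolding image_image by (intro image_cong) auto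
  also have "\<dots> = m \<tau> ` {1..2 * s}" using permutes_image[OF pg] by simp
  finally have im: "(\<lambda>k. \<tau>' (2 * k - 1)) ` {1..s} = (\<lambda>k. \<tau> (2 * k - 1)) ` {1..s}" using firsts \<tau> by simp
  have first: "g (2 * k - 1) = 2 * k - 1" if k: "k \<in> {1..s}" for k
  proof -
    have "\<tau>' (2 * k - 1) = \<tau> (2 * k - 1)"
      by (rule strict_mono_on_same_image[OF _ _ im k]) (use pair_partitions_firsts \<tau> in blast)+
    then show ?thesis using permutes_inj[OF p(1)] by (auto simp: eq dest: injD)
  qed
  have second: "g (2 * k) = 2 * k" if k: "k \<in> {1..s}" for k
  proof -
    have "2 * k - 1 \<in> {1..2 * s}" using k by auto
    then have "g (block_partner (2 * k - 1)) = block_partner (g (2 * k - 1))"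
      using g unfolding block_perms_def by blast
    then show ?thesis using first[OF k] k by simp
  qed
  have "g j = j" if "j \<in> {1..2 * s}" for j
    using that by (cases rule: block_cases) (simp_all only: first second)
  then show "g = id" using permutes_not_in[OF pg] by (intro ext) (metis id_apply)
qed

text \<open>Every coset of the block permutations contains a normalised representative: the one
  maximising \<open>\<Sum> k \<tau>(2 k - 1) + (s + 1) \<tau>(2 k)\<close>, since flipping a pair or exchanging two pairs
  in the wrong order increases this sum.\<close>
lemma block_normal_form:
  assumes \<sigma>: "\<sigma> permutes {1..2 * s}"
  shows "\<exists>\<tau>\<in>pair_partitions s. \<exists>h\<in>block_perms s. \<sigma> = \<tau> \<circ> h"
proof -
  \<comment> \<open>The weight \<open>s + 1\<close> of second entries exceeds every weight
    \<open>k\<close> of first entries, so a flip into the right order gains. In an exchange of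
    neighbouring pairs the second entries cancel and the first entries decide.\<close>
  define \<Phi> where "\<Phi> \<tau> = (\<Sum>k=1..s. int k * int (\<tau> (2 * k - 1)) + int (Suc s) * int (\<tau> (2 * k)))" for \<tau> :: "nat \<Rightarrow> nat"
  define C where "C = (\<lambda>h. \<sigma> \<circ> h) ` block_perms s"
  have "finite C" "C \<noteq> {}" unfolding C_def using block_perms_id by auto
  then have "Max (\<Phi> ` C) \<in> \<Phi> ` C" by (intro Max_in) auto
  then obtain \<tau> where \<tau>: "\<tau> \<in> C" "Max (\<Phi> ` C) = \<Phi> \<tau>" by blast
  then have \<tau>max: "\<Phi> \<tau>' \<le> \<Phi> \<tau>" if "\<tau>' \<in> C" for \<tau>'
    using Max_ge[of "\<Phi> ` C" "\<Phi> \<tau>'"] \<open>finite C\<close> that by simp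
  obtain h where h: "h \<in> block_perms s" "\<tau> = \<sigma> \<circ> h" using \<tau>(1) by (auto simp: C_def)
  have ph: "h permutes {1..2 * s}" by (rule block_perms_permutes[OF h(1)])
  have p\<tau>: "\<tau> permutes {1..2 * s}" unfolding h(2) by (rule permutes_compose[OF ph \<sigma>])
  have max: "\<Phi> (\<tau> \<circ> g) \<le> \<Phi> \<tau>" if "g \<in> block_perms s" for g
    using \<tau>max[of "\<tau> \<circ> g"] block_perms_compose[OF h(1) that] by (auto simp: C_def h(2) o_assoc[symmetric])
  have inj: "\<tau> i = \<tau> j \<longleftrightarrow> i = j" for i j using permutes_inj[OF p\<tau>] by (auto dest: injD)
  have "\<tau> \<in> pair_partitions s"
    unfolding pair_partitions_def
  proof (intro CollectI conjI ballI p\<tau>)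
    fix k assume k: "k \<in> {1..s}"
    let ?t = "Transposition.transpose (2 * k - 1) (2 * k)"
    let ?f = "\<lambda>\<tau> l. int l * int (\<tau> (2 * l - 1)) + int (Suc s) * int (\<tau> (2 * l))"
    have "(\<Sum>l\<in>{1..s} - {k}. ?f (\<tau> \<circ> ?t) l) = (\<Sum>l\<in>{1..s} - {k}. ?f \<tau> l)"
    proof (rule sum.cong[OF refl])
      fix l assume l: "l \<in> {1..s} - {k}"
      then have "2 * l - 1 \<noteq> 2 * k - 1" "2 * l - 1 \<noteq> 2 * k" "2 * l \<noteq> 2 * k - 1" "2 * l \<noteq> 2 * k"
        using k by (auto; presburger)+
      then show "?f (\<tau> \<circ> ?t) l = ?f \<tau> l" by (simp add: Transposition.transpose_def)
    qed
    moreover have "\<Phi> (\<tau> \<circ> ?t) \<le> \<Phi> \<tau>" by (rule max[OF flip_in_block_perms[OF k]])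
    ultimately have "?f (\<tau> \<circ> ?t) k \<le> ?f \<tau> k"
      using k unfolding \<Phi>_def by (simp only: sum.remove[of "{1..s}" k] finite_atLeastAtMost)
    then have "(int (Suc s) - int k) * (int (\<tau> (2 * k - 1)) - int (\<tau> (2 * k))) \<le> 0"
      by (simp add: algebra_simps)
    then have "\<tau> (2 * k - 1) \<le> \<tau> (2 * k)"
      using k by (simp add: mult_le_0_iff)
    moreover have "2 * k - 1 \<noteq> 2 * k" using k by auto
    then have "\<tau> (2 * k - 1) \<noteq> \<tau> (2 * k)" by (simp only: inj not_False_eq_True)
    ultimately show "\<tau> (2 * k - 1) < \<tau> (2 * k)" by simp
  next
    fix k assume k': "k \<in> {1..<s}"
    then have k: "k \<in> {1..s}" "Suc k \<in> {1..s}" by auto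
    let ?t = "block_swap k (Suc k)"
    let ?f = "\<lambda>\<tau> l. int l * int (\<tau> (2 * l - 1)) + int (Suc s) * int (\<tau> (2 * l))"
    have ap: "(\<tau> \<circ> ?t) (2 * l - 1) = \<tau> (2 * Transposition.transpose k (Suc k) l - 1)"
      "(\<tau> \<circ> ?t) (2 * l) = \<tau> (2 * Transposition.transpose k (Suc k) l)" if "l \<in> {1..s}" for l
      using that k by (simp_all add: block_swap_apply)
    have rest: "(\<Sum>l\<in>{1..s} - {k} - {Suc k}. ?f (\<tau> \<circ> ?t) l) = (\<Sum>l\<in>{1..s} - {k} - {Suc k}. ?f \<tau> l)"
    proof (rule sum.cong[OF refl])
      fix l assume l: "l \<in> {1..s} - {k} - {Suc k}"
      then have "Transposition.transpose k (Suc k) l = l" by (auto simp: Transposition.transpose_def)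
      moreover have "l \<in> {1..s}" using l by simp
      ultimately show "?f (\<tau> \<circ> ?t) l = ?f \<tau> l" by (simp only: ap)
    qed
    have le: "\<Phi> (\<tau> \<circ> ?t) \<le> \<Phi> \<tau>" by (rule max[OF block_swap_in_block_perms[OF k]])
    have S: "sum F {1..s} = F k + (F (Suc k) + sum F ({1..s} - {k} - {Suc k}))" for F :: "nat \<Rightarrow> int"
    proof -
      have "sum F {1..s} = F k + sum F ({1..s} - {k})" by (rule sum.remove) (use k in simp_all)
      moreover have "sum F ({1..s} - {k}) = F (Suc k) + sum F ({1..s} - {k} - {Suc k})"
        by (rule sum.remove) (use k in simp_all)
      ultimately show ?thesis by simp
    qed
    have "?f (\<tau> \<circ> ?t) k + ?f (\<tau> \<circ> ?t) (Suc k) \<le> ?f \<tau> k + ?f \<tau> (Suc k)"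
      using le unfolding \<Phi>_def S[of "?f (\<tau> \<circ> ?t)"] S[of "?f \<tau>"] rest by linarith
    then have "int (\<tau> (2 * k - 1)) \<le> int (\<tau> (2 * Suc k - 1))"
      unfolding ap[OF k(1)] ap[OF k(2)] by (simp add: algebra_simps)
    moreover have "2 * k - 1 \<noteq> 2 * Suc k - 1" by auto
    then have "\<tau> (2 * k - 1) \<noteq> \<tau> (2 * Suc k - 1)" by (simp only: inj not_False_eq_True)
    ultimately show "\<tau> (2 * k - 1) < \<tau> (2 * k + 1)" by simp
  qed
  moreover have "\<sigma> = \<tau> \<circ> inv h"
    unfolding h(2) using permutes_inv_o(1)[OF ph] by (simp add: o_assoc[symmetric])
  ultimately show ?thesis using block_perms_inv[OF h(1)] by blast
qed

text \<open>Every permutation is uniquely a normalised pairing composed with a block permutation,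
  and \<open>pf_term\<close> is constant on such a coset.\<close>

lemma sum_pf_term_eq_pfaffian:
  assumes skew: "\<And>i j. A i j = - A j i"
  shows "(\<Sum>\<sigma> | \<sigma> permutes {1..2 * s}. pf_term s A \<sigma>) = of_nat (card (block_perms s)) * pfaffian s A"
proof -
  have pp: "\<tau> permutes {1..2 * s}" if "\<tau> \<in> pair_partitions s" for \<tau> using that by (simp add: pair_partitions_def)
  have bij: "bij_betw (\<lambda>(\<tau>, h). \<tau> \<circ> h) (pair_partitions s \<times> block_perms s) {\<sigma>. \<sigma> permutes {1..2 * s}}"
    unfolding bij_betw_def
  proof
    show "inj_on (\<lambda>(\<tau>, h). \<tau> \<circ> h) (pair_partitions s \<times> block_perms s)"
    proof (rule inj_onI, clarify)
      fix \<tau> h \<tau>' h'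
      assume \<tau>: "\<tau> \<in> pair_partitions s" "\<tau>' \<in> pair_partitions s" and h: "h \<in> block_perms s" "h' \<in> block_perms s"
        and eq: "\<tau> \<circ> h = \<tau>' \<circ> h'"
      have p: "h permutes {1..2 * s}" "h' permutes {1..2 * s}" using block_perms_permutes[OF h(1)] block_perms_permutes[OF h(2)] .
      have "\<tau>' = \<tau>' \<circ> h' \<circ> inv h'" using permutes_inv_o(1)[OF p(2)] by (simp add: o_assoc[symmetric])
      also have "\<dots> = \<tau> \<circ> (h \<circ> inv h')" by (simp add: eq[symmetric] o_assoc)
      finally have *: "\<tau>' = \<tau> \<circ> (h \<circ> inv h')" .
      have "h \<circ> inv h' = id"
        by (rule inj_on_block_decomposition[OF \<tau> _ *]) (intro block_perms_compose block_perms_inv h)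
      moreover from this * have "\<tau>' = \<tau>" by simp
      moreover have "h = h \<circ> inv h' \<circ> h'" using permutes_inv_o(2)[OF p(2)] by (simp add: o_assoc[symmetric])
      ultimately show "\<tau> = \<tau>' \<and> h = h'" by simp
    qed
    show "(\<lambda>(\<tau>, h). \<tau> \<circ> h) ` (pair_partitions s \<times> block_perms s) = {\<sigma>. \<sigma> permutes {1..2 * s}}"
    proof safe
      fix \<tau> h assume "\<tau> \<in> pair_partitions s" "h \<in> block_perms s"
      then show "\<tau> \<circ> h permutes {1..2 * s}" using pp block_perms_permutes by (blast intro: permutes_compose)
    next
      fix \<sigma> assume "\<sigma> permutes {1..2 * s}"
      from block_normal_form[OF this] show "\<sigma> \<in> (\<lambda>(\<tau>, h). \<tau> \<circ> h) ` (pair_partitions s \<times> block_perms s)" by force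
    qed
  qed
  have "(\<Sum>\<sigma> | \<sigma> permutes {1..2 * s}. pf_term s A \<sigma>) = (\<Sum>(\<tau>, h)\<in>pair_partitions s \<times> block_perms s. pf_term s A (\<tau> \<circ> h))"
    by (subst sum.reindex_bij_betw[OF bij, symmetric]) (simp add: split_beta')
  also have "\<dots> = (\<Sum>(\<tau>, h)\<in>pair_partitions s \<times> block_perms s. pf_term s A \<tau>)"
    using pf_term_block_perm[OF skew] pp by (intro sum.cong) auto
  also have "\<dots> = of_nat (card (block_perms s)) * (\<Sum>\<tau>\<in>pair_partitions s. pf_term s A \<tau>)"
    by (simp add: sum.cartesian_product[symmetric] sum_distrib_left)
  also have "(\<Sum>\<tau>\<in>pair_partitions s. pf_term s A \<tau>) = pfaffian s A"
    by (simp add: pfaffian_def pf_term_def)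
  finally show ?thesis .
qed

section \<open>Schur's Pfaffian of signs\<close>

text \<open>The matrix of Schur's identity: for an even number of distinct points
  \<open>\<kappa> i\<close> its Pfaffian is the sign of their Vandermonde product. The identity is
  proved below in the form summed over all permutations.\<close>

definition sgn_kernel :: "(nat \<Rightarrow> real) \<Rightarrow> nat \<Rightarrow> nat \<Rightarrow> real" where
  "sgn_kernel \<kappa> i j = sgn (\<kappa> j - \<kappa> i)"

lemma sgn_kernel_skew: "sgn_kernel \<kappa> i j = - sgn_kernel \<kappa> j i"
  by (simp add: sgn_kernel_def sgn_if)

text \<open>\<open>inv \<sigma>\<close> tells at which position a value sits; if the values
  \<open>2 * l - 1\<close> and \<open>2 * l\<close> sat in one pair for every \<open>l\<close>, then
  \<open>inv \<sigma>\<close>, and with it \<open>\<sigma>\<close>, would be a block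
  permutation.\<close>

lemma not_block_perm_pair:
  assumes \<sigma>: "\<sigma> permutes {1..2 * s}" "\<sigma> \<notin> block_perms s"
  shows "\<exists>l\<in>{1..s}. block_partner (inv \<sigma> (2 * l - 1)) \<noteq> inv \<sigma> (2 * l)"
proof (rule ccontr)
  assume "\<not> ?thesis"
  then have *: "block_partner (inv \<sigma> (2 * l - 1)) = inv \<sigma> (2 * l)" if "l \<in> {1..s}" for l using that by blast
  have pi: "inv \<sigma> permutes {1..2 * s}" using \<sigma>(1) by (rule permutes_inv)
  have "inv \<sigma> (block_partner j) = block_partner (inv \<sigma> j)" if "j \<in> {1..2 * s}" for j
    using that
  proof (cases rule: block_cases)
    case (1 k)
    then show ?thesis using *[of k] by simp
  next
    case (2 k)
    have "inv \<sigma> (2 * k - 1) \<in> {1..2 * s}" using 2 by (subst permutes_in_image[OF pi]) auto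
    then have "block_partner (inv \<sigma> (2 * k)) = inv \<sigma> (2 * k - 1)"
      using *[OF 2(1)] block_partner_twice by metis
    then show ?thesis using 2 by simp
  qed
  then have "inv \<sigma> \<in> block_perms s" using pi by (simp add: block_perms_def)
  from block_perms_inv[OF this] show False using \<sigma> permutes_inv_inv[OF \<sigma>(1)] by simp
qed

text \<open>Permutations outside \<^const>\<open>block_perms\<close> cancel: exchange the values \<open>2 l - 1\<close> and \<open>2 l\<close>
  for the first \<open>l\<close> for which these two values are not paired.\<close>
lemma sum_pf_term_sgn_sorted:
  "(\<Sum>\<sigma> | \<sigma> permutes {1..2 * s}. pf_term s (sgn_kernel real) \<sigma>) = of_nat (card (block_perms s))"
proof -
  let ?X = "{\<sigma>. \<sigma> permutes {1..2 * s}}"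
  let ?T = "pf_term s (sgn_kernel real)"
  have fin: "finite ?X" by (rule finite_permutations) simp
  define bad where "bad \<sigma> l \<longleftrightarrow> l \<in> {1..s} \<and> block_partner (inv \<sigma> (2 * l - 1)) \<noteq> inv \<sigma> (2 * l)" for \<sigma> :: "nat \<Rightarrow> nat" and l
  define t where "t l = Transposition.transpose (2 * l - 1) (2 * l)" for l :: nat
  define L where "L \<sigma> = (LEAST l. bad \<sigma> l)" for \<sigma>
  define Y where "Y = ?X - block_perms s"
  have badL: "bad \<sigma> (L \<sigma>)" if "\<sigma> \<in> Y" for \<sigma>
  proof -
    obtain l where "bad \<sigma> l" using not_block_perm_pair[of \<sigma> s] \<open>\<sigma> \<in> Y\<close> unfolding bad_def Y_def by blast
    then show ?thesis unfolding L_def by (rule LeastI)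
  qed
  have tt: "t l \<circ> t l = id" for l by (simp add: t_def)
  have tp: "t l permutes {1..2 * s}" if "l \<in> {1..s}" for l
    unfolding t_def by (rule block_perms_permutes[OF flip_in_block_perms[OF that]])
  \<comment> \<open>Exchanging the values \<open>2 * l - 1\<close> and \<open>2 * l\<close> does not
    affect which indices are bad, so the first bad index is the same before and after, and
    exchanging twice restores \<open>\<sigma>\<close>.\<close>
  have bad_t: "bad (t l \<circ> \<sigma>) k \<longleftrightarrow> bad \<sigma> k" if \<sigma>: "\<sigma> permutes {1..2 * s}" and l: "l \<in> {1..s}" for \<sigma> l k
  proof (cases "k \<in> {1..s}")
    case k: True
    have inv: "inv (t l \<circ> \<sigma>) j = inv \<sigma> (t l j)" for j
    proof -
      have "inv (t l \<circ> \<sigma>) = inv \<sigma> \<circ> inv (t l)"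
        using \<sigma> tp[OF l] by (intro o_inv_distrib permutes_bij)
      moreover have "inv (t l) = t l" using tt by (intro inv_unique_comp)
      ultimately show ?thesis by simp
    qed
    show ?thesis
    proof (cases "k = l")
      case True
      have in2: "inv \<sigma> (2 * l - 1) \<in> {1..2 * s}" "inv \<sigma> (2 * l) \<in> {1..2 * s}"
        unfolding permutes_in_image[OF permutes_inv[OF \<sigma>]] using l by auto
      have "block_partner (inv \<sigma> (2 * l)) = inv \<sigma> (2 * l - 1) \<longleftrightarrow> block_partner (inv \<sigma> (2 * l - 1)) = inv \<sigma> (2 * l)"
        using in2 block_partner_twice by metis
      moreover have "t l (2 * l - 1) = 2 * l" "t l (2 * l) = 2 * l - 1" by (simp_all add: t_def)
      ultimately show ?thesis unfolding True bad_def inv by metis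
    next
      case False
      then have "2 * k - 1 \<noteq> 2 * l - 1" "2 * k - 1 \<noteq> 2 * l" "2 * k \<noteq> 2 * l - 1" "2 * k \<noteq> 2 * l"
        using k l by (auto; presburger)+
      then have "t l (2 * k - 1) = 2 * k - 1" "t l (2 * k) = 2 * k"
        by (simp_all add: t_def Transposition.transpose_def)
      then show ?thesis unfolding bad_def inv by (simp only:)
    qed
  qed (auto simp: bad_def)
  have notblock: "\<sigma> \<notin> block_perms s" if "\<sigma> permutes {1..2 * s}" "bad \<sigma> l" for \<sigma> l
  proof
    assume "\<sigma> \<in> block_perms s"
    then have "inv \<sigma> \<in> block_perms s" by (rule block_perms_inv)
    moreover have l: "l \<in> {1..s}" using that(2) by (simp add: bad_def)
    then have "2 * l - 1 \<in> {1..2 * s}" by auto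
    ultimately have "inv \<sigma> (block_partner (2 * l - 1)) = block_partner (inv \<sigma> (2 * l - 1))"
      unfolding block_perms_def by blast
    then show False using that(2) l by (simp add: bad_def)
  qed
  have swap: "?T (t (L \<sigma>) \<circ> \<sigma>) = - ?T \<sigma>" if "\<sigma> \<in> Y" for \<sigma>
  proof -
    let ?l = "L \<sigma>"
    have \<sigma>: "\<sigma> permutes {1..2 * s}" using that by (simp add: Y_def)
    have b: "bad \<sigma> ?l" by (rule badL[OF that])
    then have l: "?l \<in> {1..s}" by (simp add: bad_def)
    have "sign (t ?l \<circ> \<sigma>) = - sign \<sigma>"
      using sign_comp[OF tp[OF l] \<sigma>] l by (auto simp: t_def sign_swap_id)
    moreover have "sgn_kernel real (t ?l (\<sigma> (2 * k - 1))) (t ?l (\<sigma> (2 * k))) = sgn_kernel real (\<sigma> (2 * k - 1)) (\<sigma> (2 * k))"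
      if k: "k \<in> {1..s}" for k
    proof -
      define a b where "a = \<sigma> (2 * k - 1)" and "b = \<sigma> (2 * k)"
      have ia: "inv \<sigma> a = 2 * k - 1" "inv \<sigma> b = 2 * k" using \<sigma> by (simp_all add: a_def b_def permutes_inverses)
      have "\<not> (a = 2 * ?l - 1 \<and> b = 2 * ?l)" "\<not> (a = 2 * ?l \<and> b = 2 * ?l - 1)"
        using b ia k unfolding bad_def by auto
      moreover have "a \<noteq> b" using k permutes_inj[OF \<sigma>] by (auto simp: a_def b_def dest!: injD)
      \<comment> \<open>Exchanging two consecutive values preserves the order of any two values that
        are not exactly this pair.\<close>
      ultimately have "(t ?l a < t ?l b \<longleftrightarrow> a < b) \<and> (t ?l a = t ?l b \<longleftrightarrow> a = b)"
      proof -
        assume ab: "\<not> (a = 2 * ?l - 1 \<and> b = 2 * ?l)" "\<not> (a = 2 * ?l \<and> b = 2 * ?l - 1)" "a \<noteq> b"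
        obtain m where m: "2 * ?l - 1 = m" "2 * ?l = Suc m" using l by (metis Suc_diff_1 atLeastAtMost_iff mult_pos_pos not_one_le_zero neq0_conv zero_less_numeral)
        show ?thesis using ab unfolding t_def m Transposition.transpose_def by auto
      qed
      then have "sgn (real (t ?l b) - real (t ?l a)) = sgn (real b - real a)"
        by (auto simp: sgn_if)
      then show ?thesis by (simp add: sgn_kernel_def a_def b_def)
    qed
    ultimately show ?thesis by (simp add: pf_term_def)
  qed
  define \<iota> where "\<iota> \<sigma> = t (L \<sigma>) \<circ> \<sigma>" for \<sigma>
  have \<iota>Y: "\<iota> \<sigma> \<in> Y" and L\<iota>: "L (\<iota> \<sigma>) = L \<sigma>" if "\<sigma> \<in> Y" for \<sigma>
  proof -
    have \<sigma>: "\<sigma> permutes {1..2 * s}" using that by (simp add: Y_def)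
    have b: "bad \<sigma> (L \<sigma>)" by (rule badL[OF that])
    then have l: "L \<sigma> \<in> {1..s}" by (simp add: bad_def)
    have p: "\<iota> \<sigma> permutes {1..2 * s}" unfolding \<iota>_def by (rule permutes_compose[OF \<sigma> tp[OF l]])
    have bt: "bad (\<iota> \<sigma>) k \<longleftrightarrow> bad \<sigma> k" for k unfolding \<iota>_def by (rule bad_t[OF \<sigma> l])
    then show "L (\<iota> \<sigma>) = L \<sigma>" by (simp add: L_def)
    show "\<iota> \<sigma> \<in> Y" using p notblock[OF p, of "L \<sigma>"] b by (simp add: Y_def bt)
  qed
  have "\<iota> (\<iota> \<sigma>) = \<sigma>" if "\<sigma> \<in> Y" for \<sigma>
  proof -
    have "\<iota> (\<iota> \<sigma>) = t (L \<sigma>) \<circ> t (L \<sigma>) \<circ> \<sigma>"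
    proof -
      have "\<iota> (\<iota> \<sigma>) = t (L (\<iota> \<sigma>)) \<circ> \<iota> \<sigma>" by (subst \<iota>_def) (rule refl)
      then show ?thesis unfolding L\<iota>[OF that] by (simp only: \<iota>_def o_assoc)
    qed
    then show ?thesis by (simp add: tt)
  qed
  then have "bij_betw \<iota> Y Y" using \<iota>Y by (intro bij_betwI[of _ _ _ \<iota>]) auto
  then have "sum ?T Y = (\<Sum>\<sigma>\<in>Y. ?T (\<iota> \<sigma>))" by (rule sum.reindex_bij_betw[symmetric])
  also have "\<dots> = - sum ?T Y" using swap by (simp add: \<iota>_def sum_negf)
  finally have "sum ?T Y = 0" by simp
  moreover have "block_perms s \<subseteq> ?X" using block_perms_permutes by blast
  then have "sum ?T ?X = sum ?T Y + sum ?T (block_perms s)"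
    unfolding Y_def using fin by (rule sum.subset_diff)
  ultimately have "sum ?T ?X = sum ?T (block_perms s)" by simp
  also have "\<dots> = (\<Sum>h\<in>block_perms s. 1)"
  proof (rule sum.cong[OF refl])
    fix h assume "h \<in> block_perms s"
    then have "?T (id \<circ> h) = ?T id"
      by (intro pf_term_block_perm sgn_kernel_skew permutes_id)
    also have "\<dots> = 1" by (auto simp: pf_term_def sgn_kernel_def sgn_if intro!: prod.neutral)
    finally show "?T h = 1" by simp
  qed
  finally show ?thesis by simp
qed

section \<open>The Vandermonde determinant in Leibniz form\<close>

text \<open>The signed counterpart of \<open>vdm\<close>; written as a sum of monomials, it makes
  the integrand of De Bruijn's formula a sum of products.\<close>

definition vdm_leibniz :: "nat \<Rightarrow> (nat \<Rightarrow> real) \<Rightarrow> real" where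
  "vdm_leibniz n \<kappa> = (\<Sum>\<rho> | \<rho> permutes {1..n}. of_int (sign \<rho>) * (\<Prod>i=1..n. \<kappa> i ^ (\<rho> i - 1)))"

lemma vdm_leibniz_compose:
  assumes p: "p permutes {1..n}"
  shows "vdm_leibniz n (\<kappa> \<circ> p) = of_int (sign p) * vdm_leibniz n \<kappa>"
proof -
  have "vdm_leibniz n (\<kappa> \<circ> p) = (\<Sum>\<rho> | \<rho> permutes {1..n}. of_int (sign (\<rho> \<circ> p)) * (\<Prod>i=1..n. \<kappa> (p i) ^ ((\<rho> \<circ> p) i - 1)))"
    unfolding vdm_leibniz_def by (subst sum_permutations_compose_right[OF p]) simp
  also have "\<dots> = (\<Sum>\<rho> | \<rho> permutes {1..n}. of_int (sign p) * (of_int (sign \<rho>) * (\<Prod>i=1..n. \<kappa> i ^ (\<rho> i - 1))))"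
  proof (rule sum.cong[OF refl])
    fix \<rho> assume "\<rho> \<in> {\<rho>. \<rho> permutes {1..n}}"
    then have "sign (\<rho> \<circ> p) = sign \<rho> * sign p" using p by (intro sign_comp) auto
    moreover have "(\<Prod>i=1..n. \<kappa> (p i) ^ ((\<rho> \<circ> p) i - 1)) = (\<Prod>i=1..n. \<kappa> i ^ (\<rho> i - 1))"
      using prod.permute[OF p, of "\<lambda>i. \<kappa> i ^ (\<rho> i - 1)"] by (simp add: o_def)
    ultimately show "of_int (sign (\<rho> \<circ> p)) * (\<Prod>i=1..n. \<kappa> (p i) ^ ((\<rho> \<circ> p) i - 1))
      = of_int (sign p) * (of_int (sign \<rho>) * (\<Prod>i=1..n. \<kappa> i ^ (\<rho> i - 1)))" by simp
  qed
  finally show ?thesis by (simp add: vdm_leibniz_def sum_distrib_left)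
qed

lemma vdm_leibniz_not_inj:
  assumes "\<not> inj_on \<kappa> {1..n}"
  shows "vdm_leibniz n \<kappa> = 0"
proof -
  obtain i j where ij: "i \<in> {1..n}" "j \<in> {1..n}" "i \<noteq> j" "\<kappa> i = \<kappa> j"
    using assms by (auto simp: inj_on_def)
  have "\<kappa> \<circ> Transposition.transpose i j = \<kappa>" using ij(4) by (auto simp: Transposition.transpose_def)
  moreover have "Transposition.transpose i j permutes {1..n}" using ij by (intro permutes_swap_id)
  ultimately have "vdm_leibniz n \<kappa> = of_int (sign (Transposition.transpose i j)) * vdm_leibniz n \<kappa>"
    using vdm_leibniz_compose by metis
  then show ?thesis using ij(3) by (simp add: sign_swap_id)
qed

lemma vdm_leibniz_cong: "(\<And>i. i \<in> {1..n} \<Longrightarrow> \<kappa> i = \<kappa>' i) \<Longrightarrow> vdm_leibniz n \<kappa> = vdm_leibniz n \<kappa>'"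
  unfolding vdm_leibniz_def by (intro sum.cong refl arg_cong2[where f = "(*)"] prod.cong) auto

text \<open>As a polynomial in the last variable, the determinant has degree at most
  \<open>n\<close>, its coefficient of index \<open>n\<close> is
  \<open>vdm_leibniz n \<kappa>\<close>, coming from the permutations fixing \<open>Suc n\<close>,
  and it vanishes at the other \<open>n\<close> points. If these are not distinct, both sides are
  zero.\<close>

lemma vdm_leibniz_Suc: "vdm_leibniz (Suc n) \<kappa> = vdm_leibniz n \<kappa> * (\<Prod>i=1..n. \<kappa> (Suc n) - \<kappa> i)"
proof -
  let ?X = "{\<rho>. \<rho> permutes {1..Suc n}}"
  have fin: "finite ?X" by (rule finite_permutations) simp
  define c where "c \<rho> = of_int (sign \<rho>) * (\<Prod>i=1..n. \<kappa> i ^ (\<rho> i - 1))" for \<rho> :: "nat \<Rightarrow> nat"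
  define Q where "Q = (\<Sum>\<rho>\<in>?X. monom (c \<rho>) (\<rho> (Suc n) - 1))"
  have Q: "poly Q x = vdm_leibniz (Suc n) (\<kappa>(Suc n := x))" for x
  proof -
    have "(\<Prod>i=1..Suc n. (\<kappa>(Suc n := x)) i ^ (\<rho> i - 1)) = (\<Prod>i=1..n. \<kappa> i ^ (\<rho> i - 1)) * x ^ (\<rho> (Suc n) - 1)" for \<rho> :: "nat \<Rightarrow> nat"
    proof -
      have "(\<Prod>i=1..n. (\<kappa>(Suc n := x)) i ^ (\<rho> i - 1)) = (\<Prod>i=1..n. \<kappa> i ^ (\<rho> i - 1))" by (rule prod.cong) auto
      then show ?thesis by simp
    qed
    then show ?thesis by (simp add: Q_def poly_sum poly_monom vdm_leibniz_def c_def mult.assoc)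
  qed
  define P where "P = smult (vdm_leibniz n \<kappa>) (\<Prod>i=1..n. [:- \<kappa> i, 1:])"
  have le: "\<rho> (Suc n) \<in> {1..Suc n}" if "\<rho> \<in> ?X" for \<rho>
    using that permutes_in_image[of \<rho> "{1..Suc n}" "Suc n"] by simp
  have fixed: "{\<rho>\<in>?X. \<rho> (Suc n) = Suc n} = {\<rho>. \<rho> permutes {1..n}}"
  proof safe
    fix \<rho> assume "\<rho> permutes {1..Suc n}" "\<rho> (Suc n) = Suc n"
    then show "\<rho> permutes {1..n}" by (elim permutes_superset) (auto simp: le_Suc_eq)
  next
    fix \<rho> assume \<rho>: "\<rho> permutes {1..n}"
    then show "\<rho> permutes {1..Suc n}" by (rule permutes_subset) auto
    show "\<rho> (Suc n) = Suc n" using \<rho> by (rule permutes_not_in) simp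
  qed
  have cQ: "coeff Q j = 0" if "j > n" for j
    using le that by (force simp: Q_def coeff_sum intro!: sum.neutral)
  have cQn: "coeff Q n = vdm_leibniz n \<kappa>"
  proof -
    have "coeff Q n = (\<Sum>\<rho>\<in>?X. if \<rho> (Suc n) = Suc n then c \<rho> else 0)"
      unfolding Q_def coeff_sum using le by (intro sum.cong) (force simp: coeff_monom)+
    also have "\<dots> = (\<Sum>\<rho>\<in>{\<rho>\<in>?X. \<rho> (Suc n) = Suc n}. c \<rho>)" using fin by (subst sum.inter_filter) auto
    finally show ?thesis unfolding fixed by (simp add: c_def vdm_leibniz_def)
  qed
  show ?thesis
  proof (cases "inj_on \<kappa> {1..n}")
    case True
    have "Q = P"
    proof (rule ccontr)
      assume ne: "Q \<noteq> P"
      have root: "poly (Q - P) (\<kappa> i) = 0" if i: "i \<in> {1..n}" for i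
      proof -
        have "\<not> inj_on (\<kappa>(Suc n := \<kappa> i)) {1..Suc n}"
        proof
          assume "inj_on (\<kappa>(Suc n := \<kappa> i)) {1..Suc n}"
          then have "i = Suc n" using i by (elim inj_onD) auto
          then show False using i by simp
        qed
        then have "poly Q (\<kappa> i) = 0" unfolding Q by (rule vdm_leibniz_not_inj)
        moreover have "poly P (\<kappa> i) = 0" using i by (auto simp: P_def poly_prod)
        ultimately show ?thesis by simp
      qed
      have "card (\<kappa> ` {1..n}) \<le> card {x. poly (Q - P) x = 0}"
        using root ne by (intro card_mono poly_roots_finite) auto
      also have "\<dots> \<le> degree (Q - P)" using ne by (intro card_poly_roots_bound) auto
      finally have deg: "n \<le> degree (Q - P)" using True by (simp add: card_image)
      have dP: "degree (\<Prod>i=1..n. [:- \<kappa> i, 1:]) = n" using degree_linear_factors[of "{1..n}" \<kappa>] by simp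
      then have "coeff (\<Prod>i=1..n. [:- \<kappa> i, 1:]) n = 1"
        using lead_coeff_prod[of "\<lambda>i. [:- \<kappa> i, 1:]" "{1..n}"] by simp
      then have "coeff P n = vdm_leibniz n \<kappa>" by (simp add: P_def)
      moreover have "coeff P j = 0" if "j > n" for j using that dP by (simp add: P_def coeff_eq_0)
      ultimately have "coeff (Q - P) j = 0" if "j \<ge> n" for j
        using that cQ cQn by (cases "j = n") auto
      from this[OF deg] have "Q - P = 0" by (simp only: leading_coeff_0_iff)
      with ne show False by (simp only: right_minus_eq)
    qed
    then have "poly Q (\<kappa> (Suc n)) = poly P (\<kappa> (Suc n))" by simp
    then show ?thesis unfolding Q by (simp add: P_def poly_prod)
  next
    case False
    then have "\<not> inj_on \<kappa> {1..Suc n}" using inj_on_subset[of \<kappa> "{1..Suc n}" "{1..n}"] by auto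
    then show ?thesis using False by (simp add: vdm_leibniz_not_inj)
  qed
qed

lemma vdm_leibniz_sorted_pos:
  assumes "\<And>i j. i \<in> {1..n} \<Longrightarrow> j \<in> {1..n} \<Longrightarrow> i < j \<Longrightarrow> \<kappa> i < \<kappa> j"
  shows "vdm_leibniz n \<kappa> > 0"
  using assms
proof (induction n)
  case 0
  then show ?case by (simp add: vdm_leibniz_def)
next
  case (Suc n)
  have "vdm_leibniz n \<kappa> > 0" using Suc.prems by (intro Suc.IH) auto
  moreover have "(\<Prod>i=1..n. \<kappa> (Suc n) - \<kappa> i) > 0"
    using Suc.prems by (intro prod_pos) auto
  ultimately show ?case by (simp add: vdm_leibniz_Suc)
qed

lemma vdm_eq_abs_leibniz: "vdm \<kappa> {1..n} = \<bar>vdm_leibniz n \<kappa>\<bar>"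
proof (induction n)
  case 0
  then show ?case by (simp add: vdm_leibniz_def)
next
  case (Suc n)
  have "{1..Suc n} = insert (Suc n) {1..n}" by auto
  then have "vdm \<kappa> {1..Suc n} = vdm \<kappa> {1..n} * (\<Prod>r\<in>{1..n}. \<bar>\<kappa> (Suc n) - \<kappa> r\<bar>)"
    by (simp only: finite_atLeastAtMost vdm_insert) (simp add: vdm_insert)
  then show ?case by (simp only: Suc.IH vdm_leibniz_Suc abs_mult abs_prod)
qed

text \<open>Rearrangement inequality: a permutation maximising \<open>\<Phi>\<close> sorts, since
  exchanging two entries in the wrong order would increase the sum.\<close>

lemma sorting_permutation:
  fixes \<kappa> :: "nat \<Rightarrow> real"
  assumes inj: "inj_on \<kappa> {1..N}"
  shows "\<exists>p. p permutes {1..N} \<and> (\<forall>i\<in>{1..N}. \<forall>j\<in>{1..N}. i < j \<longrightarrow> \<kappa> (p i) < \<kappa> (p j))"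
proof -
  let ?X = "{p. p permutes {1..N}}"
  define \<Phi> where "\<Phi> p = (\<Sum>i=1..N. real i * \<kappa> (p i))" for p :: "nat \<Rightarrow> nat"
  have "finite ?X" by (rule finite_permutations) simp
  moreover have "id \<in> ?X" by (simp add: permutes_id)
  then have "\<Phi> ` ?X \<noteq> {}" by blast
  ultimately have "Max (\<Phi> ` ?X) \<in> \<Phi> ` ?X" by (intro Max_in finite_imageI)
  then obtain p where p: "p permutes {1..N}" "Max (\<Phi> ` ?X) = \<Phi> p" by blast
  have max: "\<Phi> q \<le> \<Phi> p" if "q permutes {1..N}" for q
  proof -
    have "\<Phi> q \<le> Max (\<Phi> ` ?X)" by (rule Max_ge) (use \<open>finite ?X\<close> that in auto)
    then show ?thesis unfolding p(2) .
  qed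
  show ?thesis
  proof (intro exI[of _ p] conjI ballI impI p(1))
    fix i j assume ij: "i \<in> {1..N}" "j \<in> {1..N}" "i < j"
    let ?t = "Transposition.transpose i j"
    have "\<Phi> (p \<circ> ?t) \<le> \<Phi> p"
      by (intro max permutes_compose[OF _ p(1)] permutes_swap_id ij)
    moreover have S: "sum F {1..N} = F i + (F j + sum F ({1..N} - {i} - {j}))" for F :: "nat \<Rightarrow> real"
    proof -
      have "sum F {1..N} = F i + sum F ({1..N} - {i})" by (rule sum.remove) (use ij in simp_all)
      moreover have "sum F ({1..N} - {i}) = F j + sum F ({1..N} - {i} - {j})"
        by (rule sum.remove) (use ij in simp_all)
      ultimately show ?thesis by simp
    qed
    moreover have "(\<Sum>k\<in>{1..N} - {i} - {j}. real k * \<kappa> ((p \<circ> ?t) k)) = (\<Sum>k\<in>{1..N} - {i} - {j}. real k * \<kappa> (p k))"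
      by (rule sum.cong) (auto simp: Transposition.transpose_def)
    ultimately have "real i * \<kappa> (p j) + real j * \<kappa> (p i) \<le> real i * \<kappa> (p i) + real j * \<kappa> (p j)"
      unfolding \<Phi>_def S[of "\<lambda>k. real k * \<kappa> (p k)"] S[of "\<lambda>k. real k * \<kappa> ((p \<circ> ?t) k)"] by simp
    then have "(real j - real i) * (\<kappa> (p i) - \<kappa> (p j)) \<le> 0" by (simp add: algebra_simps)
    then have "\<kappa> (p i) \<le> \<kappa> (p j)" using ij(3) by (simp add: mult_le_0_iff)
    moreover have "\<kappa> (p i) \<noteq> \<kappa> (p j)"
    proof
      assume "\<kappa> (p i) = \<kappa> (p j)"
      moreover have "p i \<in> {1..N}" "p j \<in> {1..N}" using ij permutes_in_image[OF p(1)] by blast+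
      ultimately have "p i = p j" using inj by (blast dest: inj_onD)
      then have "i = j" using permutes_inj[OF p(1)] by (blast dest: injD)
      with ij(3) show False by simp
    qed
    ultimately show "\<kappa> (p i) < \<kappa> (p j)" by simp
  qed
qed

text \<open>Only the order of the \<open>\<kappa> i\<close> matters, so after sorting by
  \<open>p\<close> the sum is the one for \<open>real\<close>; undoing \<open>p\<close> costs
  \<open>sign p\<close>, which is also the sign of the Vandermonde determinant.\<close>

lemma sum_pf_term_sgn_kernel:
  assumes inj: "inj_on \<kappa> {1..2 * s}"
  shows "(\<Sum>\<sigma> | \<sigma> permutes {1..2 * s}. pf_term s (sgn_kernel \<kappa>) \<sigma>)
    = of_nat (card (block_perms s)) * sgn (vdm_leibniz (2 * s) \<kappa>)"
proof -
  let ?X = "{\<sigma>. \<sigma> permutes {1..2 * s}}"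
  obtain p where p: "p permutes {1..2 * s}"
    "\<And>i j. i \<in> {1..2 * s} \<Longrightarrow> j \<in> {1..2 * s} \<Longrightarrow> i < j \<Longrightarrow> \<kappa> (p i) < \<kappa> (p j)"
    using sorting_permutation[OF inj] by blast
  have "vdm_leibniz (2 * s) (\<kappa> \<circ> p) > 0" by (rule vdm_leibniz_sorted_pos) (simp add: p(2))
  then have sgnV: "sgn (vdm_leibniz (2 * s) \<kappa>) = of_int (sign p)"
    unfolding vdm_leibniz_compose[OF p(1)]
    by (cases p rule: sign_cases) (auto simp: sgn_if)
  have "of_nat (card (block_perms s)) = (\<Sum>\<sigma>\<in>?X. pf_term s (sgn_kernel real) \<sigma>)"
    by (rule sum_pf_term_sgn_sorted[symmetric])
  also have "\<dots> = (\<Sum>\<sigma>\<in>?X. pf_term s (sgn_kernel (\<kappa> \<circ> p)) \<sigma>)"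
  proof (rule sum.cong[OF refl])
    fix \<sigma> assume "\<sigma> \<in> ?X"
    then have \<sigma>: "\<sigma> permutes {1..2 * s}" by simp
    have "sgn_kernel real (\<sigma> (2 * k - 1)) (\<sigma> (2 * k)) = sgn_kernel (\<kappa> \<circ> p) (\<sigma> (2 * k - 1)) (\<sigma> (2 * k))" if k: "k \<in> {1..s}" for k
    proof -
      have "2 * k - 1 \<in> {1..2 * s}" "2 * k \<in> {1..2 * s}" using k by auto
      then have "\<sigma> (2 * k - 1) \<in> {1..2 * s}" "\<sigma> (2 * k) \<in> {1..2 * s}"
        using permutes_in_image[OF \<sigma>] by blast+
      then show ?thesis
        using p(2)[of "\<sigma> (2 * k - 1)" "\<sigma> (2 * k)"] p(2)[of "\<sigma> (2 * k)" "\<sigma> (2 * k - 1)"]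
        by (cases "\<sigma> (2 * k - 1)" "\<sigma> (2 * k)" rule: linorder_cases) (simp_all add: sgn_kernel_def sgn_if)
    qed
    then show "pf_term s (sgn_kernel real) \<sigma> = pf_term s (sgn_kernel (\<kappa> \<circ> p)) \<sigma>"
      unfolding pf_term_def by (intro arg_cong2[where f = "(*)"] prod.cong) auto
  qed
  also have "\<dots> = (\<Sum>\<sigma>\<in>?X. of_int (sign p) * pf_term s (sgn_kernel \<kappa>) (p \<circ> \<sigma>))"
  proof (rule sum.cong[OF refl])
    fix \<sigma> assume "\<sigma> \<in> ?X"
    then have "sign (p \<circ> \<sigma>) = sign p * sign \<sigma>" using p(1) by (intro sign_comp) auto
    then show "pf_term s (sgn_kernel (\<kappa> \<circ> p)) \<sigma> = of_int (sign p) * pf_term s (sgn_kernel \<kappa>) (p \<circ> \<sigma>)"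
      by (cases p rule: sign_cases) (simp_all add: pf_term_def sgn_kernel_def)
  qed
  also have "\<dots> = of_int (sign p) * (\<Sum>\<sigma>\<in>?X. pf_term s (sgn_kernel \<kappa>) \<sigma>)"
    unfolding sum_distrib_left[symmetric]
  proof (rule arg_cong[where f = "(*) _"], rule sum.reindex_bij_betw)
    show "bij_betw ((\<circ>) p) ?X ?X"
    proof (rule bij_betwI[where g = "(\<circ>) (inv p)"])
      show "(\<circ>) p \<in> ?X \<rightarrow> ?X" "(\<circ>) (inv p) \<in> ?X \<rightarrow> ?X"
        using p(1) by (auto intro: permutes_compose permutes_inv)
    qed (simp_all add: o_assoc permutes_inv_o[OF p(1)])
  qed
  finally show ?thesis
    unfolding sgnV by (cases p rule: sign_cases) auto
qed

text \<open>For odd \<open>n\<close> the index \<open>n + 1\<close> stands for a point at \<open>+ \<infinity>\<close>.\<close>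
definition sgn_ext :: "nat \<Rightarrow> nat \<Rightarrow> nat \<Rightarrow> real \<Rightarrow> real \<Rightarrow> real" where
  "sgn_ext n i j x y = (if i \<le> n \<and> j \<le> n then sgn (y - x) else if i \<le> n then 1 else if j \<le> n then - 1 else 0)"

text \<open>The absolute value of the Vandermonde determinant is the determinant times its sign, and
  the sign is a Pfaffian up to the order of the block group.\<close>

lemma vdm_eq_sum_pf_term:
  assumes s: "2 * s = n \<or> 2 * s = Suc n"
  shows "of_nat (card (block_perms s)) * vdm x {1..n}
    = vdm_leibniz n x * (\<Sum>\<sigma> | \<sigma> permutes {1..2 * s}. pf_term s (\<lambda>i j. sgn_ext n i j (x i) (x j)) \<sigma>)"
proof (cases "inj_on x {1..n}")
  case False
  then show ?thesis by (simp only: vdm_leibniz_not_inj[OF False] vdm_eq_abs_leibniz)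
next
  case inj: True
  \<comment> \<open>A finite stand-in for the point at infinity: it exceeds all \<open>x i\<close>,
    so the signs involving the index \<open>n + 1\<close> agree with \<open>sgn_ext\<close>, and the
    extra Vandermonde factors are positive.\<close>
  define M where "M = 1 + Max (insert 0 (x ` {1..n}))"
  have M: "x i < M" if "i \<in> {1..n}" for i
  proof -
    have "x i \<le> Max (insert 0 (x ` {1..n}))" by (rule Max_ge) (use that in auto)
    then show ?thesis unfolding M_def by linarith
  qed
  define \<kappa> where "\<kappa> i = (if i \<le> n then x i else M)" for i
  have inj': "inj_on \<kappa> {1..2 * s}"
  proof (rule inj_onI)
    fix i j assume ij: "i \<in> {1..2 * s}" "j \<in> {1..2 * s}" "\<kappa> i = \<kappa> j"
    have "i \<in> {1..n} \<or> i = Suc n" "j \<in> {1..n} \<or> j = Suc n" using ij(1,2) s by auto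
    then consider "i \<in> {1..n}" "j \<in> {1..n}" | "i \<in> {1..n}" "j = Suc n" | "i = Suc n" "j \<in> {1..n}" | "i = j"
      by blast
    then show "i = j"
    proof cases
      case 1
      then have "x i = x j" using ij(3) by (simp add: \<kappa>_def)
      then show ?thesis using inj 1 by (blast dest: inj_onD)
    next
      case 2
      then show ?thesis using ij(3) M[of i] by (simp add: \<kappa>_def)
    next
      case 3
      then show ?thesis using ij(3) M[of j] by (simp add: \<kappa>_def)
    qed
  qed
  have V: "sgn (vdm_leibniz (2 * s) \<kappa>) = sgn (vdm_leibniz n x)"
  proof -
    have n: "vdm_leibniz n \<kappa> = vdm_leibniz n x" by (rule vdm_leibniz_cong) (simp add: \<kappa>_def)
    show ?thesis
    proof (cases "2 * s = n")
      case True
      then show ?thesis using n by simp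
    next
      case False
      have "(\<Prod>i=1..n. \<kappa> (Suc n) - \<kappa> i) > 0" using M by (intro prod_pos) (auto simp: \<kappa>_def)
      then show ?thesis using False s by (simp add: vdm_leibniz_Suc n sgn_mult)
    qed
  qed
  have "(\<Sum>\<sigma> | \<sigma> permutes {1..2 * s}. pf_term s (\<lambda>i j. sgn_ext n i j (x i) (x j)) \<sigma>)
    = (\<Sum>\<sigma> | \<sigma> permutes {1..2 * s}. pf_term s (sgn_kernel \<kappa>) \<sigma>)"
  proof (rule sum.cong[OF refl])
    fix \<sigma> assume "\<sigma> \<in> {\<sigma>. \<sigma> permutes {1..2 * s}}"
    then have \<sigma>: "\<sigma> permutes {1..2 * s}" by simp
    have "sgn_ext n (\<sigma> (2 * k - 1)) (\<sigma> (2 * k)) (x (\<sigma> (2 * k - 1))) (x (\<sigma> (2 * k))) = sgn_kernel \<kappa> (\<sigma> (2 * k - 1)) (\<sigma> (2 * k))"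
      if k: "k \<in> {1..s}" for k
    proof -
      have "2 * k - 1 \<in> {1..2 * s}" "2 * k \<in> {1..2 * s}" using k by auto
      then have "\<sigma> (2 * k - 1) \<in> {1..2 * s}" "\<sigma> (2 * k) \<in> {1..2 * s}"
        using permutes_in_image[OF \<sigma>] by blast+
      then show ?thesis using M[of "\<sigma> (2 * k - 1)"] M[of "\<sigma> (2 * k)"]
        by (auto simp: sgn_ext_def sgn_kernel_def \<kappa>_def sgn_if)
    qed
    then show "pf_term s (\<lambda>i j. sgn_ext n i j (x i) (x j)) \<sigma> = pf_term s (sgn_kernel \<kappa>) \<sigma>"
      unfolding pf_term_def by (intro arg_cong2[where f = "(*)"] prod.cong) auto
  qed
  also have "\<dots> = of_nat (card (block_perms s)) * sgn (vdm_leibniz n x)"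
    unfolding V[symmetric] by (rule sum_pf_term_sgn_kernel[OF inj'])
  finally show ?thesis
    by (simp add: vdm_eq_abs_leibniz abs_sgn mult_ac del: One_nat_def)
qed

subsection \<open>De Bruijn's formula\<close>

lemma (in pair_sigma_finite) integral_pair_mult:
  fixes f :: "'a \<Rightarrow> real" and g :: "'b \<Rightarrow> real"
  assumes f: "integrable M1 f" and g: "integrable M2 g"
  shows "integrable (M1 \<Otimes>\<^sub>M M2) (\<lambda>z. f (fst z) * g (snd z))" (is ?I)
    and "(\<integral>z. f (fst z) * g (snd z) \<partial>(M1 \<Otimes>\<^sub>M M2)) = (\<integral>x. f x \<partial>M1) * (\<integral>y. g y \<partial>M2)"
proof -
  have [measurable]: "f \<in> borel_measurable M1" "g \<in> borel_measurable M2" using f g by auto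
  show I: ?I
  proof (rule Fubini_integrable)
    show "integrable M1 (\<lambda>x. \<integral>y. norm (f (fst (x, y)) * g (snd (x, y))) \<partial>M2)"
      using f by (simp add: abs_mult)
    show "AE x in M1. integrable M2 (\<lambda>y. f (fst (x, y)) * g (snd (x, y)))"
      using g by simp
  qed measurable
  have "(\<integral>z. f (fst z) * g (snd z) \<partial>(M1 \<Otimes>\<^sub>M M2)) = (\<integral>x. \<integral>y. f x * g y \<partial>M2 \<partial>M1)"
    using integral_fst'[OF I] by simp
  then show "(\<integral>z. f (fst z) * g (snd z) \<partial>(M1 \<Otimes>\<^sub>M M2)) = (\<integral>x. f x \<partial>M1) * (\<integral>y. g y \<partial>M2)"
    by simp
qed

lemma (in product_sigma_finite) distr_PiM_pair:
  assumes "a \<noteq> b"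
  shows "distr (Pi\<^sub>M {a, b} M) (M a \<Otimes>\<^sub>M M b) (\<lambda>x. (x a, x b)) = M a \<Otimes>\<^sub>M M b"
proof (rule measure_eqI)
  fix A assume "A \<in> sets (distr (Pi\<^sub>M {a, b} M) (M a \<Otimes>\<^sub>M M b) (\<lambda>x. (x a, x b)))"
  then have A [measurable]: "A \<in> sets (M a \<Otimes>\<^sub>M M b)" by simp
  have [measurable]: "(\<lambda>x. (x a, x b)) \<in> Pi\<^sub>M {a, b} M \<rightarrow>\<^sub>M M a \<Otimes>\<^sub>M M b" by measurable
  have "emeasure (distr (Pi\<^sub>M {a, b} M) (M a \<Otimes>\<^sub>M M b) (\<lambda>x. (x a, x b))) A
    = (\<integral>\<^sup>+ x. indicator A (x a, x b) \<partial>Pi\<^sub>M {a, b} M)"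
    by (subst nn_integral_indicator[symmetric], simp, subst nn_integral_distr) simp_all
  also have "\<dots> = (\<integral>\<^sup>+ z. indicator A (fst z, snd z) \<partial>(M a \<Otimes>\<^sub>M M b))"
    by (rule product_nn_integral_pair[of "\<lambda>x y. indicator A (x, y)"]) (use assms in simp_all)
  also have "\<dots> = emeasure (M a \<Otimes>\<^sub>M M b) A" by simp
  finally show "emeasure (distr (Pi\<^sub>M {a, b} M) (M a \<Otimes>\<^sub>M M b) (\<lambda>x. (x a, x b))) A = emeasure (M a \<Otimes>\<^sub>M M b) A" .
qed simp

text \<open>Fubini over disjoint pairs of coordinates; \<open>a k\<close> and \<open>b k\<close>
  name the two coordinates of the pair \<open>k\<close>.\<close>

lemma (in product_sigma_finite) integral_prod_pairs:
  fixes g :: "'k \<Rightarrow> 'a \<Rightarrow> 'a \<Rightarrow> real"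
  assumes "finite K" "inj_on a K" "inj_on b K" "a ` K \<inter> b ` K = {}"
    and "\<And>k. k \<in> K \<Longrightarrow> integrable (M (a k) \<Otimes>\<^sub>M M (b k)) (\<lambda>z. g k (fst z) (snd z))"
  shows "integrable (Pi\<^sub>M (a ` K \<union> b ` K) M) (\<lambda>x. \<Prod>k\<in>K. g k (x (a k)) (x (b k))) \<and>
    (\<integral>x. (\<Prod>k\<in>K. g k (x (a k)) (x (b k))) \<partial>Pi\<^sub>M (a ` K \<union> b ` K) M) = (\<Prod>k\<in>K. \<integral>z. g k (fst z) (snd z) \<partial>(M (a k) \<Otimes>\<^sub>M M (b k)))"
  using assms
proof (induction K rule: finite_induct)
  case empty
  interpret finite_product_sigma_finite M "{}" by standard simp
  have "finite_measure (Pi\<^sub>M {} M)"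
    by (rule finite_measureI) (simp add: space_PiM_empty)
  then interpret finite_measure "Pi\<^sub>M {} M" .
  show ?case by (simp add: space_PiM_empty measure_def)
next
  case (insert k K)
  define I where "I = a ` K \<union> b ` K"
  define J where "J = {a k, b k}"
  let ?F = "\<lambda>x. \<Prod>k\<in>K. g k (x (a k)) (x (b k))"
  let ?G = "\<lambda>y. g k (y (a k)) (y (b k))"
  have IH: "integrable (Pi\<^sub>M I M) ?F" "(\<integral>x. ?F x \<partial>Pi\<^sub>M I M) = (\<Prod>k\<in>K. \<integral>z. g k (fst z) (snd z) \<partial>(M (a k) \<Otimes>\<^sub>M M (b k)))"
    using insert.IH insert.prems unfolding I_def by (auto simp: inj_on_def)
  have ab: "a k \<noteq> b k" using insert.prems(3) by auto
  have IJ: "I \<inter> J = {}" "finite I" "finite J"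
    using insert.hyps insert.prems unfolding I_def J_def by (auto simp: inj_on_def)
  interpret I: finite_product_sigma_finite M I by standard (rule IJ)
  interpret J: finite_product_sigma_finite M J by standard (rule IJ)
  interpret P: pair_sigma_finite "Pi\<^sub>M I M" "Pi\<^sub>M J M" ..
  have gk: "integrable (M (a k) \<Otimes>\<^sub>M M (b k)) (\<lambda>z. g k (fst z) (snd z))" using insert.prems by simp
  then have [measurable]: "(\<lambda>z. g k (fst z) (snd z)) \<in> borel_measurable (M (a k) \<Otimes>\<^sub>M M (b k))" by auto
  have pm: "(\<lambda>x. (x (a k), x (b k))) \<in> Pi\<^sub>M J M \<rightarrow>\<^sub>M M (a k) \<Otimes>\<^sub>M M (b k)" unfolding J_def by measurable
  have G: "integrable (Pi\<^sub>M J M) ?G" "(\<integral>y. ?G y \<partial>Pi\<^sub>M J M) = (\<integral>z. g k (fst z) (snd z) \<partial>(M (a k) \<Otimes>\<^sub>M M (b k)))"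
  proof -
    have d: "distr (Pi\<^sub>M J M) (M (a k) \<Otimes>\<^sub>M M (b k)) (\<lambda>x. (x (a k), x (b k))) = M (a k) \<Otimes>\<^sub>M M (b k)"
      unfolding J_def by (rule distr_PiM_pair[OF ab])
    show "integrable (Pi\<^sub>M J M) ?G"
      using gk by (subst (asm) d[symmetric], subst (asm) integrable_distr_eq[OF pm]) simp_all
    show "(\<integral>y. ?G y \<partial>Pi\<^sub>M J M) = (\<integral>z. g k (fst z) (snd z) \<partial>(M (a k) \<Otimes>\<^sub>M M (b k)))"
      by (subst d[symmetric], subst integral_distr[OF pm]) simp_all
  qed
  have un: "a ` insert k K \<union> b ` insert k K = I \<union> J" by (auto simp: I_def J_def)
  have dm: "distr (Pi\<^sub>M I M \<Otimes>\<^sub>M Pi\<^sub>M J M) (Pi\<^sub>M (I \<union> J) M) (merge I J) = Pi\<^sub>M (I \<union> J) M"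
    by (rule distr_merge[OF IJ])
  let ?H = "\<lambda>x. \<Prod>k\<in>insert k K. g k (x (a k)) (x (b k))"
  have merge: "?H (merge I J z) = ?F (fst z) * ?G (snd z)" for z
  proof -
    have "?F (merge I J z) = ?F (fst z)"
      by (rule prod.cong[OF refl]) (cases z, auto simp: merge_def I_def)
    moreover have "a k \<notin> I" "b k \<notin> I" "a k \<in> J" "b k \<in> J" using IJ(1) by (auto simp: J_def)
    then have "?G (merge I J z) = ?G (snd z)" by (cases z) (simp add: merge_def)
    ultimately show ?thesis using insert.hyps by (simp add: mult.commute)
  qed
  have meas: "?H \<in> borel_measurable (Pi\<^sub>M (I \<union> J) M)"
  proof (rule borel_measurable_prod)
    fix j assume j: "j \<in> insert k K"
    have 1: "(\<lambda>z. g j (fst z) (snd z)) \<in> borel_measurable (M (a j) \<Otimes>\<^sub>M M (b j))" using insert.prems(4)[OF j] by auto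
    have "a j \<in> I \<union> J" "b j \<in> I \<union> J" using j by (auto simp: I_def J_def)
    then have "(\<lambda>x. (x (a j), x (b j))) \<in> Pi\<^sub>M (I \<union> J) M \<rightarrow>\<^sub>M M (a j) \<Otimes>\<^sub>M M (b j)" by measurable
    from measurable_compose[OF this 1] show "(\<lambda>x. g j (x (a j)) (x (b j))) \<in> borel_measurable (Pi\<^sub>M (I \<union> J) M)" by simp
  qed
  have int: "integrable (Pi\<^sub>M (I \<union> J) M) ?H"
    by (subst dm[symmetric], subst integrable_distr_eq[OF measurable_merge meas])
       (simp only: merge P.integral_pair_mult(1)[OF IH(1) G(1)])
  have "(\<integral>x. ?H x \<partial>Pi\<^sub>M (I \<union> J) M) = (\<integral>z. ?F (fst z) * ?G (snd z) \<partial>(Pi\<^sub>M I M \<Otimes>\<^sub>M Pi\<^sub>M J M))"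
    by (subst dm[symmetric], subst integral_distr[OF measurable_merge meas]) (simp only: merge)
  also have "\<dots> = (\<integral>x. ?F x \<partial>Pi\<^sub>M I M) * (\<integral>y. ?G y \<partial>Pi\<^sub>M J M)"
    by (rule P.integral_pair_mult(2)[OF IH(1) G(1)])
  finally show ?case unfolding un using int insert.hyps by (simp add: IH(2) G(2) mult.commute)
qed

lemma prod_pairs_interval:
  fixes h :: "nat \<Rightarrow> real"
  shows "(\<Prod>i=1..2 * s. h i) = (\<Prod>k=1..s. h (2 * k - 1) * h (2 * k))"
proof (induction s)
  case (Suc s)
  have "{1..2 * Suc s} = insert (2 * Suc s) (insert (2 * Suc s - 1) {1..2 * s})" by auto
  then have "(\<Prod>i=1..2 * Suc s. h i) = h (2 * Suc s) * (h (2 * Suc s - 1) * (\<Prod>i=1..2 * s. h i))" by simp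
  then show ?case by (simp only: Suc.IH) (simp add: mult_ac)
qed simp

text \<open>For odd \<open>n\<close> the last pair is completed by a dummy coordinate
  \<open>n + 1\<close>, which carries a unit point mass and, below, the constant monomial 1; even
  and odd \<open>n\<close> can then be integrated alike.\<close>

definition ext_measure :: "nat \<Rightarrow> nat \<Rightarrow> real measure" where
  "ext_measure n i = (if i \<le> n then lborel else return borel 0)"

definition ext_monomial :: "nat \<Rightarrow> (real \<Rightarrow> real) \<Rightarrow> nat \<Rightarrow> real \<Rightarrow> real" where
  "ext_monomial n w i x = (if i \<le> n then x ^ (i - 1) * w x else 1)"

lemma sets_ext_measure [simp, measurable_cong]: "sets (ext_measure n i) = sets borel"
  by (simp add: ext_measure_def)

lemma product_sigma_finite_ext_measure: "product_sigma_finite (ext_measure n)"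
proof (rule product_sigma_finite.intro)
  fix i
  interpret prob_space "return borel (0::real)" by (rule prob_space_return) simp
  show "sigma_finite_measure (ext_measure n i)"
    unfolding ext_measure_def using lborel.sigma_finite_measure_axioms sigma_finite_measure_axioms by auto
qed

text \<open>The dummy coordinate has total mass 1 and \<open>f\<close> does not depend on
  it.\<close>

lemma nn_integral_ext_measure:
  assumes s: "2 * s = n \<or> 2 * s = Suc n" and f: "f \<in> borel_measurable (\<Pi>\<^sub>M i\<in>{1..n}. lborel)"
    and dep: "\<And>x y. (\<And>i. i \<in> {1..n} \<Longrightarrow> x i = y i) \<Longrightarrow> f x = f y"
  shows "(\<integral>\<^sup>+ x. f x \<partial>(\<Pi>\<^sub>M i\<in>{1..n}. lborel)) = (\<integral>\<^sup>+ x. f x \<partial>Pi\<^sub>M {1..2 * s} (ext_measure n))"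
proof -
  interpret product_sigma_finite "ext_measure n" by (rule product_sigma_finite_ext_measure)
  have eq: "Pi\<^sub>M {1..n} (ext_measure n) = (\<Pi>\<^sub>M i\<in>{1..n}. lborel)"
    by (rule PiM_cong) (auto simp: ext_measure_def)
  show ?thesis
  proof (cases "2 * s = n")
    case True
    then show ?thesis by (simp only: eq)
  next
    case False
    then have N: "{1..2 * s} = insert (Suc n) {1..n}" using s by auto
    have fS: "f \<in> borel_measurable (Pi\<^sub>M (insert (Suc n) {1..n}) (ext_measure n))"
    proof -
      have "(\<lambda>x. f (restrict x {1..n})) \<in> borel_measurable (Pi\<^sub>M (insert (Suc n) {1..n}) (ext_measure n))"
        using f unfolding eq[symmetric]
        by (intro measurable_compose[OF measurable_restrict_subset]) auto
      moreover have "f (restrict x {1..n}) = f x" for x by (rule dep) simp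
      ultimately show ?thesis by simp
    qed
    have "(\<integral>\<^sup>+ x. f x \<partial>Pi\<^sub>M (insert (Suc n) {1..n}) (ext_measure n))
      = (\<integral>\<^sup>+ y. \<integral>\<^sup>+ x. f (x(Suc n := y)) \<partial>Pi\<^sub>M {1..n} (ext_measure n) \<partial>ext_measure n (Suc n))"
      by (rule product_nn_integral_insert_rev) (use fS in auto)
    also have "\<dots> = (\<integral>\<^sup>+ y. \<integral>\<^sup>+ x. f x \<partial>Pi\<^sub>M {1..n} (ext_measure n) \<partial>ext_measure n (Suc n))"
      by (intro nn_integral_cong dep) auto
    also have "\<dots> = (\<integral>\<^sup>+ x. f x \<partial>Pi\<^sub>M {1..n} (ext_measure n))"
      by (simp add: ext_measure_def emeasure_return)
    finally show ?thesis unfolding N eq ..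
  qed
qed

text \<open>De Bruijn's formula: expand the sign of the Vandermonde determinant as a Pfaffian and the
  determinant itself by Leibniz' formula; each summand is a product over pairs of variables.\<close>
theorem nn_integral_vdm_pfaffian:
  fixes w :: "real \<Rightarrow> real"
  assumes s: "2 * s = n \<or> 2 * s = Suc n"
    and w [measurable]: "w \<in> borel_measurable borel" and w0: "\<And>x. w x \<ge> 0"
    and int: "\<And>i. integrable (ext_measure n i) (ext_monomial n w i)"
    and skew: "\<And>i j. A i j = - A j i"
    and entry: "\<And>i j. i \<in> {1..2 * s} \<Longrightarrow> j \<in> {1..2 * s} \<Longrightarrow> i \<noteq> j \<Longrightarrow>
      (\<integral>z. sgn_ext n i j (fst z) (snd z) * (ext_monomial n w i (fst z) * ext_monomial n w j (snd z)) \<partial>(ext_measure n i \<Otimes>\<^sub>M ext_measure n j)) = A i j"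
  shows "(\<integral>\<^sup>+ x. ennreal (vdm x {1..n} * (\<Prod>i=1..n. w (x i))) \<partial>(\<Pi>\<^sub>M i\<in>{1..n}. lborel)) = ennreal (fact n * pfaffian s A)"
    and "pfaffian s A \<ge> 0"
proof -
  interpret P: product_sigma_finite "ext_measure n" by (rule product_sigma_finite_ext_measure)
  let ?N = "{1..2 * s}"
  let ?M = "ext_measure n" and ?\<psi> = "ext_monomial n w"
  let ?S = "{\<sigma>. \<sigma> permutes ?N}" and ?R = "{\<rho>. \<rho> permutes {1..n}}"
  have [measurable]: "?\<psi> i \<in> borel_measurable borel" for i
    unfolding ext_monomial_def by simp
  have [measurable]: "(\<lambda>z. sgn_ext n i j (fst z) (snd z)) \<in> borel_measurable (borel \<Otimes>\<^sub>M borel)" for i j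
    unfolding sgn_ext_def by simp
  let ?g = "\<lambda>i j p q z. sgn_ext n i j (fst z) (snd z) * (?\<psi> p (fst z) * ?\<psi> q (snd z))"
  have intg: "integrable (?M i \<Otimes>\<^sub>M ?M j) (?g i j p q)" if "?M i = ?M p" "?M j = ?M q" for i j p q
  proof -
    interpret pair_sigma_finite "?M i" "?M j" ..
    have [measurable_cong]: "sets (?M i \<Otimes>\<^sub>M ?M j) = sets (borel \<Otimes>\<^sub>M borel)" by (intro sets_pair_measure_cong) simp_all
    have "integrable (?M i \<Otimes>\<^sub>M ?M j) (\<lambda>z. ?\<psi> p (fst z) * ?\<psi> q (snd z))"
      using int[of p] int[of q] that by (intro integral_pair_mult(1)) simp_all
    then show ?thesis
      by (rule Bochner_Integration.integrable_bound) (auto simp: abs_mult sgn_ext_def sgn_if mult_left_le_one_le intro!: AE_I2)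
  qed
  define f where "f x = vdm x {1..n} * (\<Prod>i=1..n. w (x i))" for x :: "nat \<Rightarrow> real"
  define t where "t \<rho> \<sigma> x = (\<Prod>k=1..s. ?g (\<sigma> (2 * k - 1)) (\<sigma> (2 * k)) (\<rho> (\<sigma> (2 * k - 1))) (\<rho> (\<sigma> (2 * k))) (x (\<sigma> (2 * k - 1)), x (\<sigma> (2 * k))))"
    for \<rho> \<sigma> :: "nat \<Rightarrow> nat" and x :: "nat \<Rightarrow> real"
  \<comment> \<open>\<open>\<rho>\<close> permutes \<open>{1..n}\<close> and fixes the dummy index,
    so renaming by \<open>\<rho>\<close> changes neither the measures nor the sign
    functions.\<close>
  have rho: "?M (\<rho> i) = ?M i" "sgn_ext n (\<rho> i) (\<rho> j) = sgn_ext n i j" if \<rho>: "\<rho> \<in> ?R" and i: "i \<in> ?N" and j: "j \<in> ?N" for \<rho> i j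
  proof -
    have "\<rho> k \<le> n \<longleftrightarrow> k \<le> n" if "k \<in> ?N" for k
    proof (cases "k \<le> n")
      case True
      then have "k \<in> {1..n}" using that by auto
      then have "\<rho> k \<in> {1..n}" using \<rho> permutes_in_image[of \<rho> "{1..n}" k] by blast
      then show ?thesis using True by simp
    next
      case False
      then show ?thesis using \<rho> permutes_not_in[of \<rho> "{1..n}" k] by auto
    qed
    from this[OF i] this[OF j] show "?M (\<rho> i) = ?M i" "sgn_ext n (\<rho> i) (\<rho> j) = sgn_ext n i j"
      by (simp_all add: ext_measure_def sgn_ext_def fun_eq_iff)
  qed
  \<comment> \<open>The two permutations play independent roles: \<open>\<rho>\<close>, from the
    Leibniz formula, chooses the exponents and \<open>\<sigma>\<close>, from the Pfaffian, the
    pairing of the variables.\<close>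
  have expand: "of_nat (card (block_perms s)) * f x = (\<Sum>\<rho>\<in>?R. \<Sum>\<sigma>\<in>?S. of_int (sign \<rho>) * of_int (sign \<sigma>) * t \<rho> \<sigma> x)" for x
  proof -
    have "of_nat (card (block_perms s)) * f x = vdm_leibniz n x * (\<Prod>i=1..n. w (x i)) *
       (\<Sum>\<sigma>\<in>?S. pf_term s (\<lambda>i j. sgn_ext n i j (x i) (x j)) \<sigma>)"
      using vdm_eq_sum_pf_term[OF s, of x] by (simp add: f_def mult_ac)
    also have "\<dots> = (\<Sum>\<rho>\<in>?R. \<Sum>\<sigma>\<in>?S. of_int (sign \<rho>) * (\<Prod>i=1..n. x i ^ (\<rho> i - 1)) * (\<Prod>i=1..n. w (x i)) *
       pf_term s (\<lambda>i j. sgn_ext n i j (x i) (x j)) \<sigma>)"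
      unfolding vdm_leibniz_def sum_distrib_right unfolding sum_distrib_left by (rule refl)
    also have "\<dots> = (\<Sum>\<rho>\<in>?R. \<Sum>\<sigma>\<in>?S. of_int (sign \<rho>) * of_int (sign \<sigma>) * t \<rho> \<sigma> x)"
    proof (intro sum.cong refl)
      fix \<rho> \<sigma> assume \<rho>: "\<rho> \<in> ?R" and \<sigma>: "\<sigma> \<in> ?S"
      have "(\<Prod>i=1..n. x i ^ (\<rho> i - 1)) * (\<Prod>i=1..n. w (x i)) = (\<Prod>i=1..n. ?\<psi> (\<rho> i) (x i))"
        unfolding prod.distrib[symmetric]
      proof (rule prod.cong[OF refl])
        fix i assume "i \<in> {1..n}"
        then have "\<rho> i \<in> {1..n}" using \<rho> permutes_in_image[of \<rho> "{1..n}" i] by blast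
        then show "x i ^ (\<rho> i - 1) * w (x i) = ?\<psi> (\<rho> i) (x i)" by (simp add: ext_monomial_def)
      qed
      also have "\<dots> = (\<Prod>i\<in>?N. ?\<psi> (\<rho> i) (x i))"
      proof (rule prod.mono_neutral_left)
        show "{1..n} \<subseteq> ?N" using s by auto
        show "\<forall>i\<in>?N - {1..n}. ?\<psi> (\<rho> i) (x i) = 1"
          using \<rho> permutes_not_in[of \<rho> "{1..n}"] by (auto simp: ext_monomial_def)
      qed simp
      also have "\<dots> = (\<Prod>i\<in>?N. ?\<psi> (\<rho> (\<sigma> i)) (x (\<sigma> i)))"
        using prod.permute[of \<sigma> ?N "\<lambda>i. ?\<psi> (\<rho> i) (x i)"] \<sigma> by (simp add: o_def)
      also have "\<dots> = (\<Prod>k=1..s. ?\<psi> (\<rho> (\<sigma> (2 * k - 1))) (x (\<sigma> (2 * k - 1))) * ?\<psi> (\<rho> (\<sigma> (2 * k))) (x (\<sigma> (2 * k))))"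
        by (rule prod_pairs_interval)
      finally have *: "(\<Prod>i=1..n. x i ^ (\<rho> i - 1)) * (\<Prod>i=1..n. w (x i))
        = (\<Prod>k=1..s. ?\<psi> (\<rho> (\<sigma> (2 * k - 1))) (x (\<sigma> (2 * k - 1))) * ?\<psi> (\<rho> (\<sigma> (2 * k))) (x (\<sigma> (2 * k))))" .
      have "t \<rho> \<sigma> x = (\<Prod>k=1..s. sgn_ext n (\<sigma> (2 * k - 1)) (\<sigma> (2 * k)) (x (\<sigma> (2 * k - 1))) (x (\<sigma> (2 * k)))) *
        ((\<Prod>i=1..n. x i ^ (\<rho> i - 1)) * (\<Prod>i=1..n. w (x i)))"
        unfolding * by (simp only: t_def prod.distrib fst_conv snd_conv)
      then show "of_int (sign \<rho>) * (\<Prod>i=1..n. x i ^ (\<rho> i - 1)) * (\<Prod>i=1..n. w (x i)) *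
         pf_term s (\<lambda>i j. sgn_ext n i j (x i) (x j)) \<sigma> = of_int (sign \<rho>) * of_int (sign \<sigma>) * t \<rho> \<sigma> x"
        by (simp only: pf_term_def mult_ac)
    qed
    finally show ?thesis .
  qed
  have t: "integrable (Pi\<^sub>M ?N ?M) (t \<rho> \<sigma>)" "(\<integral>x. t \<rho> \<sigma> x \<partial>Pi\<^sub>M ?N ?M) = (\<Prod>k=1..s. A (\<rho> (\<sigma> (2 * k - 1))) (\<rho> (\<sigma> (2 * k))))"
    if \<rho>: "\<rho> \<in> ?R" and \<sigma>: "\<sigma> \<in> ?S" for \<rho> \<sigma>
  proof -
    define a b where "a k = \<sigma> (2 * k - 1)" and "b k = \<sigma> (2 * k)" for k
    have \<sigma>p: "\<sigma> permutes ?N" using \<sigma> by simp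
    have injS: "\<sigma> i = \<sigma> j \<longleftrightarrow> i = j" for i j using permutes_inj[OF \<sigma>p] by (auto dest: injD)
    have ab: "a k \<in> ?N" "b k \<in> ?N" "a k \<noteq> b k" if "k \<in> {1..s}" for k
    proof -
      have "2 * k - 1 \<in> ?N" "2 * k \<in> ?N" "2 * k - 1 \<noteq> 2 * k" using that by auto
      then show "a k \<in> ?N" "b k \<in> ?N" "a k \<noteq> b k"
        unfolding a_def b_def injS using permutes_in_image[OF \<sigma>p] by blast+
    qed
    have inja: "inj_on a {1..s}" "inj_on b {1..s}" by (auto simp: inj_on_def a_def b_def injS)
    have disj: "a ` {1..s} \<inter> b ` {1..s} = {}"
    proof -
      have "a k \<noteq> b l" if "k \<in> {1..s}" for k l unfolding a_def b_def injS using that by auto presburger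
      then show ?thesis by blast
    qed
    have un: "a ` {1..s} \<union> b ` {1..s} = ?N"
    proof
      show "?N \<subseteq> a ` {1..s} \<union> b ` {1..s}"
      proof
        fix i assume "i \<in> ?N"
        then have "inv \<sigma> i \<in> ?N" using permutes_in_image[OF permutes_inv[OF \<sigma>p]] by blast
        then show "i \<in> a ` {1..s} \<union> b ` {1..s}"
        proof (cases rule: block_cases)
          case (1 k)
          then have "i = a k" unfolding a_def using permutes_inverses(1)[OF \<sigma>p, of i] by metis
          then show ?thesis using 1(1) by blast
        next
          case (2 k)
          then have "i = b k" unfolding b_def using permutes_inverses(1)[OF \<sigma>p, of i] by metis
          then show ?thesis using 2(1) by blast
        qed
      qed
    qed (use ab in blast)
    have g: "integrable (?M (a k) \<Otimes>\<^sub>M ?M (b k)) (\<lambda>z. ?g (a k) (b k) (\<rho> (a k)) (\<rho> (b k)) (fst z, snd z))" if "k \<in> {1..s}" for k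
      using intg[of "a k" "\<rho> (a k)" "b k" "\<rho> (b k)"] rho(1)[OF \<rho>] ab[OF that] by simp
    note main = P.integral_prod_pairs[OF _ inja disj, of "\<lambda>k x y. ?g (a k) (b k) (\<rho> (a k)) (\<rho> (b k)) (x, y)", OF _ g, unfolded un]
    have t_eq: "t \<rho> \<sigma> = (\<lambda>x. \<Prod>k=1..s. ?g (a k) (b k) (\<rho> (a k)) (\<rho> (b k)) (x (a k), x (b k)))"
      by (simp add: fun_eq_iff t_def a_def b_def)
    show "integrable (Pi\<^sub>M ?N ?M) (t \<rho> \<sigma>)" unfolding t_eq using main by simp
    have "(\<integral>x. t \<rho> \<sigma> x \<partial>Pi\<^sub>M ?N ?M) = (\<Prod>k=1..s. \<integral>z. ?g (a k) (b k) (\<rho> (a k)) (\<rho> (b k)) (fst z, snd z) \<partial>(?M (a k) \<Otimes>\<^sub>M ?M (b k)))"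
      unfolding t_eq using main by simp
    also have "\<dots> = (\<Prod>k=1..s. A (\<rho> (a k)) (\<rho> (b k)))"
    proof (rule prod.cong[OF refl])
      fix k assume k: "k \<in> {1..s}"
      have \<rho>N: "\<rho> permutes ?N" using \<rho> s by (auto intro: permutes_subset)
      have "\<rho> (a k) \<in> ?N" "\<rho> (b k) \<in> ?N" using ab[OF k] permutes_in_image[OF \<rho>N] by blast+
      moreover have "\<rho> (a k) \<noteq> \<rho> (b k)" using ab(3)[OF k] permutes_inj[OF \<rho>N] by (auto dest: injD)
      ultimately have "(\<integral>z. ?g (\<rho> (a k)) (\<rho> (b k)) (\<rho> (a k)) (\<rho> (b k)) z \<partial>(?M (\<rho> (a k)) \<Otimes>\<^sub>M ?M (\<rho> (b k)))) = A (\<rho> (a k)) (\<rho> (b k))"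
        by (rule entry)
      then show "(\<integral>z. ?g (a k) (b k) (\<rho> (a k)) (\<rho> (b k)) (fst z, snd z) \<partial>(?M (a k) \<Otimes>\<^sub>M ?M (b k))) = A (\<rho> (a k)) (\<rho> (b k))"
        unfolding rho(2)[OF \<rho> ab(1,2)[OF k]] rho(1)[OF \<rho> ab(1)[OF k] ab(1)[OF k]] rho(1)[OF \<rho> ab(2)[OF k] ab(2)[OF k]] by simp
    qed
    finally show "(\<integral>x. t \<rho> \<sigma> x \<partial>Pi\<^sub>M ?N ?M) = (\<Prod>k=1..s. A (\<rho> (\<sigma> (2 * k - 1))) (\<rho> (\<sigma> (2 * k))))"
      by (simp add: a_def b_def)
  qed
  define h where "h = of_nat (card (block_perms s)) * (1::real)"
  have hpos: "h > 0"
    using block_perms_id[of s] by (auto simp: h_def card_gt_0_iff)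
  have hf: "h * f x = (\<Sum>\<rho>\<in>?R. \<Sum>\<sigma>\<in>?S. of_int (sign \<rho>) * of_int (sign \<sigma>) * t \<rho> \<sigma> x)" for x
    using expand[of x] by (simp add: h_def)
  have inthf: "integrable (Pi\<^sub>M ?N ?M) (\<lambda>x. h * f x)"
    unfolding hf using t(1) by (intro Bochner_Integration.integrable_sum integrable_mult_right)
  then have intf: "integrable (Pi\<^sub>M ?N ?M) f" using hpos by simp
  have "h * (\<integral>x. f x \<partial>Pi\<^sub>M ?N ?M) = (\<integral>x. h * f x \<partial>Pi\<^sub>M ?N ?M)" by simp
  also have "\<dots> = (\<Sum>\<rho>\<in>?R. \<Sum>\<sigma>\<in>?S. of_int (sign \<rho>) * of_int (sign \<sigma>) * (\<integral>x. t \<rho> \<sigma> x \<partial>Pi\<^sub>M ?N ?M))"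
    unfolding hf by (intro has_bochner_integral_integral_eq has_bochner_integral_sum has_bochner_integral_mult_right has_bochner_integral_integrable t(1))
  also have "\<dots> = (\<Sum>\<rho>\<in>?R. \<Sum>\<sigma>\<in>?S. pf_term s A (\<rho> \<circ> \<sigma>))"
  proof (intro sum.cong refl)
    fix \<rho> \<sigma> assume \<rho>: "\<rho> \<in> ?R" and \<sigma>: "\<sigma> \<in> ?S"
    have "\<rho> permutes ?N" using \<rho> s by (auto intro: permutes_subset)
    then have "sign (\<rho> \<circ> \<sigma>) = sign \<rho> * sign \<sigma>" using \<sigma> by (intro sign_comp) auto
    then show "of_int (sign \<rho>) * of_int (sign \<sigma>) * (\<integral>x. t \<rho> \<sigma> x \<partial>Pi\<^sub>M ?N ?M) = pf_term s A (\<rho> \<circ> \<sigma>)"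
      unfolding t(2)[OF \<rho> \<sigma>] by (simp add: pf_term_def)
  qed
  \<comment> \<open>For each \<open>\<rho>\<close>, composition merely permutes the summands, so all
    \<open>n!\<close> choices contribute the same multiple of the Pfaffian.\<close>
  also have "\<dots> = (\<Sum>\<rho>\<in>?R. h * pfaffian s A)"
  proof (rule sum.cong[OF refl])
    fix \<rho> assume "\<rho> \<in> ?R"
    then have \<rho>N: "\<rho> permutes ?N" using s by (auto intro: permutes_subset)
    have "bij_betw ((\<circ>) \<rho>) ?S ?S"
    proof (rule bij_betwI[where g = "(\<circ>) (inv \<rho>)"])
      show "(\<circ>) \<rho> \<in> ?S \<rightarrow> ?S" "(\<circ>) (inv \<rho>) \<in> ?S \<rightarrow> ?S"
        using \<rho>N by (auto intro: permutes_compose permutes_inv)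
    qed (simp_all add: o_assoc permutes_inv_o[OF \<rho>N])
    then have "(\<Sum>\<sigma>\<in>?S. pf_term s A (\<rho> \<circ> \<sigma>)) = (\<Sum>\<sigma>\<in>?S. pf_term s A \<sigma>)" by (rule sum.reindex_bij_betw)
    also have "\<dots> = h * pfaffian s A" using sum_pf_term_eq_pfaffian[OF skew, of s] by (simp add: h_def)
    finally show "(\<Sum>\<sigma>\<in>?S. pf_term s A (\<rho> \<circ> \<sigma>)) = h * pfaffian s A" .
  qed
  also have "\<dots> = h * (fact n * pfaffian s A)"
    using card_permutations[of "{1..n}" n] by simp
  finally have val: "(\<integral>x. f x \<partial>Pi\<^sub>M ?N ?M) = fact n * pfaffian s A" using hpos by simp
  have f0: "f x \<ge> 0" for x using w0 by (simp add: f_def vdm_nonneg prod_nonneg)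
  have "(\<integral>\<^sup>+ x. ennreal (f x) \<partial>(\<Pi>\<^sub>M i\<in>{1..n}. lborel)) = (\<integral>\<^sup>+ x. ennreal (f x) \<partial>Pi\<^sub>M ?N ?M)"
  proof (rule nn_integral_ext_measure[OF s])
    show "(\<lambda>x. ennreal (f x)) \<in> borel_measurable (\<Pi>\<^sub>M i\<in>{1..n}. lborel)" unfolding f_def by measurable
    fix x y :: "nat \<Rightarrow> real" assume xy: "\<And>i. i \<in> {1..n} \<Longrightarrow> x i = y i"
    have "vdm x {1..n} = vdm y {1..n}" using xy by (rule vdm_cong)
    moreover have "(\<Prod>i=1..n. w (x i)) = (\<Prod>i=1..n. w (y i))" using xy by (intro prod.cong) auto
    ultimately show "ennreal (f x) = ennreal (f y)" by (simp only: f_def)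
  qed
  also have "\<dots> = ennreal (\<integral>x. f x \<partial>Pi\<^sub>M ?N ?M)"
    by (rule nn_integral_eq_integral[OF intf]) (simp add: f0)
  finally show "(\<integral>\<^sup>+ x. ennreal (vdm x {1..n} * (\<Prod>i=1..n. w (x i))) \<partial>(\<Pi>\<^sub>M i\<in>{1..n}. lborel)) = ennreal (fact n * pfaffian s A)"
    unfolding val by (simp add: f_def)
  have "fact n * pfaffian s A \<ge> 0" unfolding val[symmetric] using f0 by simp
  then show "pfaffian s A \<ge> 0" by (simp add: zero_le_mult_iff not_le[THEN iffD2, OF fact_gt_zero])
qed

subsection \<open>The matrix entries\<close>

text \<open>The substitution \<open>u = c * x^2\<close> in the Gamma integral.\<close>

lemma nn_integral_power_exp_square:
  fixes c :: real
  assumes c: "c > 0"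
  shows "(\<integral>\<^sup>+ x. (if x > 0 then ennreal (x ^ k * exp (- c * x\<^sup>2)) else 0) \<partial>lborel)
    = ennreal (c powr (- (real (Suc k) / 2)) * Gamma (real (Suc k) / 2) / 2)"
proof -
  define a where "a = real (Suc k) / 2"
  have a: "a > 0" by (simp add: a_def)
  have "ennreal (Gamma a) = (\<integral>\<^sup>+ u. ennreal (indicator {0..} u * u powr (a - 1) / exp u) \<partial>lborel)"
    by (rule Gamma_conv_nn_integral_real[OF a])
  also have "\<dots> = (\<integral>\<^sup>+ u. indicator {0<..} u * ennreal (u powr (a - 1) / exp u) \<partial>lborel)"
    by (intro nn_integral_cong) (auto simp: indicator_def)
  also have "\<dots> = (\<integral>\<^sup>+ x. (if c * x\<^sup>2 \<in> {0<..} \<and> sqrt (c * x\<^sup>2 / c) = x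
      then ennreal \<bar>2 * c * x\<bar> * ennreal ((c * x\<^sup>2) powr (a - 1) / exp (c * x\<^sup>2)) else 0) \<partial>lborel)"
    by (rule nn_integral_change_of_variables_1[where \<rho> = "\<lambda>v. sqrt (v / c)"])
      (use c in \<open>auto intro!: derivative_eq_intros\<close>)
  also have "\<dots> = (\<integral>\<^sup>+ x. ennreal (2 * c powr a) * (if x > 0 then ennreal (x ^ k * exp (- c * x\<^sup>2)) else 0) \<partial>lborel)"
  proof (intro nn_integral_cong)
    fix x :: real
    show "(if c * x\<^sup>2 \<in> {0<..} \<and> sqrt (c * x\<^sup>2 / c) = x
      then ennreal \<bar>2 * c * x\<bar> * ennreal ((c * x\<^sup>2) powr (a - 1) / exp (c * x\<^sup>2)) else 0)
      = ennreal (2 * c powr a) * (if x > 0 then ennreal (x ^ k * exp (- c * x\<^sup>2)) else 0)"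
    proof (cases "x > 0")
      case True
      have "2 * c * x * (c * x\<^sup>2) powr (a - 1) = 2 * (c * c powr (a - 1)) * (x powr 1 * x powr (2 * (a - 1)))"
        using True c by (simp add: powr_mult powr_powr flip: powr_numeral)
      also have "\<dots> = 2 * c powr a * x ^ k"
        using True c by (simp add: powr_mult_base a_def field_simps flip: powr_add powr_realpow)
      finally have "2 * c * x * (c * x\<^sup>2) powr (a - 1) = 2 * c powr a * x ^ k" .
      then show ?thesis
        using True c by (simp add: exp_minus field_simps flip: ennreal_mult'')
    qed (use c in \<open>auto simp: not_less real_sqrt_abs zero_less_mult_iff\<close>)
  qed
  also have "\<dots> = ennreal (2 * c powr a) * (\<integral>\<^sup>+ x. (if x > 0 then ennreal (x ^ k * exp (- c * x\<^sup>2)) else 0) \<partial>lborel)"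
    by (rule nn_integral_cmult) simp
  finally have "ennreal (c powr (- a) / 2) * ennreal (Gamma a)
    = ennreal (c powr (- a) / 2) * (ennreal (2 * c powr a) * (\<integral>\<^sup>+ x. (if x > 0 then ennreal (x ^ k * exp (- c * x\<^sup>2)) else 0) \<partial>lborel))"
    by simp
  also have "\<dots> = ennreal (c powr (- a) / 2 * (2 * c powr a)) * (\<integral>\<^sup>+ x. (if x > 0 then ennreal (x ^ k * exp (- c * x\<^sup>2)) else 0) \<partial>lborel)"
    by (simp only: ennreal_mult'[of "c powr (- a) / 2" "2 * c powr a", OF divide_nonneg_nonneg[OF powr_ge_zero zero_le_numeral]] mult.assoc)
  also have "c powr (- a) / 2 * (2 * c powr a) = 1" using c by (simp add: powr_minus)
  finally show ?thesis using a by (simp add: a_def ennreal_mult'[symmetric] Gamma_real_pos less_imp_le)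
qed

lemma incomplete_beta_nonneg_nn_integral:
  fixes a b t :: real
  assumes "a > 0" "b > 0" "t \<le> 1"
  shows "(\<integral>\<^sup>+ \<theta>. indicator {0<..<t} \<theta> * ennreal (\<theta> powr (a - 1) * (1 - \<theta>) powr (b - 1)) \<partial>lborel) = ennreal (incomplete_beta t a b)"
    and "incomplete_beta t a b \<ge> 0"
proof -
  let ?f = "\<lambda>x. x powr (a - 1) * (1 - x) powr (b - 1)"
  have "?f integrable_on {0..t}"
    by (rule integrable_on_subinterval[OF integrable_Beta']) (use assms in auto)
  then have I: "(?f has_integral incomplete_beta t a b) {0..t}"
    unfolding incomplete_beta_def by (rule integrable_integral)
  from nn_integral_has_integral_lebesgue[OF _ I]
  have "ennreal (incomplete_beta t a b) = (\<integral>\<^sup>+ x. ennreal (indicator {0..t} x * ?f x) \<partial>lborel)"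
    by simp
  also have "\<dots> = (\<integral>\<^sup>+ \<theta>. indicator {0<..<t} \<theta> * ennreal (?f \<theta>) \<partial>lborel)"
    by (intro nn_integral_cong_AE eventually_mono[OF eventually_conj[OF AE_lborel_singleton[of 0] AE_lborel_singleton[of t]]])
      (auto simp: indicator_def)
  finally show "(\<integral>\<^sup>+ \<theta>. indicator {0<..<t} \<theta> * ennreal (?f \<theta>) \<partial>lborel) = ennreal (incomplete_beta t a b)" ..
  show "incomplete_beta t a b \<ge> 0" by (rule has_integral_nonneg[OF I]) auto
qed

text \<open>The substitution \<open>\<theta> = r^2 / (1 + r^2)\<close> takes
  \<open>0 < r < 1\<close> to \<open>0 < \<theta> < 1/2\<close>; this is where the upper limit
  \<open>1/2\<close> of the incomplete beta function comes from.\<close>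

lemma nn_integral_ratio_beta:
  assumes i: "i \<ge> 1" and j: "j \<ge> 1"
  shows "(\<integral>\<^sup>+ r. (if 0 < r \<and> r < 1 then ennreal (r ^ (i - 1) * (1 + r\<^sup>2) powr (- (real (i + j) / 2))) else 0) \<partial>lborel)
    = ennreal (incomplete_beta (1 / 2) (real i / 2) (real j / 2) / 2)"
proof -
  define a b where "a = real i / 2" and "b = real j / 2"
  have ab: "a > 0" "b > 0" using i j by (auto simp: a_def b_def)
  let ?F = "\<lambda>r::real. r\<^sup>2 / (1 + r\<^sup>2)"
  have pos: "1 + r\<^sup>2 > 0" for r :: real by (rule add_pos_nonneg) auto
  have "ennreal (incomplete_beta (1 / 2) a b)
    = (\<integral>\<^sup>+ \<theta>. indicator {0<..<1/2} \<theta> * ennreal (\<theta> powr (a - 1) * (1 - \<theta>) powr (b - 1)) \<partial>lborel)"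
    using incomplete_beta_nonneg_nn_integral(1)[OF ab, of "1/2"] by simp
  also have "\<dots> = (\<integral>\<^sup>+ r. (if ?F r \<in> {0<..<1/2} \<and> sqrt (?F r / (1 - ?F r)) = r
      then ennreal \<bar>2 * r / (1 + r\<^sup>2)\<^sup>2\<bar> * ennreal (?F r powr (a - 1) * (1 - ?F r) powr (b - 1)) else 0) \<partial>lborel)"
  proof (rule nn_integral_change_of_variables_1[where \<rho> = "\<lambda>v. sqrt (v / (1 - v))"])
    fix r :: real
    have "1 + r\<^sup>2 \<noteq> 0" using pos[of r] by simp
    then show "(?F has_real_derivative 2 * r / (1 + r\<^sup>2)\<^sup>2) (at r)"
      by (auto intro!: derivative_eq_intros simp: field_simps power2_eq_square)
  qed (auto simp: field_simps)
  also have "\<dots> = (\<integral>\<^sup>+ r. ennreal 2 * (if 0 < r \<and> r < 1 then ennreal (r ^ (i - 1) * (1 + r\<^sup>2) powr (- (real (i + j) / 2))) else 0) \<partial>lborel)"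
  proof (intro nn_integral_cong)
    fix r :: real
    have nz: "1 + r\<^sup>2 \<noteq> 0" using pos[of r] by simp
    have F1: "1 - ?F r = 1 / (1 + r\<^sup>2)" using nz by (simp add: field_simps)
    have "?F r / (1 - ?F r) = r\<^sup>2" unfolding F1 using nz by simp
    then have sq: "sqrt (?F r / (1 - ?F r)) = \<bar>r\<bar>" by simp
    have F: "?F r \<in> {0<..<1/2} \<longleftrightarrow> 0 < r\<^sup>2 \<and> r\<^sup>2 < 1" using pos[of r] by (auto simp: field_simps)
    show "(if ?F r \<in> {0<..<1/2} \<and> sqrt (?F r / (1 - ?F r)) = r
      then ennreal \<bar>2 * r / (1 + r\<^sup>2)\<^sup>2\<bar> * ennreal (?F r powr (a - 1) * (1 - ?F r) powr (b - 1)) else 0)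
      = ennreal 2 * (if 0 < r \<and> r < 1 then ennreal (r ^ (i - 1) * (1 + r\<^sup>2) powr (- (real (i + j) / 2))) else 0)"
    proof (cases "0 < r \<and> r < 1")
      case True
      define q where "q = 1 + r\<^sup>2"
      have q: "q > 0" unfolding q_def by (rule pos)
      have "2 * r / q\<^sup>2 * ((r\<^sup>2 / q) powr (a - 1) * (1 / q) powr (b - 1))
        = 2 * (r powr 1 * r powr (2 * (a - 1))) * (1 / (q powr 2 * q powr (a - 1) * q powr (b - 1)))"
        using True q by (simp add: powr_divide powr_powr flip: powr_numeral)
      also have "r powr 1 * r powr (2 * (a - 1)) = r powr real (i - 1)"
        unfolding powr_add[symmetric] using i by (simp add: a_def of_nat_diff algebra_simps)
      also have "\<dots> = r ^ (i - 1)" using True by (intro powr_realpow) auto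
      also have "q powr 2 * q powr (a - 1) * q powr (b - 1) = q powr (real (i + j) / 2)"
        unfolding powr_add[symmetric] by (simp add: a_def b_def add_divide_distrib)
      also have "2 * r ^ (i - 1) * (1 / q powr (real (i + j) / 2)) = 2 * (r ^ (i - 1) * q powr (- (real (i + j) / 2)))"
        by (simp add: powr_minus_divide)
      finally have e: "2 * r / q\<^sup>2 * ((r\<^sup>2 / q) powr (a - 1) * (1 / q) powr (b - 1)) = 2 * (r ^ (i - 1) * q powr (- (real (i + j) / 2)))" .
      have "r\<^sup>2 < 1" using True by (simp add: power_less_one_iff)
      then have "ennreal \<bar>2 * r / q\<^sup>2\<bar> * ennreal ((r\<^sup>2 / q) powr (a - 1) * (1 / q) powr (b - 1)) = ennreal (2 * (r ^ (i - 1) * q powr (- (real (i + j) / 2))))"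
        using True q e by (simp flip: ennreal_mult'')
      also have "\<dots> = ennreal 2 * ennreal (r ^ (i - 1) * q powr (- (real (i + j) / 2)))"
        by (rule ennreal_mult') simp
      finally have "ennreal \<bar>2 * r / q\<^sup>2\<bar> * ennreal ((r\<^sup>2 / q) powr (a - 1) * (1 / q) powr (b - 1)) = ennreal 2 * ennreal (r ^ (i - 1) * q powr (- (real (i + j) / 2)))" .
      then show ?thesis using True \<open>r\<^sup>2 < 1\<close> F unfolding sq unfolding F1 unfolding q_def[symmetric] by simp
    next
      case False
      then have "\<not> (0 < r\<^sup>2 \<and> r\<^sup>2 < 1 \<and> \<bar>r\<bar> = r)" by (auto simp: power_less_one_iff abs_square_less_1)
      then show ?thesis using False F unfolding sq by auto
    qed
  qed
  also have "\<dots> = ennreal 2 * (\<integral>\<^sup>+ r. (if 0 < r \<and> r < 1 then ennreal (r ^ (i - 1) * (1 + r\<^sup>2) powr (- (real (i + j) / 2))) else 0) \<partial>lborel)"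
    by (rule nn_integral_cmult) simp
  finally have "ennreal (1 / 2) * ennreal (incomplete_beta (1 / 2) a b) = ennreal (1 / 2) * (ennreal 2 * (\<integral>\<^sup>+ r. (if 0 < r \<and> r < 1 then ennreal (r ^ (i - 1) * (1 + r\<^sup>2) powr (- (real (i + j) / 2))) else 0) \<partial>lborel))"
    by simp
  also have "\<dots> = ennreal (1 / 2 * 2) * (\<integral>\<^sup>+ r. (if 0 < r \<and> r < 1 then ennreal (r ^ (i - 1) * (1 + r\<^sup>2) powr (- (real (i + j) / 2))) else 0) \<partial>lborel)"
    by (simp only: ennreal_mult' mult.assoc)
  finally have "ennreal (1 / 2) * ennreal (incomplete_beta (1 / 2) a b) = (\<integral>\<^sup>+ r. (if 0 < r \<and> r < 1 then ennreal (r ^ (i - 1) * (1 + r\<^sup>2) powr (- (real (i + j) / 2))) else 0) \<partial>lborel)"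
    by simp
  with ennreal_mult'[of "1 / 2" "incomplete_beta (1 / 2) a b"]
  have "ennreal (1 / 2 * incomplete_beta (1 / 2) a b) = (\<integral>\<^sup>+ r. (if 0 < r \<and> r < 1 then ennreal (r ^ (i - 1) * (1 + r\<^sup>2) powr (- (real (i + j) / 2))) else 0) \<partial>lborel)"
    by simp
  then show ?thesis unfolding a_def b_def by simp
qed

text \<open>After \<open>x = r * y\<close> the \<open>y\<close>-integral is a Gamma integral with
  \<open>c = (1 + r^2) / 4\<close>, and the remaining integral over \<open>0 < r < 1\<close> is an
  incomplete beta function. The power of 2 is \<open>4^((i + j) / 2)\<close> with a factor
  \<open>1/2\<close> from each of the two integrals.\<close>

lemma nn_integral_ordered_pair:
  assumes i: "i \<ge> 1" and j: "j \<ge> 1"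
  shows "(\<integral>\<^sup>+ y. \<integral>\<^sup>+ x. (if x < y then ennreal (x ^ (i - 1) * half_weight x * (y ^ (j - 1) * half_weight y)) else 0) \<partial>lborel \<partial>lborel)
    = ennreal (2 ^ (i + j - 2) * Gamma ((real i + real j) / 2) * incomplete_beta (1 / 2) (real i / 2) (real j / 2))"
proof -
  let ?H = "\<lambda>y r. if 0 < r \<and> r < 1 then (if 0 < y then ennreal (r ^ (i - 1) * (y ^ (i + j - 1) * exp (- ((1 + r\<^sup>2) / 4) * y\<^sup>2))) else 0) else 0"
  have "(\<integral>\<^sup>+ x. (if x < y then ennreal (x ^ (i - 1) * half_weight x * (y ^ (j - 1) * half_weight y)) else 0) \<partial>lborel)
    = (\<integral>\<^sup>+ r. ?H y r \<partial>lborel)" for y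
  proof (cases "y > 0")
    case True
    have "(\<integral>\<^sup>+ x. (if x < y then ennreal (x ^ (i - 1) * half_weight x * (y ^ (j - 1) * half_weight y)) else 0) \<partial>lborel)
      = ennreal y * (\<integral>\<^sup>+ r. (if 0 + y * r < y then ennreal ((0 + y * r) ^ (i - 1) * half_weight (0 + y * r) * (y ^ (j - 1) * half_weight y)) else 0) \<partial>lborel)"
      using True nn_integral_real_affine[of "\<lambda>x. if x < y then ennreal (x ^ (i - 1) * half_weight x * (y ^ (j - 1) * half_weight y)) else 0" y 0] by simp
    also have "\<dots> = (\<integral>\<^sup>+ r. ennreal y * (if 0 + y * r < y then ennreal ((0 + y * r) ^ (i - 1) * half_weight (0 + y * r) * (y ^ (j - 1) * half_weight y)) else 0) \<partial>lborel)"
      by (rule nn_integral_cmult[symmetric]) simp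
    also have "\<dots> = (\<integral>\<^sup>+ r. ?H y r \<partial>lborel)"
    proof (intro nn_integral_cong)
      fix r :: real
      have lt: "y * r < y \<longleftrightarrow> r < 1" using True by (auto simp: mult_less_cancel_left2)
      have "i + j - 1 = Suc ((i - 1) + (j - 1))" using i j by simp
      then have pw: "y ^ (i + j - 1) = y * (y ^ (i - 1) * y ^ (j - 1))" by (simp only: power_Suc power_add)
      have "exp (- ((1 + r\<^sup>2) / 4) * y\<^sup>2) = exp (- (y * r)\<^sup>2 / 4) * exp (- y\<^sup>2 / 4)"
        by (simp add: field_simps power_mult_distrib flip: exp_add)
      then show "ennreal y * (if 0 + y * r < y then ennreal ((0 + y * r) ^ (i - 1) * half_weight (0 + y * r) * (y ^ (j - 1) * half_weight y)) else 0) = ?H y r"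
        using True unfolding pw
        by (simp add: half_weight_def lt zero_less_mult_iff power_mult_distrib mult_ac flip: ennreal_mult')
    qed
    finally show ?thesis .
  next
    case False
    then show ?thesis by (intro nn_integral_cong) (auto simp: half_weight_def)
  qed
  then have "(\<integral>\<^sup>+ y. \<integral>\<^sup>+ x. (if x < y then ennreal (x ^ (i - 1) * half_weight x * (y ^ (j - 1) * half_weight y)) else 0) \<partial>lborel \<partial>lborel)
    = (\<integral>\<^sup>+ y. \<integral>\<^sup>+ r. ?H y r \<partial>lborel \<partial>lborel)" by simp
  also have "\<dots> = (\<integral>\<^sup>+ r. \<integral>\<^sup>+ y. ?H y r \<partial>lborel \<partial>lborel)"
    by (rule lborel_pair.Fubini') simp
  also have "\<dots> = (\<integral>\<^sup>+ r. ennreal (2 ^ (i + j - 1) * Gamma ((real i + real j) / 2)) *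
      (if 0 < r \<and> r < 1 then ennreal (r ^ (i - 1) * (1 + r\<^sup>2) powr (- (real (i + j) / 2))) else 0) \<partial>lborel)"
  proof (intro nn_integral_cong)
    fix r :: real
    show "(\<integral>\<^sup>+ y. ?H y r \<partial>lborel) = ennreal (2 ^ (i + j - 1) * Gamma ((real i + real j) / 2)) *
      (if 0 < r \<and> r < 1 then ennreal (r ^ (i - 1) * (1 + r\<^sup>2) powr (- (real (i + j) / 2))) else 0)"
    proof (cases "0 < r \<and> r < 1")
      case True
      define q where "q = 1 + r\<^sup>2"
      have q: "q > 0" unfolding q_def by (rule add_pos_nonneg) auto
      have Suc: "Suc (i + j - 1) = i + j" using i by simp
      have "(4::real) powr (real (i + j) / 2) = 2 powr real (i + j)"
        using powr_powr[of "2::real" 2 "real (i + j) / 2"] by simp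
      also have "\<dots> = 2 ^ (i + j)" by (rule powr_realpow) simp
      also have "\<dots> = 2 * 2 ^ (i + j - 1)" by (metis Suc power_Suc)
      finally have "(q / 4) powr (- (real (i + j) / 2)) = 2 * 2 ^ (i + j - 1) * q powr (- (real (i + j) / 2))"
        using q by (simp add: powr_divide powr_minus divide_simps)
      then have c: "(q / 4) powr (- (real (i + j) / 2)) * Gamma (real (i + j) / 2) / 2 = 2 ^ (i + j - 1) * Gamma (real (i + j) / 2) * q powr (- (real (i + j) / 2))"
        by simp
      have G: "Gamma (real (i + j) / 2) \<ge> 0" using i by (intro less_imp_le Gamma_real_pos) auto
      have "(\<integral>\<^sup>+ y. ?H y r \<partial>lborel) = (\<integral>\<^sup>+ y. ennreal (r ^ (i - 1)) * (if 0 < y then ennreal (y ^ (i + j - 1) * exp (- (q / 4) * y\<^sup>2)) else 0) \<partial>lborel)"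
        using True by (intro nn_integral_cong) (auto simp: q_def ennreal_mult')
      also have "\<dots> = ennreal (r ^ (i - 1)) * (\<integral>\<^sup>+ y. (if 0 < y then ennreal (y ^ (i + j - 1) * exp (- (q / 4) * y\<^sup>2)) else 0) \<partial>lborel)"
        by (rule nn_integral_cmult) simp
      also have "\<dots> = ennreal (r ^ (i - 1)) * ennreal (2 ^ (i + j - 1) * Gamma (real (i + j) / 2) * q powr (- (real (i + j) / 2)))"
        using nn_integral_power_exp_square[of "q / 4" "i + j - 1"] q unfolding Suc c by simp
      finally show ?thesis using True G
        by (simp add: q_def[symmetric] mult_ac flip: ennreal_mult' ennreal_mult'')
    next
      case False
      then show ?thesis by (simp only: if_False) simp
    qed
  qed
  also have "\<dots> = ennreal (2 ^ (i + j - 1) * Gamma ((real i + real j) / 2)) * ennreal (incomplete_beta (1 / 2) (real i / 2) (real j / 2) / 2)"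
    unfolding nn_integral_ratio_beta[OF i j, symmetric] by (rule nn_integral_cmult) simp
  also have "\<dots> = ennreal (2 ^ (i + j - 1) * Gamma ((real i + real j) / 2) * (incomplete_beta (1 / 2) (real i / 2) (real j / 2) / 2))"
    using i j incomplete_beta_nonneg_nn_integral(2)[of "real i / 2" "real j / 2" "1/2"] by (intro ennreal_mult''[symmetric]) auto
  also have "i + j - 1 = Suc (i + j - 2)" using i j by simp
  finally show ?thesis by (simp add: mult_ac)
qed

text \<open>A Gamma integral with \<open>c = 1/4\<close>; these moments form the last column for odd
  \<open>n\<close>, where the sign is constantly 1.\<close>

lemma has_bochner_integral_half_weight_moment:
  assumes i: "i \<ge> 1"
  shows "has_bochner_integral lborel (\<lambda>x. x ^ (i - 1) * half_weight x) (2 ^ (i - 1) * Gamma (real i / 2))"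
proof (rule has_bochner_integral_nn_integral)
  have "(4::real) powr (real i / 2) = 2 powr real i"
    using powr_powr[of "2::real" 2 "real i / 2"] by simp
  also have "\<dots> = 2 ^ i" by (rule powr_realpow) simp
  also have "\<dots> = 2 * 2 ^ (i - 1)" using i by (cases i) auto
  finally have c: "(1 / 4) powr (- (real i / 2)) = (2 * 2 ^ (i - 1) :: real)"
    by (simp add: powr_divide powr_minus_divide)
  have "(\<integral>\<^sup>+ x. ennreal (x ^ (i - 1) * half_weight x) \<partial>lborel)
    = (\<integral>\<^sup>+ x. (if x > 0 then ennreal (x ^ (i - 1) * exp (- (1 / 4) * x\<^sup>2)) else 0) \<partial>lborel)"
    by (intro nn_integral_cong) (simp add: half_weight_def)
  also have "\<dots> = ennreal (2 ^ (i - 1) * Gamma (real i / 2))"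
    using nn_integral_power_exp_square[of "1 / 4" "i - 1"] c i by simp
  finally show "(\<integral>\<^sup>+ x. ennreal (x ^ (i - 1) * half_weight x) \<partial>lborel) = ennreal (2 ^ (i - 1) * Gamma (real i / 2))" .
  show "0 \<le> 2 ^ (i - 1) * Gamma (real i / 2)"
    using i by (intro mult_nonneg_nonneg less_imp_le[OF Gamma_real_pos]) auto
  show "AE x in lborel. 0 \<le> x ^ (i - 1) * half_weight x" by (simp add: half_weight_def)
qed simp

lemma integral_ext_monomial:
  assumes "i \<ge> 1"
  shows "(\<integral>x. ext_monomial n half_weight i x \<partial>ext_measure n i) = (if i \<le> n then 2 ^ (i - 1) * Gamma (real i / 2) else 1)"
proof (cases "i \<le> n")
  case True
  then show ?thesis
    using has_bochner_integral_integral_eq[OF has_bochner_integral_half_weight_moment[OF assms]]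
    by (simp add: ext_monomial_def ext_measure_def)
next
  case False
  then show ?thesis by (simp add: ext_monomial_def ext_measure_def measure_return)
qed

lemma integrable_ext_monomial: "integrable (ext_measure n i) (ext_monomial n half_weight i)"
proof (cases "i \<le> n")
  case True
  \<comment> \<open>Truncated subtraction gives the exponent 0 at \<open>i = 0\<close> as well as at
    \<open>i = 1\<close>, so the moment for \<open>max 1 i\<close> covers both.\<close>
  have "x ^ (i - 1) = x ^ (max 1 i - 1)" for x :: real by (cases i) auto
  then have "ext_monomial n half_weight i = (\<lambda>x. x ^ (max 1 i - 1) * half_weight x)"
    using True by (simp add: ext_monomial_def fun_eq_iff)
  then show ?thesis
    using True has_bochner_integral_half_weight_moment[of "max 1 i"]
    by (simp add: ext_measure_def has_bochner_integral_iff)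
next
  case False
  interpret prob_space "return borel (0::real)" by (rule prob_space_return) simp
  have "ext_monomial n half_weight i = (\<lambda>_. 1)" using False by (simp add: ext_monomial_def fun_eq_iff)
  then show ?thesis using False by (simp add: ext_measure_def)
qed

text \<open>The sign splits the integral into the regions \<open>x < y\<close> and
  \<open>y < x\<close>. Each is an ordered-pair integral, the second with \<open>i\<close> and
  \<open>j\<close> exchanged, which produces the difference of beta functions.\<close>

lemma integral_signed_pair:
  assumes i: "i \<ge> 1" and j: "j \<ge> 1"
  shows "(\<integral>z. sgn (snd z - fst z) * ((fst z ^ (i - 1) * half_weight (fst z)) * (snd z ^ (j - 1) * half_weight (snd z))) \<partial>(lborel \<Otimes>\<^sub>M lborel))
    = 2 ^ (i + j - 2) * Gamma ((real i + real j) / 2) *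
       (incomplete_beta (1 / 2) (real i / 2) (real j / 2) - incomplete_beta (1 / 2) (real j / 2) (real i / 2))"
proof -
  let ?M = "lborel \<Otimes>\<^sub>M lborel :: (real \<times> real) measure"
  let ?T = "\<lambda>i j. 2 ^ (i + j - 2) * Gamma ((real i + real j) / 2) * incomplete_beta (1 / 2) (real i / 2) (real j / 2)"
  let ?f = "\<lambda>i x. x ^ (i - 1) * half_weight x"
  let ?u = "\<lambda>z. if fst z < snd z then ?f i (fst z) * ?f j (snd z) else 0"
  let ?v = "\<lambda>z. if snd z < fst z then ?f j (snd z) * ?f i (fst z) else 0"
  have T0: "?T i j \<ge> 0" if "i \<ge> 1" "j \<ge> 1" for i j
    using that incomplete_beta_nonneg_nn_integral(2)[of "real i / 2" "real j / 2" "1/2"]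
    by (intro mult_nonneg_nonneg less_imp_le[OF Gamma_real_pos]) auto
  have f0: "?f i x \<ge> 0" for i x by (simp add: half_weight_def)
  have "has_bochner_integral ?M ?u (?T i j)"
  proof (rule has_bochner_integral_nn_integral)
    have "(\<integral>\<^sup>+ z. ennreal (?u z) \<partial>?M) = (\<integral>\<^sup>+ y. \<integral>\<^sup>+ x. ennreal (?u (x, y)) \<partial>lborel \<partial>lborel)"
      by (rule lborel_pair.nn_integral_snd[symmetric]) simp
    also have "\<dots> = ennreal (?T i j)"
      unfolding nn_integral_ordered_pair[OF i j, symmetric] by (intro nn_integral_cong) simp
    finally show "(\<integral>\<^sup>+ z. ennreal (?u z) \<partial>?M) = ennreal (?T i j)" .
    show "AE z in ?M. 0 \<le> ?u z" using f0 by (intro AE_I2) (auto intro!: mult_nonneg_nonneg)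
  qed (use T0[OF i j] in simp_all)
  moreover have "has_bochner_integral ?M ?v (?T j i)"
  proof (rule has_bochner_integral_nn_integral)
    have "(\<integral>\<^sup>+ z. ennreal (?v z) \<partial>?M) = (\<integral>\<^sup>+ x. \<integral>\<^sup>+ y. ennreal (?v (x, y)) \<partial>lborel \<partial>lborel)"
      by (rule lborel.nn_integral_fst[symmetric]) simp
    also have "\<dots> = ennreal (?T j i)"
      unfolding nn_integral_ordered_pair[OF j i, symmetric] by (intro nn_integral_cong) simp
    finally show "(\<integral>\<^sup>+ z. ennreal (?v z) \<partial>?M) = ennreal (?T j i)" .
    show "AE z in ?M. 0 \<le> ?v z" using f0 by (intro AE_I2) (auto intro!: mult_nonneg_nonneg)
  qed (use T0[OF j i] in simp_all)
  ultimately have "has_bochner_integral ?M (\<lambda>z. ?u z - ?v z) (?T i j - ?T j i)"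
    by (rule has_bochner_integral_diff)
  moreover have "(\<lambda>z. ?u z - ?v z) = (\<lambda>z. sgn (snd z - fst z) * (?f i (fst z) * ?f j (snd z)))"
    by (auto simp: fun_eq_iff sgn_if)
  ultimately have "(\<integral>z. sgn (snd z - fst z) * (?f i (fst z) * ?f j (snd z)) \<partial>?M) = ?T i j - ?T j i"
    by (metis (no_types, lifting) has_bochner_integral_integral_eq)
  then show ?thesis by (simp add: algebra_simps)
qed

lemma integral_sgn_ext_eq_skew_matrix:
  assumes i: "i \<in> {1..Suc n}" and j: "j \<in> {1..Suc n}" and ij: "i \<noteq> j"
  shows "(\<integral>z. sgn_ext n i j (fst z) (snd z) * (ext_monomial n half_weight i (fst z) * ext_monomial n half_weight j (snd z))
      \<partial>(ext_measure n i \<Otimes>\<^sub>M ext_measure n j)) = skew_matrix n i j"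
proof -
  interpret product_sigma_finite "ext_measure n" by (rule product_sigma_finite_ext_measure)
  interpret pair_sigma_finite "ext_measure n i" "ext_measure n j" ..
  note prod = integral_pair_mult(2)[OF integrable_ext_monomial integrable_ext_monomial]
  have i1: "i \<ge> 1" and j1: "j \<ge> 1" using i j by auto
  consider "i \<le> n" "j \<le> n" | "i \<le> n" "j = Suc n" | "i = Suc n" "j \<le> n" using i j ij by fastforce
  then show ?thesis
  proof cases
    case 1
    then have "(\<integral>z. sgn_ext n i j (fst z) (snd z) * (ext_monomial n half_weight i (fst z) * ext_monomial n half_weight j (snd z))
      \<partial>(ext_measure n i \<Otimes>\<^sub>M ext_measure n j)) = 2 ^ (i + j - 2) * Gamma ((real i + real j) / 2) *
       (incomplete_beta (1 / 2) (real i / 2) (real j / 2) - incomplete_beta (1 / 2) (real j / 2) (real i / 2))"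
      using integral_signed_pair[OF i1 j1] by (simp only: sgn_ext_def ext_monomial_def ext_measure_def if_True simp_thms)
    then show ?thesis using 1 ij by (auto simp: skew_matrix_def upper_entry_def add.commute not_less algebra_simps)
  next
    case 2
    then show ?thesis
      using prod integral_ext_monomial[OF i1, of n] integral_ext_monomial[OF j1, of n]
      by (simp add: sgn_ext_def skew_matrix_def upper_entry_def)
  next
    case 3
    then show ?thesis
      using prod integral_ext_monomial[OF i1, of n] integral_ext_monomial[OF j1, of n]
      by (simp add: sgn_ext_def skew_matrix_def upper_entry_def)
  qed
qed

section \<open>The normalising constant and the probability\<close>

text \<open>The exponents of 2 add up: the sum of \<open>1 + k / 2\<close> over \<open>k < n\<close>
  is \<open>n * (n + 3) / 4\<close>.\<close>

lemma goe_norm_eq: "goe_norm n = 2 powr (real n * (real n + 3) / 4) * (\<Prod>m=1..n. Gamma (real m / 2))"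
proof (induction n)
  case 0
  then show ?case by (simp add: goe_norm_def)
next
  case (Suc n)
  have "2 * sqrt 2 ^ n = (2::real) powr 1 * 2 powr (real n / 2)"
    by (simp add: powr_half_sqrt[symmetric] powr_powr flip: powr_realpow)
  then have "2 powr (real n * (real n + 3) / 4) * (2 * sqrt 2 ^ n) = 2 powr (real n * (real n + 3) / 4 + (1 + real n / 2))"
    by (simp add: powr_add)
  also have "real n * (real n + 3) / 4 + (1 + real n / 2) = real (Suc n) * (real (Suc n) + 3) / 4"
    by (simp add: field_simps)
  finally have e: "2 powr (real n * (real n + 3) / 4) * (2 * sqrt 2 ^ n) = 2 powr (real (Suc n) * (real (Suc n) + 3) / 4)" .
  have "goe_norm (Suc n) = goe_norm n * (2 * sqrt 2 ^ n * Gamma (real (Suc n) / 2))"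
    by (simp add: goe_norm_def)
  also have "\<dots> = 2 powr (real n * (real n + 3) / 4) * (2 * sqrt 2 ^ n) * ((\<Prod>m=1..n. Gamma (real m / 2)) * Gamma (real (Suc n) / 2))"
    unfolding Suc.IH by (simp only: mult_ac)
  finally show ?case unfolding e by simp
qed

text \<open>The extracted factor 2 will cancel the 2 contributed by positive and negative definite
  forms; it turns the exponent into
  \<open>n * (n + 3) / 4 - 1 = (n - 1) * (n + 4) / 4\<close>.\<close>

lemma goe_norm_eq_twice: "goe_norm n = 2 * (2 powr ((real n - 1) * (real n + 4) / 4) * (\<Prod>m=1..n. Gamma (real m / 2)))"
proof -
  have "2 * 2 powr ((real n - 1) * (real n + 4) / 4) = (2::real) powr (1 + (real n - 1) * (real n + 4) / 4)"
    by (simp add: powr_add)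
  also have "1 + (real n - 1) * (real n + 4) / 4 = real n * (real n + 3) / 4" by (simp add: field_simps)
  finally show ?thesis unfolding goe_norm_eq by simp
qed

theorem theorem3:
  fixes n :: nat
  assumes "n = CARD('n::finite)"
  shows "{M :: real ^ 'n ^ 'n. isotropic (quad_form M)} \<in> sets GOE \<and>
    measure GOE {M :: real ^ 'n ^ 'n. isotropic (quad_form M)} =
      1 - pfaffian (nat \<lceil>real n / 2\<rceil>) (skew_matrix n) /
          (2 powr ((real n - 1) * (real n + 4) / 4) * (\<Prod>m=1..n. Gamma (real m / 2)))"
proof -
  define s where "s = nat \<lceil>real n / 2\<rceil>"
  have s: "2 * s = n \<or> 2 * s = Suc n"
  proof -
    have "real n / 2 \<le> real s" "real s < real n / 2 + 1" unfolding s_def by linarith+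
    then show ?thesis by linarith
  qed
  let ?iso = "{M :: real ^ 'n ^ 'n. isotropic (quad_form M)}"
  let ?G = "GOE :: (real ^ 'n ^ 'n) measure"
  interpret gauss: product_prob_space "\<lambda>p. gauss" "UNIV :: ('n \<times> 'n) set"
    by (intro product_prob_spaceI prob_space_gauss)
  interpret GOE: prob_space ?G
    unfolding GOE_eq by (rule gauss.prob_space_distr[OF measurable_sym_matrix])
  have sets: "sets ?G = sets borel" and space: "space ?G = UNIV" by (simp_all add: GOE_eq)
  have iso: "?iso \<in> sets ?G" unfolding sets by (rule borel_closed[OF closed_isotropic])
  note pf = nn_integral_vdm_pfaffian[OF s measurable_half_weight half_weight_nonneg integrable_ext_monomial, of "skew_matrix n"]
  have skew: "skew_matrix n i j = - skew_matrix n j i" for i j by (simp add: skew_matrix_def)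
  have entry: "(\<integral>z. sgn_ext n i j (fst z) (snd z) * (ext_monomial n half_weight i (fst z) * ext_monomial n half_weight j (snd z))
      \<partial>(ext_measure n i \<Otimes>\<^sub>M ext_measure n j)) = skew_matrix n i j"
    if "i \<in> {1..2 * s}" "j \<in> {1..2 * s}" "i \<noteq> j" for i j
    using that s by (intro integral_sgn_ext_eq_skew_matrix) auto
  let ?P = "pfaffian s (skew_matrix n)"
  have P0: "?P \<ge> 0" by (rule pf(2)[OF skew entry])
  \<comment> \<open>The two factors \<open>n!\<close>, one from labelling the roots and one from the
    Leibniz expansion, cancel, which leaves the Pfaffian divided by
    \<open>goe_norm n / 2\<close>.\<close>
  have "ennreal (fact n * goe_norm n * measure ?G (- ?iso)) = ennreal (fact n * goe_norm n) * emeasure ?G (- ?iso)"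
    using goe_norm_pos[of n] by (simp add: GOE.emeasure_eq_measure ennreal_mult'')
  also have "\<dots> = 2 * ennreal (fact n * ?P)"
    unfolding emeasure_GOE_anisotropic[OF assms finite_atLeastAtMost[of 1 n], simplified] using pf(1)[OF skew entry] by simp
  also have "\<dots> = ennreal (2 * (fact n * ?P))" by (simp add: ennreal_mult')
  finally have "fact n * goe_norm n * measure ?G (- ?iso) = 2 * (fact n * ?P)"
    by (rule ennreal_inj[THEN iffD1, rotated 2]) (use goe_norm_pos[of n] P0 in auto)
  then have "goe_norm n * measure ?G (- ?iso) = 2 * ?P" by simp
  then have "measure ?G (- ?iso) = ?P / (goe_norm n / 2)" using goe_norm_pos[of n] by (simp add: field_simps)
  moreover have "measure ?G (- ?iso) = 1 - measure ?G ?iso"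
    using GOE.prob_compl[OF iso] by (simp add: space Compl_eq_Diff_UNIV)
  ultimately show ?thesis using iso unfolding s_def goe_norm_eq_twice by simp
qed

end
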